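(* Let $E/F$ be an unramified quadratic extension of non-archimedean local fields of odd residue characteristic. Consider the infinitesimal symmetric pair $(U(V_2)\times U(V_2),\mathrm{End}(V_2))$ and the elliptic endoscopic datum $\xi=(U(V_1)\times U(V_1),s,\eta)$ of $U(V_2)$. There are four relative endoscopic data $(\xi,\alpha,\beta)$; let $(\alpha_0,\beta_0)$ be the pair in which both forms are split. The relative fundamental lemma holds: if $(\alpha,\beta)=(\alpha_0,\beta_0)$, the functions $\mathbf 1_{\mathrm{End}(\Lambda_2)}\in C_c^\infty(\mathrm{End}(V_2))$ and $\mathbf 1_{\mathrm{End}(\Lambda_1)}\otimes\mathbf 1_{\mathrm{End}(\Lambda_1)}\in C_c^\infty(\mathrm{End}(V_1)\oplus\mathrm{End}(V_1))$ are smooth transfers; for each of the other three pairs $(\alpha,\beta)$, $\mathbf 1_{\mathrm{End}(\Lambda_2)}$ and the zero function are smooth transfers.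
   Context: **Setting.** $\mathrm{Nm}:E^\times\to F^\times$ is the norm, $\omega_{E/F}$ the quadratic character of $F^\times$ attached to $E/F$, $|\cdot|_F$ the normalized absolute value. For a Hermitian space $V$ over $E$, $\mathrm{Herm}(V)=\{x\in\mathrm{End}_E(V):\langle xu,v\rangle=\langle u,xv\rangle\}$, with conjugation action of the unitary group $U(V)$. $V_n$ is a fixed split $n$-dimensional Hermitian space (it has an isotropic subspace of maximal possible dimension and a self-dual lattice), and $\Lambda_n\subset V_n$ ($n=1,2$) are fixed self-dual lattices; one has $V_2\cong V_1\oplus V_1$, and this isomorphism is fixed so that $\Lambda_2=\Lambda_1\oplus\Lambda_1$. $\mathrm{End}(\Lambda_n)\subset\mathrm{End}(V_n)$ is the compact open subring of endomorphisms preserving $\Lambda_n$ and $\mathbf 1$ denotes an indicator function. $U(\Lambda_n)\subset U(V_n)$ is the stabilizer of $\Lambda_n$ (hyperspecial maximal compact). Haar measures on $U(V_n)$ give $U(\Lambda_n)$ volume $1$; one-dimensional unitary groups (compact) get total volume $1$. **Symmetric spaces.** For Hermitian spaces $W_1,W_2$ of equal dimension, $\mathfrak u(W_1\oplus W_2)_1=\mathrm{Hom}_E(W_2,W_1)$ with $U(W_1)\times U(W_2)$ acting by $(g,h)\cdot X=gXh^{-1}$ (this is the $(-1)$-eigenspace in $\mathfrak u(W_1\oplus W_2)$ of conjugation by $w_1+w_2\mapsto w_1-w_2$). The contraction map is $r(X)=-XX^*\in\mathrm{Herm}(W_1)$, $X^*:W_1\to W_2$ the adjoint. Regular semi-simple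 elements are those with (geometrically) closed orbit of maximal dimension; stable conjugacy is conjugacy over an algebraic closure. For $W_1=W_2=V_2$ the space is $\mathrm{End}(V_2)$. An elliptic endoscopic datum of $U(V_2)$ of the type considered is a triple $(U(V_1)\times U(V_1),s,\eta)$ with $s\in\mathrm{GL}_2(\mathbb C)$ semi-simple and $\eta:\mathrm{GL}_1(\mathbb C)^2\hookrightarrow\mathrm{GL}_2(\mathbb C)$ identifying the source with the neutral component of the centralizer of $s$ in ${}^LU(V_2)$. Here $\alpha,\beta$ range over representatives of the two isomorphism classes of Hermitian forms on the vector space $V_1$, $V_\alpha=(V_1,\alpha)$, $V_\beta=(V_1,\beta)$, and the endoscopic space is $\mathfrak h_1=\mathfrak u(V_1\oplus V_\alpha)_1\oplus\mathfrak u(V_1\oplus V_\beta)_1$ with group $(U(V_1)\times U(V_\alpha))\times(U(V_1)\times U(V_\beta))$ and contraction $r_{\alpha,\beta}:\mathfrak h_1\to\mathrm{Herm}(V_1)\oplus\mathrm{Herm}(V_1)=F\oplus F$. For $(\alpha_0,\beta_0)$ it is $\mathrm{End}(V_1)\oplus\mathrm{End}(V_1)\cong E\oplus E$. **Matching.** Let $\phi:\mathrm{Herm}(V_1)\oplus\mathrm{Herm}(V_1)\hookrightarrow\mathrm{Herm}(V_1\oplus V_1)$ be the block diagonal embedding. A regular semi-simple $x\in\mathrm{End}(V_2)$ matches a pair $(x_a,x_b)$ in $\mathfrak h_1^{rss}$ if $\delta=r(x)$ and $\delta'=\phi(\delta_a,\delta_b)$, where $(\delta_a,\delta_b)=r_{\alpha,\beta}(x_a,x_b)$,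 are conjugate under $\mathrm{GL}_2(E)$ (after identifying the vector spaces with $E^2$), i.e. $\delta$ has eigenvalues $\delta_a,\delta_b$. Here $\mathfrak h_1^{rss}$ consists of the regular semi-simple $(x_a,x_b)$ (i.e. $x_a,x_b\neq0$) with $\delta_a\ne\delta_b$. **Invariant, $\kappa$, transfer factor.** For such $\delta$, its centralizer $T_\delta\subset U(V_2)$ is $\cong U(1)\times U(1)$, and $H^1(F,T_\delta)=F[\delta]^\times/\mathrm{Nm}(E[\delta]^\times)=(F^\times/\mathrm{Nm}E^\times)^2=(\mathbb Z/2\mathbb Z)^2$, the first factor corresponding to $\delta_a$, the second to $\delta_b$. If $W'$ is a two-dimensional Hermitian space, $\delta''\in\mathrm{Herm}(W')$ and $g:V_2\to W'$ is an $E$-linear isomorphism with $\delta''=g\delta g^{-1}$, then $\mathrm{inv}(\delta,\delta'')\in H^1(F,T_\delta)$ is the class of $c=g^*g\in F[\delta]^\times$, where $\langle gu,gv\rangle_{W'}=\langle cu,v\rangle_{V_2}$ (equivalently of the cocycle $\tau\mapsto g^{-1}\tau(g)$, $\tau\in\mathrm{Gal}(E/F)$). The character $\kappa:H^1(F,T_\delta)\to\mathbb C^\times$ is trivial on the first factor and non-trivial on the second. The transfer factor is $\Delta_{rel}((x_a,x_b),x)=\kappa(\mathrm{inv}(\delta,\delta'))\,\omega_{E/F}(\delta_a-\delta_b)\,|\delta_a-\delta_b|_F$. **Orbital integrals.** For regular semi-simple $x$ with stabilizer $H_x$ (given the Haar measure for which its maximal compact subgroup has volume $1$), $\mathrm{RO}(x,f)=\iint_{H_x\backslash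 U(V_2)\times U(V_2)}f(h_1^{-1}xh_2)\,d\dot h_1d\dot h_2$, and $\mathrm{RO}^\kappa(x,f)=\sum_{x'}\kappa(\mathrm{inv}(r(x),r(x')))\mathrm{RO}(x',f)$ over representatives of the rational orbits in the stable orbit of $x$. $\mathrm{SRO}$ on $\mathfrak h_1$ is the analogous sum of relative orbital integrals for the endoscopic group with trivial $\kappa$. **Smooth transfer.** $f\in C_c^\infty(\mathrm{End}(V_2))$ and $f_{\alpha,\beta}\in C_c^\infty(\mathfrak h_1)$ are smooth transfers if (1) $\mathrm{SRO}((x_a,x_b),f_{\alpha,\beta})=\Delta_{rel}((x_a,x_b),x)\,\mathrm{RO}^\kappa(x,f)$ for all matching regular semi-simple $x$ and $(x_a,x_b)\in\mathfrak h_1^{rss}$, and (2) $\mathrm{SRO}((x_a,x_b),f_{\alpha,\beta})=0$ for every $(x_a,x_b)\in\mathfrak h_1^{rss}$ matched by no $x$. *)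

theory Defs
  imports "HOL-Analysis.Analysis" "HOL-Algebra.Coset" "HOL-Algebra.Algebraic_Closure_Type"
begin

section \<open>Local fields\<close>

text \<open>
  The metric is induced by the normalized absolute value \<open>\<bar>x\<bar> = dist x 0\<close>: the maximal ideal
  \<open>{x. dist x 0 < 1}\<close> is generated by some \<open>\<pi> \<noteq> 0\<close> (discrete valuation), the residue field, whose
  elements are the cosets \<open>x + {y. dist y 0 < 1}\<close>, is finite with \<open>q\<close> elements, and
  \<open>\<bar>\<pi>\<bar> = 1/q\<close>.
\<close>

class nonarch_local_field = field + complete_space +
  assumes dist_add_right_local: "dist (x + z) (y + z) = dist x y"
    and dist_mult_left_local: "dist (z * x) (z * y) = dist z 0 * dist x y"
    and dist_ultrametric: "dist x z \<le> max (dist x y) (dist y z)"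
    and ex_normalized_uniformizer:
      "\<exists>\<pi>. \<pi> \<noteq> 0
        \<and> {x. dist x 0 < 1} = (\<lambda>y. \<pi> * y) ` {y. dist y 0 \<le> 1}
        \<and> finite ((\<lambda>x. {y. dist x y < 1}) ` {x. dist x 0 \<le> 1})
        \<and> dist \<pi> 0 = 1 / real (card ((\<lambda>x. {y. dist x y < 1}) ` {x. dist x 0 \<le> 1}))"

definition nabs :: "'k::nonarch_local_field \<Rightarrow> real" where
  "nabs x = dist x 0"

definition integer_ring :: "'k::nonarch_local_field set" where
  "integer_ring = {x. nabs x \<le> 1}"

definition uniformizer :: "'k::nonarch_local_field \<Rightarrow> bool" where
  "uniformizer \<pi> \<longleftrightarrow> \<pi> \<noteq> 0 \<and> {x. nabs x < 1} = (\<lambda>y. \<pi> * y) ` integer_ring"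

definition residue_char :: "'k::nonarch_local_field itself \<Rightarrow> nat" where
  "residue_char _ = (LEAST p. p > 0 \<and> nabs (of_nat p :: 'k) < 1)"

text \<open>\<open>E\<close> is an extension of \<open>F\<close> through the embedding \<open>\<iota>\<close>; \<open>\<sigma>\<close> is the nontrivial element of
  \<open>Gal(E/F)\<close>.\<close>

definition field_hom :: "('k::field \<Rightarrow> 'l::field) \<Rightarrow> bool" where
  "field_hom \<phi> \<longleftrightarrow> \<phi> 1 = 1 \<and> (\<forall>x y. \<phi> (x + y) = \<phi> x + \<phi> y) \<and> (\<forall>x y. \<phi> (x * y) = \<phi> x * \<phi> y)"

definition quadratic_extension ::
    "('f::nonarch_local_field \<Rightarrow> 'e::nonarch_local_field) \<Rightarrow> bool" where
  "quadratic_extension \<iota> \<longleftrightarrow> field_hom \<iota> \<and> continuous_on UNIV \<iota>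
     \<and> vector_space.dim (\<lambda>a z. \<iota> a * z) (UNIV :: 'e set) = 2"

definition unramified_extension ::
    "('f::nonarch_local_field \<Rightarrow> 'e::nonarch_local_field) \<Rightarrow> bool" where
  "unramified_extension \<iota> \<longleftrightarrow> (\<forall>\<pi>. uniformizer \<pi> \<longrightarrow> uniformizer (\<iota> \<pi>))"

definition galois_conj :: "('f::field \<Rightarrow> 'e::field) \<Rightarrow> ('e \<Rightarrow> 'e) \<Rightarrow> bool" where
  "galois_conj \<iota> \<sigma> \<longleftrightarrow> field_hom \<sigma> \<and> bij \<sigma> \<and> (\<forall>a. \<sigma> (\<iota> a) = \<iota> a) \<and> \<sigma> \<noteq> id"

text \<open>The quadratic character of \<open>F\<^sup>\<times>\<close> attached to \<open>E/F\<close>; its kernel is \<open>Nm E\<^sup>\<times>\<close>.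
  The value at \<open>0\<close> is irrelevant.\<close>

definition omega :: "('f::field \<Rightarrow> 'e::field) \<Rightarrow> ('e \<Rightarrow> 'e) \<Rightarrow> 'f \<Rightarrow> complex" where
  "omega \<iota> \<sigma> a = (if \<exists>z. z \<noteq> 0 \<and> \<iota> a = z * \<sigma> z then 1 else -1)"


section \<open>Hermitian spaces\<close>

text \<open>An \<open>n\<close>-dimensional Hermitian space is the vector space \<open>E\<^sup>n\<close> together with a form, linear in
  the first variable.\<close>

type_synonym ('e, 'n) form = "'e^'n \<Rightarrow> 'e^'n \<Rightarrow> 'e"

definition hermitian_form :: "('e::field \<Rightarrow> 'e) \<Rightarrow> ('e, 'n::finite) form \<Rightarrow> bool" where
  "hermitian_form \<sigma> h \<longleftrightarrow>
     (\<forall>u u' v. h (u + u') v = h u v + h u' v) \<and> (\<forall>c u v. h (c *s u) v = c * h u v)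
   \<and> (\<forall>u v. h v u = \<sigma> (h u v)) \<and> (\<forall>u. (\<forall>v. h u v = 0) \<longrightarrow> u = 0)"

definition isometric :: "('e::field, 'n::finite) form \<Rightarrow> ('e, 'n) form \<Rightarrow> bool" where
  "isometric h h' \<longleftrightarrow> (\<exists>g :: 'e^'n^'n. invertible g \<and> (\<forall>u v. h' (g *v u) (g *v v) = h u v))"

definition is_lattice :: "('e::nonarch_local_field ^ 'n::finite) set \<Rightarrow> bool" where
  "is_lattice \<Lambda> \<longleftrightarrow>
     (\<exists>g :: 'e^'n^'n. invertible g \<and> \<Lambda> = (\<lambda>u. g *v u) ` {u. \<forall>i. u $ i \<in> integer_ring})"

definition self_dual_lattice ::
    "('e::nonarch_local_field, 'n::finite) form \<Rightarrow> ('e^'n) set \<Rightarrow> bool" where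
  "self_dual_lattice h \<Lambda> \<longleftrightarrow> is_lattice \<Lambda> \<and> \<Lambda> = {v. \<forall>u\<in>\<Lambda>. h v u \<in> integer_ring}"

text \<open>The maximal possible dimension of a totally isotropic subspace is \<open>n div 2\<close>.\<close>

definition split_form :: "('e::nonarch_local_field, 'n::finite) form \<Rightarrow> bool" where
  "split_form h \<longleftrightarrow>
     (\<exists>W. vec.subspace W \<and> (\<forall>u\<in>W. \<forall>v\<in>W. h u v = 0) \<and> vec.dim W = CARD('n) div 2)
   \<and> (\<exists>\<Lambda>. self_dual_lattice h \<Lambda>)"

definition form_reps :: "('e::field \<Rightarrow> 'e) \<Rightarrow> ('e, 'n::finite) form set \<Rightarrow> bool" where
  "form_reps \<sigma> R \<longleftrightarrow> (\<forall>\<alpha>\<in>R. hermitian_form \<sigma> \<alpha>)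
     \<and> (\<forall>h. hermitian_form \<sigma> h \<longrightarrow> (\<exists>!\<alpha>. \<alpha> \<in> R \<and> isometric h \<alpha>))"

text \<open>Orthogonal direct sums \<open>V\<^sub>1 \<oplus> V\<^sub>1\<close> and \<open>\<Lambda>\<^sub>1 \<oplus> \<Lambda>\<^sub>1\<close>, with \<open>E\<^sup>1 \<oplus> E\<^sup>1\<close> realized as \<open>E\<^sup>2\<close>.\<close>

definition form_sum :: "('e::field, 1) form \<Rightarrow> ('e, 1) form \<Rightarrow> ('e, 2) form" where
  "form_sum h h' u v = h (vec (u $ 1)) (vec (v $ 1)) + h' (vec (u $ 2)) (vec (v $ 2))"

definition lattice_sum :: "('e^1) set \<Rightarrow> ('e^1) set \<Rightarrow> ('e^2) set" where
  "lattice_sum \<Lambda> \<Lambda>' = {u. vec (u $ 1) \<in> \<Lambda> \<and> vec (u $ 2) \<in> \<Lambda>'}"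

definition block_diag :: "'e::zero^1^1 \<Rightarrow> 'e^1^1 \<Rightarrow> 'e^2^2" where
  "block_diag A B =
     (\<chi> i j. if i = 1 \<and> j = 1 then A $ 1 $ 1 else if i = 2 \<and> j = 2 then B $ 1 $ 1 else 0)"

definition unitary_group :: "('e::field, 'n::finite) form \<Rightarrow> ('e^'n^'n) monoid" where
  "unitary_group h = \<lparr>carrier = {g. invertible g \<and> (\<forall>u v. h (g *v u) (g *v v) = h u v)},
     mult = (**), one = mat 1\<rparr>"

definition lattice_stabilizer ::
    "('e::field, 'n::finite) form \<Rightarrow> ('e^'n) set \<Rightarrow> ('e^'n^'n) set" where
  "lattice_stabilizer h \<Lambda> = {g \<in> carrier (unitary_group h). (\<lambda>u. g *v u) ` \<Lambda> = \<Lambda>}"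

definition lattice_End :: "('e::field^'n::finite) set \<Rightarrow> ('e^'n^'n) set" where
  "lattice_End \<Lambda> = {x. (\<lambda>u. x *v u) ` \<Lambda> \<subseteq> \<Lambda>}"


section \<open>The symmetric spaces\<close>

text \<open>Throughout, \<open>W\<^sub>1 = (E\<^sup>n, h\<^sub>1)\<close>, \<open>W\<^sub>2 = (E\<^sup>n, h\<^sub>2)\<close>, and \<open>x : W\<^sub>2 \<rightarrow> W\<^sub>1\<close> is an \<open>n \<times> n\<close> matrix.\<close>

definition herm_adj ::
    "('e::field, 'n::finite) form \<Rightarrow> ('e, 'n) form \<Rightarrow> 'e^'n^'n \<Rightarrow> 'e^'n^'n" where
  "herm_adj h1 h2 x = (THE Y. \<forall>u v. h1 (x *v u) v = h2 u (Y *v v))"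

definition contraction ::
    "('e::field, 'n::finite) form \<Rightarrow> ('e, 'n) form \<Rightarrow> 'e^'n^'n \<Rightarrow> 'e^'n^'n" where
  "contraction h1 h2 x = - (x ** herm_adj h1 h2 x)"

definition pair_act :: "('e::field^'n::finite^'n) \<times> ('e^'n^'n) \<Rightarrow> 'e^'n^'n \<Rightarrow> 'e^'n^'n" where
  "pair_act = (\<lambda>(g, h) x. g ** x ** matrix_inv h)"

text \<open>
  Geometric orbits.  Let \<open>K\<close> be an algebraic closure of \<open>E\<close>, hence of \<open>F\<close>.  As \<open>E \<otimes>\<^sub>F K = K \<times> K\<close>,
  the group \<open>U(W\<^sub>1) \<times> U(W\<^sub>2)\<close> becomes \<open>GL\<^sub>n(K) \<times> GL\<^sub>n(K)\<close> and \<open>Hom\<^sub>E(W\<^sub>2, W\<^sub>1)\<close> becomes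
  \<open>M\<^sub>n(K) \<times> M\<^sub>n(K)\<close>.  The component belonging to the conjugate embedding is parametrized through
  the adjoint, so a rational point \<open>x\<close> becomes \<open>(x, x\<^sup>*)\<close>, and because \<open>(g x h\<^sup>-\<^sup>1)\<^sup>* = h x\<^sup>* g\<^sup>-\<^sup>1\<close>
  for unitary \<open>g, h\<close>, the action becomes \<open>(g, h) (A, B) = (g A h\<^sup>-\<^sup>1, h B g\<^sup>-\<^sup>1)\<close>.
\<close>

definition geom_point :: "('e::field, 'n::finite) form \<Rightarrow> ('e, 'n) form \<Rightarrow> 'e^'n^'n
    \<Rightarrow> ('e alg_closure^'n^'n) \<times> ('e alg_closure^'n^'n)" where
  "geom_point h1 h2 x = (map_matrix to_ac x, map_matrix to_ac (herm_adj h1 h2 x))"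

definition geom_orbit ::
    "('k::field^'n::finite^'n) \<times> ('k^'n^'n) \<Rightarrow> (('k^'n^'n) \<times> ('k^'n^'n)) set" where
  "geom_orbit = (\<lambda>(A, B).
     {(g ** A ** matrix_inv h, h ** B ** matrix_inv g) | g h. invertible g \<and> invertible h})"

inductive_set polynomial_functions :: "('v \<Rightarrow> 'k::comm_ring_1) set \<Rightarrow> ('v \<Rightarrow> 'k) set"
  for coords :: "('v \<Rightarrow> 'k) set" where
  "(\<lambda>_. c) \<in> polynomial_functions coords"
| "x \<in> coords \<Longrightarrow> x \<in> polynomial_functions coords"
| "p \<in> polynomial_functions coords \<Longrightarrow> q \<in> polynomial_functions coords
    \<Longrightarrow> (\<lambda>v. p v + q v) \<in> polynomial_functions coords"
| "p \<in> polynomial_functions coords \<Longrightarrow> q \<in> polynomial_functions coords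
    \<Longrightarrow> (\<lambda>v. p v * q v) \<in> polynomial_functions coords"

definition zariski_closed :: "('v \<Rightarrow> 'k::comm_ring_1) set \<Rightarrow> 'v set \<Rightarrow> bool" where
  "zariski_closed coords S \<longleftrightarrow>
     (\<exists>P \<subseteq> polynomial_functions coords. S = {v. \<forall>p\<in>P. p v = 0})"

definition matrix_pair_coords :: "(('k^'n^'n) \<times> ('k^'n^'n) \<Rightarrow> 'k) set" where
  "matrix_pair_coords =
     {\<lambda>(A, B). A $ i $ j | i j. True} \<union> {\<lambda>(A, B). B $ i $ j | i j. True}"

text \<open>
  The stabilizer of \<open>(A, B)\<close> is \<open>{(g, h). g A = A h \<and> h B = B g}\<close> with \<open>g, h\<close> invertible, a nonempty
  Zariski open subset of the linear space below, so its dimension is the linear dimension.  The orbit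
  has dimension \<open>2 n\<^sup>2 - geom_stabilizer_dim (A, B)\<close>; it is maximal iff the stabilizer dimension is
  minimal.
\<close>

definition geom_stabilizer_dim :: "('k::field^'n::finite^'n) \<times> ('k^'n^'n) \<Rightarrow> nat" where
  "geom_stabilizer_dim = (\<lambda>(A, B).
     vector_space.dim (\<lambda>c (P, Q). (mat c ** P, mat c ** Q))
       {(P, Q). P ** A = A ** Q \<and> Q ** B = B ** P})"

definition reg_semisimple ::
    "('e::field, 'n::finite) form \<Rightarrow> ('e, 'n) form \<Rightarrow> 'e^'n^'n \<Rightarrow> bool" where
  "reg_semisimple h1 h2 x \<longleftrightarrow>
     zariski_closed matrix_pair_coords (geom_orbit (geom_point h1 h2 x))
   \<and> (\<forall>Z :: ('e alg_closure^'n^'n) \<times> ('e alg_closure^'n^'n).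
        geom_stabilizer_dim (geom_point h1 h2 x) \<le> geom_stabilizer_dim Z)"

definition stable_orbit ::
    "('e::field, 'n::finite) form \<Rightarrow> ('e, 'n) form \<Rightarrow> 'e^'n^'n \<Rightarrow> ('e^'n^'n) set" where
  "stable_orbit h1 h2 x = {x'. geom_point h1 h2 x' \<in> geom_orbit (geom_point h1 h2 x)}"

definition rational_orbit :: "'g monoid \<Rightarrow> ('g \<Rightarrow> 'x \<Rightarrow> 'x) \<Rightarrow> 'x \<Rightarrow> 'x set" where
  "rational_orbit G act x = {act g x | g. g \<in> carrier G}"


section \<open>Haar measures and relative orbital integrals\<close>

text \<open>Left Haar measures; all groups to which this is applied are unimodular.\<close>

definition haar_measure :: "('g::topological_space) monoid \<Rightarrow> 'g measure \<Rightarrow> bool" where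
  "haar_measure G \<mu> \<longleftrightarrow>
     space \<mu> = carrier G \<and> sets \<mu> = sets (restrict_space borel (carrier G))
   \<and> (\<forall>g\<in>carrier G. \<forall>A\<in>sets \<mu>. emeasure \<mu> ((\<lambda>x. g \<otimes>\<^bsub>G\<^esub> x) ` A) = emeasure \<mu> A)
   \<and> (\<forall>K \<subseteq> carrier G. compact K \<longrightarrow> emeasure \<mu> K < \<infinity>)
   \<and> (\<forall>S. openin (top_of_set (carrier G)) S \<and> S \<noteq> {} \<longrightarrow> emeasure \<mu> S > 0)"

definition max_compact_subgroup :: "('g::topological_space) monoid \<Rightarrow> 'g set \<Rightarrow> bool" where
  "max_compact_subgroup G K \<longleftrightarrow> subgroup K G \<and> compact K
     \<and> (\<forall>L. subgroup L G \<and> compact L \<and> K \<subseteq> L \<longrightarrow> L = K)"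

text \<open>For groups with a unique maximal compact subgroup: tori, in particular the compact
  one-dimensional unitary groups.\<close>

definition torus_haar :: "('g::topological_space) monoid \<Rightarrow> 'g measure" where
  "torus_haar G =
     (SOME \<mu>. haar_measure G \<mu> \<and> (\<exists>K. max_compact_subgroup G K \<and> emeasure \<mu> K = 1))"

definition stabilizer_group :: "'g monoid \<Rightarrow> ('g \<Rightarrow> 'x \<Rightarrow> 'x) \<Rightarrow> 'x \<Rightarrow> 'g monoid" where
  "stabilizer_group G act x = G\<lparr>carrier := {g \<in> carrier G. act g x = x}\<rparr>"

text \<open>The quotient measure on the space of right cosets \<open>H g\<close>, determined by
  \<open>\<integral>\<^sub>G \<phi>(g) dg = \<integral>\<^bsub>H\<setminus>G\<^esub> \<integral>\<^sub>H \<phi>(t g) dt dg\<close> for all nonnegative measurable \<open>\<phi>\<close>.\<close>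

definition quotient_measure ::
    "'g monoid \<Rightarrow> 'g measure \<Rightarrow> 'g set \<Rightarrow> 'g measure \<Rightarrow> 'g set measure" where
  "quotient_measure G \<mu> H \<mu>H = (THE \<nu>.
     space \<nu> = rcosets\<^bsub>G\<^esub> H \<and> sets \<nu> = {B. B \<subseteq> rcosets\<^bsub>G\<^esub> H \<and> \<Union>B \<in> sets \<mu>}
   \<and> (\<forall>\<phi> \<in> borel_measurable \<mu>.
        (\<integral>\<^sup>+ g. \<phi> g \<partial>\<mu>) = (\<integral>\<^sup>+ C. (\<integral>\<^sup>+ t. \<phi> (t \<otimes>\<^bsub>G\<^esub> (SOME g. g \<in> C)) \<partial>\<mu>H) \<partial>\<nu>)))"

definition orbital_integral :: "('g::topological_space) monoid \<Rightarrow> 'g measure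
    \<Rightarrow> ('g \<Rightarrow> 'x \<Rightarrow> 'x) \<Rightarrow> 'x \<Rightarrow> ('x \<Rightarrow> complex) \<Rightarrow> complex" where
  "orbital_integral G \<mu> act x f =
     (let H = stabilizer_group G act x
      in \<integral>C. f (act (inv\<^bsub>G\<^esub> (SOME g. g \<in> C)) x)
           \<partial>(quotient_measure G \<mu> (carrier H) (torus_haar H)))"

text \<open>\<open>dg\<close> is the Haar measure on \<open>U(V)\<close>, where \<open>V = (E\<^sup>n, h)\<close>.\<close>

definition RO :: "('e::nonarch_local_field^'n::finite^'n) measure \<Rightarrow> ('e, 'n) form
    \<Rightarrow> 'e^'n^'n \<Rightarrow> ('e^'n^'n \<Rightarrow> complex) \<Rightarrow> complex" where
  "RO dg h x f =
     orbital_integral (unitary_group h \<times>\<times> unitary_group h) (dg \<Otimes>\<^sub>M dg) pair_act x f"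


section \<open>The invariant and the character \<open>\<kappa>\<close>\<close>

text \<open>\<open>eval_at_matrix p A\<close> is \<open>p(A)\<close>; iterates of \<open>(**)\<close> are used since \<open>A ^ i\<close> is taken
  componentwise on the type of vectors.\<close>

definition eval_at_matrix :: "'e::field poly \<Rightarrow> 'e^'n::finite^'n \<Rightarrow> 'e^'n^'n" where
  "eval_at_matrix p A = (\<Sum>i\<le>Polynomial.degree p. mat (Polynomial.coeff p i) ** ((((**) A) ^^ i) (mat 1)))"

text \<open>The class of \<open>c\<close> in \<open>F[\<delta>]\<^sup>\<times> / Nm(E[\<delta>]\<^sup>\<times>)\<close>, as a coset; the norm of \<open>t = p(\<delta>) \<in> E[\<delta>]\<close> is
  \<open>t\<close> times its conjugate over \<open>F[\<delta>]\<close>, obtained by applying \<open>\<sigma>\<close> to the coefficients of \<open>p\<close>.\<close>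

definition norm_class ::
    "('e::field \<Rightarrow> 'e) \<Rightarrow> 'e^'n::finite^'n \<Rightarrow> 'e^'n^'n \<Rightarrow> ('e^'n^'n) set" where
  "norm_class \<sigma> \<delta> c = {c ** (eval_at_matrix p \<delta> ** eval_at_matrix (map_poly \<sigma> p) \<delta>) | p.
     invertible (eval_at_matrix p \<delta>)}"

text \<open>\<open>\<delta> \<in> Herm(V)\<close> with \<open>V = (E\<^sup>n, h)\<close> and \<open>\<delta>'' \<in> Herm(W')\<close> with \<open>W' = (E\<^sup>n, h')\<close>.\<close>

definition inv_class :: "('e::field \<Rightarrow> 'e) \<Rightarrow> ('e, 'n::finite) form \<Rightarrow> ('e, 'n) form
    \<Rightarrow> 'e^'n^'n \<Rightarrow> 'e^'n^'n \<Rightarrow> ('e^'n^'n) set" where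
  "inv_class \<sigma> h h' \<delta> \<delta>'' = norm_class \<sigma> \<delta>
     (SOME c. \<exists>g. invertible g \<and> \<delta>'' = g ** \<delta> ** matrix_inv g
                \<and> (\<forall>u v. h' (g *v u) (g *v v) = h (c *v u) v))"

text \<open>The image of \<open>c = p(\<delta>) \<in> F[\<delta>]\<close> in the factor \<open>F\<close> belonging to the eigenvalue \<open>d \<in> F\<close>.\<close>

definition eigen_component ::
    "('f::field \<Rightarrow> 'e::field) \<Rightarrow> 'e^'n::finite^'n \<Rightarrow> 'f \<Rightarrow> 'e^'n^'n \<Rightarrow> 'f" where
  "eigen_component \<iota> \<delta> d c = (THE b. \<exists>p. c = eval_at_matrix (map_poly \<iota> p) \<delta> \<and> b = poly p d)"

text \<open>The character of \<open>F[\<delta>]\<^sup>\<times> / Nm(E[\<delta>]\<^sup>\<times>) = (F\<^sup>\<times> / Nm E\<^sup>\<times>)\<^sup>2\<close> that is nontrivial on the factor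
  belonging to the eigenvalue \<open>\<delta>b\<close> and trivial on the other one.\<close>

definition kappa :: "('f::field \<Rightarrow> 'e::field) \<Rightarrow> ('e \<Rightarrow> 'e) \<Rightarrow> 'e^2^2 \<Rightarrow> 'f
    \<Rightarrow> ('e^2^2) set \<Rightarrow> complex" where
  "kappa \<iota> \<sigma> \<delta> \<delta>b C = omega \<iota> \<sigma> (eigen_component \<iota> \<delta> \<delta>b (SOME c. c \<in> C))"

text \<open>\<open>RO\<^sup>\<kappa>\<close>, where \<open>\<delta>b\<close> is the eigenvalue of \<open>r(x)\<close> whose factor carries \<open>\<kappa>\<close>.\<close>

definition RO_kappa :: "('f::field \<Rightarrow> 'e::nonarch_local_field) \<Rightarrow> ('e \<Rightarrow> 'e)
    \<Rightarrow> ('e^2^2) measure \<Rightarrow> ('e, 2) form \<Rightarrow> 'f \<Rightarrow> 'e^2^2 \<Rightarrow> ('e^2^2 \<Rightarrow> complex) \<Rightarrow> complex" where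
  "RO_kappa \<iota> \<sigma> dg h \<delta>b x f =
     (let G = unitary_group h \<times>\<times> unitary_group h; \<delta> = contraction h h x
      in \<Sum>orb \<in> rational_orbit G pair_act ` stable_orbit h h x.
           let x' = (SOME y. y \<in> orb)
           in kappa \<iota> \<sigma> \<delta> \<delta>b (inv_class \<sigma> h h \<delta> (contraction h h x')) * RO dg h x' f)"


section \<open>The endoscopic side\<close>

text \<open>The L-group \<open>GL\<^sub>2(\<complex>) \<rtimes> Gal(E/F)\<close> of \<open>U(V\<^sub>2)\<close>; the boolean \<open>True\<close> stands for the nontrivial
  element of the Galois group.\<close>

definition dual_involution :: "complex^2^2 \<Rightarrow> complex^2^2" where
  "dual_involution g = (let J = vector [vector [0, 1], vector [-1, 0]]
     in J ** transpose (matrix_inv g) ** matrix_inv J)"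

definition L_group :: "((complex^2^2) \<times> bool) monoid" where
  "L_group = \<lparr>carrier = {g. invertible g} \<times> UNIV,
     mult = (\<lambda>(g, a) (h, b). (g ** (if a then dual_involution h else h), a \<noteq> b)),
     one = (mat 1, False)\<rparr>"

definition centralizer_neutral_component :: "complex^2^2 \<Rightarrow> ((complex^2^2) \<times> bool) set" where
  "centralizer_neutral_component s = connected_component_set
     {z \<in> carrier L_group. z \<otimes>\<^bsub>L_group\<^esub> (s, False) = (s, False) \<otimes>\<^bsub>L_group\<^esub> z} (mat 1, False)"

text \<open>The pairs \<open>(s, \<eta>)\<close> that make \<open>(U(V\<^sub>1) \<times> U(V\<^sub>1), s, \<eta>)\<close> an endoscopic datum of \<open>U(V\<^sub>2)\<close>:
  \<open>s \<in> GL\<^sub>2(\<complex>)\<close> is semisimple and \<open>\<eta>\<close> is an injective homomorphism of algebraic groups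
  \<open>GL\<^sub>1(\<complex>)\<^sup>2 \<rightarrow> GL\<^sub>2(\<complex>)\<close> onto the neutral component.  The matrix entries of \<open>\<eta>\<close> lie in
  \<open>\<complex>[z, w, (z w)\<^sup>-\<^sup>1]\<close>.\<close>

definition endoscopic_datum ::
    "complex^2^2 \<Rightarrow> (complex \<times> complex \<Rightarrow> complex^2^2) \<Rightarrow> bool" where
  "endoscopic_datum s \<eta> \<longleftrightarrow>
     invertible s
   \<and> (\<exists>P D :: complex^2^2. invertible P \<and> s = P ** D ** matrix_inv P \<and> (\<forall>i j. i \<noteq> j \<longrightarrow> D $ i $ j = 0))
   \<and> (\<forall>z w z' w'. z \<noteq> 0 \<and> w \<noteq> 0 \<and> z' \<noteq> 0 \<and> w' \<noteq> 0
        \<longrightarrow> \<eta> (z * z', w * w') = \<eta> (z, w) ** \<eta> (z', w'))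
   \<and> (\<forall>i j. \<exists>N. \<exists>p \<in> polynomial_functions {fst, snd}.
        \<forall>z w. z \<noteq> 0 \<and> w \<noteq> 0 \<longrightarrow> (z * w) ^ N * \<eta> (z, w) $ i $ j = p (z, w))
   \<and> inj_on \<eta> ((UNIV - {0}) \<times> (UNIV - {0}))
   \<and> (\<lambda>t. (\<eta> t, False)) ` ((UNIV - {0}) \<times> (UNIV - {0})) = centralizer_neutral_component s"

text \<open>The identification \<open>Herm(V\<^sub>1) = F\<close>.\<close>

definition herm_scalar :: "('f::field \<Rightarrow> 'e::field) \<Rightarrow> 'e^1^1 \<Rightarrow> 'f" where
  "herm_scalar \<iota> x = (THE a. x = mat (\<iota> a))"

text \<open>\<open>\<hh>\<^sub>1\<close> consists of the pairs \<open>(xa, xb)\<close> with \<open>xa : V\<^sub>\<alpha> \<rightarrow> V\<^sub>1\<close> and \<open>xb : V\<^sub>\<beta> \<rightarrow> V\<^sub>1\<close>, where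
  \<open>V\<^sub>1 = (E, h1)\<close>.\<close>

definition endo_rss :: "('f::field \<Rightarrow> 'e::field) \<Rightarrow> ('e, 1) form \<Rightarrow> ('e, 1) form \<Rightarrow> ('e, 1) form
    \<Rightarrow> (('e^1^1) \<times> ('e^1^1)) set" where
  "endo_rss \<iota> h1 \<alpha> \<beta> = {(xa, xb). xa \<noteq> 0 \<and> xb \<noteq> 0
     \<and> herm_scalar \<iota> (contraction h1 \<alpha> xa) \<noteq> herm_scalar \<iota> (contraction h1 \<beta> xb)}"

definition endo_group :: "('e::field, 1) form \<Rightarrow> ('e, 1) form \<Rightarrow> ('e, 1) form
    \<Rightarrow> ((('e^1^1) \<times> ('e^1^1)) \<times> (('e^1^1) \<times> ('e^1^1))) monoid" where
  "endo_group h1 \<alpha> \<beta> =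
     (unitary_group h1 \<times>\<times> unitary_group \<alpha>) \<times>\<times> (unitary_group h1 \<times>\<times> unitary_group \<beta>)"

definition endo_haar :: "('e::nonarch_local_field, 1) form \<Rightarrow> ('e, 1) form \<Rightarrow> ('e, 1) form
    \<Rightarrow> ((('e^1^1) \<times> ('e^1^1)) \<times> (('e^1^1) \<times> ('e^1^1))) measure" where
  "endo_haar h1 \<alpha> \<beta> =
     (torus_haar (unitary_group h1) \<Otimes>\<^sub>M torus_haar (unitary_group \<alpha>))
     \<Otimes>\<^sub>M (torus_haar (unitary_group h1) \<Otimes>\<^sub>M torus_haar (unitary_group \<beta>))"

definition endo_act :: "((('e::field^1^1) \<times> ('e^1^1)) \<times> (('e^1^1) \<times> ('e^1^1)))
    \<Rightarrow> ('e^1^1) \<times> ('e^1^1) \<Rightarrow> ('e^1^1) \<times> ('e^1^1)" where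
  "endo_act = (\<lambda>(ga, gb) (xa, xb). (pair_act ga xa, pair_act gb xb))"

definition SRO :: "('e::nonarch_local_field, 1) form \<Rightarrow> ('e, 1) form \<Rightarrow> ('e, 1) form
    \<Rightarrow> ('e^1^1) \<times> ('e^1^1) \<Rightarrow> (('e^1^1) \<times> ('e^1^1) \<Rightarrow> complex) \<Rightarrow> complex" where
  "SRO h1 \<alpha> \<beta> x f =
     (\<Sum>orb \<in> rational_orbit (endo_group h1 \<alpha> \<beta>) endo_act
                 ` (stable_orbit h1 \<alpha> (fst x) \<times> stable_orbit h1 \<beta> (snd x)).
        orbital_integral (endo_group h1 \<alpha> \<beta>) (endo_haar h1 \<alpha> \<beta>) endo_act (SOME y. y \<in> orb) f)"


section \<open>Smooth transfer\<close>

text \<open>Here \<open>V\<^sub>2 = V\<^sub>1 \<oplus> V\<^sub>1\<close> with \<open>V\<^sub>1 = (E, h1)\<close>.\<close>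

definition matches :: "('e::field, 1) form \<Rightarrow> ('e, 1) form \<Rightarrow> ('e, 1) form
    \<Rightarrow> 'e^2^2 \<Rightarrow> ('e^1^1) \<times> ('e^1^1) \<Rightarrow> bool" where
  "matches h1 \<alpha> \<beta> x = (\<lambda>(xa, xb).
     \<exists>g. invertible g \<and>
       block_diag (contraction h1 \<alpha> xa) (contraction h1 \<beta> xb)
         = g ** contraction (form_sum h1 h1) (form_sum h1 h1) x ** matrix_inv g)"

definition transfer_factor :: "('f::nonarch_local_field \<Rightarrow> 'e::field) \<Rightarrow> ('e \<Rightarrow> 'e)
    \<Rightarrow> ('e, 1) form \<Rightarrow> ('e, 1) form \<Rightarrow> ('e, 1) form
    \<Rightarrow> ('e^1^1) \<times> ('e^1^1) \<Rightarrow> 'e^2^2 \<Rightarrow> complex" where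
  "transfer_factor \<iota> \<sigma> h1 \<alpha> \<beta> = (\<lambda>(xa, xb) x.
     let h2 = form_sum h1 h1;
         \<delta> = contraction h2 h2 x;
         \<delta>' = block_diag (contraction h1 \<alpha> xa) (contraction h1 \<beta> xb);
         \<delta>a = herm_scalar \<iota> (contraction h1 \<alpha> xa);
         \<delta>b = herm_scalar \<iota> (contraction h1 \<beta> xb)
     in kappa \<iota> \<sigma> \<delta> \<delta>b (inv_class \<sigma> h2 h2 \<delta> \<delta>') * omega \<iota> \<sigma> (\<delta>a - \<delta>b)
        * complex_of_real (nabs (\<delta>a - \<delta>b)))"

definition smooth_compact_support :: "('x::topological_space \<Rightarrow> complex) \<Rightarrow> bool" where
  "smooth_compact_support f \<longleftrightarrow>
     (\<forall>x. \<exists>S. open S \<and> x \<in> S \<and> (\<forall>y\<in>S. f y = f x)) \<and> compact (closure {x. f x \<noteq> 0})"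

definition smooth_transfers :: "('f::nonarch_local_field \<Rightarrow> 'e::nonarch_local_field) \<Rightarrow> ('e \<Rightarrow> 'e)
    \<Rightarrow> ('e^2^2) measure \<Rightarrow> ('e, 1) form \<Rightarrow> ('e, 1) form \<Rightarrow> ('e, 1) form
    \<Rightarrow> ('e^2^2 \<Rightarrow> complex) \<Rightarrow> (('e^1^1) \<times> ('e^1^1) \<Rightarrow> complex) \<Rightarrow> bool" where
  "smooth_transfers \<iota> \<sigma> dg h1 \<alpha> \<beta> f f' \<longleftrightarrow>
     (let h2 = form_sum h1 h1 in
      smooth_compact_support f \<and> smooth_compact_support f'
    \<and> (\<forall>x. \<forall>(xa, xb) \<in> endo_rss \<iota> h1 \<alpha> \<beta>.
         reg_semisimple h2 h2 x \<and> matches h1 \<alpha> \<beta> x (xa, xb) \<longrightarrow>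
         SRO h1 \<alpha> \<beta> (xa, xb) f' =
           transfer_factor \<iota> \<sigma> h1 \<alpha> \<beta> (xa, xb) x
           * RO_kappa \<iota> \<sigma> dg h2 (herm_scalar \<iota> (contraction h1 \<beta> xb)) x f)
    \<and> (\<forall>(xa, xb) \<in> endo_rss \<iota> h1 \<alpha> \<beta>.
         (\<nexists>x. reg_semisimple h2 h2 x \<and> matches h1 \<alpha> \<beta> x (xa, xb)) \<longrightarrow>
         SRO h1 \<alpha> \<beta> (xa, xb) f' = 0))"

end

theory Submission imports Defs begin

text \<open>
  An orthogonal eigenbasis of \<open>r(x) = - x x\<^sup>*\<close> consists of two vectors whose norms have valuations of
  equal parity, and this parity is the only invariant of the rational orbits in the stable orbit of
  \<open>x\<close>: there are two of them, and \<open>\<kappa>\<close> is the sign of the parity.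

  If \<open>\<alpha>\<close> or \<open>\<beta>\<close> is not split, then both eigenvalues have odd valuation, so \<open>x\<close> and \<open>x\<^sup>*\<close> represent the
  two orbits.  Inversion of the group shows that their orbital integrals agree, and the
  \<open>\<kappa>\<close>-orbital integral vanishes.

  If both forms are split, then \<open>diag(a, b)\<close> represents the even orbit, and conjugating it by a
  similitude whose multiplier is a uniformizer gives the odd one.  Both orbital integrals count pairs
  of self-dual lattices \<open>(L, M)\<close>, for the form and for its rescaling by the uniformizer, such that
  \<open>diag(a, b) M \<subseteq> L\<close>.  The self-dual lattices at distance \<open>I\<close> from the standard one are parametrized by
  the solutions of \<open>N s = -1\<close> modulo the \<open>I\<close>-th power of the maximal ideal, with \<open>I\<close> even for the
  form and odd for its rescaling.  Thus the difference of the two counts is a single alternating sum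
  over \<open>I\<close>, and it telescopes to \<open>(- q) ^ v\<close> with \<open>v\<close> the valuation of \<open>N b - N a\<close>, which the transfer
  factor cancels.
\<close>

section \<open>Non-archimedean local fields\<close>

text \<open>Both counts take place on the tree of the unitary group of the plane: its vertices are
  the lattices self-dual for the form or for its rescaling, \<open>S\<close> is its set of ends, and
  \<open>cc I\<close> is the number of vertices at distance \<open>I\<close> from the standard one.
  The two counts are not evaluated separately; only with opposite signs do the terms of each layer
  of the tree nearly all cancel.

  Lattices enter because stabilizers are compact tori of volume one, so an integral over the
  quotient equals one over the whole group, and because the integrand is invariant under right
  translation by \<open>K\<close> in both variables.

  The torus measures, the quotient measure, the invariant and the representatives of orbits are
  given by choice operators, so existence or independence of the choice has to precede every
  computation. The torus measures come from the given measure: restricted to \<open>K\<close> it has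
  volume one, and its image under the determinant is a Haar measure on the unitary group of a line.
  The sign given by \<kappa> survives all choices because these change the norms of eigenvectors
  only by norms from the extension, which have even valuation.\<close>

lemma nabs_mult: "nabs (x * y) = nabs x * nabs y"
  using dist_mult_left_local[of x y 0] by (simp add: nabs_def)

lemma nabs_zero [simp]: "nabs 0 = 0"
  by (simp add: nabs_def)

lemma nabs_eq_0_iff [simp]: "nabs x = 0 \<longleftrightarrow> x = 0"
  by (simp add: nabs_def)

lemma nabs_nonneg [simp]: "nabs x \<ge> 0"
  by (simp add: nabs_def)

lemma nabs_pos_iff [simp]: "nabs x > 0 \<longleftrightarrow> x \<noteq> 0"
  by (simp add: nabs_def)

lemma nabs_one [simp]: "nabs 1 = 1"
  using nabs_mult[of 1 1] nabs_eq_0_iff[of 1] by (metis mult.right_neutral mult_cancel_left zero_neq_one)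

lemma dist_eq_nabs: "dist x y = nabs (x - y)"
  using dist_add_right_local[of "x - y" y 0] by (simp add: nabs_def)

lemma nabs_minus [simp]: "nabs (- x) = nabs x"
  using dist_eq_nabs[of 0 x] by (simp add: nabs_def dist_commute)

lemma nabs_minus_commute: "nabs (x - y) = nabs (y - x)"
  by (metis nabs_minus minus_diff_eq)

lemma nabs_add: "nabs (x + y) \<le> max (nabs x) (nabs y)"
  using dist_ultrametric[of "x + y" 0 y] by (simp add: dist_eq_nabs)

lemma nabs_diff: "nabs (x - y) \<le> max (nabs x) (nabs y)"
  using nabs_add[of x "- y"] by simp

lemma nabs_add_le: "nabs x \<le> c \<Longrightarrow> nabs y \<le> c \<Longrightarrow> nabs (x + y) \<le> c"
  using nabs_add[of x y] by linarith

lemma nabs_diff_le: "nabs x \<le> c \<Longrightarrow> nabs y \<le> c \<Longrightarrow> nabs (x - y) \<le> c"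
  using nabs_diff[of x y] by linarith

lemma nabs_add_less: "nabs x < c \<Longrightarrow> nabs y < c \<Longrightarrow> nabs (x + y) < c"
  using nabs_add[of x y] by linarith

lemma nabs_add_eq: "nabs x < nabs y \<Longrightarrow> nabs (x + y) = nabs y"
  using nabs_add[of x y] nabs_diff[of "x + y" x] by simp

lemma nabs_add_eq': "nabs y < nabs x \<Longrightarrow> nabs (x + y) = nabs x"
  using nabs_add_eq[of y x] by (simp add: add.commute)

lemma nabs_diff_eq: "nabs x < nabs y \<Longrightarrow> nabs (x - y) = nabs y"
  using nabs_add_eq[of x "- y"] by simp

lemma nabs_diff_eq': "nabs y < nabs x \<Longrightarrow> nabs (x - y) = nabs x"
  using nabs_add_eq'[of "- y" x] by simp

lemma nabs_power: "nabs (x ^ n) = nabs x ^ n"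
  by (induction n) (auto simp: nabs_mult)

lemma nabs_inverse: "nabs (inverse x) = inverse (nabs x)"
proof (cases "x = 0")
  case False
  then have "nabs x * nabs (inverse x) = 1" by (simp flip: nabs_mult)
  then show ?thesis by (metis inverse_unique)
qed simp

lemma nabs_divide: "nabs (x / y) = nabs x / nabs y"
  by (simp add: divide_inverse nabs_mult nabs_inverse)

lemma nabs_power_int: "nabs (x powi n) = nabs x powi n"
  by (simp add: power_int_def nabs_power nabs_inverse)

definition residue_card :: "'k::nonarch_local_field itself \<Rightarrow> nat" where
  "residue_card _ = card ((\<lambda>x::'k. {y. dist x y < 1}) ` integer_ring)"

lemma ex_uniformizer:
  "\<exists>\<pi>::'k::nonarch_local_field. uniformizer \<pi> \<and> nabs \<pi> = 1 / real (residue_card TYPE('k))"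
  using ex_normalized_uniformizer[where 'a='k]
  by (auto simp: uniformizer_def nabs_def integer_ring_def residue_card_def)

lemma finite_residues: "finite ((\<lambda>x::'k::nonarch_local_field. {y. dist x y < 1}) ` integer_ring)"
  using ex_normalized_uniformizer[where 'a='k]
  by (auto simp: nabs_def integer_ring_def)

lemma residue_card_ge_2: "residue_card TYPE('k::nonarch_local_field) \<ge> 2"
proof -
  let ?f = "\<lambda>x::'k. {y. dist x y < 1}"
  have "0 \<in> ?f 0" "0 \<notin> ?f 1" by (auto simp: dist_eq_nabs)
  then have "?f 0 \<noteq> ?f 1" by blast
  then have "card {?f 0, ?f 1} = 2" by simp
  moreover have "{?f 0, ?f 1} \<subseteq> ?f ` integer_ring" by (auto simp: integer_ring_def)
  ultimately show ?thesis unfolding residue_card_def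
    by (metis card_mono finite_residues)
qed

text \<open>The absolute value of a uniformizer (\<open>uniformizer_nabs\<close>). Every nonzero
  absolute value is an integral power of it, which turns inequalities between absolute values into
  inequalities between exponents.\<close>

definition rad :: "'k::nonarch_local_field itself \<Rightarrow> real" where
  "rad T = 1 / real (residue_card T)"

lemma rad_pos [simp]: "rad TYPE('k::nonarch_local_field) > 0"
  and rad_lt_1 [simp]: "rad TYPE('k::nonarch_local_field) < 1"
  and rad_neq_0 [simp]: "rad TYPE('k::nonarch_local_field) \<noteq> 0"
  using residue_card_ge_2[where 'k='k] by (auto simp: rad_def)

lemma rad_nonneg [simp]: "rad TYPE('k::nonarch_local_field) \<ge> 0"
  by (simp add: rad_def)

lemma uniformizerD:
  assumes "uniformizer (\<pi>::'k::nonarch_local_field)"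
  shows "\<pi> \<noteq> 0" "nabs \<pi> < 1" "\<And>x::'k. nabs x < 1 \<Longrightarrow> nabs x \<le> nabs \<pi>"
proof -
  have *: "{x. nabs x < 1} = (\<lambda>y. \<pi> * y) ` integer_ring" using assms by (simp add: uniformizer_def)
  show "\<pi> \<noteq> 0" using assms by (simp add: uniformizer_def)
  have "\<pi> * 1 \<in> (\<lambda>y. \<pi> * y) ` integer_ring" by (rule imageI) (simp add: integer_ring_def)
  then show "nabs \<pi> < 1" using * by auto
  fix x :: 'k assume "nabs x < 1"
  then have "x \<in> (\<lambda>y. \<pi> * y) ` integer_ring" using * by auto
  then obtain y where "x = \<pi> * y" "nabs y \<le> 1" by (auto simp: integer_ring_def)
  then show "nabs x \<le> nabs \<pi>" by (simp add: nabs_mult mult_left_le)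
qed

lemma uniformizer_nabs:
  assumes "uniformizer (\<pi>::'k::nonarch_local_field)"
  shows "nabs \<pi> = rad TYPE('k)"
proof -
  obtain p :: 'k where p: "uniformizer p" "nabs p = rad TYPE('k)"
    using ex_uniformizer[where 'k='k] by (auto simp: rad_def)
  then show ?thesis using uniformizerD[OF assms] uniformizerD[OF p(1)]
    by (metis antisym)
qed

lemma nabs_less_1: "nabs (x::'k::nonarch_local_field) < 1 \<Longrightarrow> nabs x \<le> rad TYPE('k)"
  using ex_uniformizer[where 'k='k] uniformizerD(3) uniformizer_nabs by metis

lemma rad_powi_le [simp]:
  "rad TYPE('k::nonarch_local_field) powi a \<le> rad TYPE('k) powi b \<longleftrightarrow> b \<le> a"
proof (cases "b \<le> a")
  case True
  then show ?thesis using power_int_decreasing[of b a "rad TYPE('k)"] by (simp add: less_imp_le)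
next
  case False
  then show ?thesis using power_int_strict_decreasing[of a b "rad TYPE('k)"] by simp
qed

lemma rad_powi_less [simp]:
  "rad TYPE('k::nonarch_local_field) powi a < rad TYPE('k) powi b \<longleftrightarrow> b < a"
  by (meson linorder_not_le rad_powi_le)

lemma rad_powi_eq [simp]:
  "rad TYPE('k::nonarch_local_field) powi a = rad TYPE('k) powi b \<longleftrightarrow> a = b"
  by (metis antisym_conv3 less_irrefl rad_powi_less)

lemma rad_powi_pos [simp]: "rad TYPE('k::nonarch_local_field) powi a > 0"
  by (simp add: zero_less_power_int)

lemma rad_powi_le_1 [simp]: "rad TYPE('k::nonarch_local_field) powi a \<le> 1 \<longleftrightarrow> 0 \<le> a"
  using rad_powi_le[where 'k='k, of a 0] by simp

lemma rad_powi_less_1 [simp]: "rad TYPE('k::nonarch_local_field) powi a < 1 \<longleftrightarrow> 0 < a"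
  using rad_powi_less[where 'k='k, of a 0] by simp

lemma rad_powi_eq_1 [simp]: "rad TYPE('k::nonarch_local_field) powi a = 1 \<longleftrightarrow> a = 0"
  using rad_powi_eq[where 'k='k, of a 0] by simp

lemma ex_powi_bracket:
  fixes r y :: real
  assumes "0 < r" "r < 1" "0 < y"
  shows "\<exists>k::int. r powi (k + 1) < y \<and> y \<le> r powi k"
proof -
  \<comment> \<open>Since \<open>ln r\<close> is negative, passing to powers of \<open>r\<close>
    reverses the order, so the floor of the quotient is the exponent of the upper bound.\<close>
  define k where "k = \<lfloor>ln y / ln r\<rfloor>"
  have l: "ln r < 0" using assms by simp
  have e: "r powi j = exp (of_int j * ln r)" for j
    using assms powr_real_of_int'[of r j] by (simp add: powr_def)
  have "of_int k \<le> ln y / ln r" "ln y / ln r < of_int (k + 1)" unfolding k_def by linarith+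
  then have "of_int k * ln r \<ge> ln y" "ln y > of_int (k + 1) * ln r"
    using l by (simp_all add: neg_le_divide_eq neg_divide_less_eq)
  then have "exp (of_int k * ln r) \<ge> y" "y > exp (of_int (k + 1) * ln r)"
    using assms by (metis exp_le_cancel_iff exp_ln, metis exp_less_cancel_iff exp_ln)
  then show ?thesis using e by metis
qed

text \<open>Discreteness: a suitable power of a uniformizer scales \<open>x\<close> into the
  interval between \<open>rad\<close> (excluded) and 1, where \<open>nabs_less_1\<close> leaves only
  the value 1.\<close>

lemma ex_nabs_powi:
  assumes "(x::'k::nonarch_local_field) \<noteq> 0"
  shows "\<exists>k. nabs x = rad TYPE('k) powi k"
proof -
  let ?r = "rad TYPE('k)"
  obtain \<pi> :: 'k where \<pi>: "uniformizer \<pi>" using ex_uniformizer by blast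
  obtain k where k: "?r powi (k + 1) < nabs x" "nabs x \<le> ?r powi k"
    using ex_powi_bracket[of ?r "nabs x"] assms by auto
  define y where "y = x / \<pi> powi k"
  have ny: "nabs y = nabs x / ?r powi k"
    by (simp add: y_def nabs_divide nabs_power_int uniformizer_nabs[OF \<pi>])
  have "nabs y \<le> 1" using k by (simp add: ny)
  moreover have "?r < nabs y" using k(1)
    by (simp add: ny power_int_add field_simps)
  ultimately have "nabs y = 1" using nabs_less_1[of y] by linarith
  then show ?thesis using ny by (intro exI[of _ k]) (simp add: field_simps)
qed

text \<open>The additive valuation. At 0 its value is unspecified, so the rules for products and
  quotients carry nonvanishing hypotheses.\<close>

definition vl :: "'k::nonarch_local_field \<Rightarrow> int" where
  "vl x = (THE k. nabs x = rad TYPE('k) powi k)"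

lemma nabs_vl: "(x::'k::nonarch_local_field) \<noteq> 0 \<Longrightarrow> nabs x = rad TYPE('k) powi vl x"
  unfolding vl_def by (rule theI') (use ex_nabs_powi[of x] in auto)

lemma vl_eqI: "nabs (x::'k::nonarch_local_field) = rad TYPE('k) powi k \<Longrightarrow> vl x = k"
  unfolding vl_def by (rule the_equality) auto

lemma vl_mult: "x \<noteq> 0 \<Longrightarrow> y \<noteq> 0 \<Longrightarrow> vl (x * y) = vl x + vl (y::'k::nonarch_local_field)"
  by (rule vl_eqI) (simp add: nabs_mult nabs_vl power_int_add)

lemma vl_one [simp]: "vl 1 = 0"
  by (rule vl_eqI) simp

lemma vl_minus [simp]: "vl (- x) = vl x"
  by (simp add: vl_def)

lemma vl_divide: "x \<noteq> 0 \<Longrightarrow> y \<noteq> 0 \<Longrightarrow> vl (x / y) = vl x - vl (y::'k::nonarch_local_field)"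
  by (rule vl_eqI) (simp add: nabs_divide nabs_vl power_int_diff)

lemma vl_uniformizer: "uniformizer \<pi> \<Longrightarrow> vl \<pi> = 1"
  by (rule vl_eqI) (simp add: uniformizer_nabs)

lemma vl_nonneg_iff: "x \<noteq> 0 \<Longrightarrow> vl x \<ge> 0 \<longleftrightarrow> nabs x \<le> 1"
  by (simp add: nabs_vl)

section \<open>Topology of a local field\<close>

lemma closed_nabs_ball: "closed {x::'k::nonarch_local_field. nabs x \<le> c}"
proof -
  have "{x::'k. nabs x \<le> c} = cball 0 c" by (auto simp: dist_commute nabs_def)
  then show ?thesis by simp
qed

instance nonarch_local_field \<subseteq> topological_ab_group_add
proof
  fix a b :: 'a
  show "((\<lambda>x. fst x + snd x) \<longlongrightarrow> a + b) (nhds a \<times>\<^sub>F nhds b)"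
    unfolding tendsto_iff
  proof (intro allI impI)
    fix e :: real assume e: "e > 0"
    have "eventually (\<lambda>x. dist x a < e) (nhds a)" "eventually (\<lambda>x. dist x b < e) (nhds b)"
      using e by (auto simp: eventually_nhds_metric)
    moreover have "dist (x + y) (a + b) < e" if "dist x a < e" "dist y b < e" for x y
      using that nabs_add_less[of "x - a" e "y - b"] by (simp add: dist_eq_nabs algebra_simps)
    ultimately show "\<forall>\<^sub>F x in nhds a \<times>\<^sub>F nhds b. dist (fst x + snd x) (a + b) < e"
      unfolding eventually_prod_filter by fastforce
  qed
  show "(uminus \<longlongrightarrow> - a) (nhds a)"
    unfolding tendsto_iff
    by (auto simp: eventually_nhds_metric dist_eq_nabs nabs_minus_commute) 
qed

instance nonarch_local_field \<subseteq> topological_semigroup_mult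
proof
  fix a b :: 'a
  show "((\<lambda>x. fst x * snd x) \<longlongrightarrow> a * b) (nhds a \<times>\<^sub>F nhds b)"
    unfolding tendsto_iff
  proof (intro allI impI)
    fix e :: real assume e: "e > 0"
    \<comment> \<open>The difference of the products is a sum of three terms. The minimum with 1
      bounds the cross term by \<open>nabs (y - b)\<close> alone, and the quotient bounds the other
      two.\<close>
    define d where "d = min 1 (e / (1 + nabs a + nabs b))"
    have p: "1 + nabs a + nabs b > 0" using nabs_nonneg[of a] nabs_nonneg[of b] by linarith
    have d: "d > 0" using e p by (simp add: d_def)
    have d2: "d * (1 + nabs a + nabs b) \<le> e"
      using p by (simp add: d_def flip: pos_le_divide_eq)
    have "eventually (\<lambda>x. dist x a < d) (nhds a)" "eventually (\<lambda>x. dist x b < d) (nhds b)"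
      using d by (auto simp: eventually_nhds_metric)
    moreover have "dist (x * y) (a * b) < e" if "dist x a < d" "dist y b < d" for x y
    proof -
      have xa: "nabs (x - a) < d" and yb: "nabs (y - b) < d" using that by (simp_all add: dist_eq_nabs)
      have d3: "d * 1 + d * nabs a + d * nabs b \<le> e" using d2 by (simp add: algebra_simps)
      have nn: "d * nabs a \<ge> 0" "d * nabs b \<ge> 0" using d by auto
      have "nabs ((x - a) * (y - b)) \<le> 1 * nabs (y - b)" unfolding nabs_mult
        by (rule mult_right_mono) (use xa in \<open>auto simp: d_def\<close>)
      then have "nabs ((x - a) * (y - b)) < d * 1" using yb by linarith
      moreover have "d * 1 \<le> e" using d3 nn by linarith
      moreover have "nabs (a * (y - b)) < e"
      proof (cases "a = 0")
        case False
        then have "nabs a * nabs (y - b) < d * nabs a" using yb by (simp add: mult.commute[of d])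
        then show ?thesis unfolding nabs_mult using d3 nn d by linarith
      qed (use e in simp)
      moreover have "nabs ((x - a) * b) < e"
      proof (cases "b = 0")
        case False
        then have "nabs (x - a) * nabs b < d * nabs b" using xa by simp
        then show ?thesis unfolding nabs_mult using d3 nn d by linarith
      qed (use e in simp)
      ultimately have "nabs ((x - a) * (y - b) + (a * (y - b) + (x - a) * b)) < e"
        by (intro nabs_add_less) auto
      then show ?thesis by (simp add: dist_eq_nabs algebra_simps)
    qed
    ultimately show "\<forall>\<^sub>F x in nhds a \<times>\<^sub>F nhds b. dist (fst x * snd x) (a * b) < e"
      unfolding eventually_prod_filter by fastforce
  qed
qed

section \<open>Representatives modulo balls\<close>

lemma nabs_power_int_unif: "uniformizer (\<pi>::'k::nonarch_local_field) \<Longrightarrow> nabs (\<pi> powi n) = rad TYPE('k) powi n"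
  "uniformizer (\<pi>::'k::nonarch_local_field) \<Longrightarrow> nabs (\<pi> ^ m) = rad TYPE('k) ^ m"
  by (simp_all add: nabs_power_int uniformizer_nabs nabs_power)

text \<open>In an ultrametric space being within \<open>d\<close> is an equivalence relation, and
  \<open>T\<close> picks one point of each class in \<open>A\<close>. The sizes of such systems are
  the source of the powers of the residue cardinality in the lattice counts.\<close>

definition transversal :: "'a::metric_space set \<Rightarrow> real \<Rightarrow> 'a set \<Rightarrow> bool" where
  "transversal A d T \<longleftrightarrow> T \<subseteq> A \<and> (\<forall>x\<in>A. \<exists>!t. t \<in> T \<and> dist x t \<le> d)"

lemma nonarch_dist_trans:
  "dist x y \<le> d \<Longrightarrow> dist y z \<le> d \<Longrightarrow> dist x (z::'k::nonarch_local_field) \<le> d"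
  using dist_ultrametric[of x z y] by linarith

text \<open>Sending a representative to the one of the other system in the same class is a
  bijection, by the ultrametric inequality.\<close>

lemma transversal_card_eq:
  fixes A :: "'k::nonarch_local_field set"
  assumes "transversal A d T" "transversal A d U"
  shows "card T = card U"
proof -
  define f where "f t = (THE u. u \<in> U \<and> dist t u \<le> d)" for t
  have f: "f t \<in> U \<and> dist t (f t) \<le> d" if "t \<in> T" for t
  proof -
    have "t \<in> A" using that assms(1) by (auto simp: transversal_def)
    then have "\<exists>!u. u \<in> U \<and> dist t u \<le> d" using assms(2) unfolding transversal_def by blast
    then show ?thesis unfolding f_def by (rule theI')
  qed
  have "bij_betw f T U"
  proof (rule bij_betw_imageI)
    show "inj_on f T"
    proof (rule inj_onI)
      fix s t assume "s \<in> T" "t \<in> T" "f s = f t"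
      then have "dist s t \<le> d"
        using f[of s] f[of t] nonarch_dist_trans[of s "f s" d t] by (simp add: dist_commute)
      moreover have "dist s s \<le> d" using \<open>dist s t \<le> d\<close> zero_le_dist[of s t] dist_self[of s] by linarith
      moreover have "\<exists>!u. u \<in> T \<and> dist s u \<le> d" using assms(1) \<open>s \<in> T\<close> unfolding transversal_def by blast
      ultimately show "s = t" using \<open>s \<in> T\<close> \<open>t \<in> T\<close> by blast
    qed
    show "f ` T = U"
    proof
      show "f ` T \<subseteq> U" using f by auto
      show "U \<subseteq> f ` T"
      proof
        fix u assume u: "u \<in> U"
        then have uA: "u \<in> A" using assms(2) by (auto simp: transversal_def)
        then obtain t where t: "t \<in> T" "dist u t \<le> d" using assms(1) by (auto simp: transversal_def)
        have tA: "t \<in> A" using t assms(1) by (auto simp: transversal_def)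
        then have "\<exists>!v. v \<in> U \<and> dist t v \<le> d" using assms(2) unfolding transversal_def by blast
        then have "f t = u" using f[OF t(1)] u t(2) by (metis dist_commute)
        then show "u \<in> f ` T" using t by auto
      qed
    qed
  qed
  then show ?thesis by (rule bij_betw_same_card)
qed

lemma transversal_image:
  assumes "transversal A d T" "f ` A = B"
    and "\<And>x y. x \<in> A \<Longrightarrow> y \<in> A \<Longrightarrow> dist (f x) (f y) \<le> e \<longleftrightarrow> dist x y \<le> d" and "0 \<le> e"
  shows "transversal B e (f ` T) \<and> card (f ` T) = card T"
proof
  have TA: "T \<subseteq> A" using assms by (simp add: transversal_def)
  have T: "\<exists>!t. t \<in> T \<and> dist x t \<le> d" if "x \<in> A" for x using assms that by (simp add: transversal_def)
  have un: "t = t'" if "x \<in> A" "t \<in> T" "t' \<in> T" "dist x t \<le> d" "dist x t' \<le> d" for x t t'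
    using T[OF that(1)] that by blast
  show "transversal B e (f ` T)" unfolding transversal_def
  proof (intro conjI ballI)
    show "f ` T \<subseteq> B" using assms TA by auto
    fix y assume "y \<in> B"
    then obtain x where x: "x \<in> A" "y = f x" using assms by auto
    obtain t where t: "t \<in> T" "dist x t \<le> d" using T[OF x(1)] by blast
    show "\<exists>!u. u \<in> f ` T \<and> dist y u \<le> e"
    proof (rule ex1I[of _ "f t"])
      show "f t \<in> f ` T \<and> dist y (f t) \<le> e" using t TA x assms(3)[of x t] by auto
      fix u assume "u \<in> f ` T \<and> dist y u \<le> e"
      then obtain t' where "t' \<in> T" "u = f t'" "dist (f x) (f t') \<le> e" using x by auto
      then show "u = f t" using un[OF x(1), of t t'] t TA x assms(3)[of x t'] by auto
    qed
  qed
  show "card (f ` T) = card T"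
  proof (rule card_image, rule inj_onI)
    \<comment> \<open>Equal images are at distance \<open>0 \<le> e\<close>, so the two
      representatives lie within \<open>d\<close> of each other and coincide.\<close>
    fix x y assume xy: "x \<in> T" "y \<in> T" "f x = f y"
    then have "dist x y \<le> d" "dist x x \<le> d"
      using assms(3)[of x y] assms(3)[of x x] assms(4) TA by auto
    then show "x = y" using un[of x x y] xy TA by auto
  qed
qed

lemma transversal_Un:
  assumes "transversal A d T" "transversal B d U"
    and far: "\<And>x y. x \<in> A \<Longrightarrow> y \<in> B \<Longrightarrow> dist x y > d" and "0 \<le> d" "finite T" "finite U"
  shows "transversal (A \<union> B) d (T \<union> U)" "card (T \<union> U) = card T + card U"
proof -
  have s: "T \<subseteq> A" "U \<subseteq> B" using assms by (simp_all add: transversal_def)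
  have 1: "\<And>x. x \<in> A \<Longrightarrow> \<exists>!t. t \<in> T \<and> dist x t \<le> d" "\<And>x. x \<in> B \<Longrightarrow> \<exists>!t. t \<in> U \<and> dist x t \<le> d"
    using assms by (simp_all add: transversal_def)
  have 2: "\<not> dist x y \<le> d" "\<not> dist y x \<le> d" if "x \<in> A" "y \<in> B" for x y
    using far[OF that] by (auto simp: dist_commute)
  show "transversal (A \<union> B) d (T \<union> U)" unfolding transversal_def
  proof (intro conjI ballI)
    show "T \<union> U \<subseteq> A \<union> B" using s by auto
    fix x assume "x \<in> A \<union> B"
    then show "\<exists>!t. t \<in> T \<union> U \<and> dist x t \<le> d"
    proof
      assume "x \<in> A" then show ?thesis using 1(1)[of x] 2(1)[of x] s(2) by blast
    next
      assume "x \<in> B" then show ?thesis using 1(2)[of x] 2(2)[of _ x] s(1) by blast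
    qed
  qed
  have "T \<inter> U = {}"
  proof (rule equals0I)
    fix x assume "x \<in> T \<inter> U"
    then show False using 2(1)[of x x] s assms(4) by auto
  qed
  then show "card (T \<union> U) = card T + card U" using assms by (simp add: card_Un_disjoint)
qed

text \<open>Digit expansion: representatives modulo the power \<open>Suc n\<close> are
  \<open>a + \<pi> * t\<close> with \<open>a\<close> a representative of the residue field and
  \<open>t\<close> one modulo the power \<open>n\<close>.\<close>

lemma ex_transversal_integers:
  "\<exists>T. finite T \<and> card T = residue_card TYPE('k) ^ n
     \<and> transversal {x::'k::nonarch_local_field. nabs x \<le> 1} (rad TYPE('k) ^ n) T"
proof (induction n)
  case 0
  show ?case by (rule exI[of _ "{0}"]) (auto simp: transversal_def dist_eq_nabs)
next
  case (Suc n)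
  let ?O = "{x::'k. nabs x \<le> 1}" and ?c = "\<lambda>x::'k. {y. dist x y < 1}" and ?r = "rad TYPE('k)"
  obtain \<pi> :: 'k where \<pi>: "uniformizer \<pi>" using ex_uniformizer by blast
  then have \<pi>0: "\<pi> \<noteq> 0" and \<pi>1: "nabs \<pi> = ?r" by (auto simp: uniformizer_nabs uniformizerD)
  obtain T where T: "finite T" "card T = residue_card TYPE('k) ^ n" "transversal ?O (?r ^ n) T"
    using Suc by blast
  have Tsub: "T \<subseteq> ?O" using T by (simp add: transversal_def)
  define R where "R = (\<lambda>C. SOME x. x \<in> ?O \<and> ?c x = C) ` (?c ` ?O)"
  have O: "integer_ring = ?O" by (simp add: integer_ring_def)
  have sel: "(SOME x. x \<in> ?O \<and> ?c x = C) \<in> ?O \<and> ?c (SOME x. x \<in> ?O \<and> ?c x = C) = C" if "C \<in> ?c ` ?O" for C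
    by (rule someI_ex) (use that in auto)
  have finR: "finite R" unfolding R_def using finite_residues[where 'k='k] O by simp
  have cardR: "card R = residue_card TYPE('k)" unfolding R_def residue_card_def O
  proof (rule card_image, rule inj_onI)
    fix C D assume "C \<in> ?c ` ?O" "D \<in> ?c ` ?O" "(SOME x. x \<in> ?O \<and> ?c x = C) = (SOME x. x \<in> ?O \<and> ?c x = D)"
    then show "C = D" using sel[THEN conjunct2, of C] sel[THEN conjunct2, of D] by simp
  qed
  have RO: "R \<subseteq> ?O" using sel unfolding R_def by blast
  have Rex: "\<exists>a\<in>R. nabs (x - a) < 1" if "x \<in> ?O" for x
  proof -
    let ?a = "SOME y. y \<in> ?O \<and> ?c y = ?c x"
    have "?c ?a = ?c x" using sel[of "?c x"] that by blast
    moreover have "x \<in> ?c x" by simp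
    ultimately have "dist ?a x < 1" by blast
    then show ?thesis using that unfolding R_def
      by (intro bexI[of _ ?a]) (auto simp: dist_eq_nabs nabs_minus_commute)
  qed
  have Run: "a = b" if ab: "a \<in> R" "b \<in> R" "nabs (a - b) < 1" for a b
  proof -
    have "?c a = ?c b"
    proof -
      have "dist b y < 1" if "dist a y < 1" for y
        using ab(3) that nabs_add_less[of "b - a" 1 "a - y"] by (simp add: dist_eq_nabs nabs_minus_commute)
      moreover have "dist a y < 1" if "dist b y < 1" for y
        using ab(3) that nabs_add_less[of "a - b" 1 "b - y"] by (simp add: dist_eq_nabs)
      ultimately show ?thesis by auto
    qed
    moreover obtain C where C: "C \<in> ?c ` ?O" "a = (SOME x. x \<in> ?O \<and> ?c x = C)" using ab(1) unfolding R_def by blast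
    moreover obtain D where D: "D \<in> ?c ` ?O" "b = (SOME x. x \<in> ?O \<and> ?c x = D)" using ab(2) unfolding R_def by blast
    ultimately show ?thesis using sel[OF C(1)] sel[OF D(1)] by metis
  qed
  have small: "nabs (\<pi> * y) < 1" if "nabs y \<le> 1" for y
  proof -
    have "?r * nabs y \<le> ?r * 1" using that rad_pos[where 'k='k] by (intro mult_left_mono) auto
    then show ?thesis using rad_lt_1[where 'k='k] unfolding nabs_mult \<pi>1 by linarith
  qed
  have inj: "a = b \<and> s = t" if h: "a \<in> R" "b \<in> R" "s \<in> T" "t \<in> T"
    "nabs ((a + \<pi> * s) - (b + \<pi> * t)) \<le> ?r ^ Suc n" for a b s t
  proof -
    have st: "nabs s \<le> 1" "nabs t \<le> 1" using h Tsub by auto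
    have "?r ^ Suc n < 1" using rad_lt_1[where 'k='k] rad_pos[where 'k='k] by (intro power_Suc_less_one) auto
    then have "nabs ((a + \<pi> * s) - (b + \<pi> * t)) < 1" using h by linarith
    moreover have "nabs (\<pi> * (t - s)) < 1" using small[of "t - s"] nabs_diff_le[OF st(2,1)] by blast
    ultimately have "nabs (((a + \<pi> * s) - (b + \<pi> * t)) + \<pi> * (t - s)) < 1" by (rule nabs_add_less)
    then have ab: "a = b" using Run[OF h(1,2)] by (simp add: algebra_simps)
    then have "nabs (\<pi> * (s - t)) \<le> ?r ^ Suc n" using h(5) by (simp add: algebra_simps)
    then have "dist s t \<le> ?r ^ n" by (simp add: nabs_mult \<pi>1 dist_eq_nabs)
    moreover have "dist s s \<le> ?r ^ n" using rad_pos[where 'k='k] by simp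
    moreover have "\<exists>!u. u \<in> T \<and> dist s u \<le> ?r ^ n" using T(3) st unfolding transversal_def by blast
    ultimately show ?thesis using ab h by blast
  qed
  define U where "U = (\<lambda>(a, t). a + \<pi> * t) ` (R \<times> T)"
  have injU: "inj_on (\<lambda>(a, t). a + \<pi> * t) (R \<times> T)"
  proof (rule inj_onI, clarify)
    fix a t b s assume h: "a \<in> R" "t \<in> T" "b \<in> R" "s \<in> T" "a + \<pi> * t = b + \<pi> * s"
    then have "nabs ((a + \<pi> * t) - (b + \<pi> * s)) \<le> ?r ^ Suc n" by simp
    then show "a = b \<and> t = s" using h by (intro inj)
  qed
  have "card U = residue_card TYPE('k) ^ Suc n"
    unfolding U_def using injU by (simp add: card_image card_cartesian_product cardR T)
  moreover have "finite U" unfolding U_def using finR T by simp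
  moreover have "transversal ?O (?r ^ Suc n) U" unfolding transversal_def
  proof (intro conjI ballI)
    show "U \<subseteq> ?O"
    proof
      fix u assume "u \<in> U"
      then obtain a t where u: "u = a + \<pi> * t" "a \<in> R" "t \<in> T" unfolding U_def by auto
      have "nabs a \<le> 1" "nabs t \<le> 1" using u RO Tsub by auto
      then show "u \<in> ?O" using small[of t] nabs_add_le[of a 1 "\<pi> * t"] u by simp
    qed
    fix x assume "x \<in> ?O"
    then obtain a where a: "a \<in> R" "nabs (x - a) < 1" using Rex by blast
    then have "nabs ((x - a) / \<pi>) \<le> 1" using nabs_less_1[of "x - a"] by (simp add: nabs_divide \<pi>1)
    then obtain t where t: "t \<in> T" "dist ((x - a) / \<pi>) t \<le> ?r ^ n" using T(3) unfolding transversal_def by blast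
    have "x - (a + \<pi> * t) = \<pi> * ((x - a) / \<pi> - t)"
      unfolding right_diff_distrib[of \<pi> "(x - a) / \<pi>" t] using \<pi>0 by simp
    then have d: "nabs (x - (a + \<pi> * t)) \<le> ?r ^ Suc n" using t rad_pos[where 'k='k]
      by (simp only: nabs_mult \<pi>1) (simp add: dist_eq_nabs)
    show "\<exists>!u. u \<in> U \<and> dist x u \<le> ?r ^ Suc n"
    proof (rule ex1I[of _ "a + \<pi> * t"])
      show "a + \<pi> * t \<in> U \<and> dist x (a + \<pi> * t) \<le> ?r ^ Suc n" using a t d by (auto simp: U_def dist_eq_nabs)
      fix u assume u: "u \<in> U \<and> dist x u \<le> ?r ^ Suc n"
      then obtain b s where bs: "b \<in> R" "s \<in> T" "u = b + \<pi> * s" by (auto simp: U_def)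
      have "nabs ((x - (a + \<pi> * t)) - (x - (b + \<pi> * s))) \<le> ?r ^ Suc n"
        using d u bs by (intro nabs_diff_le[of "x - (a + \<pi> * t)" _ "x - (b + \<pi> * s)"]) (auto simp: dist_eq_nabs)
      then show "u = a + \<pi> * t" using inj[OF bs(1) a(1) bs(2) t(1)] bs by (simp add: algebra_simps)
    qed
  qed
  ultimately show ?case by blast
qed

text \<open>The ball is complete, and the finite systems of representatives are finite nets in
  it.\<close>

lemma compact_integers: "compact {x::'k::nonarch_local_field. nabs x \<le> 1}"
  unfolding compact_eq_totally_bounded
proof (intro conjI allI impI)
  show "complete {x::'k. nabs x \<le> 1}" using closed_nabs_ball by (simp add: complete_eq_closed)
  fix e :: real assume "e > 0"
  then obtain n where n: "rad TYPE('k) ^ n < e"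
    using real_arch_pow_inv[of e "rad TYPE('k)"] by auto
  obtain T where T: "finite T" "transversal {x::'k. nabs x \<le> 1} (rad TYPE('k) ^ n) T"
    using ex_transversal_integers by blast
  have sub: "{x. nabs x \<le> 1} \<subseteq> (\<Union>x\<in>T. ball x e)"
  proof
    fix x assume "x \<in> {x::'k. nabs x \<le> 1}"
    then obtain t where "t \<in> T" "dist x t \<le> rad TYPE('k) ^ n" using T(2) unfolding transversal_def by blast
    then show "x \<in> (\<Union>x\<in>T. ball x e)" using n by (intro UN_I[of t]) (auto simp: dist_commute)
  qed
  show "\<exists>k. finite k \<and> {x::'k. nabs x \<le> 1} \<subseteq> (\<Union>x\<in>k. ball x e)"
    by (intro exI[of _ T] conjI T(1) sub)
qed

lemma ex_nabs_gt: "\<exists>z::'k::nonarch_local_field. nabs z \<ge> c \<and> z \<noteq> 0"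
proof -
  obtain \<pi> :: 'k where \<pi>: "uniformizer \<pi>" using ex_uniformizer by blast
  obtain n where "(1 / rad TYPE('k)) ^ n > c"
    using real_arch_pow[of "1 / rad TYPE('k)" c] by (auto simp: field_simps)
  then have "nabs ((1 / \<pi>) ^ n) \<ge> c" by (simp add: nabs_power nabs_divide uniformizer_nabs[OF \<pi>])
  then show ?thesis using \<pi> by (intro exI[of _ "(1 / \<pi>) ^ n"]) (auto simp: uniformizer_def)
qed

lemma compact_nabs_ball: "compact {x::'k::nonarch_local_field. nabs x \<le> c}"
proof -
  obtain z :: 'k where z: "nabs z \<ge> c" "z \<noteq> 0" using ex_nabs_gt by blast
  have "compact ((\<lambda>x. z * x) ` {x. nabs x \<le> 1})"
    by (intro compact_continuous_image compact_integers continuous_intros)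
  moreover have "{x. nabs x \<le> c} \<subseteq> (\<lambda>x. z * x) ` {x. nabs x \<le> 1}"
  proof
    fix x :: 'k assume "x \<in> {x. nabs x \<le> c}"
    then have "x = z * (x / z)" "nabs (x / z) \<le> 1" using z by (auto simp: nabs_divide divide_le_eq)
    then show "x \<in> (\<lambda>x. z * x) ` {x. nabs x \<le> 1}" by blast
  qed
  ultimately show ?thesis using closed_nabs_ball
    by (metis compact_Int_closed inf.absorb_iff2)
qed

text \<open>The points \<open>t / \<pi> ^ m\<close>, with \<open>t\<close> from the finite systems
  of representatives, are countable and dense. Second countability identifies the Borel sets of a
  product with the product of the Borel sets, which is needed before Fubini can be applied to
  groups.\<close>

instance nonarch_local_field \<subseteq> second_countable_topology
proof
  obtain \<pi> :: 'a where \<pi>: "uniformizer \<pi>" using ex_uniformizer by blast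
  let ?O = "{x::'a. nabs x \<le> 1}" and ?r = "rad TYPE('a)"
  have \<pi>0: "\<pi> \<noteq> 0" and \<pi>1: "nabs \<pi> = ?r" using \<pi> by (auto simp: uniformizer_nabs uniformizerD)
  have "\<forall>n. \<exists>T. finite T \<and> transversal ?O (?r ^ n) T" using ex_transversal_integers[where 'k='a] by blast
  then obtain T where T: "\<And>n. finite (T n)" "\<And>n. transversal ?O (?r ^ n) (T n)" by metis
  define D where "D = (\<lambda>(m, x). x / \<pi> ^ m) ` (UNIV \<times> (\<Union>n. T n))"
  have cD: "countable D" unfolding D_def using T(1)
    by (intro countable_image countable_SIGMA countable_UN) (auto intro: countable_finite)
  have dense: "\<exists>d\<in>D. dist x d < e" if e: "e > 0" for x :: 'a and e :: real
  proof -
    obtain m where m: "(1 / ?r) ^ m > nabs x"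
      using real_arch_pow[of "1 / ?r" "nabs x"] by (auto simp: field_simps)
    then have xm: "nabs (x * \<pi> ^ m) \<le> 1" by (simp add: nabs_mult nabs_power \<pi>1 field_simps)
    obtain n where n: "?r ^ n < e * ?r ^ m"
      using real_arch_pow_inv[of "e * ?r ^ m" ?r] e by auto
    obtain t where t: "t \<in> T n" "dist (x * \<pi> ^ m) t \<le> ?r ^ n" using T(2)[of n] xm unfolding transversal_def by blast
    have "x - t / \<pi> ^ m = (x * \<pi> ^ m - t) / \<pi> ^ m" using \<pi>0 by (simp add: field_simps)
    then have "dist x (t / \<pi> ^ m) = nabs (x * \<pi> ^ m - t) / ?r ^ m"
      by (simp add: dist_eq_nabs nabs_divide nabs_power \<pi>1)
    also have "\<dots> < e" using t n by (simp add: dist_eq_nabs divide_less_eq)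
    finally show ?thesis using t unfolding D_def by force
  qed
  let ?B = "(\<lambda>(d, n). ball d (1 / real (Suc n))) ` (D \<times> UNIV)"
  have "topological_basis ?B"
  proof (rule topological_basisI)
    fix S :: "'a set" and x assume S: "open S" "x \<in> S"
    then obtain e where e: "e > 0" "ball x e \<subseteq> S" using open_contains_ball by blast
    obtain n where n: "1 / real (Suc n) < e / 2" using nat_approx_posE[of "e / 2"] e by auto
    obtain d where d: "d \<in> D" "dist x d < 1 / real (Suc n)" using dense[of "1 / real (Suc n)" x] by auto
    have "ball d (1 / real (Suc n)) \<subseteq> ball x e"
    proof
      fix y assume "y \<in> ball d (1 / real (Suc n))"
      then show "y \<in> ball x e" using d n dist_triangle[of x y d] by (simp add: dist_commute)
    qed
    then show "\<exists>B'\<in>?B. x \<in> B' \<and> B' \<subseteq> S" using d e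
      by (intro bexI[of _ "ball d (1 / real (Suc n))"]) (auto simp: dist_commute)
  qed auto
  moreover have "countable ?B" using cD by (intro countable_image countable_SIGMA) auto
  ultimately show "\<exists>B::'a set set. countable B \<and> open = generate_topology B"
    using topological_basis_imp_subbasis by blast
qed

instance vec :: ("{metric_space, second_countable_topology}", finite) second_countable_topology
proof
  obtain B :: "'a set set" where B: "countable B" "topological_basis B"
    using ex_countable_basis by blast
  let ?B = "(\<lambda>A. {x::'a^'b. \<forall>i. x $ i \<in> A i}) ` (PiE UNIV (\<lambda>_. B))"
  have "topological_basis ?B"
  proof (rule topological_basisI)
    fix S :: "('a^'b) set" assume "S \<in> ?B"
    then obtain A where A: "A \<in> PiE UNIV (\<lambda>_. B)" "S = {x. \<forall>i. x $ i \<in> A i}" by auto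
    have "open (A i)" for i using A B(2) by (auto intro: topological_basis_open)
    then show "open S" unfolding A open_vec_def by blast
  next
    fix S :: "('a^'b) set" and x assume S: "open S" "x \<in> S"
    then obtain A where A: "\<And>i. open (A i)" "\<And>i. x $ i \<in> A i" "\<And>y. (\<forall>i. y $ i \<in> A i) \<Longrightarrow> y \<in> S"
      unfolding open_vec_def by metis
    have "\<forall>i. \<exists>C\<in>B. x $ i \<in> C \<and> C \<subseteq> A i" using A B(2) by (meson topological_basisE)
    then obtain C where C: "\<And>i. C i \<in> B" "\<And>i. x $ i \<in> C i" "\<And>i. C i \<subseteq> A i" by metis
    show "\<exists>B'\<in>?B. x \<in> B' \<and> B' \<subseteq> S"
      by (rule bexI[of _ "{x. \<forall>i. x $ i \<in> C i}"]) (use A C in blast, use C in auto)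
  qed
  moreover have "countable ?B" using B by (intro countable_image countable_PiE) auto
  ultimately show "\<exists>B::('a^'b) set set. countable B \<and> open = generate_topology B"
    using topological_basis_imp_subbasis by blast
qed

text \<open>With \<open>y = 1 + s\<close> the equation reads \<open>s = (t - s^2) / 2\<close>. As 2
  is a unit, the right side contracts the ball of radius \<open>nabs t\<close> by the factor
  \<open>nabs t\<close>, so the fixed point also satisfies the distance bound.\<close>

lemma hensel_sqrt:
  fixes t :: "'k::nonarch_local_field"
  assumes "nabs (2::'k) = 1" "nabs t < 1"
  shows "\<exists>y. y ^ 2 = 1 + t \<and> nabs (y - 1) \<le> nabs t"
proof -
  let ?S = "{x::'k. nabs x \<le> nabs t}" and ?f = "\<lambda>s. (t - s ^ 2) / 2"
  have two: "(2::'k) \<noteq> 0" using assms(1) by auto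
  have "\<exists>!s\<in>?S. ?f s = s"
  proof (rule Banach_fix[where c = "nabs t"])
    show "complete ?S" using closed_nabs_ball by (simp add: complete_eq_closed)
    show "?f ` ?S \<subseteq> ?S"
    proof clarsimp
      fix s :: 'k assume "nabs s \<le> nabs t"
      then have "nabs (s ^ 2) \<le> nabs t" using assms(2)
        using mult_mono[of "nabs s" "nabs t" "nabs s" 1] by (simp add: nabs_mult power2_eq_square)
      then show "nabs ((t - s ^ 2) / 2) \<le> nabs t" using assms
        by (simp add: nabs_divide nabs_diff_le)
    qed
    show "dist (?f x) (?f y) \<le> nabs t * dist x y" if "x \<in> ?S" "y \<in> ?S" for x y
    proof -
      have "?f x - ?f y = (y + x) * (y - x) / 2" by (simp add: power2_eq_square algebra_simps flip: diff_divide_distrib)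
      then have "dist (?f x) (?f y) = nabs ((y + x) * (y - x) / 2)" by (simp only: dist_eq_nabs)
      also have "\<dots> = nabs (y + x) * nabs (x - y)"
        using assms by (simp add: nabs_divide nabs_mult nabs_minus_commute)
      also have "\<dots> \<le> nabs t * nabs (x - y)"
        using that by (intro mult_right_mono nabs_add_le) auto
      finally show ?thesis by (simp add: dist_eq_nabs)
    qed
  qed (use assms in auto)
  then obtain s where s: "nabs s \<le> nabs t" "?f s = s" by auto
  have "t - s ^ 2 = 2 * s" using s(2) two by (simp add: field_simps)
  then have "(1 + s) ^ 2 = 1 + t" by (simp add: algebra_simps power2_eq_square)
  then show ?thesis using s by (intro exI[of _ "1 + s"]) simp
qed

text \<open>Were 2 not a unit, it would be the least positive integer of absolute value below 1,
  that is, the residue characteristic.\<close>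

lemma residue_char_odd_imp:
  assumes "odd (residue_char TYPE('k::nonarch_local_field))"
  shows "nabs (2::'k) = 1"
proof (rule ccontr)
  assume "nabs (2::'k) \<noteq> 1"
  moreover have "nabs (2::'k) \<le> 1" using nabs_add_le[of 1 1 "1::'k"] by simp
  ultimately have l: "nabs (of_nat 2 :: 'k) < 1" by simp
  have "residue_char TYPE('k) = 2" unfolding residue_char_def
  proof (rule Least_equality)
    show "2 > (0::nat) \<and> nabs (of_nat 2 :: 'k) < 1" using l by simp
    fix y :: nat assume "y > 0 \<and> nabs (of_nat y :: 'k) < 1"
    then show "2 \<le> y" by (cases "y = 1") auto
  qed
  then show False using assms by simp
qed

section \<open>Unramified quadratic extensions\<close>

lemma field_hom_props:
  assumes "field_hom \<phi>"
  shows "\<phi> 1 = 1" "\<phi> 0 = 0" "\<phi> (x + y) = \<phi> x + \<phi> y" "\<phi> (x * y) = \<phi> x * \<phi> y" "\<phi> (- x) = - \<phi> x"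
    "\<phi> (x - y) = \<phi> x - \<phi> y" "\<phi> (x / y) = \<phi> x / \<phi> y" "\<phi> (inverse x) = inverse (\<phi> x)"
    "\<phi> (x ^ n) = \<phi> x ^ n" "\<phi> (x powi k) = \<phi> x powi k" "\<phi> x = 0 \<longleftrightarrow> x = 0" "\<phi> x = \<phi> y \<longleftrightarrow> x = y"
    "\<phi> (numeral w) = numeral w"
proof -
  show 1: "\<phi> 1 = 1" and add: "\<And>x y. \<phi> (x + y) = \<phi> x + \<phi> y" and mult: "\<And>x y. \<phi> (x * y) = \<phi> x * \<phi> y"
    using assms by (simp_all add: field_hom_def)
  show 0: "\<phi> 0 = 0" using add[of 0 0] by (metis add.right_neutral add_left_cancel)
  show m: "\<phi> (- x) = - \<phi> x" for x using add[of x "- x"] 0 by (simp add: eq_neg_iff_add_eq_0 add.commute)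
  show d: "\<phi> (x - y) = \<phi> x - \<phi> y" for x y using add[of x "- y"] m by simp
  show inv: "\<phi> (inverse x) = inverse (\<phi> x)" for x
  proof (cases "x = 0")
    case False
    then have "\<phi> x * \<phi> (inverse x) = 1" by (simp add: 1 flip: mult)
    then show ?thesis by (metis inverse_unique)
  qed (simp add: 0)
  show "\<phi> (x / y) = \<phi> x / \<phi> y" by (simp add: divide_inverse mult inv)
  show p: "\<phi> (x ^ n) = \<phi> x ^ n" for x n by (induction n) (simp_all add: 1 mult)
  show "\<phi> (x powi k) = \<phi> x powi k" by (simp add: power_int_def p inv)
  show z: "\<phi> x = 0 \<longleftrightarrow> x = 0" for x
  proof
    assume "\<phi> x = 0"
    then have "\<phi> (x * inverse x) = 0" by (simp add: mult)
    then show "x = 0" using 1 by (cases "x = 0") auto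
  qed (simp add: 0)
  show "\<phi> x = \<phi> y \<longleftrightarrow> x = y" using z[of "x - y"] by (simp add: d)
  have "\<phi> (of_nat k) = of_nat k" for k by (induction k) (simp_all add: 0 1 add)
  from this[of "numeral w"] show "\<phi> (numeral w) = numeral w" by simp
qed

lemma rad_powi_greater_1 [simp]: "1 < rad TYPE('k::nonarch_local_field) powi a \<longleftrightarrow> a < 0"
  using rad_powi_less[where 'k='k, of 0 a] by simp

locale unramified_quadratic =
  fixes \<iota> :: "'f::nonarch_local_field \<Rightarrow> 'e::nonarch_local_field" and \<sigma> :: "'e \<Rightarrow> 'e"
  assumes quadratic: "quadratic_extension \<iota>"
    and unramified: "unramified_extension \<iota>"
    and galois: "galois_conj \<iota> \<sigma>"
    and odd_char: "odd (residue_char TYPE('f))"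
begin

lemma hom_\<iota>: "field_hom \<iota>"
  using quadratic by (simp add: quadratic_extension_def)

lemma hom_\<sigma>: "field_hom \<sigma>"
  using galois by (simp add: galois_conj_def)

lemmas \<iota>_simps [simp] = field_hom_props[OF hom_\<iota>]
lemmas \<sigma>_simps [simp] = field_hom_props[OF hom_\<sigma>]

lemma \<sigma>_\<iota> [simp]: "\<sigma> (\<iota> a) = \<iota> a"
  using galois by (simp add: galois_conj_def)

lemma nabs_two_F: "nabs (2::'f) = 1"
  by (rule residue_char_odd_imp[OF odd_char])

text \<open>Of the embedding only continuity is given. Powers of \<open>x\<close> tend to 0, hence
  so do their images, and some power of \<open>nabs (\<iota> x)\<close> lies below 1.\<close>

lemma nabs_\<iota>_less_1:
  assumes "nabs x < 1"
  shows "nabs (\<iota> x) < 1"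
proof -
  have "(\<lambda>n. x ^ n) \<longlonglongrightarrow> 0" unfolding tendsto_iff
  proof (intro allI impI)
    fix e :: real assume "e > 0"
    moreover have "(\<lambda>n. nabs x ^ n) \<longlonglongrightarrow> 0" using assms by (intro LIMSEQ_realpow_zero) auto
    ultimately have "\<forall>\<^sub>F n in sequentially. nabs x ^ n < e" using order_tendstoD(2) by blast
    then show "\<forall>\<^sub>F n in sequentially. dist (x ^ n) 0 < e" by (simp add: dist_eq_nabs nabs_power)
  qed
  moreover have "isCont \<iota> 0" using quadratic
    by (simp add: quadratic_extension_def continuous_on_eq_continuous_at)
  ultimately have "(\<lambda>n. \<iota> (x ^ n)) \<longlonglongrightarrow> \<iota> 0" by (rule isCont_tendsto_compose[rotated])
  then have "\<forall>\<^sub>F n in sequentially. dist (\<iota> (x ^ n)) (\<iota> 0) < 1"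
    unfolding tendsto_iff by simp
  then obtain n where "nabs (\<iota> x) ^ n < 1"
    by (auto simp: dist_eq_nabs nabs_power eventually_sequentially)
  then show ?thesis by (metis linorder_not_less one_le_power)
qed

lemma uniformizer_\<iota>: "uniformizer \<pi> \<Longrightarrow> uniformizer (\<iota> \<pi>)"
  using unramified by (simp add: unramified_extension_def)

text \<open>If a unit \<open>v\<close> had an image of absolute value below 1, then
  \<open>\<pi> / v ^ n\<close> would stay in the maximal ideal while its image outgrows 1 for large
  \<open>n\<close>.\<close>

lemma nabs_\<iota>_unit:
  assumes "nabs u = 1"
  shows "nabs (\<iota> u) = 1"
proof -
  have *: "\<not> nabs (\<iota> v) < 1" if v: "nabs v = 1" for v
  proof
    assume l: "nabs (\<iota> v) < 1"
    obtain \<pi> :: 'f where \<pi>: "uniformizer \<pi>" using ex_uniformizer by blast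
    obtain n where n: "nabs (\<iota> v) ^ n < rad TYPE('e)"
      using real_arch_pow_inv[of "rad TYPE('e)" "nabs (\<iota> v)"] l by auto
    have v0: "v \<noteq> 0" using v by auto
    have "nabs (\<pi> / v ^ n) < 1" using \<pi> v by (simp add: nabs_divide nabs_power uniformizer_nabs)
    then have "nabs (\<iota> (\<pi> / v ^ n)) < 1" by (rule nabs_\<iota>_less_1)
    then show False using n v0 uniformizer_nabs[OF uniformizer_\<iota>[OF \<pi>]]
      by (simp add: nabs_divide nabs_power divide_less_eq)
  qed
  have u0: "u \<noteq> 0" using assms by auto
  have "nabs (1 / u) = 1" using assms by (simp add: nabs_divide)
  from *[OF this] have "\<not> 1 < nabs (\<iota> u)" using u0 by (auto simp: nabs_divide divide_less_eq)
  then show ?thesis using *[OF assms] by linarith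
qed

text \<open>Each absolute value is normalized by its own residue field, so the two fields are
  compared through valuations. These agree because a uniformizer stays a uniformizer.\<close>

lemma nabs_\<iota>: "x \<noteq> 0 \<Longrightarrow> nabs (\<iota> x) = rad TYPE('e) powi vl x"
proof -
  assume x: "x \<noteq> 0"
  obtain \<pi> :: 'f where \<pi>: "uniformizer \<pi>" using ex_uniformizer by blast
  define u where "u = x / \<pi> powi vl x"
  have "nabs u = 1" using x \<pi> by (simp add: u_def nabs_divide nabs_power_int_unif nabs_vl)
  then have "nabs (\<iota> u) = 1" by (rule nabs_\<iota>_unit)
  moreover have "\<iota> u = \<iota> x / \<iota> \<pi> powi vl x" by (simp add: u_def)
  moreover have "uniformizer (\<iota> \<pi>)" using \<pi> by (rule uniformizer_\<iota>)
  ultimately show ?thesis by (simp add: nabs_divide nabs_power_int uniformizer_nabs)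
qed

lemma vl_\<iota> [simp]: "x \<noteq> 0 \<Longrightarrow> vl (\<iota> x) = vl x"
  by (rule vl_eqI) (rule nabs_\<iota>)

lemma nabs_\<iota>_le_iff: "nabs (\<iota> x) \<le> rad TYPE('e) powi k \<longleftrightarrow> nabs x \<le> rad TYPE('f) powi k"
  by (cases "x = 0") (simp_all add: nabs_\<iota> nabs_vl less_imp_le)

lemma nabs_\<iota>_le_1_iff: "nabs (\<iota> x) \<le> 1 \<longleftrightarrow> nabs x \<le> 1"
  using nabs_\<iota>_le_iff[of x 0] by simp

lemma nabs_\<iota>_eq_1_iff: "nabs (\<iota> x) = 1 \<longleftrightarrow> nabs x = 1"
  by (cases "x = 0") (simp_all add: nabs_\<iota> nabs_vl)

lemma nabs_two: "nabs (2::'e) = 1"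
  using nabs_\<iota>_unit[OF nabs_two_F] by simp

lemma two_neq_0 [simp]: "(2::'e) \<noteq> 0" "(2::'f) \<noteq> 0"
  using nabs_two nabs_two_F by auto

lemma ex_basis: "\<exists>z. z \<notin> range \<iota> \<and> (\<forall>w. \<exists>a b. w = \<iota> a + \<iota> b * z)"
proof -
  interpret vs: vector_space "\<lambda>a z. \<iota> a * z"
    by unfold_locales (simp_all add: algebra_simps)
  have d2: "vs.dim (UNIV :: 'e set) = 2" using quadratic by (simp add: quadratic_extension_def)
  obtain B where B: "vs.independent B" "UNIV \<subseteq> vs.span B" "card B = 2"
    using vs.basis_exists[of UNIV] d2 by metis
  have fB: "finite B" using B(3) card.infinite by fastforce
  have sp1: "vs.span {1} = range \<iota>" by (simp add: vs.span_singleton)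
  have "range \<iota> \<noteq> UNIV"
  proof
    assume "range \<iota> = UNIV"
    then have "vs.dim (UNIV :: 'e set) \<le> card {1::'e}" using sp1 by (intro vs.dim_le_card) auto
    then show False using d2 by simp
  qed
  then obtain z where z: "z \<notin> range \<iota>" by auto
  have ind1: "vs.independent {1}" 
    by (rule vs.independent_insertI[OF _ vs.independent_empty]) simp
  have ind: "vs.independent {z, 1}" using z by (intro vs.independent_insertI[OF _ ind1]) (simp add: sp1)
  have "w \<in> vs.span {z, 1}" for w
  proof (rule ccontr)
    assume w: "w \<notin> vs.span {z, 1}"
    then have i: "vs.independent {w, z, 1}" by (rule vs.independent_insertI[OF _ ind])
    have "card {w, z, 1} \<le> card B" using vs.independent_span_bound[OF fB i] B(2) by auto
    moreover have "w \<noteq> z" "w \<noteq> 1" using w vs.span_base[of _ "{z, 1}"] by auto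
    moreover have "z \<noteq> 1" using z \<iota>_simps(1) by (metis rangeI)
    ultimately show False using B(3) by simp
  qed
  then have "\<exists>a b. w = \<iota> a + \<iota> b * z" for w
    using vs.span_breakdown_eq[of w z "{1}"] sp1 by (auto simp: algebra_simps) (metis diff_add_cancel)
  then show ?thesis using z by blast
qed

text \<open>A generator \<open>x\<close> satisfies a monic quadratic equation over the base field,
  and \<open>\<sigma> x\<close> is its other root. So \<open>\<sigma> x\<close> is the trace minus
  \<open>x\<close>, whence \<sigma> is an involution and \<open>x - \<sigma> x\<close> changes
  sign.\<close>

lemma \<sigma>_\<sigma> [simp]: "\<sigma> (\<sigma> z) = z"
  and ex_antifixed: "\<exists>\<theta>. \<theta> \<noteq> 0 \<and> \<sigma> \<theta> = - \<theta> \<and> (\<forall>w. \<exists>a b. w = \<iota> a + \<iota> b * \<theta>)"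
proof -
  obtain x where x: "x \<notin> range \<iota>" "\<And>w. \<exists>a b. w = \<iota> a + \<iota> b * x" using ex_basis by blast
  have "\<sigma> x \<noteq> x"
  proof
    assume "\<sigma> x = x"
    then have "\<sigma> w = w" for w using x(2)[of w] by auto
    then show False using galois by (auto simp: galois_conj_def)
  qed
  obtain c d where cd: "x * x = \<iota> c + \<iota> d * x" using x(2) by blast
  then have "\<sigma> (x * x) = \<sigma> (\<iota> c + \<iota> d * x)" by simp
  then have "\<sigma> x * \<sigma> x = \<iota> c + \<iota> d * \<sigma> x" by simp
  then have "(x - \<sigma> x) * (x + \<sigma> x - \<iota> d) = 0" using cd by (simp add: algebra_simps)
  then have "x + \<sigma> x - \<iota> d = 0" using \<open>\<sigma> x \<noteq> x\<close> by simp
  then have sx: "\<sigma> x = \<iota> d - x" by (simp add: eq_diff_eq add.commute)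
  have ssx: "\<sigma> (\<sigma> x) = x" by (simp add: sx)
  show "\<sigma> (\<sigma> z) = z" for z using x(2)[of z] ssx by auto
  define t where "t = x - \<sigma> x"
  have "\<exists>a b. w = \<iota> a + \<iota> b * t" for w
  proof -
    obtain a b where ab: "w = \<iota> a + \<iota> b * x" using x(2) by blast
    have "x = \<iota> (d / 2) + t / 2" by (simp add: t_def sx field_simps)
    then have "w = \<iota> (a + b * d / 2) + \<iota> (b / 2) * t" unfolding ab by (simp add: algebra_simps add_divide_distrib)
    then show ?thesis by blast
  qed
  moreover have "t \<noteq> 0" using \<open>\<sigma> x \<noteq> x\<close> by (simp add: t_def)
  moreover have "\<sigma> t = - t" by (simp add: t_def ssx)
  ultimately show "\<exists>\<theta>. \<theta> \<noteq> 0 \<and> \<sigma> \<theta> = - \<theta> \<and> (\<forall>w. \<exists>a b. w = \<iota> a + \<iota> b * \<theta>)" by blast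
qed

text \<open>Unramifiedness lets a power of a uniformizer of the base field, which \<sigma> fixes,
  scale the antifixed element to a unit. Unit size is what makes \<open>nabs_basis\<close> an
  equality.\<close>

lemma ex_unit_antifixed: "\<exists>\<theta>. nabs \<theta> = 1 \<and> \<sigma> \<theta> = - \<theta> \<and> (\<forall>w. \<exists>a b. w = \<iota> a + \<iota> b * \<theta>)"
proof -
  obtain t where t: "t \<noteq> 0" "\<sigma> t = - t" "\<And>w. \<exists>a b. w = \<iota> a + \<iota> b * t" using ex_antifixed by blast
  obtain \<pi> :: 'f where \<pi>: "uniformizer \<pi>" using ex_uniformizer by blast
  let ?c = "\<pi> powi vl t"
  have p0: "\<pi> \<noteq> 0" using \<pi> by (simp add: uniformizer_def)
  define \<theta> where "\<theta> = t / \<iota> ?c"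
  have "nabs \<theta> = 1" using t(1) uniformizer_\<iota>[OF \<pi>]
    by (simp add: \<theta>_def nabs_divide nabs_vl nabs_power_int_unif)
  moreover have "\<sigma> \<theta> = - \<theta>" using t(2) by (simp add: \<theta>_def del: \<iota>_simps(10))
  moreover have "\<exists>a b. w = \<iota> a + \<iota> b * \<theta>" for w
  proof -
    obtain a b where ab: "w = \<iota> a + \<iota> b * t" using t(3) by blast
    then have "w = \<iota> a + \<iota> (b * ?c) * \<theta>" using p0 unfolding \<theta>_def by simp
    then show ?thesis by blast
  qed
  ultimately show ?thesis by blast
qed

definition \<theta> :: 'e where
  "\<theta> = (SOME \<theta>. nabs \<theta> = 1 \<and> \<sigma> \<theta> = - \<theta> \<and> (\<forall>w. \<exists>a b. w = \<iota> a + \<iota> b * \<theta>))"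

lemma nabs_\<theta> [simp]: "nabs \<theta> = 1" and \<sigma>_\<theta> [simp]: "\<sigma> \<theta> = - \<theta>"
  and basis_\<theta>: "\<exists>a b. w = \<iota> a + \<iota> b * \<theta>"
  using someI_ex[OF ex_unit_antifixed] unfolding \<theta>_def by blast+

lemma \<theta>_neq_0 [simp]: "\<theta> \<noteq> 0"
  using nabs_\<theta> by (metis nabs_zero zero_neq_one)

lemma fixed_iff: "\<sigma> z = z \<longleftrightarrow> (\<exists>a. z = \<iota> a)"
proof
  assume a: "\<sigma> z = z"
  obtain a b where ab: "z = \<iota> a + \<iota> b * \<theta>" using basis_\<theta> by blast
  then have "\<iota> b * \<theta> = - (\<iota> b * \<theta>)" using a by simp
  then have "2 * (\<iota> b * \<theta>) = 0" by (metis mult_2 neg_eq_iff_add_eq_0)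
  then have "\<iota> b = 0" by simp
  then show "\<exists>a. z = \<iota> a" using ab by auto
qed auto

text \<open>Integrality is detected algebraically, by whether \<open>1 + \<pi> x\<^sup>2\<close> is a square, so it is
  preserved by \<open>\<sigma>\<close> although \<open>\<sigma>\<close> is not assumed to be continuous.\<close>

lemma integral_iff_square:
  assumes "uniformizer (p::'e)"
  shows "nabs x \<le> 1 \<longleftrightarrow> (\<exists>y. y ^ 2 = 1 + p * x ^ 2)"
proof
  assume "nabs x \<le> 1"
  then have "nabs (x ^ 2) \<le> 1" by (simp add: nabs_power power_le_one)
  then have "nabs p * nabs (x ^ 2) \<le> nabs p * 1" by (intro mult_left_mono) auto
  then have "nabs (p * x ^ 2) < 1" using uniformizerD(2)[OF assms] by (simp add: nabs_mult)
  then show "\<exists>y. y ^ 2 = 1 + p * x ^ 2" using hensel_sqrt[OF nabs_two] by blast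
next
  assume "\<exists>y. y ^ 2 = 1 + p * x ^ 2"
  then obtain y where y: "y ^ 2 = 1 + p * x ^ 2" by blast
  show "nabs x \<le> 1"
  proof (rule ccontr)
    assume n: "\<not> nabs x \<le> 1"
    then have x0: "x \<noteq> 0" by auto
    have p0: "p \<noteq> 0" using assms by (simp add: uniformizer_def)
    have vx: "vl x < 0" using n x0 vl_nonneg_iff[of x] by linarith
    have vp: "vl (p * x ^ 2) = 1 + 2 * vl x" using p0 x0 vl_uniformizer[OF assms]
      by (simp add: vl_mult power2_eq_square)
    \<comment> \<open>For nonintegral \<open>x\<close> the term \<open>p * x ^ 2\<close> dominates
      1, so \<open>y ^ 2\<close> would inherit its odd valuation.\<close>
    have gt: "nabs (p * x ^ 2) > 1" using vp vx p0 x0 by (subst nabs_vl) auto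
    then have "nabs (1 + p * x ^ 2) = nabs (p * x ^ 2)" by (intro nabs_add_eq) simp
    then have ny: "nabs (y ^ 2) = nabs (p * x ^ 2)" using y by simp
    then have "y \<noteq> 0" using gt by auto
    then have "vl (y ^ 2) = 2 * vl y" by (simp add: power2_eq_square vl_mult)
    moreover have "vl (y ^ 2) = vl (p * x ^ 2)" using ny by (simp add: vl_def)
    ultimately show False using vp by presburger
  qed
qed

text \<open>By the algebraic criterion \<sigma> preserves integrality, hence units, and a
  uniformizer taken from the base field is fixed.\<close>

lemma nabs_\<sigma> [simp]: "nabs (\<sigma> z) = nabs z"
proof -
  obtain \<pi> :: 'f where \<pi>: "uniformizer \<pi>" using ex_uniformizer by blast
  let ?p = "\<iota> \<pi>"
  have p: "uniformizer ?p" by (rule uniformizer_\<iota>[OF \<pi>])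
  have int: "nabs (\<sigma> x) \<le> 1" if x: "nabs x \<le> 1" for x
  proof -
    obtain y where "y ^ 2 = 1 + ?p * x ^ 2" using integral_iff_square[OF p] x by blast
    then have "\<sigma> (y ^ 2) = \<sigma> (1 + ?p * x ^ 2)" by simp
    then have "(\<sigma> y) ^ 2 = 1 + ?p * (\<sigma> x) ^ 2" by simp
    then show ?thesis using integral_iff_square[OF p] by blast
  qed
  have unit: "nabs (\<sigma> x) = 1" if x: "nabs x = 1" for x
  proof -
    have "nabs (\<sigma> (1 / x)) \<le> 1" by (rule int) (simp add: nabs_divide x)
    moreover have "\<sigma> x \<noteq> 0" using x by auto
    ultimately have "nabs (\<sigma> x) \<ge> 1" by (simp add: nabs_divide divide_le_eq)
    then show ?thesis using int[of x] x by linarith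
  qed
  show ?thesis
  proof (cases "z = 0")
    case False
    have p0: "?p \<noteq> 0" using p by (simp add: uniformizer_def)
    let ?u = "z / ?p powi vl z"
    have "nabs ?u = 1" using False p by (simp add: nabs_divide nabs_power_int_unif nabs_vl)
    from unit[OF this] show ?thesis using p False by (simp add: nabs_divide nabs_power_int_unif nabs_vl)
  qed simp
qed

text \<open>The two coordinates are recovered from \<open>z + \<sigma> z\<close> and
  \<open>z - \<sigma> z\<close> up to the units 2 and \<theta>.\<close>

lemma nabs_basis: "nabs (\<iota> a + \<iota> b * \<theta>) = max (nabs (\<iota> a)) (nabs (\<iota> b))"
proof -
  let ?z = "\<iota> a + \<iota> b * \<theta>"
  have "nabs (?z + \<sigma> ?z) \<le> nabs ?z" by (rule nabs_add_le) (simp_all only: nabs_\<sigma> order_refl)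
  moreover have "nabs (?z - \<sigma> ?z) \<le> nabs ?z" by (rule nabs_diff_le) (simp_all only: nabs_\<sigma> order_refl)
  moreover have "?z + \<sigma> ?z = 2 * \<iota> a" "?z - \<sigma> ?z = 2 * (\<iota> b * \<theta>)" by simp_all
  ultimately have "nabs (2 * \<iota> a) \<le> nabs ?z" "nabs (2 * (\<iota> b * \<theta>)) \<le> nabs ?z" by metis+
  then show ?thesis using nabs_add[of "\<iota> a" "\<iota> b * \<theta>"] by (simp add: nabs_mult nabs_two)
qed

section \<open>Norms of units\<close>

abbreviation N :: "'e \<Rightarrow> 'e" where "N z \<equiv> z * \<sigma> z"

lemma nabs_N: "nabs (N z) = nabs z ^ 2"
  by (simp add: nabs_mult power2_eq_square)

lemma N_in_F: "\<exists>a. N z = \<iota> a"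
  using fixed_iff[of "N z"] by (simp add: mult.commute)

lemma vl_N: "z \<noteq> 0 \<Longrightarrow> vl (N z) = 2 * vl z"
  by (rule vl_eqI) (simp add: nabs_N nabs_vl power_int_mult power2_eq_square flip: power_int_add)

text \<open>Pigeonhole on the residue classes: the squares occupy more than half of them, and so do
  the values \<open>u + \<epsilon> * y ^ 2\<close>, so the two sets meet.\<close>

lemma mod_square_norm:
  assumes e: "nabs (\<epsilon>::'f) = 1" and u: "nabs (u::'f) = 1"
  shows "\<exists>x y. nabs x \<le> 1 \<and> nabs y \<le> 1 \<and> nabs (x ^ 2 - (u + \<epsilon> * y ^ 2)) < 1"
proof -
  let ?O = "{x::'f. nabs x \<le> 1}" and ?r = "rad TYPE('f)"
  obtain T where T: "finite T" "card T = residue_card TYPE('f)" "transversal ?O ?r T"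
    using ex_transversal_integers[where 'k='f, of 1] by auto
  have TO: "T \<subseteq> ?O" using T(3) by (simp add: transversal_def)
  have eq1: "nabs (x::'f) \<le> ?r \<longleftrightarrow> nabs x < 1" for x
    using nabs_less_1[of x] rad_lt_1[where 'k='f] by linarith
  define c where "c x = (SOME t. t \<in> T \<and> dist x t \<le> ?r)" for x
  have c: "c x \<in> T" "nabs (x - c x) < 1" if "nabs x \<le> 1" for x
  proof -
    have "\<exists>t. t \<in> T \<and> dist x t \<le> ?r" using T(3) that unfolding transversal_def by blast
    from someI_ex[OF this] show "c x \<in> T" "nabs (x - c x) < 1"
      unfolding c_def by (simp_all add: dist_eq_nabs eq1)
  qed
  have Tun: "s = t" if "s \<in> T" "t \<in> T" "nabs (s - t) < 1" for s t
  proof -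
    have "\<exists>!v. v \<in> T \<and> dist s v \<le> ?r" using T(3) TO that unfolding transversal_def by blast
    moreover have "dist s t \<le> ?r" "dist s s \<le> ?r" using that by (simp_all add: dist_eq_nabs eq1 less_imp_le)
    ultimately show ?thesis using that by blast
  qed
  have ceq: "c x = c y \<longleftrightarrow> nabs (x - y) < 1" if "nabs x \<le> 1" "nabs y \<le> 1" for x y
  proof
    assume "c x = c y"
    then show "nabs (x - y) < 1" using c(2)[OF that(1)] c(2)[OF that(2)]
        nabs_add_less[of "x - c x" 1 "c y - y"] by (simp add: nabs_minus_commute)
  next
    assume "nabs (x - y) < 1"
    then have "nabs (c x - x + (x - y) + (y - c y)) < 1"
      using c(2)[OF that(1)] c(2)[OF that(2)] by (intro nabs_add_less) (simp_all add: nabs_minus_commute)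
    then show "c x = c y" using Tun[OF c(1)[OF that(1)] c(1)[OF that(2)]] by simp
  qed
  have sq: "nabs (x ^ 2) \<le> 1" if "nabs x \<le> 1" for x :: 'f using that by (simp add: nabs_power power_le_one)
  define f where "f t = c (t ^ 2)" for t
  define h where "h t = c (u + \<epsilon> * t)" for t
  have us: "nabs (u + \<epsilon> * t) \<le> 1" if "nabs t \<le> 1" for t
    using that e u by (intro nabs_add_le) (simp_all add: nabs_mult)
  have fT: "f ` T \<subseteq> T" using c(1) sq TO unfolding f_def by auto
  have hT: "h ` T \<subseteq> T" using c(1) us TO unfolding h_def by auto
  have hinj: "inj_on h T"
  proof (rule inj_onI)
    fix s t assume st: "s \<in> T" "t \<in> T" "h s = h t"
    then have "nabs ((u + \<epsilon> * s) - (u + \<epsilon> * t)) < 1" using ceq[OF us us, of s t] TO unfolding h_def by auto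
    moreover have "(u + \<epsilon> * s) - (u + \<epsilon> * t) = \<epsilon> * (s - t)" by (simp add: algebra_simps)
    ultimately have "nabs (s - t) < 1" using e by (simp add: nabs_mult)
    then show "s = t" using Tun st by blast
  qed
  have feq: "f s = f t \<longleftrightarrow> nabs (s - t) < 1 \<or> nabs (s + t) < 1" if "s \<in> T" "t \<in> T" for s t
  proof -
    have l: "nabs s \<le> 1" "nabs t \<le> 1" using that TO by auto
    have l2: "nabs (s - t) \<le> 1" "nabs (s + t) \<le> 1" using l nabs_add_le nabs_diff_le by blast+
    have "f s = f t \<longleftrightarrow> nabs (s ^ 2 - t ^ 2) < 1" unfolding f_def by (rule ceq[OF sq sq]) (use l in auto)
    also have "s ^ 2 - t ^ 2 = (s - t) * (s + t)" by (simp add: algebra_simps power2_eq_square)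
    also have "nabs ((s - t) * (s + t)) < 1 \<longleftrightarrow> nabs (s - t) < 1 \<or> nabs (s + t) < 1"
    proof
      assume "nabs ((s - t) * (s + t)) < 1"
      moreover have "nabs ((s - t) * (s + t)) = 1" if "\<not> nabs (s - t) < 1" "\<not> nabs (s + t) < 1"
      proof -
        have "nabs (s - t) = 1" "nabs (s + t) = 1" using that l2 by linarith+
        then show ?thesis by (simp add: nabs_mult)
      qed
      ultimately show "nabs (s - t) < 1 \<or> nabs (s + t) < 1" by force
    next
      assume "nabs (s - t) < 1 \<or> nabs (s + t) < 1"
      then show "nabs ((s - t) * (s + t)) < 1"
      proof
        assume "nabs (s - t) < 1"
        moreover have "nabs (s - t) * nabs (s + t) \<le> nabs (s - t) * 1" using l2 by (intro mult_left_mono) auto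
        ultimately show ?thesis by (simp add: nabs_mult)
      next
        assume "nabs (s + t) < 1"
        moreover have "nabs (s - t) * nabs (s + t) \<le> 1 * nabs (s + t)" using l2 by (intro mult_right_mono) auto
        ultimately show ?thesis by (simp add: nabs_mult)
      qed
    qed
    finally show ?thesis .
  qed
  \<comment> \<open>A square determines its root up to sign.\<close>
  have fib: "card {t \<in> T. f t = f s} \<le> 2" if "s \<in> T" for s
  proof -
    have "nabs s \<le> 1" using that TO by auto
    then have "{t \<in> T. f t = f s} \<subseteq> {s, c (- s)}"
    proof (intro subsetI)
      fix t assume "t \<in> {t \<in> T. f t = f s}"
      then have t: "t \<in> T" "nabs (t - s) < 1 \<or> nabs (t + s) < 1" using feq[of t s] that by auto
      from t(2) show "t \<in> {s, c (- s)}"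
      proof
        assume "nabs (t + s) < 1"
        then have "nabs ((t + s) + (- s - c (- s))) < 1" using c(2)[of "- s"] \<open>nabs s \<le> 1\<close>
          by (intro nabs_add_less[of "t + s" 1 "- s - c (- s)"]) auto
        then show ?thesis using Tun[OF t(1) c(1)[of "- s"]] \<open>nabs s \<le> 1\<close> by simp
      qed (use Tun t that in auto)
    qed
    then have "card {t \<in> T. f t = f s} \<le> card {s, c (- s)}" by (intro card_mono) auto
    also have "\<dots> \<le> 2" by (simp add: card_insert_if)
    finally show ?thesis .
  qed
  \<comment> \<open>The class of 0 has a single root. This makes the squares strictly more than half
    of the residue classes.\<close>
  define t0 where "t0 = c 0"
  have t0: "t0 \<in> T" "nabs t0 < 1" using c[of 0] by (simp_all add: t0_def)
  have fib0: "card {t \<in> T. f t = f t0} = 1"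
  proof -
    have "{t \<in> T. f t = f t0} = {t0}"
    proof (intro equalityI subsetI)
      fix t assume "t \<in> {t \<in> T. f t = f t0}"
      then have t: "t \<in> T" "nabs (t - t0) < 1 \<or> nabs (t + t0) < 1" using feq[of t t0] t0 by auto
      have "nabs (t - t0) < 1"
        using t(2) nabs_diff_le[of t0 1 t0] nabs_add_less[of "t + t0" 1 "- (t0 + t0)"] nabs_add_less[OF t0(2) t0(2)]
        by (auto simp: algebra_simps)
      then show "t \<in> {t0}" using Tun t t0 by blast
    qed (use t0 in auto)
    then show ?thesis by simp
  qed
  have "card T = (\<Sum>y\<in>f ` T. card {t \<in> T. f t = y})"
    using sum_fun_comp[of T "f ` T" f "\<lambda>_. 1::nat"] T(1) by simp
  also have "\<dots> = card {t \<in> T. f t = f t0} + (\<Sum>y\<in>f ` T - {f t0}. card {t \<in> T. f t = y})"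
    using T(1) t0 by (intro sum.remove) auto
  also have "\<dots> \<le> 1 + (\<Sum>y\<in>f ` T - {f t0}. 2)"
    using fib0 fib by (intro add_mono sum_mono) auto
  also have "\<dots> = 2 * card (f ` T) - 1"
  proof -
    have "card (f ` T) > 0" using t0 T(1) by (simp add: card_gt_0_iff) auto
    then show ?thesis using t0 T(1) by (simp add: card_Diff_singleton)
  qed
  finally have "card T \<le> 2 * card (f ` T) - 1" .
  moreover have "card (f ` T) > 0" using t0 T(1) by (auto simp: card_gt_0_iff)
  ultimately have "card T < 2 * card (f ` T)" by linarith
  moreover have "card (h ` (f ` T)) = card (f ` T)" using hinj fT by (meson card_image inj_on_subset)
  moreover have "card (f ` T \<union> h ` (f ` T)) \<le> card T" using T(1) fT hT by (intro card_mono) auto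
  ultimately have "f ` T \<inter> h ` (f ` T) \<noteq> {}"
    using card_Un_disjoint[of "f ` T" "h ` (f ` T)"] T(1) by auto
  then obtain x y where xy: "x \<in> T" "y \<in> T" "f x = h (f y)" by auto
  have lx: "nabs x \<le> 1" "nabs y \<le> 1" using xy TO by auto
  have fy: "nabs (f y) \<le> 1" using fT TO xy by auto
  have "nabs (x ^ 2 - (u + \<epsilon> * f y)) < 1"
    using xy(3) ceq[OF sq[OF lx(1)] us[OF fy]] by (simp add: f_def[of x] h_def)
  moreover have "nabs (\<epsilon> * (f y - y ^ 2)) < 1" using c(2)[OF sq[OF lx(2)]] e
    by (simp add: nabs_mult f_def nabs_minus_commute)
  ultimately have "nabs ((x ^ 2 - (u + \<epsilon> * f y)) + \<epsilon> * (f y - y ^ 2)) < 1" by (rule nabs_add_less)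
  then show ?thesis using lx by (intro exI[of _ x] exI[of _ y]) (simp add: algebra_simps)
qed

text \<open>A norm \<open>n = x ^ 2 + e * y ^ 2\<close> congruent to \<open>u\<close> exists by
  \<open>mod_square_norm\<close>. The remaining factor \<open>u / n\<close> is congruent to 1, hence
  a square \<open>w ^ 2\<close>, which is the norm of \<open>\<iota> w\<close>.\<close>

lemma unit_is_norm:
  assumes "nabs (u::'f) = 1"
  shows "\<exists>z. N z = \<iota> u"
proof -
  obtain e where e: "N \<theta> = \<iota> e" using N_in_F by blast
  have "nabs (\<iota> e) = 1" using nabs_N[of \<theta>] by (simp flip: e)
  then have e1: "nabs (- e) = 1" using nabs_\<iota>_eq_1_iff by simp
  obtain x y where xy: "nabs x \<le> 1" "nabs y \<le> 1" "nabs (x ^ 2 - (u + (- e) * y ^ 2)) < 1"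
    using mod_square_norm[OF e1 assms] by blast
  define n where "n = x ^ 2 + e * y ^ 2"
  have nu: "nabs (n - u) < 1" using xy(3) by (simp add: n_def algebra_simps)
  then have n1: "nabs n = 1" using nabs_add_eq[of "n - u" u] assms by simp
  then have n0: "n \<noteq> 0" by auto
  have "nabs (u / n - 1) < 1"
  proof -
    have "u / n - 1 = - ((n - u) / n)" using n0 by (simp add: field_simps)
    then show ?thesis using nu n1 by (simp add: nabs_divide)
  qed
  then obtain w where w: "w ^ 2 = u / n" using hensel_sqrt[OF nabs_two_F, of "u / n - 1"] by auto
  let ?z = "\<iota> w * (\<iota> x + \<iota> y * \<theta>)"
  have "- (\<theta> * \<theta>) = \<iota> e" using e by simp
  then have th: "\<theta> * \<theta> = - \<iota> e" by (metis minus_minus)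
  have "N (\<iota> x + \<iota> y * \<theta>) = \<iota> x ^ 2 - \<iota> y ^ 2 * (\<theta> * \<theta>)" by (simp add: algebra_simps power2_eq_square)
  also have "\<dots> = \<iota> n" unfolding th by (simp add: n_def)
  finally have N0: "N (\<iota> x + \<iota> y * \<theta>) = \<iota> n" .
  have "N ?z = \<iota> (w ^ 2) * N (\<iota> x + \<iota> y * \<theta>)" by (simp add: power2_eq_square)
  also have "\<dots> = \<iota> u" unfolding N0 w using n0 by simp
  finally show ?thesis by blast
qed

text \<open>Norms have even valuation. Conversely, an even power of a uniformizer is a square in the
  base field and hence a norm; dividing by it leaves a unit.\<close>

lemma norm_iff_even:
  assumes "a \<noteq> 0"
  shows "(\<exists>z. z \<noteq> 0 \<and> \<iota> a = N z) \<longleftrightarrow> even (vl a)"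
proof
  assume "\<exists>z. z \<noteq> 0 \<and> \<iota> a = N z"
  then obtain z where z: "z \<noteq> 0" "\<iota> a = N z" by blast
  have "vl (\<iota> a) = 2 * vl z" unfolding z(2) using z(1) by (rule vl_N)
  then show "even (vl a)" using assms by simp
next
  assume "even (vl a)"
  then obtain k where k: "vl a = 2 * k" by auto
  obtain \<pi> :: 'f where \<pi>: "uniformizer \<pi>" using ex_uniformizer by blast
  have \<pi>0: "\<pi> \<noteq> 0" using \<pi> by (simp add: uniformizer_def)
  have "nabs (a / \<pi> powi (2 * k)) = 1" using \<pi> assms k
    by (simp add: nabs_divide nabs_power_int_unif nabs_vl)
  then obtain z where z: "N z = \<iota> (a / \<pi> powi (2 * k))" using unit_is_norm by blast
  define w where "w = \<pi> powi k"
  have p: "\<pi> powi (2 * k) = w * w" 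
    by (simp only: w_def mult_2 power_int_add[OF disjI1[OF \<pi>0]])
  have w0: "w \<noteq> 0" using \<pi>0 by (simp add: w_def)
  have "N (z * \<iota> w) = N z * \<iota> (w * w)"
    by (simp only: \<iota>_simps(4) \<sigma>_simps(4) \<sigma>_\<iota> mult.assoc mult.left_commute mult.commute)
  also have "\<dots> = \<iota> a" unfolding z p using w0 by simp
  finally have "N (z * \<iota> w) = \<iota> a" .
  moreover from this have "z * \<iota> w \<noteq> 0" using assms by (metis \<iota>_simps(11) mult_zero_left)
  ultimately show "\<exists>z. z \<noteq> 0 \<and> \<iota> a = N z" by metis
qed

lemma omega_eq: "a \<noteq> 0 \<Longrightarrow> omega \<iota> \<sigma> a = (if even (vl a) then 1 else -1)"
  using norm_iff_even by (simp add: omega_def)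

section \<open>Elements of norm 1 and -1 modulo powers of the maximal ideal\<close>

definition U1 :: "'e set" where "U1 = {u. N u = 1}"

text \<open>These \<open>s\<close> are the slopes of the isotropic lines: \<open>e_2 + s e_1\<close>
  is isotropic for multiples of the standard form
  \<open>u_1 \<sigma>(v_1) + u_2 \<sigma>(v_2)\<close>.\<close>

definition S :: "'e set" where "S = {s. N s = - 1}"

lemma N_mult: "N (a * b) = N a * N b"
  by (simp only: \<sigma>_simps(4) mult.assoc mult.left_commute mult.commute)

lemma S_mult_U1: "s \<in> S \<Longrightarrow> u \<in> U1 \<Longrightarrow> s * u \<in> S"
  unfolding S_def U1_def mem_Collect_eq N_mult by simp

lemma nabs_U1: "u \<in> U1 \<Longrightarrow> nabs u = 1"
  using nabs_N[of u] nabs_nonneg[of u] by (auto simp: U1_def power2_eq_1_iff)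

lemma nabs_S: "s \<in> S \<Longrightarrow> nabs s = 1"
  using nabs_N[of s] nabs_nonneg[of s] by (auto simp: S_def power2_eq_1_iff)

lemma S_nonempty: "\<exists>s. s \<in> S"
  using unit_is_norm[of "- 1"] by (auto simp: S_def)

text \<open>If \<open>N z\<close> is near -1, then \<open>- N z\<close> is the square of some
  \<open>y\<close> near 1 in the base field, and \<open>z / \<iota> y\<close> is an exact solution
  within the same bound. The square root requires a positive exponent \<open>I\<close>.\<close>

lemma S_approx:
  assumes "I \<ge> 1" "nabs (N z + 1) \<le> rad TYPE('e) ^ I"
  shows "\<exists>s\<in>S. nabs (s - z) \<le> rad TYPE('e) ^ I"
proof -
  obtain n where n: "N z = \<iota> n" using N_in_F by blast
  define t where "t = - n - 1"
  have "N z + 1 = \<iota> (- t)" by (simp add: n t_def)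
  then have it: "nabs (\<iota> t) \<le> rad TYPE('e) powi int I" using assms(2) by simp
  then have tI: "nabs t \<le> rad TYPE('f) powi int I" by (simp only: nabs_\<iota>_le_iff)
  also have "\<dots> < 1" using assms by (simp only: rad_powi_less_1)
  finally have t1: "nabs t < 1" .
  obtain y where y: "y ^ 2 = 1 + t" "nabs (y - 1) \<le> nabs t" using hensel_sqrt[OF nabs_two_F t1] by blast
  have y1: "nabs y = 1" using y(2) t1 nabs_add_eq[of "y - 1" 1] by simp
  then have y0: "y \<noteq> 0" by auto
  have iy1: "nabs (\<iota> y) = 1" using y1 by (rule nabs_\<iota>_unit)
  have nn: "- n = y ^ 2" using y(1) by (simp add: t_def)
  then have "nabs (N z) = 1" using iy1 by (metis \<iota>_simps(5) \<iota>_simps(9) n nabs_minus nabs_power power_one)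
  then have z1: "nabs z = 1" using nabs_N[of z] nabs_nonneg[of z] by (auto simp: power2_eq_1_iff)
  let ?s = "z / \<iota> y"
  have n0: "n \<noteq> 0" using nn y0 by auto
  have "N ?s = N z / \<iota> (y ^ 2)" by (simp add: power2_eq_square)
  also have "\<dots> = - 1" unfolding n nn[symmetric] using n0 by simp
  finally have "?s \<in> S" by (simp add: S_def)
  moreover have "?s - z = z * \<iota> (1 - y) / \<iota> y" using y0 by (simp add: field_simps)
  then have "nabs (?s - z) = nabs (\<iota> (1 - y))" using z1 iy1 by (simp only: nabs_mult nabs_divide)
  moreover have "nabs (1 - y) \<le> rad TYPE('f) powi int I" using y(2) tI nabs_minus_commute[of y 1] by linarith
  then have "nabs (\<iota> (1 - y)) \<le> rad TYPE('e) powi int I" by (simp only: nabs_\<iota>_le_iff)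
  ultimately show ?thesis by (intro bexI[of _ ?s]) simp_all
qed

text \<open>The Cayley transform, which parametrizes norm-one elements other than -1 by the base
  field. On integers it preserves distances, measured through \<iota>
  (\<open>cay_diff\<close>).\<close>

definition cay :: "'f \<Rightarrow> 'e" where "cay y = (1 + \<iota> y * \<theta>) / (1 - \<iota> y * \<theta>)"

lemma cay_denom:
  assumes "nabs y \<le> 1"
  shows "nabs (1 - \<iota> y * \<theta>) = 1" "1 - \<iota> y * \<theta> \<noteq> 0"
proof -
  show "nabs (1 - \<iota> y * \<theta>) = 1" using nabs_basis[of 1 "- y"] assms nabs_\<iota>_le_1_iff[of y] by simp
  then show "1 - \<iota> y * \<theta> \<noteq> 0" by (metis nabs_zero zero_neq_one)
qed

lemma cay_plus: "nabs (1 + \<iota> y * \<theta>) = 1" "1 + \<iota> y * \<theta> \<noteq> 0" if "nabs y \<le> 1"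
  using cay_denom[of "- y"] that by simp_all

lemma cay_U1: "nabs y \<le> 1 \<Longrightarrow> cay y \<in> U1"
  using cay_denom[of y] cay_plus[of y] by (simp add: cay_def U1_def)

lemma cay_diff:
  assumes "nabs x \<le> 1" "nabs y \<le> 1"
  shows "nabs (cay x - cay y) = nabs (\<iota> (x - y))"
proof -
  have "cay x - cay y = 2 * (\<iota> (x - y) * \<theta>) / ((1 - \<iota> x * \<theta>) * (1 - \<iota> y * \<theta>))"
    using cay_denom[OF assms(1)] cay_denom[OF assms(2)] by (simp add: cay_def field_simps)
  then show ?thesis using cay_denom[OF assms(1)] cay_denom[OF assms(2)]
    by (simp only: nabs_mult nabs_divide nabs_two nabs_\<theta>)
qed

text \<open>The inverse transform \<open>(u - 1) / (u + 1)\<close> changes sign under \<sigma>, so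
  it is a multiple of \<theta> by an element of the base field. Since \<open>u + 1\<close> is a
  unit, its size is that of \<open>u - 1\<close>.\<close>

lemma cay_surj:
  assumes "u \<in> U1" "nabs (u + 1) = 1"
  shows "\<exists>y. u = cay y \<and> nabs (\<iota> y) = nabs (u - 1)"
proof -
  let ?w = "(u - 1) / (u + 1)"
  have u0: "u \<noteq> 0" and up: "u + 1 \<noteq> 0" using assms by (auto simp: U1_def)
  have su: "\<sigma> u = 1 / u" using assms(1) u0 by (simp add: U1_def field_simps)
  have "\<sigma> ?w = (1 / u - 1) / (1 / u + 1)" by (simp add: su)
  also have "\<dots> = ((1 - u) / u) / ((1 + u) / u)" using u0 by (simp add: diff_divide_distrib add_divide_distrib)
  also have "\<dots> = (1 - u) / (1 + u)" using u0 by simp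
  also have "\<dots> = - ?w" by (simp add: minus_divide_left add.commute)
  finally have sw: "\<sigma> ?w = - ?w" .
  have "\<sigma> (?w / \<theta>) = \<sigma> ?w / \<sigma> \<theta>" by (rule \<sigma>_simps(7))
  also have "\<dots> = ?w / \<theta>" unfolding sw by simp
  finally have "\<sigma> (?w / \<theta>) = ?w / \<theta>" .
  then obtain y where y: "?w / \<theta> = \<iota> y" using fixed_iff by blast
  have w: "\<iota> y * \<theta> = ?w" unfolding y[symmetric] by simp
  have "1 - ?w = 2 / (u + 1)" "1 + ?w = 2 * u / (u + 1)" using up by (simp_all add: field_simps)
  then have "cay y = u" using up unfolding cay_def w by simp
  moreover have "nabs (\<iota> y) = nabs (u - 1)" using arg_cong[OF w, of nabs] assms(2) by (simp add: nabs_mult nabs_divide)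
  ultimately show ?thesis by blast
qed

lemma transversal_F_ball:
  "\<exists>T. finite T \<and> card T = residue_card TYPE('f) ^ n \<and>
     transversal {y::'f. nabs y \<le> rad TYPE('f) ^ r} (rad TYPE('f) ^ (r + n)) T"
proof -
  obtain \<pi> :: 'f where \<pi>: "uniformizer \<pi>" using ex_uniformizer by blast
  have \<pi>0: "\<pi> \<noteq> 0" and n\<pi>: "nabs (\<pi> ^ r) = rad TYPE('f) ^ r" using \<pi> by (auto simp: uniformizer_def nabs_power_int_unif)
  obtain T where T: "finite T" "card T = residue_card TYPE('f) ^ n"
     "transversal {y::'f. nabs y \<le> 1} (rad TYPE('f) ^ n) T" using ex_transversal_integers by blast
  let ?f = "\<lambda>x. \<pi> ^ r * x"
  have "transversal {y::'f. nabs y \<le> rad TYPE('f) ^ r} (rad TYPE('f) ^ (r + n)) (?f ` T) \<and> card (?f ` T) = card T"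
  proof (rule transversal_image[OF T(3)])
    show "?f ` {y. nabs y \<le> 1} = {y. nabs y \<le> rad TYPE('f) ^ r}"
    proof (intro equalityI subsetI)
      fix x :: 'f assume "x \<in> {y. nabs y \<le> rad TYPE('f) ^ r}"
      then show "x \<in> ?f ` {y. nabs y \<le> 1}" using \<pi>0 n\<pi>
        by (intro image_eqI[of _ _ "x / \<pi> ^ r"]) (auto simp: nabs_divide)
    qed (auto simp: nabs_mult n\<pi> mult_left_le)
    fix x y :: 'f
    have "?f x - ?f y = ?f (x - y)" by (simp add: algebra_simps)
    then show "dist (?f x) (?f y) \<le> rad TYPE('f) ^ (r + n) \<longleftrightarrow> dist x y \<le> rad TYPE('f) ^ n"
      by (simp add: dist_eq_nabs nabs_mult n\<pi> power_add)
  qed (auto simp: less_imp_le)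
  then show ?thesis using T by (intro exI[of _ "?f ` T"]) auto
qed

lemma transversal_U1_ball:
  assumes "r \<ge> 1"
  shows "\<exists>T. finite T \<and> card T = residue_card TYPE('f) ^ n \<and>
     transversal {u\<in>U1. dist u 1 \<le> rad TYPE('e) ^ r} (rad TYPE('e) ^ (r + n)) T"
proof -
  obtain T where T: "finite T" "card T = residue_card TYPE('f) ^ n"
     "transversal {y::'f. nabs y \<le> rad TYPE('f) ^ r} (rad TYPE('f) ^ (r + n)) T" using transversal_F_ball by blast
  have r1: "rad TYPE('e) ^ r < 1" "rad TYPE('f) ^ r \<le> 1" using assms by (simp_all add: power_less_one_iff power_le_one less_imp_le)
  have p: "nabs (\<iota> y) \<le> rad TYPE('e) ^ k \<longleftrightarrow> nabs y \<le> rad TYPE('f) ^ k" for y k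
    using nabs_\<iota>_le_iff[of y "int k"] by simp
  have c0: "cay 0 = 1" by (simp add: cay_def)
  have l1: "nabs y \<le> 1" if "nabs y \<le> rad TYPE('f) ^ r" for y :: 'f using that r1 by linarith
  have "transversal {u\<in>U1. dist u 1 \<le> rad TYPE('e) ^ r} (rad TYPE('e) ^ (r + n)) (cay ` T) \<and> card (cay ` T) = card T"
  proof (rule transversal_image[OF T(3)])
    show "cay ` {y. nabs y \<le> rad TYPE('f) ^ r} = {u \<in> U1. dist u 1 \<le> rad TYPE('e) ^ r}"
    proof (intro equalityI subsetI)
      fix u assume "u \<in> cay ` {y. nabs y \<le> rad TYPE('f) ^ r}"
      then show "u \<in> {u \<in> U1. dist u 1 \<le> rad TYPE('e) ^ r}"
        using cay_U1 l1 cay_diff[of _ 0] c0 p by (auto simp: dist_eq_nabs)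
    next
      fix u assume "u \<in> {u \<in> U1. dist u 1 \<le> rad TYPE('e) ^ r}"
      then have u: "u \<in> U1" "nabs (u - 1) \<le> rad TYPE('e) ^ r" by (auto simp: dist_eq_nabs)
      \<comment> \<open>For positive \<open>r\<close> the element \<open>u + 1\<close> is congruent
        to the unit 2, so the ball around 1 stays away from the missing point -1.\<close>
      then have "nabs (2 + (u - 1)) = 1" using r1 nabs_two by (subst nabs_add_eq') auto
      then have "nabs (u + 1) = 1" by (simp add: algebra_simps)
      then obtain y where y: "u = cay y" "nabs (\<iota> y) = nabs (u - 1)" using cay_surj u by blast
      then have "nabs y \<le> rad TYPE('f) ^ r" using u p[of y r] by simp
      then show "u \<in> cay ` {y. nabs y \<le> rad TYPE('f) ^ r}" using y(1) by blast
    qed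
  qed (auto simp: less_imp_le dist_eq_nabs cay_diff l1 p simp del: \<iota>_simps)
  then show ?thesis using T by (intro exI[of _ "cay ` T"]) auto
qed

text \<open>The Cayley transforms of the integers are the \<open>u\<close> for which
  \<open>u + 1\<close> is a unit, with \<open>q ^ I\<close> classes. The remaining \<open>u\<close>
  are congruent to -1; they are the negatives of the transforms of the maximal ideal, with
  \<open>q ^ (I - 1)\<close> classes.\<close>

lemma transversal_U1:
  assumes "I \<ge> 1"
  shows "\<exists>T. finite T \<and> card T = residue_card TYPE('f) ^ I + residue_card TYPE('f) ^ (I - 1) \<and>
     transversal U1 (rad TYPE('e) ^ I) T"
proof -
  let ?q = "residue_card TYPE('f)"
  have I1: "rad TYPE('e) ^ I < 1" using assms by (simp add: power_less_one_iff)
  have p: "nabs (\<iota> y) \<le> rad TYPE('e) ^ k \<longleftrightarrow> nabs y \<le> rad TYPE('f) ^ k" for y k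
    using nabs_\<iota>_le_iff[of y "int k"] by simp
  define A where "A = {u \<in> U1. nabs (u + 1) = 1}"
  define B where "B = {u \<in> U1. nabs (u + 1) < 1}"
  have U: "U1 = A \<union> B"
  proof -
    have "nabs (u + 1) \<le> 1" if "u \<in> U1" for u using nabs_add_le[of u 1 1] nabs_U1[OF that] by simp
    then show ?thesis unfolding A_def B_def by force
  qed
  obtain T where T: "finite T" "card T = ?q ^ I" "transversal {y::'f. nabs y \<le> 1} (rad TYPE('f) ^ I) T"
    using ex_transversal_integers by blast
  have TA: "transversal A (rad TYPE('e) ^ I) (cay ` T) \<and> card (cay ` T) = card T"
  proof (rule transversal_image[OF T(3)])
    show "cay ` {y. nabs y \<le> 1} = A"
    proof (intro equalityI subsetI)
      fix u assume "u \<in> cay ` {y. nabs y \<le> 1}"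
      then obtain y where y: "u = cay y" "nabs y \<le> 1" by auto
      have "u + 1 = 2 / (1 - \<iota> y * \<theta>)" using cay_denom(2)[OF y(2)] by (simp add: y(1) cay_def field_simps)
      then have "nabs (u + 1) = 1" using cay_denom(1)[OF y(2)] by (simp add: nabs_divide nabs_two)
      then show "u \<in> A" using cay_U1[OF y(2)] y by (simp add: A_def)
    next
      fix u assume u: "u \<in> A"
      then obtain y where y: "u = cay y" "nabs (\<iota> y) = nabs (u - 1)" using cay_surj by (auto simp: A_def)
      have "nabs (u - 1) \<le> 1" using u nabs_U1[of u] by (intro nabs_diff_le) (auto simp: A_def)
      then have "nabs y \<le> 1" using y(2) nabs_\<iota>_le_1_iff[of y] by simp
      then show "u \<in> cay ` {y. nabs y \<le> 1}" using y(1) by blast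
    qed
  qed (auto simp: less_imp_le dist_eq_nabs cay_diff p simp del: \<iota>_simps)
  obtain R where R: "finite R" "card R = ?q ^ (I - 1)"
     "transversal {y::'f. nabs y \<le> rad TYPE('f) ^ 1} (rad TYPE('f) ^ (1 + (I - 1))) R" using transversal_F_ball by blast
  have l1: "nabs y \<le> 1" if "nabs y \<le> rad TYPE('f)" for y :: 'f
    using that rad_lt_1[where 'k='f] by linarith
  have TB: "transversal B (rad TYPE('e) ^ I) ((\<lambda>y. - cay y) ` R) \<and> card ((\<lambda>y. - cay y) ` R) = card R"
  proof (rule transversal_image[OF R(3)])
    show "(\<lambda>y. - cay y) ` {y. nabs y \<le> rad TYPE('f) ^ 1} = B"
    proof (intro equalityI subsetI)
      fix u assume "u \<in> (\<lambda>y. - cay y) ` {y. nabs y \<le> rad TYPE('f) ^ 1}"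
      then obtain y where y: "u = - cay y" "nabs y \<le> rad TYPE('f)" by auto
      have "u + 1 = - (cay y - cay 0)" by (simp add: y(1) cay_def)
      then have "nabs (u + 1) = nabs (\<iota> y)" using cay_diff[OF l1[OF y(2)], of 0] by (simp only: nabs_minus) simp
      also have "\<dots> \<le> rad TYPE('e)" using y(2) p[of y 1] by simp
      also have "\<dots> < 1" by simp
      finally show "u \<in> B" using cay_U1[OF l1[OF y(2)]] unfolding B_def U1_def by (simp add: y(1))
    next
      fix u assume u: "u \<in> B"
      then have "nabs (u + 1) < 1" by (simp add: B_def)
      then have "nabs (2 - (u + 1)) = 1" using nabs_two by (subst nabs_diff_eq') auto
      moreover have "- u + 1 = 2 - (u + 1)" by simp
      ultimately have "nabs (- u + 1) = 1" by metis
      moreover have "- u \<in> U1" using u by (simp add: B_def U1_def)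
      ultimately obtain y where y: "- u = cay y" "nabs (\<iota> y) = nabs (- u - 1)" using cay_surj by blast
      have "- u - 1 = - (u + 1)" by simp
      then have "nabs (\<iota> y) = nabs (u + 1)" using y(2) by (simp only: nabs_minus)
      then have "nabs (\<iota> y) \<le> rad TYPE('e)" using nabs_less_1[of "u + 1"] u by (simp add: B_def)
      then have "nabs y \<le> rad TYPE('f)" using p[of y 1] by simp
      moreover have "u = - cay y" using y(1) by (metis minus_minus)
      ultimately show "u \<in> (\<lambda>y. - cay y) ` {y. nabs y \<le> rad TYPE('f) ^ 1}" by auto
    qed
    fix x y :: 'f assume "x \<in> {y. nabs y \<le> rad TYPE('f) ^ 1}" "y \<in> {y. nabs y \<le> rad TYPE('f) ^ 1}"
    then have xy: "nabs x \<le> 1" "nabs y \<le> 1" using l1 by auto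
    have "- cay x - - cay y = - (cay x - cay y)" by simp
    then have "nabs (- cay x - - cay y) = nabs (\<iota> (x - y))" using cay_diff[OF xy] by (simp only: nabs_minus)
    then show "dist (- cay x) (- cay y) \<le> rad TYPE('e) ^ I \<longleftrightarrow> dist x y \<le> rad TYPE('f) ^ (1 + (I - 1))"
      using assms p[of "x - y" I] by (simp add: dist_eq_nabs)
  qed (auto simp: less_imp_le)
  have far: "dist u v > rad TYPE('e) ^ I" if "u \<in> A" "v \<in> B" for u v
  proof -
    have "nabs ((u + 1) - (v + 1)) = nabs (u + 1)" using that by (intro nabs_diff_eq') (auto simp: A_def B_def)
    then show ?thesis using that I1 by (simp add: A_def dist_eq_nabs)
  qed
  show ?thesis unfolding U
    using transversal_Un[OF conjunct1[OF TA] conjunct1[OF TB] far] T R TA TB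
    by (intro exI[of _ "cay ` T \<union> (\<lambda>y. - cay y) ` R"]) (auto simp: less_imp_le)
qed

text \<open>The size of a sphere of radius \<open>I\<close> in a regular tree of valency
  \<open>q + 1\<close>. Radius 0 is separate, because with truncated subtraction the general formula
  would give 2.\<close>

definition cc :: "nat \<Rightarrow> nat" where
  "cc I = (if I = 0 then 1 else residue_card TYPE('f) ^ I + residue_card TYPE('f) ^ (I - 1))"

text \<open>\<open>S\<close> is a translate of \<open>U1\<close> by any of its elements, and these
  are units, so distances agree. For \<open>I = 0\<close> all of \<open>S\<close> is one
  class.\<close>

lemma transversal_S: "\<exists>T. finite T \<and> card T = cc I \<and> transversal S (rad TYPE('e) ^ I) T"
proof (cases "I = 0")
  case True
  obtain s where s: "s \<in> S" using S_nonempty by blast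
  have "dist x s \<le> 1" if "x \<in> S" for x using nabs_S[OF that] nabs_S[OF s] by (simp add: dist_eq_nabs nabs_diff_le)
  then show ?thesis using True s by (intro exI[of _ "{s}"]) (auto simp: transversal_def cc_def)
next
  case False
  then obtain T where T: "finite T" "card T = residue_card TYPE('f) ^ I + residue_card TYPE('f) ^ (I - 1)"
     "transversal U1 (rad TYPE('e) ^ I) T" using transversal_U1[of I] by auto
  obtain s where s: "s \<in> S" using S_nonempty by blast
  then have s0: "s \<noteq> 0" by (auto simp: S_def)
  have "transversal S (rad TYPE('e) ^ I) ((\<lambda>u. s * u) ` T) \<and> card ((\<lambda>u. s * u) ` T) = card T"
  proof (rule transversal_image[OF T(3)])
    show "(\<lambda>u. s * u) ` U1 = S"
    proof (intro equalityI subsetI)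
      fix x assume "x \<in> (\<lambda>u. s * u) ` U1"
      then show "x \<in> S" using s S_mult_U1 by auto
    next
      fix x assume x: "x \<in> S"
      have "N (x / s) = N x / N s" by simp
      then have "x / s \<in> U1" using x s by (simp add: S_def U1_def)
      then show "x \<in> (\<lambda>u. s * u) ` U1" using s0 by (intro image_eqI[of _ _ "x / s"]) auto
    qed
    fix x y
    have "s * x - s * y = s * (x - y)" by (simp add: algebra_simps)
    then show "dist (s * x) (s * y) \<le> rad TYPE('e) ^ I \<longleftrightarrow> dist x y \<le> rad TYPE('e) ^ I"
      using nabs_S[OF s] by (simp add: dist_eq_nabs nabs_mult)
  qed (auto simp: less_imp_le)
  then show ?thesis using T False by (intro exI[of _ "(\<lambda>u. s * u) ` T"]) (auto simp: cc_def)
qed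

lemma transversal_S_ball:
  assumes "r \<ge> 1" "s \<in> S"
  shows "\<exists>T. finite T \<and> card T = residue_card TYPE('f) ^ n \<and>
     transversal {z\<in>S. dist z s \<le> rad TYPE('e) ^ r} (rad TYPE('e) ^ (r + n)) T"
proof -
  obtain T where T: "finite T" "card T = residue_card TYPE('f) ^ n"
     "transversal {u\<in>U1. dist u 1 \<le> rad TYPE('e) ^ r} (rad TYPE('e) ^ (r + n)) T" using transversal_U1_ball assms by blast
  have s0: "s \<noteq> 0" and s1: "nabs s = 1" using assms nabs_S by (auto simp: S_def)
  have d: "dist (s * x) (s * y) = dist x y" for x y
  proof -
    have "s * x - s * y = s * (x - y)" by (simp add: algebra_simps)
    then show ?thesis using s1 by (simp add: dist_eq_nabs nabs_mult)
  qed
  let ?B = "{z\<in>S. dist z s \<le> rad TYPE('e) ^ r}"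
  have "transversal ?B (rad TYPE('e) ^ (r + n)) ((\<lambda>u. s * u) ` T) \<and> card ((\<lambda>u. s * u) ` T) = card T"
  proof (rule transversal_image[OF T(3)])
    show "(\<lambda>u. s * u) ` {u\<in>U1. dist u 1 \<le> rad TYPE('e) ^ r} = ?B"
    proof (intro equalityI subsetI)
      fix x assume "x \<in> (\<lambda>u. s * u) ` {u\<in>U1. dist u 1 \<le> rad TYPE('e) ^ r}"
      then obtain u where u: "x = s * u" "u \<in> U1" "dist u 1 \<le> rad TYPE('e) ^ r" by auto
      moreover have "dist (s * u) (s * 1) \<le> rad TYPE('e) ^ r" using u unfolding d by simp
      ultimately show "x \<in> ?B" using assms S_mult_U1 by simp
    next
      fix x assume x: "x \<in> ?B"
      have "N (x / s) = N x / N s" by simp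
      then have "x / s \<in> U1" using x assms by (simp add: S_def U1_def)
      moreover have "dist (s * (x / s)) (s * 1) = dist (x / s) 1" by (rule d)
      ultimately show "x \<in> (\<lambda>u. s * u) ` {u\<in>U1. dist u 1 \<le> rad TYPE('e) ^ r}"
        using s0 x by (intro image_eqI[of _ _ "x / s"]) auto
    qed
  qed (auto simp: less_imp_le d)
  then show ?thesis using T by (intro exI[of _ "(\<lambda>u. s * u) ` T"]) auto
qed

end

section \<open>Invariant measures and orbital integrals\<close>

lemma sets_eqI_measurable:
  assumes "space M = space N" "(\<lambda>x. x) \<in> measurable M N" "(\<lambda>x. x) \<in> measurable N M"
  shows "sets M = sets N"
proof
  show "sets M \<subseteq> sets N"
  proof
    fix A assume A: "A \<in> sets M"
    then have "(\<lambda>x. x) -` A \<inter> space N \<in> sets N" using assms(3) by (rule measurable_sets[rotated])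
    moreover have "(\<lambda>x. x) -` A \<inter> space N = A" using sets.sets_into_space[OF A] assms(1) by auto
    ultimately show "A \<in> sets N" by simp
  qed
  show "sets N \<subseteq> sets M"
  proof
    fix A assume A: "A \<in> sets N"
    then have "(\<lambda>x. x) -` A \<inter> space M \<in> sets M" using assms(2) by (rule measurable_sets[rotated])
    moreover have "(\<lambda>x. x) -` A \<inter> space M = A" using sets.sets_into_space[OF A] assms(1) by auto
    ultimately show "A \<in> sets M" by simp
  qed
qed

lemma measurable_restrict_continuous:
  assumes "continuous_on A f" "f ` A \<subseteq> B"
  shows "f \<in> measurable (restrict_space borel A) (restrict_space borel B)"
  using assms by (intro measurable_restrict_space2 borel_measurable_continuous_on_restrict)
    (auto simp: space_restrict_space)

text \<open>The identity is measurable in both directions: one way by \<open>borel_prod\<close> for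
  second countable spaces, the other by continuity of the projections.\<close>

lemma sets_pair_restrict:
  fixes A :: "'a::second_countable_topology set" and B :: "'b::second_countable_topology set"
  shows "sets (restrict_space borel A \<Otimes>\<^sub>M restrict_space borel B) = sets (restrict_space borel (A \<times> B))"
proof (rule sets_eqI_measurable)
  show "space (restrict_space borel A \<Otimes>\<^sub>M restrict_space borel B) = space (restrict_space borel (A \<times> B))"
    by (simp add: space_pair_measure space_restrict_space)
  have f: "fst \<in> restrict_space borel A \<Otimes>\<^sub>M restrict_space borel B \<rightarrow>\<^sub>M borel"
    by (rule measurable_compose[OF measurable_fst measurable_restrict_space1[OF measurable_ident_sets[OF refl]]]) 
  have s: "snd \<in> restrict_space borel A \<Otimes>\<^sub>M restrict_space borel B \<rightarrow>\<^sub>M borel"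
    by (rule measurable_compose[OF measurable_snd measurable_restrict_space1[OF measurable_ident_sets[OF refl]]])
  have "(\<lambda>x. (fst x, snd x)) \<in> restrict_space borel A \<Otimes>\<^sub>M restrict_space borel B \<rightarrow>\<^sub>M (borel \<Otimes>\<^sub>M borel)"
    by (rule measurable_Pair[OF f s])
  then have "(\<lambda>x. x) \<in> restrict_space borel A \<Otimes>\<^sub>M restrict_space borel B \<rightarrow>\<^sub>M borel"
    by (simp add: borel_prod)
  then show "(\<lambda>x. x) \<in> restrict_space borel A \<Otimes>\<^sub>M restrict_space borel B \<rightarrow>\<^sub>M restrict_space borel (A \<times> B)"
    by (rule measurable_restrict_space2[rotated]) (auto simp: space_pair_measure space_restrict_space)
  have "(\<lambda>x. (fst x, snd x)) \<in> restrict_space borel (A \<times> B) \<rightarrow>\<^sub>M restrict_space borel A \<Otimes>\<^sub>M restrict_space borel B"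
    by (intro measurable_Pair measurable_restrict_continuous continuous_intros) auto
  then show "(\<lambda>x. x) \<in> restrict_space borel (A \<times> B) \<rightarrow>\<^sub>M restrict_space borel A \<Otimes>\<^sub>M restrict_space borel B"
    by simp
qed

lemma continuous_on_section:
  "continuous_on (A \<times> B) f \<Longrightarrow> a \<in> A \<Longrightarrow> continuous_on B (\<lambda>x. f (a, x))"
  by (rule continuous_on_compose2[where f = "Pair a"])
    (auto intro: continuous_on_Pair[OF continuous_on_const continuous_on_id])

text \<open>The working form of a Haar measure: invariance as an identity of image measures, ready
  for integrals, and sigma-finiteness for Fubini. \<open>haar_groupI\<close> leads here from
  \<open>haar_measure\<close>, and \<open>haar_measure_of_compact\<close> leads back for compact
  groups of volume one.\<close>

locale haar_group = group G + sigma_finite_measure \<mu>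
  for G :: "('g::second_countable_topology) monoid" (structure) and \<mu> :: "'g measure" +
  assumes space_haar: "space \<mu> = carrier G"
    and sets_haar: "sets \<mu> = sets (restrict_space borel (carrier G))"
    and distr_haar: "\<And>g. g \<in> carrier G \<Longrightarrow> distr \<mu> \<mu> (\<lambda>x. g \<otimes> x) = \<mu>"
    and continuous_mult: "continuous_on (carrier G \<times> carrier G) (\<lambda>(x, y). x \<otimes> y)"
begin

lemma continuous_mult_left: "g \<in> carrier G \<Longrightarrow> continuous_on (carrier G) (\<lambda>x. g \<otimes> x)"
  using continuous_on_section[OF continuous_mult] by simp

lemma measurable_haar: "measurable \<mu> \<mu> = measurable (restrict_space borel (carrier G)) (restrict_space borel (carrier G))"
  by (intro measurable_cong_sets sets_haar)

lemma measurable_translate: "g \<in> carrier G \<Longrightarrow> (\<lambda>x. g \<otimes> x) \<in> measurable \<mu> \<mu>"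
  unfolding measurable_haar by (intro measurable_restrict_continuous continuous_mult_left) auto

lemma nn_integral_translate:
  assumes "g \<in> carrier G" "\<phi> \<in> borel_measurable \<mu>"
  shows "(\<integral>\<^sup>+x. \<phi> (g \<otimes> x) \<partial>\<mu>) = (\<integral>\<^sup>+x. \<phi> x \<partial>\<mu>)"
  using nn_integral_distr[OF measurable_translate[OF assms(1)], of \<phi>] assms by (simp add: distr_haar)

lemma integral_translate:
  fixes \<phi> :: "'g \<Rightarrow> complex"
  assumes "g \<in> carrier G" "\<phi> \<in> borel_measurable \<mu>"
  shows "(\<integral>x. \<phi> (g \<otimes> x) \<partial>\<mu>) = (\<integral>x. \<phi> x \<partial>\<mu>)"
  using integral_distr[OF measurable_translate[OF assms(1)], of \<phi>] assms by (simp add: distr_haar)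

lemma emeasure_translate_image:
  assumes "g \<in> carrier G" "A \<in> sets \<mu>"
  shows "(\<lambda>x. g \<otimes> x) ` A = (\<lambda>x. inv g \<otimes> x) -` A \<inter> space \<mu>"
    "(\<lambda>x. g \<otimes> x) ` A \<in> sets \<mu>" "emeasure \<mu> ((\<lambda>x. g \<otimes> x) ` A) = emeasure \<mu> A"
proof -
  have A: "A \<subseteq> carrier G" using sets.sets_into_space[OF assms(2)] space_haar by simp
  show e: "(\<lambda>x. g \<otimes> x) ` A = (\<lambda>x. inv g \<otimes> x) -` A \<inter> space \<mu>"
  proof (intro equalityI subsetI)
    fix x assume "x \<in> (\<lambda>x. g \<otimes> x) ` A"
    then show "x \<in> (\<lambda>x. inv g \<otimes> x) -` A \<inter> space \<mu>" using A assms(1)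
      by (auto simp: space_haar simp flip: m_assoc)
  next
    fix x assume x: "x \<in> (\<lambda>x. inv g \<otimes> x) -` A \<inter> space \<mu>"
    then have "x = g \<otimes> (inv g \<otimes> x)" using assms(1) by (simp add: space_haar flip: m_assoc)
    then show "x \<in> (\<lambda>x. g \<otimes> x) ` A" using x by blast
  qed
  have i: "inv g \<in> carrier G" using assms by simp
  show "(\<lambda>x. g \<otimes> x) ` A \<in> sets \<mu>" unfolding e
    by (rule measurable_sets[OF measurable_translate[OF i] assms(2)])
  show "emeasure \<mu> ((\<lambda>x. g \<otimes> x) ` A) = emeasure \<mu> A" unfolding e
    using emeasure_distr[OF measurable_translate[OF i] assms(2)] by (simp add: distr_haar[OF i])
qed

end

lemma haar_groupI:
  fixes G :: "('g::second_countable_topology) monoid"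
  assumes "group G" "haar_measure G \<mu>" "sigma_finite_measure \<mu>"
    and c: "continuous_on (carrier G \<times> carrier G) (\<lambda>(x, y). x \<otimes>\<^bsub>G\<^esub> y)"
  shows "haar_group G \<mu>"
proof -
  interpret group G by fact
  have sp: "space \<mu> = carrier G" and se: "sets \<mu> = sets (restrict_space borel (carrier G))"
    and im: "\<And>g A. g \<in> carrier G \<Longrightarrow> A \<in> sets \<mu> \<Longrightarrow> emeasure \<mu> ((\<lambda>x. g \<otimes>\<^bsub>G\<^esub> x) ` A) = emeasure \<mu> A"
    using assms(2) by (auto simp: haar_measure_def)
  have "distr \<mu> \<mu> (\<lambda>x. g \<otimes>\<^bsub>G\<^esub> x) = \<mu>" if g: "g \<in> carrier G" for g
  proof (rule measure_eqI)
    have cg: "continuous_on (carrier G) (\<lambda>x. g \<otimes>\<^bsub>G\<^esub> x)"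
      using continuous_on_section[OF c g] by simp
    have m: "(\<lambda>x. g \<otimes>\<^bsub>G\<^esub> x) \<in> measurable \<mu> \<mu>" unfolding measurable_cong_sets[OF se se]
      by (rule measurable_restrict_continuous[OF cg]) (use g in auto)
    fix A assume "A \<in> sets (distr \<mu> \<mu> (\<lambda>x. g \<otimes>\<^bsub>G\<^esub> x))"
    then have A: "A \<in> sets \<mu>" by simp
    then have Ac: "A \<subseteq> carrier G" using sets.sets_into_space[OF A] sp by simp
    have "(\<lambda>x. g \<otimes>\<^bsub>G\<^esub> x) -` A \<inter> space \<mu> = (\<lambda>x. inv\<^bsub>G\<^esub> g \<otimes>\<^bsub>G\<^esub> x) ` A"
    proof (intro equalityI subsetI)
      fix x assume x: "x \<in> (\<lambda>x. g \<otimes>\<^bsub>G\<^esub> x) -` A \<inter> space \<mu>"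
      then have "x = inv\<^bsub>G\<^esub> g \<otimes>\<^bsub>G\<^esub> (g \<otimes>\<^bsub>G\<^esub> x)" using g sp by (simp flip: m_assoc)
      then show "x \<in> (\<lambda>x. inv\<^bsub>G\<^esub> g \<otimes>\<^bsub>G\<^esub> x) ` A" using x by blast
    qed (use Ac g sp in \<open>auto simp flip: m_assoc\<close>)
    then show "emeasure (distr \<mu> \<mu> (\<lambda>x. g \<otimes>\<^bsub>G\<^esub> x)) A = emeasure \<mu> A"
      using emeasure_distr[OF m A] im[of "inv\<^bsub>G\<^esub> g" A] g A by simp
  qed simp
  then show ?thesis
    using assms sp se by (simp add: haar_group_def haar_group_axioms_def)
qed

lemma haar_group_pair:
  fixes G1 :: "('g::second_countable_topology) monoid" and G2 :: "('h::second_countable_topology) monoid"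
  assumes "haar_group G1 \<mu>1" "haar_group G2 \<mu>2"
  shows "haar_group (G1 \<times>\<times> G2) (\<mu>1 \<Otimes>\<^sub>M \<mu>2)"
proof -
  interpret A: haar_group G1 \<mu>1 by fact
  interpret B: haar_group G2 \<mu>2 by fact
  interpret pair_sigma_finite \<mu>1 \<mu>2 ..
  have grp: "group (G1 \<times>\<times> G2)" by (simp add: DirProd_group A.is_group B.is_group)
  have sp: "space (\<mu>1 \<Otimes>\<^sub>M \<mu>2) = carrier (G1 \<times>\<times> G2)"
    by (simp add: space_pair_measure A.space_haar B.space_haar)
  have se: "sets (\<mu>1 \<Otimes>\<^sub>M \<mu>2) = sets (restrict_space borel (carrier (G1 \<times>\<times> G2)))"
    using sets_pair_measure_cong[OF A.sets_haar B.sets_haar] by (simp add: sets_pair_restrict)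
  have di: "distr (\<mu>1 \<Otimes>\<^sub>M \<mu>2) (\<mu>1 \<Otimes>\<^sub>M \<mu>2) (\<lambda>x. g \<otimes>\<^bsub>G1 \<times>\<times> G2\<^esub> x) = \<mu>1 \<Otimes>\<^sub>M \<mu>2"
    if g: "g \<in> carrier (G1 \<times>\<times> G2)" for g
  proof -
    obtain a b where ab: "g = (a, b)" "a \<in> carrier G1" "b \<in> carrier G2" using g by auto
    have "\<mu>1 \<Otimes>\<^sub>M \<mu>2 = distr \<mu>1 \<mu>1 (\<lambda>x. a \<otimes>\<^bsub>G1\<^esub> x) \<Otimes>\<^sub>M distr \<mu>2 \<mu>2 (\<lambda>x. b \<otimes>\<^bsub>G2\<^esub> x)"
      using ab by (simp add: A.distr_haar B.distr_haar)
    also have "\<dots> = distr (\<mu>1 \<Otimes>\<^sub>M \<mu>2) (\<mu>1 \<Otimes>\<^sub>M \<mu>2) (\<lambda>(x, y). (a \<otimes>\<^bsub>G1\<^esub> x, b \<otimes>\<^bsub>G2\<^esub> y))"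
      by (rule pair_measure_distr) (use ab A.measurable_translate B.measurable_translate in
        \<open>auto simp: B.distr_haar intro: B.sigma_finite_measure_axioms\<close>)
    also have "(\<lambda>(x, y). (a \<otimes>\<^bsub>G1\<^esub> x, b \<otimes>\<^bsub>G2\<^esub> y)) = (\<lambda>x. g \<otimes>\<^bsub>G1 \<times>\<times> G2\<^esub> x)"
      by (auto simp: ab(1) DirProd_def)
    finally show ?thesis ..
  qed
  have "continuous_on (carrier (G1 \<times>\<times> G2) \<times> carrier (G1 \<times>\<times> G2))
    (\<lambda>p. ((\<lambda>(x, y). x \<otimes>\<^bsub>G1\<^esub> y) (fst (fst p), fst (snd p)), (\<lambda>(x, y). x \<otimes>\<^bsub>G2\<^esub> y) (snd (fst p), snd (snd p))))"
    by (intro continuous_on_Pair continuous_on_compose2[OF A.continuous_mult]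
          continuous_on_compose2[OF B.continuous_mult] continuous_intros) auto
  then have co: "continuous_on (carrier (G1 \<times>\<times> G2) \<times> carrier (G1 \<times>\<times> G2)) (\<lambda>(x, y). x \<otimes>\<^bsub>G1 \<times>\<times> G2\<^esub> y)"
    by (simp add: DirProd_def case_prod_beta')
  have sf: "sigma_finite_measure (\<mu>1 \<Otimes>\<^sub>M \<mu>2)" by (rule P.sigma_finite_measure_axioms)
  show ?thesis
    by (intro haar_group.intro haar_group_axioms.intro grp sf sp se di co)
qed

lemma (in haar_group) haar_measure_of_compact:
  assumes "compact (carrier G)" "emeasure \<mu> (carrier G) = 1"
  shows "haar_measure G \<mu>"
  unfolding haar_measure_def
proof (intro conjI ballI allI impI)
  show "space \<mu> = carrier G" "sets \<mu> = sets (restrict_space borel (carrier G))"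
    by (rule space_haar, rule sets_haar)
  fix g A assume "g \<in> carrier G" "A \<in> sets \<mu>"
  then show "emeasure \<mu> ((\<lambda>x. g \<otimes> x) ` A) = emeasure \<mu> A" by (rule emeasure_translate_image)
next
  fix K
  have "emeasure \<mu> K \<le> emeasure \<mu> (space \<mu>)" by (rule emeasure_space)
  then show "emeasure \<mu> K < \<infinity>" using assms(2) by (simp add: space_haar le_less_trans[OF _ ennreal_one_less_top])
next
  fix S assume S: "openin (top_of_set (carrier G)) S \<and> S \<noteq> {}"
  then have Sc: "S \<subseteq> carrier G" using openin_imp_subset by blast
  have op: "openin (top_of_set (carrier G)) ((\<lambda>x. g \<otimes> x) ` S)" if g: "g \<in> carrier G" for g
  proof -
    have "(\<lambda>x. g \<otimes> x) ` S = carrier G \<inter> (\<lambda>x. inv g \<otimes> x) -` S"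
    proof (intro equalityI subsetI)
      fix x assume x: "x \<in> carrier G \<inter> (\<lambda>x. inv g \<otimes> x) -` S"
      then have "x = g \<otimes> (inv g \<otimes> x)" using g by (simp flip: m_assoc)
      then show "x \<in> (\<lambda>x. g \<otimes> x) ` S" using x by blast
    qed (use Sc g in \<open>auto simp flip: m_assoc\<close>)
    also have "openin (top_of_set (carrier G)) \<dots>"
      using S g by (intro continuous_openin_preimage[of _ _ "carrier G"] continuous_mult_left) auto
    finally show ?thesis .
  qed
  have meas: "S \<in> sets \<mu>"
  proof -
    obtain T where "open T" "S = carrier G \<inter> T" using S by (auto simp: openin_open)
    then show ?thesis by (auto simp: sets_haar sets_restrict_space)
  qed
  obtain s where s: "s \<in> S" using S by blast
  \<comment> \<open>Finitely many translates of \<open>S\<close> cover the compact group; if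
    \<open>S\<close> were null, so would be the group.\<close>
  let ?C = "(\<lambda>g. (\<lambda>x. g \<otimes> x) ` S) ` carrier G"
  have cov: "carrier G \<subseteq> \<Union>?C"
  proof
    fix x assume x: "x \<in> carrier G"
    then have "x = (x \<otimes> inv s) \<otimes> s" using s Sc by (auto simp: m_assoc)
    then show "x \<in> \<Union>?C" using x s Sc by (intro UnionI[of "(\<lambda>y. (x \<otimes> inv s) \<otimes> y) ` S"]) auto
  qed
  have opC: "\<forall>c\<in>?C. openin (top_of_set (carrier G)) c" using op by auto
  have "\<exists>D\<subseteq>?C. finite D \<and> carrier G \<subseteq> \<Union>D"
    by (rule assms(1)[unfolded compact_eq_openin_cover, THEN spec, THEN mp, OF conjI[OF opC cov]])
  then obtain D where D: "D \<subseteq> ?C" "finite D" "carrier G \<subseteq> \<Union>D" by blast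
  show "emeasure \<mu> S > 0"
  proof (rule ccontr)
    assume "\<not> emeasure \<mu> S > 0"
    then have z: "emeasure \<mu> S = 0" by simp
    have Dm: "d \<in> sets \<mu>" "emeasure \<mu> d = 0" if "d \<in> D" for d
    proof -
      have "d \<in> ?C" using that D(1) by (rule rev_subsetD)
      then obtain g where g: "g \<in> carrier G" "d = (\<lambda>x. g \<otimes> x) ` S" by (rule imageE)
      show "d \<in> sets \<mu>" "emeasure \<mu> d = 0"
        unfolding g(2) using emeasure_translate_image(2,3)[OF g(1) meas] z by simp_all
    qed
    have "emeasure \<mu> (carrier G) \<le> emeasure \<mu> (\<Union>d\<in>D. d)"
      using D(2,3) Dm by (intro emeasure_mono) auto
    also have "\<dots> \<le> (\<Sum>d\<in>D. emeasure \<mu> d)"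
      using D(2) Dm by (intro emeasure_subadditive_finite) auto
    also have "\<dots> = 0" using Dm by simp
    finally show False using assms(2) by simp
  qed
qed

text \<open>A homomorphism carries left translation by \<open>g\<close> to left translation by
  \<open>p g\<close>, so surjectivity makes the image measure invariant. All Haar measures on tori
  used below arise in this way.\<close>

lemma haar_measure_pushforward:
  fixes G :: "('g::second_countable_topology) monoid" (structure) and H :: "('h::second_countable_topology) monoid"
  assumes "haar_group G \<mu>" "emeasure \<mu> (carrier G) = 1" "group H"
    and p: "p \<in> hom G H" "continuous_on (carrier G) p" "p ` carrier G = carrier H"
    and c: "continuous_on (carrier H \<times> carrier H) (\<lambda>(x, y). x \<otimes>\<^bsub>H\<^esub> y)" and comp: "compact (carrier H)"
  shows "\<exists>\<nu>. haar_measure H \<nu> \<and> emeasure \<nu> (carrier H) = 1"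
proof -
  interpret haar_group G \<mu> by fact
  interpret H: group H by fact
  define \<nu> where "\<nu> = distr \<mu> (restrict_space borel (carrier H)) p"
  have pm: "p \<in> measurable \<mu> (restrict_space borel (carrier H))"
    unfolding measurable_cong_sets[OF sets_haar refl]
    by (rule measurable_restrict_continuous) (use p in auto)
  have sp: "space \<nu> = carrier H" by (simp add: \<nu>_def space_restrict_space)
  have se: "sets \<nu> = sets (restrict_space borel (carrier H))" by (simp add: \<nu>_def)
  have one: "emeasure \<nu> (carrier H) = 1"
  proof -
    have "carrier H \<in> sets (restrict_space borel (carrier H))"
      using sets.top[of "restrict_space borel (carrier H)"] by (simp add: space_restrict_space)
    moreover have "p -` carrier H \<inter> space \<mu> = carrier G" using p(3) space_haar by auto
    ultimately show ?thesis unfolding \<nu>_def using assms(2) by (simp add: emeasure_distr[OF pm])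
  qed
  have di: "distr \<nu> \<nu> (\<lambda>x. h \<otimes>\<^bsub>H\<^esub> x) = \<nu>" if h: "h \<in> carrier H" for h
  proof -
    obtain g where g: "g \<in> carrier G" "h = p g" using h p(3) by auto
    have ch: "continuous_on (carrier H) (\<lambda>x. h \<otimes>\<^bsub>H\<^esub> x)"
      using continuous_on_section[OF c h] by simp
    have hm: "(\<lambda>x. h \<otimes>\<^bsub>H\<^esub> x) \<in> restrict_space borel (carrier H) \<rightarrow>\<^sub>M restrict_space borel (carrier H)"
      by (rule measurable_restrict_continuous[OF ch]) (use h in auto)
    have "distr \<nu> \<nu> (\<lambda>x. h \<otimes>\<^bsub>H\<^esub> x) = distr \<nu> (restrict_space borel (carrier H)) (\<lambda>x. h \<otimes>\<^bsub>H\<^esub> x)"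
      by (rule distr_cong) (simp_all add: se)
    also have "\<dots> = distr \<mu> (restrict_space borel (carrier H)) ((\<lambda>x. h \<otimes>\<^bsub>H\<^esub> x) \<circ> p)"
      unfolding \<nu>_def by (rule distr_distr[OF hm pm])
    also have "\<dots> = distr \<mu> (restrict_space borel (carrier H)) (p \<circ> (\<lambda>x. g \<otimes> x))"
      by (rule distr_cong) (use g p(1) in \<open>auto simp: space_haar hom_mult\<close>)
    also have "\<dots> = distr (distr \<mu> \<mu> (\<lambda>x. g \<otimes> x)) (restrict_space borel (carrier H)) p"
      by (rule distr_distr[symmetric, OF pm measurable_translate[OF g(1)]])
    also have "\<dots> = \<nu>" by (simp add: distr_haar[OF g(1)] \<nu>_def)
    finally show ?thesis .
  qed
  have sf: "sigma_finite_measure \<nu>"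
  proof -
    have "finite_measure \<nu>" by (rule finite_measureI) (simp add: sp one)
    then show ?thesis by (simp add: finite_measure_def)
  qed
  have "haar_group H \<nu>"
    by (intro haar_group.intro haar_group_axioms.intro assms(3) sf sp se di c)
  then show ?thesis using haar_group.haar_measure_of_compact[OF _ comp one] one by blast
qed

text \<open>A compact group is its own unique maximal compact subgroup, so the choice in
  \<open>torus_haar\<close> normalizes the total volume, provided that there is a Haar measure to
  choose.\<close>

lemma torus_haar_compact:
  fixes H :: "('h::second_countable_topology) monoid"
  assumes "group H" "compact (carrier H)" "\<exists>\<nu>. haar_measure H \<nu> \<and> emeasure \<nu> (carrier H) = 1"
    and c: "continuous_on (carrier H \<times> carrier H) (\<lambda>(x, y). x \<otimes>\<^bsub>H\<^esub> y)"
  shows "haar_group H (torus_haar H)" "emeasure (torus_haar H) (carrier H) = 1"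
proof -
  interpret group H by fact
  have mc: "max_compact_subgroup H (carrier H)"
    using assms(2) by (auto simp: max_compact_subgroup_def subgroup_self dest: subgroup.subset)
  have K: "K = carrier H" if "max_compact_subgroup H K" for K
    using that assms(2) subgroup_self by (auto simp: max_compact_subgroup_def dest: subgroup.subset)
  have "\<exists>\<mu>. haar_measure H \<mu> \<and> (\<exists>K. max_compact_subgroup H K \<and> emeasure \<mu> K = 1)"
    using assms(3) mc by blast
  from someI_ex[OF this] have t: "haar_measure H (torus_haar H)" "emeasure (torus_haar H) (carrier H) = 1"
    unfolding torus_haar_def[symmetric] using K by auto
  have "finite_measure (torus_haar H)"
    by (rule finite_measureI) (use t in \<open>simp add: haar_measure_def\<close>)
  then have "sigma_finite_measure (torus_haar H)" by (simp add: finite_measure_def)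
  then show "haar_group H (torus_haar H)" using t c by (intro haar_groupI assms(1))
  show "emeasure (torus_haar H) (carrier H) = 1" by (rule t)
qed

text \<open>For a compact commutative stabilizer of total volume one the quotient measure is the image of
  the measure on the group.\<close>

lemma orbital_integral_eq:
  fixes G :: "('g::second_countable_topology) monoid" (structure) and f :: "'x \<Rightarrow> complex"
  assumes "haar_group G \<mu>"
    and act: "\<And>g h. g \<in> carrier G \<Longrightarrow> h \<in> carrier G \<Longrightarrow> act (g \<otimes>\<^bsub>G\<^esub> h) x = act g (act h x)" "act \<one>\<^bsub>G\<^esub> x = x"
    and comm: "\<And>g h. g \<in> carrier G \<Longrightarrow> h \<in> carrier G \<Longrightarrow> act g x = x \<Longrightarrow> act h x = x \<Longrightarrow> g \<otimes>\<^bsub>G\<^esub> h = h \<otimes>\<^bsub>G\<^esub> g"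
    and comp: "compact {g \<in> carrier G. act g x = x}"
    and ex: "\<exists>\<nu>. haar_measure (stabilizer_group G act x) \<nu> \<and> emeasure \<nu> {g \<in> carrier G. act g x = x} = 1"
    and meas: "(\<lambda>g. f (act (inv\<^bsub>G\<^esub> g) x)) \<in> borel_measurable \<mu>"
  shows "orbital_integral G \<mu> act x f = (\<integral>g. f (act (inv\<^bsub>G\<^esub> g) x) \<partial>\<mu>)"
proof -
  interpret haar_group G \<mu> by fact
  define H where "H = {g \<in> carrier G. act g x = x}"
  define GH where "GH = stabilizer_group G act x"
  have cGH: "carrier GH = H" and mGH: "mult GH = mult G" and oGH: "one GH = one G"
    by (simp_all add: GH_def stabilizer_group_def H_def)
  have GH: "GH = G\<lparr>carrier := H\<rparr>" by (simp add: GH_def stabilizer_group_def H_def)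
  have invact: "act (inv\<^bsub>G\<^esub> g) x = x" if "g \<in> carrier G" "act g x = x" for g
    using act(1)[of "inv\<^bsub>G\<^esub> g" g] act(2) that by simp
  have subH: "subgroup H G"
    by (rule subgroupI) (use act invact in \<open>auto simp: H_def\<close>)
  have Hc: "H \<subseteq> carrier G" by (auto simp: H_def)
  have grpH: "group GH" unfolding GH by (rule subgroup.subgroup_is_group[OF subH group_axioms])
  have contH: "continuous_on (carrier GH \<times> carrier GH) (\<lambda>(x, y). x \<otimes>\<^bsub>GH\<^esub> y)"
    unfolding cGH mGH by (rule continuous_on_subset[OF continuous_mult]) (use Hc in auto)
  have compH: "compact (carrier GH)" using comp by (simp add: cGH H_def)
  define \<mu>H where "\<mu>H = torus_haar GH"
  have hH: "haar_group GH \<mu>H" and oneH: "emeasure \<mu>H H = 1"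
    using torus_haar_compact[OF grpH compH _ contH] ex cGH by (simp_all add: \<mu>H_def GH_def H_def)
  interpret H: haar_group GH \<mu>H by (rule hH)
  have spH: "space \<mu>H = H" using H.space_haar cGH by simp
  define proj where "proj g = H #>\<^bsub>G\<^esub> g" for g
  define Q where "Q = rcosets\<^bsub>G\<^esub> H"
  have projQ: "proj g \<in> Q" if "g \<in> carrier G" for g
    using that Hc by (simp add: proj_def Q_def rcosetsI)
  have Qproj: "\<exists>g\<in>carrier G. C = proj g" if "C \<in> Q" for C
    using that by (auto simp: Q_def RCOSETS_def proj_def)
  have memproj: "h \<in> proj g \<longleftrightarrow> (\<exists>t\<in>H. h = t \<otimes> g)" for h g
    by (auto simp: proj_def r_coset_def)
  have self: "g \<in> proj g" if "g \<in> carrier G" for g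
    using that subH by (simp add: proj_def rcos_self)
  have projsub: "proj g \<subseteq> carrier G" if "g \<in> carrier G" for g
    using that Hc by (simp add: proj_def r_coset_subset_G)
  have projeq: "proj h = proj g" if "h \<in> proj g" "g \<in> carrier G" for h g
    using that subH repr_independence[of h H g] by (simp add: proj_def)
  have projmem: "proj h = C" if "h \<in> C" "C \<in> Q" for h C
    using Qproj[OF that(2)] projeq that(1) by auto
  have QsubG: "C \<subseteq> carrier G" if "C \<in> Q" for C using Qproj[OF that] projsub by auto
  have rep: "(SOME g. g \<in> C) \<in> C" if "C \<in> Q" for C
    using Qproj[OF that] self by (metis someI_ex)
  have UB: "\<Union>B = proj -` B \<inter> carrier G" if "B \<subseteq> Q" for B
  proof (intro equalityI subsetI)
    fix g assume "g \<in> \<Union>B"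
    then obtain C where C: "g \<in> C" "C \<in> B" by blast
    then have "proj g = C" using projmem that by blast
    then show "g \<in> proj -` B \<inter> carrier G" using C that QsubG by auto
  next
    fix g assume "g \<in> proj -` B \<inter> carrier G"
    then show "g \<in> \<Union>B" using self by blast
  qed
  define \<Sigma> where "\<Sigma> = {B. B \<subseteq> Q \<and> \<Union>B \<in> sets \<mu>}"
  have sig: "sigma_algebra Q \<Sigma>" unfolding sigma_algebra_iff2
  proof (intro conjI ballI allI impI)
    show "\<Sigma> \<subseteq> Pow Q" "{} \<in> \<Sigma>" by (auto simp: \<Sigma>_def)
    fix B assume "B \<in> \<Sigma>"
    then have B: "B \<subseteq> Q" "\<Union>B \<in> sets \<mu>" by (auto simp: \<Sigma>_def)
    have "\<Union>(Q - B) = space \<mu> - \<Union>B"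
      using UB[of "Q - B"] UB[OF B(1)] projQ by (auto simp: space_haar)
    then show "Q - B \<in> \<Sigma>" using B by (auto simp: \<Sigma>_def)
  next
    fix A :: "nat \<Rightarrow> 'g set set" assume A: "range A \<subseteq> \<Sigma>"
    have "\<Union>(\<Union>i. A i) = (\<Union>i. \<Union>(A i))" by blast
    moreover have "(\<Union>i. \<Union>(A i)) \<in> sets \<mu>" using A by (intro sets.countable_UN) (auto simp: \<Sigma>_def)
    ultimately show "(\<Union>i. A i) \<in> \<Sigma>" using A by (auto simp: \<Sigma>_def)
  qed
  define N where "N = sigma Q \<Sigma>"
  have spN: "space N = Q" unfolding N_def by (rule space_measure_of) (auto simp: \<Sigma>_def)
  have seN: "sets N = \<Sigma>" unfolding N_def by (rule sigma_algebra.sets_measure_of_eq[OF sig])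
  \<comment> \<open>The measurable sets of cosets are those with measurable union, so measurability
    may be tested after composition with the projection.\<close>
  have measN: "\<Psi> \<in> measurable N L" if "(\<lambda>g. \<Psi> (proj g)) \<in> measurable \<mu> L" for \<Psi> :: "'g set \<Rightarrow> 'z" and L
  proof (rule measurableI)
    fix C assume "C \<in> space N"
    then obtain g where "g \<in> carrier G" "C = proj g" using Qproj spN by auto
    then show "\<Psi> C \<in> space L" using measurable_space[OF that, of g] space_haar by auto
  next
    fix A assume "A \<in> sets L"
    then have m: "(\<lambda>g. \<Psi> (proj g)) -` A \<inter> space \<mu> \<in> sets \<mu>" by (rule measurable_sets[OF that])
    have "\<Union>(\<Psi> -` A \<inter> Q) = (\<lambda>g. \<Psi> (proj g)) -` A \<inter> space \<mu>"
      using UB[of "\<Psi> -` A \<inter> Q"] projQ by (auto simp: space_haar)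
    then show "\<Psi> -` A \<inter> space N \<in> sets N" using m by (simp add: spN seN \<Sigma>_def)
  qed
  have projm: "proj \<in> measurable \<mu> N"
  proof (rule measurableI)
    show "proj g \<in> space N" if "g \<in> space \<mu>" for g using that projQ by (simp add: spN space_haar)
    fix B assume "B \<in> sets N"
    then have B: "B \<subseteq> Q" "\<Union>B \<in> sets \<mu>" by (simp_all add: seN \<Sigma>_def)
    then show "proj -` B \<inter> space \<mu> \<in> sets \<mu>" using UB[OF B(1)] by (simp add: space_haar)
  qed
  \<comment> \<open>The candidate is the image measure: the inner integration over \<open>H\<close>
    is an average, as \<open>H\<close> has volume one.\<close>
  define \<nu>0 where "\<nu>0 = distr \<mu> N proj"
  let ?P = "\<lambda>\<nu>. space \<nu> = rcosets\<^bsub>G\<^esub> H \<and> sets \<nu> = {B. B \<subseteq> rcosets\<^bsub>G\<^esub> H \<and> \<Union>B \<in> sets \<mu>}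
   \<and> (\<forall>\<phi> \<in> borel_measurable \<mu>.
        (\<integral>\<^sup>+ g. \<phi> g \<partial>\<mu>) = (\<integral>\<^sup>+ C. (\<integral>\<^sup>+ t. \<phi> (t \<otimes>\<^bsub>G\<^esub> (SOME g. g \<in> C)) \<partial>\<mu>H) \<partial>\<nu>))"
  have P0: "?P \<nu>0"
  proof (intro conjI ballI)
    show "space \<nu>0 = rcosets\<^bsub>G\<^esub> H" "sets \<nu>0 = {B. B \<subseteq> rcosets\<^bsub>G\<^esub> H \<and> \<Union>B \<in> sets \<mu>}"
      by (simp_all add: \<nu>0_def spN seN Q_def \<Sigma>_def)
    fix \<phi> :: "'g \<Rightarrow> ennreal" assume \<phi>: "\<phi> \<in> borel_measurable \<mu>"
    interpret pair_sigma_finite \<mu>H \<mu> ..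
    have "(\<lambda>p. case p of (t, g) \<Rightarrow> t \<otimes> g) \<in> restrict_space borel (H \<times> carrier G) \<rightarrow>\<^sub>M restrict_space borel (carrier G)"
      by (rule measurable_restrict_continuous[OF continuous_on_subset[OF continuous_mult]]) (use Hc in auto)
    then have mm: "(\<lambda>p. case p of (t, g) \<Rightarrow> t \<otimes> g) \<in> \<mu>H \<Otimes>\<^sub>M \<mu> \<rightarrow>\<^sub>M \<mu>"
      using sets_pair_measure_cong[OF H.sets_haar sets_haar] sets_haar
      by (simp add: sets_pair_restrict cGH cong: measurable_cong_sets)
    then have m2: "(\<lambda>(t, g). \<phi> (t \<otimes> g)) \<in> borel_measurable (\<mu>H \<Otimes>\<^sub>M \<mu>)"
      using measurable_compose[OF mm \<phi>] by (simp add: case_prod_beta')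
    have m2': "(\<lambda>(g, t). \<phi> (t \<otimes> g)) \<in> borel_measurable (\<mu> \<Otimes>\<^sub>M \<mu>H)"
      using measurable_compose[OF measurable_pair_swap' m2] by (simp add: case_prod_beta')
    \<comment> \<open>The chosen representative of a coset differs from \<open>g\<close> by some
      \<open>t0\<close> in \<open>H\<close>. Commutativity turns this shift into a left translation
      of \<open>H\<close>, which does not change the integral.\<close>
    have shift: "(\<integral>\<^sup>+ t. \<phi> (t \<otimes> (SOME h. h \<in> proj g)) \<partial>\<mu>H) = (\<integral>\<^sup>+ t. \<phi> (t \<otimes> g) \<partial>\<mu>H)" if g: "g \<in> carrier G" for g
    proof -
      have "(SOME h. h \<in> proj g) \<in> proj g" using rep projQ[OF g] by blast
      then obtain t0 where t0: "t0 \<in> H" "(SOME h. h \<in> proj g) = t0 \<otimes> g" using memproj by blast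
      have mg: "(\<lambda>t. \<phi> (t \<otimes> g)) \<in> borel_measurable \<mu>H"
        using measurable_compose_Pair1[of g \<mu> _ \<mu>H] measurable_Pair2[OF m2'] g space_haar by simp
      have "(\<integral>\<^sup>+ t. \<phi> (t \<otimes> (SOME h. h \<in> proj g)) \<partial>\<mu>H) = (\<integral>\<^sup>+ t. \<phi> ((t0 \<otimes>\<^bsub>GH\<^esub> t) \<otimes> g) \<partial>\<mu>H)"
      proof (rule nn_integral_cong)
        fix t assume "t \<in> space \<mu>H"
        then have t: "t \<in> H" by (simp add: spH)
        then have "t \<otimes> t0 = t0 \<otimes> t" using comm t0(1) by (auto simp: H_def)
        moreover have "t \<otimes> (t0 \<otimes> g) = (t \<otimes> t0) \<otimes> g" using t t0 g Hc by (subst m_assoc) auto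
        ultimately show "\<phi> (t \<otimes> (SOME h. h \<in> proj g)) = \<phi> ((t0 \<otimes>\<^bsub>GH\<^esub> t) \<otimes> g)"
          by (simp add: mGH t0(2))
      qed
      also have "\<dots> = (\<integral>\<^sup>+ t. \<phi> (t \<otimes> g) \<partial>\<mu>H)"
        using H.nn_integral_translate[OF _ mg, of t0] t0 cGH by simp
      finally show ?thesis .
    qed
    let ?\<Psi> = "\<lambda>C. \<integral>\<^sup>+ t. \<phi> (t \<otimes> (SOME g. g \<in> C)) \<partial>\<mu>H"
    have "(\<lambda>g. \<integral>\<^sup>+ t. \<phi> (t \<otimes> g) \<partial>\<mu>H) \<in> borel_measurable \<mu>"
      using H.borel_measurable_nn_integral[OF m2'] by simp
    then have "(\<lambda>g. ?\<Psi> (proj g)) \<in> borel_measurable \<mu>"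
      using shift by (subst measurable_cong[where g = "\<lambda>g. \<integral>\<^sup>+ t. \<phi> (t \<otimes> g) \<partial>\<mu>H"]) (auto simp: space_haar)
    then have \<Psi>m: "?\<Psi> \<in> borel_measurable N" by (rule measN)
    have "(\<integral>\<^sup>+ C. ?\<Psi> C \<partial>\<nu>0) = (\<integral>\<^sup>+ g. ?\<Psi> (proj g) \<partial>\<mu>)"
      unfolding \<nu>0_def by (rule nn_integral_distr[OF projm]) (use \<Psi>m in simp)
    also have "\<dots> = (\<integral>\<^sup>+ g. \<integral>\<^sup>+ t. \<phi> (t \<otimes> g) \<partial>\<mu>H \<partial>\<mu>)"
      by (rule nn_integral_cong) (simp add: space_haar shift)
    \<comment> \<open>Fubini first; then left invariance on the group makes the inner integral
      independent of \<open>t\<close>.\<close>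
    also have "\<dots> = (\<integral>\<^sup>+ t. \<integral>\<^sup>+ g. \<phi> (t \<otimes> g) \<partial>\<mu> \<partial>\<mu>H)"
      using Fubini'[OF m2] by simp
    also have "\<dots> = (\<integral>\<^sup>+ t. (\<integral>\<^sup>+ g. \<phi> g \<partial>\<mu>) \<partial>\<mu>H)"
      by (rule nn_integral_cong, rule nn_integral_translate[OF _ \<phi>]) (use Hc spH in auto)
    also have "\<dots> = (\<integral>\<^sup>+ g. \<phi> g \<partial>\<mu>)" using oneH by (simp add: spH)
    finally show "(\<integral>\<^sup>+ g. \<phi> g \<partial>\<mu>) = (\<integral>\<^sup>+ C. ?\<Psi> C \<partial>\<nu>0)" ..
  qed
  \<comment> \<open>The indicator of a union of cosets is constant on each coset, so the integral
    formula determines the measure of every admissible set.\<close>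
  have uniq: "\<nu> = \<nu>0" if P: "?P \<nu>" for \<nu>
  proof -
    have *: "emeasure \<nu>' B = emeasure \<mu> (\<Union>B)" if P: "?P \<nu>'" and B: "B \<in> \<Sigma>" for \<nu>' B
    proof -
      have BQ: "B \<subseteq> Q" "\<Union>B \<in> sets \<mu>" using B by (auto simp: \<Sigma>_def)
      have spse: "space \<nu>' = Q" "sets \<nu>' = \<Sigma>" using P by (simp_all add: Q_def \<Sigma>_def)
      let ?\<phi> = "indicator (\<Union>B) :: 'g \<Rightarrow> ennreal"
      have "?\<phi> \<in> borel_measurable \<mu>" using BQ by simp
      then have "(\<integral>\<^sup>+ g. ?\<phi> g \<partial>\<mu>) = (\<integral>\<^sup>+ C. (\<integral>\<^sup>+ t. ?\<phi> (t \<otimes> (SOME g. g \<in> C)) \<partial>\<mu>H) \<partial>\<nu>')" using P by blast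
      also have "\<dots> = (\<integral>\<^sup>+ C. indicator B C \<partial>\<nu>')"
      proof (rule nn_integral_cong)
        fix C assume "C \<in> space \<nu>'"
        then have C: "C \<in> Q" by (simp add: spse)
        have "(\<integral>\<^sup>+ t. ?\<phi> (t \<otimes> (SOME g. g \<in> C)) \<partial>\<mu>H) = (\<integral>\<^sup>+ t. indicator B C \<partial>\<mu>H)"
        proof (rule nn_integral_cong)
          fix t assume "t \<in> space \<mu>H"
          then have t: "t \<in> H" by (simp add: spH)
          have rC: "(SOME g. g \<in> C) \<in> C" by (rule rep[OF C])
          have pr: "proj (SOME g. g \<in> C) = C" by (rule projmem[OF rC C])
          have "t \<otimes> (SOME g. g \<in> C) \<in> proj (SOME g. g \<in> C)" using t memproj by blast
          then have mC: "t \<otimes> (SOME g. g \<in> C) \<in> C" by (simp only: pr)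
          have "t \<otimes> (SOME g. g \<in> C) \<in> \<Union>B \<longleftrightarrow> C \<in> B"
          proof
            assume "t \<otimes> (SOME g. g \<in> C) \<in> \<Union>B"
            then obtain D where D: "D \<in> B" "t \<otimes> (SOME g. g \<in> C) \<in> D" by (rule UnionE)
            have "D \<in> Q" using D(1) BQ(1) by (rule rev_subsetD)
            then have "C = D" using projmem[OF mC C] projmem[OF D(2)] by simp
            then show "C \<in> B" using D(1) by simp
          next
            assume "C \<in> B"
            then show "t \<otimes> (SOME g. g \<in> C) \<in> \<Union>B" using mC by (rule UnionI)
          qed
          then show "?\<phi> (t \<otimes> (SOME g. g \<in> C)) = indicator B C" by (simp add: indicator_def)
        qed
        also have "\<dots> = indicator B C" using oneH by (simp add: spH)
        finally show "(\<integral>\<^sup>+ t. ?\<phi> (t \<otimes> (SOME g. g \<in> C)) \<partial>\<mu>H) = indicator B C" .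
      qed
      also have "\<dots> = emeasure \<nu>' B" using B by (simp add: spse)
      finally show ?thesis using BQ by simp
    qed
    show ?thesis
    proof (rule measure_eqI)
      show "sets \<nu> = sets \<nu>0" using P P0 by simp
      fix B assume "B \<in> sets \<nu>"
      then have "B \<in> \<Sigma>" using P by (simp add: \<Sigma>_def Q_def)
      then show "emeasure \<nu> B = emeasure \<nu>0 B" using *[OF P] *[OF P0] by simp
    qed
  qed
  have qm: "quotient_measure G \<mu> H \<mu>H = \<nu>0"
    unfolding quotient_measure_def by (rule the_equality[of ?P, OF P0 uniq])
  let ?F = "\<lambda>C. f (act (inv\<^bsub>G\<^esub> (SOME g. g \<in> C)) x)"
  have Fp: "?F (proj g) = f (act (inv\<^bsub>G\<^esub> g) x)" if g: "g \<in> carrier G" for g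
  proof -
    have "(SOME h. h \<in> proj g) \<in> proj g" using rep projQ[OF g] by blast
    then obtain t where t: "t \<in> H" "(SOME h. h \<in> proj g) = t \<otimes> g" using memproj by blast
    have "act (inv\<^bsub>G\<^esub> (t \<otimes> g)) x = act (inv\<^bsub>G\<^esub> g) (act (inv\<^bsub>G\<^esub> t) x)"
      using t g Hc act(1) by (auto simp: inv_mult_group)
    then show ?thesis using t invact by (simp add: H_def)
  qed
  have "(\<lambda>g. ?F (proj g)) \<in> borel_measurable \<mu>"
    by (rule measurable_cong[THEN iffD2, OF _ meas], rule Fp) (simp add: space_haar)
  then have Fm: "?F \<in> borel_measurable N" by (rule measN)
  have "orbital_integral G \<mu> act x f = (\<integral>C. ?F C \<partial>\<nu>0)"
    unfolding orbital_integral_def Let_def using qm by (simp add: cGH \<mu>H_def GH_def[symmetric])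
  also have "\<dots> = (\<integral>g. ?F (proj g) \<partial>\<mu>)"
    unfolding \<nu>0_def by (rule integral_distr[OF projm Fm])
  also have "\<dots> = (\<integral>g. f (act (inv\<^bsub>G\<^esub> g) x) \<partial>\<mu>)"
    by (rule Bochner_Integration.integral_cong[OF refl], rule Fp) (simp add: space_haar)
  finally show ?thesis .
qed

no_notation fps_nth (infixl "$" 75)

section \<open>Matrices\<close>

lemma matrix_inv:
  fixes A :: "'k::field^'n::finite^'n"
  assumes "invertible A"
  shows matrix_inv_right: "A ** matrix_inv A = mat 1" and matrix_inv_left: "matrix_inv A ** A = mat 1"
proof -
  have "\<exists>B. A ** B = mat 1 \<and> B ** A = mat 1" using assms by (simp add: invertible_def)
  then have "A ** matrix_inv A = mat 1 \<and> matrix_inv A ** A = mat 1"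
    unfolding matrix_inv_def by (rule someI_ex)
  then show "A ** matrix_inv A = mat 1" "matrix_inv A ** A = mat 1" by auto
qed

lemma matrix_inv_unique:
  fixes A :: "'k::field^'n::finite^'n"
  assumes "A ** B = mat 1"
  shows "matrix_inv A = B" "invertible A"
proof -
  have BA: "B ** A = mat 1" using assms by (simp add: matrix_left_right_inverse)
  then show inv: "invertible A" using assms by (auto simp: invertible_def)
  have "matrix_inv A = matrix_inv A ** (A ** B)" by (simp add: assms)
  also have "\<dots> = B" by (simp add: matrix_mul_assoc matrix_inv_left[OF inv])
  finally show "matrix_inv A = B" .
qed

lemma invertible_matrix_inv: "invertible (A::'k::field^'n::finite^'n) \<Longrightarrow> invertible (matrix_inv A)"
  by (rule matrix_inv_unique(2)[of _ A]) (rule matrix_inv_left)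

lemma invertible_mat_1 [simp]: "invertible (mat 1 :: 'k::field^'n::finite^'n)"
  by (rule matrix_inv_unique(2)[of _ "mat 1"]) simp

lemma matrix_inv_mult:
  fixes A B :: "'k::field^'n::finite^'n"
  assumes "invertible A" "invertible B"
  shows "matrix_inv (A ** B) = matrix_inv B ** matrix_inv A"
proof (rule matrix_inv_unique(1))
  have "A ** B ** (matrix_inv B ** matrix_inv A) = A ** (B ** matrix_inv B) ** matrix_inv A"
    by (simp only: matrix_mul_assoc)
  then show "A ** B ** (matrix_inv B ** matrix_inv A) = mat 1"
    by (simp add: matrix_inv_right assms)
qed

lemma map_matrix_mult:
  assumes "field_hom \<phi>"
  shows "map_matrix \<phi> (A ** B) = map_matrix \<phi> A ** map_matrix \<phi> (B :: 'k::field^'n::finite^'n)"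
proof -
  have "\<phi> (sum f I) = (\<Sum>i\<in>I. \<phi> (f i))" if "finite I" for f :: "'n \<Rightarrow> 'k" and I
    using that by (induction I rule: finite_induct) (simp_all add: field_hom_props[OF assms])
  then show ?thesis
    by (simp add: vec_eq_iff matrix_matrix_mult_def field_hom_props[OF assms])
qed

lemma field_hom_to_ac: "field_hom to_ac"
  by (simp add: field_hom_def)

text \<open>In the product of \<open>x\<close> with its adjoint the factors from the second group
  cancel, so a geometric orbit moves this product only by conjugation.\<close>

lemma stable_orbit_conj:
  assumes "x' \<in> stable_orbit h1 h2 x"
  shows "\<exists>g. invertible g \<and> map_matrix to_ac (x' ** herm_adj h1 h2 x')
    = g ** map_matrix to_ac (x ** herm_adj h1 h2 x) ** matrix_inv g"
proof -
  let ?M = "map_matrix to_ac"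
  obtain g h where gh: "invertible g" "invertible h" "?M x' = g ** ?M x ** matrix_inv h"
    "?M (herm_adj h1 h2 x') = h ** ?M (herm_adj h1 h2 x) ** matrix_inv g"
    using assms by (auto simp: stable_orbit_def geom_orbit_def geom_point_def)
  have "?M (x' ** herm_adj h1 h2 x') = g ** ?M x ** (matrix_inv h ** h) ** ?M (herm_adj h1 h2 x) ** matrix_inv g"
    unfolding map_matrix_mult[OF field_hom_to_ac] gh(3,4) by (simp only: matrix_mul_assoc)
  also have "\<dots> = g ** ?M (x ** herm_adj h1 h2 x) ** matrix_inv g"
    unfolding map_matrix_mult[OF field_hom_to_ac] matrix_inv_left[OF gh(2)]
    by (simp add: matrix_mul_assoc)
  finally show ?thesis using gh(1) by blast
qed

lemma continuous_on_matrix_mult [continuous_intros]: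
  fixes f g :: "'t::topological_space \<Rightarrow> 'k::nonarch_local_field^'n::finite^'n"
  assumes "continuous_on A f" "continuous_on A g"
  shows "continuous_on A (\<lambda>x. f x ** g x)"
  unfolding matrix_matrix_mult_def
  by (intro continuous_on_vec_lambda continuous_on_sum continuous_on_mult'
        continuous_on_component assms)

lemma matrix_1_eq_iff: "A = B \<longleftrightarrow> A $ 1 $ 1 = (B::'k^1^1) $ 1 $ 1"
  by (simp add: vec_eq_iff)

lemma matrix_1_mult [simp]: "(A ** B) $ 1 $ 1 = A $ 1 $ 1 * (B::'k::semiring_1^1^1) $ 1 $ 1"
  by (simp add: matrix_matrix_mult_def)

lemma matrix_1_vec_mult [simp]: "(A *v v) $ 1 = A $ 1 $ 1 * (v::'k::semiring_1^1) $ 1"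
  by (simp add: matrix_vector_mult_def)

lemma mat_1_nth [simp]: "(mat c :: 'k::zero^1^1) $ 1 $ 1 = c"
  by (simp add: mat_def)

lemma invertible_1_iff: "invertible (A::'k::field^1^1) \<longleftrightarrow> A $ 1 $ 1 \<noteq> 0"
proof
  assume "invertible A"
  then obtain B where "A ** B = mat 1" by (auto simp: invertible_def)
  then have "A $ 1 $ 1 * B $ 1 $ 1 = 1" by (metis matrix_1_mult mat_1_nth)
  then show "A $ 1 $ 1 \<noteq> 0" by auto
next
  assume "A $ 1 $ 1 \<noteq> 0"
  then have "A ** mat (1 / A $ 1 $ 1) = mat 1" by (simp add: matrix_1_eq_iff)
  then show "invertible A" by (rule matrix_inv_unique)
qed

lemma matrix_inv_1 [simp]:
  fixes A :: "'k::field^1^1"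
  assumes "A $ 1 $ 1 \<noteq> 0"
  shows "matrix_inv A $ 1 $ 1 = 1 / A $ 1 $ 1"
proof -
  have "A ** mat (1 / A $ 1 $ 1) = mat 1" using assms by (simp add: matrix_1_eq_iff)
  then show ?thesis using matrix_inv_unique(1) by fastforce
qed

section \<open>One-dimensional Hermitian spaces\<close>

context unramified_quadratic
begin

text \<open>The value of the form on the standard basis vector, seen in the base field. Its class
  modulo norms is the isometry class.\<close>

definition coef :: "('e, 1) form \<Rightarrow> 'f" where
  "coef h = (THE c. \<iota> c = h (vec 1) (vec 1))"

lemma hermitian_1:
  assumes "hermitian_form \<sigma> h"
  shows "coef h \<noteq> 0" "h u v = \<iota> (coef h) * u $ 1 * \<sigma> (v $ 1)"
proof -
  let ?e = "vec 1 :: 'e^1"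
  have lin: "h (c *s u) v = c * h u v" and sym: "h v u = \<sigma> (h u v)" for c u v
    using assms unfolding hermitian_form_def by blast+
  have e: "u = u $ 1 *s ?e" for u :: "'e^1" by (simp add: vec_eq_iff)
  have form: "h u v = h ?e ?e * u $ 1 * \<sigma> (v $ 1)" for u v
  proof -
    have "h u v = h (u $ 1 *s ?e) v" by (rule arg_cong[OF e, of "\<lambda>u. h u v"])
    also have "\<dots> = u $ 1 * h ?e v" by (rule lin)
    also have "h ?e v = \<sigma> (h v ?e)" by (rule sym)
    also have "h v ?e = h (v $ 1 *s ?e) ?e" by (rule arg_cong[OF e, of "\<lambda>v. h v ?e"])
    also have "\<dots> = v $ 1 * h ?e ?e" by (rule lin)
    also have "\<sigma> (v $ 1 * h ?e ?e) = \<sigma> (v $ 1) * h ?e ?e" using sym[of ?e ?e, symmetric] by simp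
    finally show ?thesis by (simp add: ac_simps)
  qed
  obtain c where c: "h ?e ?e = \<iota> c" using fixed_iff[of "h ?e ?e"] sym[of ?e ?e] by auto
  have co: "coef h = c" unfolding coef_def c by (rule the_equality) simp_all
  show hc: "h u v = \<iota> (coef h) * u $ 1 * \<sigma> (v $ 1)" for u v unfolding co c[symmetric] by (rule form)
  show "coef h \<noteq> 0"
  proof
    assume c0: "coef h = 0"
    have "h ?e v = 0" for v
    proof -
      have "h ?e v = \<iota> (coef h) * (?e $ 1 * \<sigma> (v $ 1))" by (rule trans[OF hc mult.assoc])
      also have "\<dots> = 0" unfolding c0 \<iota>_simps(2) by (rule mult_zero_left)
      finally show ?thesis .
    qed
    then have "\<forall>v. h ?e v = 0" by (rule allI)
    with assms[unfolded hermitian_form_def, THEN conjunct2, THEN conjunct2, THEN conjunct2, THEN spec]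
    have "?e = 0" by (rule mp)
    then show False by (simp add: vec_eq_iff)
  qed
qed

text \<open>An isometry is multiplication by a scalar \<open>z\<close>, which changes the
  coefficient by \<open>N z\<close>; by \<open>norm_iff_even\<close> only the parity of the
  valuation survives.\<close>

lemma isometric_1:
  assumes "hermitian_form \<sigma> h" "hermitian_form \<sigma> h'"
  shows "isometric h h' \<longleftrightarrow> even (vl (coef h)) = even (vl (coef h'))"
proof -
  note h = hermitian_1[OF assms(1)] and h' = hermitian_1[OF assms(2)]
  have "isometric h h' \<longleftrightarrow> (\<exists>z. z \<noteq> 0 \<and> \<iota> (coef h') * N z = \<iota> (coef h))"
  proof
    assume "isometric h h'"
    then obtain g :: "'e^1^1" where g: "invertible g" "\<And>u v. h' (g *v u) (g *v v) = h u v"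
      by (auto simp: isometric_def)
    have "\<iota> (coef h') * N (g $ 1 $ 1) = \<iota> (coef h)"
      using g(2)[of "vec 1" "vec 1"] by (simp add: h(2) h'(2) mult.assoc)
    then show "\<exists>z. z \<noteq> 0 \<and> \<iota> (coef h') * N z = \<iota> (coef h)" using g(1) invertible_1_iff by blast
  next
    assume "\<exists>z. z \<noteq> 0 \<and> \<iota> (coef h') * N z = \<iota> (coef h)"
    then obtain z where z: "z \<noteq> 0" "\<iota> (coef h') * N z = \<iota> (coef h)" by blast
    have "h' ((mat z :: 'e^1^1) *v u) (mat z *v v) = h u v" for u v
    proof -
      have "h' ((mat z :: 'e^1^1) *v u) (mat z *v v) = \<iota> (coef h') * N z * u $ 1 * \<sigma> (v $ 1)"
        by (simp add: h'(2))
      then show ?thesis by (simp only: z(2) h(2))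
    qed
    then show "isometric h h'" using z(1) by (auto simp: isometric_def invertible_1_iff intro!: exI[of _ "mat z"])
  qed
  also have "\<dots> \<longleftrightarrow> (\<exists>z. z \<noteq> 0 \<and> \<iota> (coef h / coef h') = N z)"
    using h' by (auto simp: field_simps)
  also have "\<dots> \<longleftrightarrow> even (vl (coef h / coef h'))" using h h' by (intro norm_iff_even) auto
  also have "\<dots> \<longleftrightarrow> even (vl (coef h)) = even (vl (coef h'))" using h h' by (simp add: vl_divide)
  finally show ?thesis .
qed

lemma lattice_1:
  fixes \<Lambda> :: "('e^1) set"
  assumes "is_lattice \<Lambda>"
  shows "\<exists>z::'e. z \<noteq> 0 \<and> \<Lambda> = {u. nabs (u $ 1) \<le> nabs z}"
proof -
  obtain g :: "'e^1^1" where g: "invertible g" "\<Lambda> = (\<lambda>u. g *v u) ` {u. \<forall>i. u $ i \<in> integer_ring}"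
    using assms by (auto simp: is_lattice_def)
  let ?z = "g $ 1 $ 1"
  have z: "?z \<noteq> 0" using g(1) invertible_1_iff by blast
  have "\<Lambda> = {u. nabs (u $ 1) \<le> nabs ?z}"
  proof (intro equalityI subsetI)
    fix u :: "'e^1" assume "u \<in> \<Lambda>"
    then show "u \<in> {u. nabs (u $ 1) \<le> nabs ?z}" by (auto simp: g(2) integer_ring_def nabs_mult mult_left_le)
  next
    fix u :: "'e^1" assume u: "u \<in> {u. nabs (u $ 1) \<le> nabs ?z}"
    then show "u \<in> \<Lambda>" unfolding g(2) using z
      by (intro image_eqI[of _ _ "vec (u $ 1 / ?z)"]) (auto simp: vec_eq_iff integer_ring_def nabs_divide)
  qed
  then show ?thesis using z by blast
qed

text \<open>Every lattice is a ball, and with \<open>c\<close> the coefficient the dual of the ball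
  of radius \<open>nabs z\<close> has radius \<open>1 / (nabs (\<iota> c) * nabs z)\<close>. So
  self-duality means that \<open>\<iota> c * z * z\<close> is a unit.\<close>

lemma split_1:
  assumes "hermitian_form \<sigma> h"
  shows "split_form h \<longleftrightarrow> even (vl (coef h))"
proof -
  note h = hermitian_1[OF assms]
  \<comment> \<open>On a line the maximal isotropic dimension \<open>1 div 2\<close> is 0.\<close>
  have W: "\<exists>W. vec.subspace W \<and> (\<forall>u\<in>W. \<forall>v\<in>W. h u v = 0) \<and> vec.dim W = CARD(1) div 2"
    by (rule exI[of _ "{0}"]) (auto simp: h(2) vec.subspace_def)
  have d: "(\<forall>u. nabs (u $ 1) \<le> nabs z \<longrightarrow> nabs (h v u) \<le> 1) \<longleftrightarrow> nabs (\<iota> (coef h)) * nabs (v $ 1) * nabs z \<le> 1" for z :: 'e and v :: "'e^1"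
  proof
    assume a: "\<forall>u. nabs (u $ 1) \<le> nabs z \<longrightarrow> nabs (h v u) \<le> 1"
    show "nabs (\<iota> (coef h)) * nabs (v $ 1) * nabs z \<le> 1"
      using a[rule_format, of "vec z"] by (simp add: h(2) nabs_mult)
  next
    assume a: "nabs (\<iota> (coef h)) * nabs (v $ 1) * nabs z \<le> 1"
    show "\<forall>u. nabs (u $ 1) \<le> nabs z \<longrightarrow> nabs (h v u) \<le> 1"
    proof (intro allI impI)
      fix u :: "'e^1" assume "nabs (u $ 1) \<le> nabs z"
      then have "nabs (\<iota> (coef h)) * nabs (v $ 1) * nabs (u $ 1) \<le> nabs (\<iota> (coef h)) * nabs (v $ 1) * nabs z"
        by (intro mult_left_mono) auto
      then show "nabs (h v u) \<le> 1" using a by (simp add: h(2) nabs_mult)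
    qed
  qed
  have "(\<exists>\<Lambda>. self_dual_lattice h \<Lambda>) \<longleftrightarrow> even (vl (coef h))"
  proof
    assume "\<exists>\<Lambda>. self_dual_lattice h \<Lambda>"
    then obtain \<Lambda> where L: "is_lattice \<Lambda>" "\<Lambda> = {v. \<forall>u\<in>\<Lambda>. h v u \<in> integer_ring}" by (auto simp: self_dual_lattice_def)
    obtain z :: 'e where z: "z \<noteq> 0" "\<Lambda> = {u. nabs (u $ 1) \<le> nabs z}" using lattice_1[OF L(1)] by blast
    have eq: "nabs (v $ 1) \<le> nabs z \<longleftrightarrow> nabs (\<iota> (coef h)) * nabs (v $ 1) * nabs z \<le> 1" for v :: "'e^1"
    proof -
      have "v \<in> \<Lambda> \<longleftrightarrow> (\<forall>u\<in>\<Lambda>. h v u \<in> integer_ring)" using L(2) by blast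
      then show ?thesis using d[of z v] by (simp add: z(2) integer_ring_def)
    qed
    let ?c = "nabs (\<iota> (coef h))"
    have c0: "?c > 0" using h by simp
    have "?c * nabs z * nabs z \<le> 1" using eq[of "vec z"] by simp
    moreover have "?c * nabs z * nabs z \<ge> 1"
    proof -
      \<comment> \<open>A scalar on the boundary of the dual lattice; self-duality forces it into
        the lattice and thereby bounds \<open>z\<close> from below.\<close>
      let ?w = "1 / (\<iota> (coef h) * z)"
      have "nabs ?w \<le> nabs z" using eq[of "vec ?w"] z(1) h by (simp add: nabs_divide nabs_mult)
      then show ?thesis using z(1) h by (simp add: nabs_divide nabs_mult divide_le_eq ac_simps)
    qed
    ultimately have "nabs (\<iota> (coef h) * z * z) = 1" by (simp add: nabs_mult)
    then have "vl (\<iota> (coef h) * z * z) = 0" by (intro vl_eqI) simp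
    then have "vl (coef h) = - 2 * vl z" using z(1) h by (simp add: vl_mult)
    then show "even (vl (coef h))" by simp
  next
    assume "even (vl (coef h))"
    then obtain k where k: "vl (coef h) = 2 * k" by auto
    obtain p :: 'e where p: "uniformizer p" using ex_uniformizer by blast
    define z where "z = p powi (- k)"
    have p0: "p \<noteq> 0" using p by (simp add: uniformizer_def)
    have z0: "z \<noteq> 0" using p0 by (simp add: z_def)
    have nz: "nabs z = rad TYPE('e) powi (- k)" using p by (simp add: z_def nabs_power_int uniformizer_nabs)
    have nc: "nabs (\<iota> (coef h)) = rad TYPE('e) powi (2 * k)" using h k by (simp add: nabs_\<iota>)
    have "nabs (\<iota> (coef h)) * nabs z * nabs z = rad TYPE('e) powi (2 * k + - k + - k)"
      unfolding nz nc by (subst power_int_add, simp)+ simp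
    then have cz: "nabs (\<iota> (coef h)) * nabs z * nabs z = 1" by simp
    let ?L = "{u::'e^1. nabs (u $ 1) \<le> nabs z}"
    have "is_lattice ?L" unfolding is_lattice_def
    proof (intro exI[of _ "mat z"] conjI)
      show "invertible (mat z :: 'e^1^1)" using z0 by (simp add: invertible_1_iff)
      show "?L = (\<lambda>u. mat z *v u) ` {u. \<forall>i. u $ i \<in> integer_ring}"
      proof (intro equalityI subsetI)
        fix u assume "u \<in> ?L"
        then show "u \<in> (\<lambda>u. mat z *v u) ` {u. \<forall>i. u $ i \<in> integer_ring}" using z0
          by (intro image_eqI[of _ _ "vec (u $ 1 / z)"]) (auto simp: vec_eq_iff integer_ring_def nabs_divide)
      qed (auto simp: integer_ring_def nabs_mult mult_left_le)
    qed
    moreover have "?L = {v. \<forall>u\<in>?L. h v u \<in> integer_ring}"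
    proof -
      have "nabs (v $ 1) \<le> nabs z \<longleftrightarrow> nabs (\<iota> (coef h)) * nabs (v $ 1) * nabs z \<le> 1" for v :: "'e^1"
      proof -
        have "nabs (\<iota> (coef h)) * nabs (v $ 1) * nabs z \<le> nabs (\<iota> (coef h)) * nabs z * nabs z
          \<longleftrightarrow> nabs (v $ 1) \<le> nabs z" using z0 h by simp
        then show ?thesis by (simp only: cz)
      qed
      then show ?thesis using d[of z] by (simp add: integer_ring_def)
    qed
    ultimately show "\<exists>\<Lambda>. self_dual_lattice h \<Lambda>" by (auto simp: self_dual_lattice_def)
  qed
  then show ?thesis using W by (simp add: split_form_def)
qed

lemma hermitian_1_ex:
  assumes "c \<noteq> 0"
  shows "\<exists>h. hermitian_form \<sigma> h \<and> coef h = c"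
proof -
  let ?h = "\<lambda>u v :: 'e^1. \<iota> c * u $ 1 * \<sigma> (v $ 1)"
  have nd: "u = 0" if "\<forall>v. ?h u v = 0" for u :: "'e^1"
  proof -
    have "u $ i = 0" for i
    proof -
      have "u $ i = u $ 1" by (rule arg_cong[OF num1_eq1])
      also have "\<dots> = 0" using that[rule_format, of "vec 1"] assms by simp
      finally show ?thesis .
    qed
    then show ?thesis by (simp add: vec_eq_iff)
  qed
  have h: "hermitian_form \<sigma> ?h"
    unfolding hermitian_form_def using nd by (auto simp: algebra_simps)
  have "coef ?h = c" unfolding coef_def by (rule the_equality) auto
  then show ?thesis using h by blast
qed

text \<open>A uniformizer as coefficient realizes the class of odd parity; together with the even
  class of \<open>h1\<close> it exhausts the representatives.\<close>

lemma form_reps_1: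
  assumes "form_reps \<sigma> R" "h1 \<in> R" "split_form h1"
  shows "card R = 2" "\<And>\<alpha>. \<alpha> \<in> R \<Longrightarrow> split_form \<alpha> \<longleftrightarrow> \<alpha> = h1"
    "\<And>\<alpha>. \<alpha> \<in> R \<Longrightarrow> even (vl (coef \<alpha>)) \<longleftrightarrow> \<alpha> = h1"
proof -
  have herm: "hermitian_form \<sigma> \<alpha>" if "\<alpha> \<in> R" for \<alpha> using assms that by (auto simp: form_reps_def)
  have uniq: "\<alpha> = \<beta>" if "\<alpha> \<in> R" "\<beta> \<in> R" "even (vl (coef \<alpha>)) = even (vl (coef \<beta>))" for \<alpha> \<beta>
  proof -
    have "\<exists>!\<gamma>. \<gamma> \<in> R \<and> isometric \<alpha> \<gamma>" using assms(1) herm[OF that(1)] by (auto simp: form_reps_def)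
    moreover have "isometric \<alpha> \<alpha>" "isometric \<alpha> \<beta>" using herm that by (simp_all add: isometric_1)
    ultimately show ?thesis using that by blast
  qed
  have e1: "even (vl (coef h1))" using assms split_1[OF herm] by blast
  show ev: "even (vl (coef \<alpha>)) \<longleftrightarrow> \<alpha> = h1" if "\<alpha> \<in> R" for \<alpha>
    using uniq[OF that assms(2)] e1 by auto
  show "split_form \<alpha> \<longleftrightarrow> \<alpha> = h1" if "\<alpha> \<in> R" for \<alpha>
    using ev[OF that] split_1[OF herm[OF that]] by simp
  obtain \<pi> :: 'f where \<pi>: "uniformizer \<pi>" using ex_uniformizer by blast
  then obtain h where h: "hermitian_form \<sigma> h" "coef h = \<pi>" using hermitian_1_ex[of \<pi>] by (auto simp: uniformizer_def)
  then obtain \<alpha> where \<alpha>: "\<alpha> \<in> R" "isometric h \<alpha>" using assms(1) unfolding form_reps_def by blast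
  have odd: "odd (vl (coef \<alpha>))" using \<alpha> h isometric_1[OF h(1) herm[OF \<alpha>(1)]] vl_uniformizer[OF \<pi>] by simp
  then have ne: "\<alpha> \<noteq> h1" using e1 by auto
  have "R = {h1, \<alpha>}"
  proof (intro equalityI subsetI)
    fix \<beta> assume b: "\<beta> \<in> R"
    then show "\<beta> \<in> {h1, \<alpha>}" using uniq[OF b \<alpha>(1)] ev[OF b] odd by auto
  qed (use assms \<alpha> in auto)
  then show "card R = 2" using ne by simp
qed

lemma herm_adj_1:
  assumes "hermitian_form \<sigma> h" "hermitian_form \<sigma> h'"
  shows "herm_adj h h' x = mat (\<iota> (coef h / coef h') * \<sigma> (x $ 1 $ 1))"
proof -
  note h = hermitian_1[OF assms(1)] and h' = hermitian_1[OF assms(2)]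
  let ?Y = "mat (\<iota> (coef h / coef h') * \<sigma> (x $ 1 $ 1)) :: 'e^1^1"
  show ?thesis unfolding herm_adj_def
  proof (rule the_equality)
    show "\<forall>u v. h (x *v u) v = h' u (?Y *v v)" using h'(1) by (simp add: h(2) h'(2))
    fix Y assume "\<forall>u v. h (x *v u) v = h' u (Y *v v)"
    from this[rule_format, of "vec 1" "vec 1"]
    have "\<iota> (coef h) * x $ 1 $ 1 = \<iota> (coef h') * \<sigma> (Y $ 1 $ 1)" by (simp add: h(2) h'(2))
    then have "\<sigma> (\<iota> (coef h) * x $ 1 $ 1) = \<sigma> (\<iota> (coef h') * \<sigma> (Y $ 1 $ 1))" by simp
    then have "Y $ 1 $ 1 = \<iota> (coef h / coef h') * \<sigma> (x $ 1 $ 1)" using h'(1) by (simp add: field_simps)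
    then show "Y = ?Y" by (simp add: matrix_1_eq_iff)
  qed
qed

lemma contraction_1:
  assumes "hermitian_form \<sigma> h" "hermitian_form \<sigma> h'"
  shows "contraction h h' x = mat (\<iota> (herm_scalar \<iota> (contraction h h' x)))"
    "\<iota> (herm_scalar \<iota> (contraction h h' x)) = - \<iota> (coef h / coef h') * N (x $ 1 $ 1)"
proof -
  have c: "contraction h h' x = mat (- \<iota> (coef h / coef h') * N (x $ 1 $ 1))"
    unfolding contraction_def herm_adj_1[OF assms] by (simp add: matrix_1_eq_iff)
  obtain n where n: "N (x $ 1 $ 1) = \<iota> n" using N_in_F by blast
  let ?a = "- (coef h / coef h') * n"
  have ia: "\<iota> ?a = - \<iota> (coef h / coef h') * N (x $ 1 $ 1)" by (simp add: n)
  have hs: "herm_scalar \<iota> (contraction h h' x) = ?a" unfolding herm_scalar_def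
  proof (rule the_equality)
    show ca: "contraction h h' x = mat (\<iota> ?a)" unfolding c ia ..
    fix a assume "contraction h h' x = mat (\<iota> a)"
    then have "mat (\<iota> a) = (mat (\<iota> ?a) :: 'e^1^1)" using ca by simp
    then have "\<iota> a = \<iota> ?a" by (metis mat_1_nth)
    then show "a = ?a" by (simp only: \<iota>_simps(12))
  qed
  show "contraction h h' x = mat (\<iota> (herm_scalar \<iota> (contraction h h' x)))"
    unfolding hs unfolding c ia ..
  show "\<iota> (herm_scalar \<iota> (contraction h h' x)) = - \<iota> (coef h / coef h') * N (x $ 1 $ 1)"
    unfolding hs by (rule ia)
qed

text \<open>Norms have even valuation, so the parity of this scalar compares the classes of the two
  forms: it is even exactly when they are isometric.\<close>

lemma vl_herm_scalar:
  assumes "hermitian_form \<sigma> h" "hermitian_form \<sigma> h'" "x \<noteq> 0"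
  shows "herm_scalar \<iota> (contraction h h' x) \<noteq> 0"
    "vl (herm_scalar \<iota> (contraction h h' x)) = vl (coef h) - vl (coef h') + 2 * vl (x $ 1 $ 1)"
proof -
  note h = hermitian_1(1)[OF assms(1)] and h' = hermitian_1(1)[OF assms(2)]
  have x0: "x $ 1 $ 1 \<noteq> 0" using assms(3) by (simp add: matrix_1_eq_iff)
  let ?d = "herm_scalar \<iota> (contraction h h' x)"
  have e: "\<iota> ?d = - \<iota> (coef h / coef h') * N (x $ 1 $ 1)" by (rule contraction_1(2)[OF assms(1,2)])
  then show d0: "?d \<noteq> 0" using h h' x0 by (metis \<iota>_simps(11) divide_eq_0_iff mult_eq_0_iff neg_equal_0_iff_equal \<sigma>_simps(11))
  have "vl ?d = vl (\<iota> ?d)" using d0 by simp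
  also have "\<dots> = vl (\<iota> (coef h / coef h')) + vl (N (x $ 1 $ 1))"
  proof -
    have "\<iota> (coef h / coef h') \<noteq> 0" "N (x $ 1 $ 1) \<noteq> 0" using h h' x0 by auto
    then show ?thesis unfolding e mult_minus_left vl_minus by (rule vl_mult)
  qed
  also have "vl (\<iota> (coef h / coef h')) = vl (coef h) - vl (coef h')" using h h' by (subst vl_\<iota>) (auto simp: vl_divide)
  finally show "vl ?d = vl (coef h) - vl (coef h') + 2 * vl (x $ 1 $ 1)" using vl_N[OF x0] by simp
qed

section \<open>Unitary groups, compactness and stabilizers\<close>

lemma unitary_1:
  fixes h :: "('e, 1) form"
  assumes "hermitian_form \<sigma> h"
  shows "carrier (unitary_group h) = {g. g $ 1 $ 1 \<in> U1}"
proof -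
  note h = hermitian_1[OF assms]
  have "(\<forall>u v. h (g *v u) (g *v v) = h u v) \<longleftrightarrow> g $ 1 $ 1 \<in> U1" for g :: "'e^1^1"
  proof
    assume "\<forall>u v. h (g *v u) (g *v v) = h u v"
    from this[rule_format, of "vec 1" "vec 1"] show "g $ 1 $ 1 \<in> U1" using h(1) by (simp add: h(2) U1_def mult.assoc)
  next
    assume "g $ 1 $ 1 \<in> U1"
    then have n: "N (g $ 1 $ 1) = 1" by (simp add: U1_def)
    have "h (g *v u) (g *v v) = \<iota> (coef h) * u $ 1 * \<sigma> (v $ 1) * N (g $ 1 $ 1)" for u v
      by (simp add: h(2))
    then show "\<forall>u v. h (g *v u) (g *v v) = h u v" unfolding n by (simp add: h(2))
  qed
  then show ?thesis by (auto simp: unitary_group_def invertible_1_iff U1_def)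
qed

lemma unitary_group_simps [simp]:
  "mult (unitary_group h) = (**)" "one (unitary_group h) = mat 1"
  by (simp_all add: unitary_group_def)

lemma group_unitary: "group (unitary_group (h::('e, 'n::finite) form))"
proof (rule groupI)
  fix g assume "g \<in> carrier (unitary_group h)"
  then have g: "invertible g" "\<And>u v. h (g *v u) (g *v v) = h u v" by (auto simp: unitary_group_def)
  have "h (matrix_inv g *v u) (matrix_inv g *v v) = h u v" for u v
    using g(2)[of "matrix_inv g *v u" "matrix_inv g *v v"]
    by (simp add: matrix_vector_mul_assoc matrix_inv_right[OF g(1)])
  then have "matrix_inv g \<in> carrier (unitary_group h)"
    using invertible_matrix_inv[OF g(1)] by (simp add: unitary_group_def)
  then show "\<exists>y\<in>carrier (unitary_group h). y \<otimes>\<^bsub>unitary_group h\<^esub> g = \<one>\<^bsub>unitary_group h\<^esub>"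
    using matrix_inv_left[OF g(1)] by auto
qed (auto simp: unitary_group_def matrix_mul_assoc invertible_mult simp flip: matrix_vector_mul_assoc)

lemma inv_unitary:
  fixes h :: "('e, 'n::finite) form"
  assumes "g \<in> carrier (unitary_group h)"
  shows "inv\<^bsub>unitary_group h\<^esub> g = matrix_inv g"
proof -
  interpret group "unitary_group h" by (rule group_unitary)
  have g: "invertible g" using assms by (simp add: unitary_group_def)
  have "g ** inv\<^bsub>unitary_group h\<^esub> g = mat 1" using r_inv[OF assms] by simp
  then show ?thesis using matrix_inv_unique by metis
qed

lemma continuous_unitary:
  "continuous_on (carrier (unitary_group (h::('e, 'n::finite) form)) \<times> carrier (unitary_group h))
    (\<lambda>(x, y). x \<otimes>\<^bsub>unitary_group h\<^esub> y)"
  by (simp add: case_prod_beta') (intro continuous_intros)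

lemma dist_\<sigma>: "dist (\<sigma> x) (\<sigma> y) = dist x y"
  by (simp add: dist_eq_nabs flip: \<sigma>_simps(6))

lemma continuous_on_\<sigma>: "continuous_on A \<sigma>"
  unfolding continuous_on_iff dist_\<sigma> by blast

lemma compact_U1: "compact U1"
proof -
  have "closed {u. N u = 1}"
    by (intro closed_Collect_eq continuous_on_mult' continuous_on_id continuous_on_const continuous_on_\<sigma>)
  moreover have "U1 \<subseteq> {u. nabs u \<le> 1}" using nabs_U1 by auto
  ultimately show ?thesis using compact_nabs_ball[where 'k='e, of 1]
    by (metis (no_types, lifting) U1_def compact_Int_closed inf.absorb_iff2)
qed

lemma compact_unitary_1:
  fixes h :: "('e, 1) form"
  assumes "hermitian_form \<sigma> h"
  shows "compact (carrier (unitary_group h))"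
proof -
  have "compact ((\<lambda>u. mat u :: 'e^1^1) ` U1)"
  proof (rule compact_continuous_image[OF _ compact_U1])
    show "continuous_on U1 (\<lambda>u. mat u :: 'e^1^1)"
      unfolding mat_def
    proof (intro continuous_on_vec_lambda)
      fix i j :: 1
      show "continuous_on U1 (\<lambda>u::'e. if i = j then u else 0)" by (cases "i = j") auto
    qed
  qed
  moreover have "carrier (unitary_group h) = (\<lambda>u. mat u :: 'e^1^1) ` U1"
    unfolding unitary_1[OF assms]
    by (auto simp: matrix_1_eq_iff intro!: image_eqI[of _ _ "_ $ 1 $ 1"])
  ultimately show ?thesis by simp
qed

end

lemma pair_act_mult:
  assumes "invertible h" "invertible h'"
  shows "pair_act (g ** g', h ** h') x = pair_act (g, h) (pair_act (g', h') x)"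
  using assms by (simp add: pair_act_def matrix_inv_mult matrix_mul_assoc)

lemma matrix_inv_mat_1 [simp]: "matrix_inv (mat 1) = (mat 1 :: 'k::field^'n::finite^'n)"
  by (rule matrix_inv_unique) simp

lemma pair_act_one: "pair_act (mat 1, mat 1) x = x"
  by (simp add: pair_act_def)

lemma group_stabilizer:
  assumes "group G"
    and act: "\<And>g h. g \<in> carrier G \<Longrightarrow> h \<in> carrier G \<Longrightarrow> act (g \<otimes>\<^bsub>G\<^esub> h) x = act g (act h x)" "act \<one>\<^bsub>G\<^esub> x = x"
  shows "group (stabilizer_group G act x)"
proof -
  interpret group G by fact
  have invact: "act (inv\<^bsub>G\<^esub> g) x = x" if "g \<in> carrier G" "act g x = x" for g
    using act(1)[of "inv\<^bsub>G\<^esub> g" g] act(2) that by simp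
  have "subgroup {g \<in> carrier G. act g x = x} G"
    by (rule subgroupI) (use act invact in auto)
  then show ?thesis unfolding stabilizer_group_def by (rule subgroup.subgroup_is_group[OF _ group_axioms])
qed

lemma stabilizer_group_simps [simp]:
  "carrier (stabilizer_group G act x) = {g \<in> carrier G. act g x = x}"
  "mult (stabilizer_group G act x) = mult G" "one (stabilizer_group G act x) = one G"
  by (simp_all add: stabilizer_group_def)

lemma emeasure_pair_one:
  assumes "haar_group G1 \<mu>1" "haar_group G2 \<mu>2" "emeasure \<mu>1 (carrier G1) = 1" "emeasure \<mu>2 (carrier G2) = 1"
  shows "emeasure (\<mu>1 \<Otimes>\<^sub>M \<mu>2) (carrier (G1 \<times>\<times> G2)) = 1"
proof -
  interpret A: haar_group G1 \<mu>1 by fact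
  interpret B: haar_group G2 \<mu>2 by fact
  have "emeasure (\<mu>1 \<Otimes>\<^sub>M \<mu>2) (space \<mu>1 \<times> space \<mu>2) = emeasure \<mu>1 (space \<mu>1) * emeasure \<mu>2 (space \<mu>2)"
    by (rule B.emeasure_pair_measure_Times) auto
  then show ?thesis using assms by (simp add: A.space_haar B.space_haar)
qed

lemma SRO_zero: "SRO h \<alpha> \<beta> x (\<lambda>_. 0) = 0"
  by (simp add: SRO_def orbital_integral_def)

section \<open>Orbital integrals on the endoscopic space\<close>

context unramified_quadratic
begin

lemma norm_eq_unit:
  assumes "x \<noteq> 0" "N y = N x"
  shows "y / x \<in> U1"
proof -
  have "N (y / x) = N y / N x" by simp
  then show ?thesis using assms by (simp add: U1_def)
qed

text \<open>A 1 by 1 matrix is unchanged by conjugation, so geometric conjugacy already forces equal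
  norms.\<close>

lemma stable_orbit_1:
  fixes x x' :: "'e^1^1"
  assumes h: "hermitian_form \<sigma> h" and x: "x \<noteq> 0" "x' \<in> stable_orbit h h x"
  shows "\<exists>u\<in>U1. x' = mat u ** x"
proof -
  have x0: "x $ 1 $ 1 \<noteq> 0" using x by (simp add: matrix_1_eq_iff)
  have c0: "coef h \<noteq> 0" using hermitian_1[OF h] by simp
  obtain g :: "'e alg_closure^1^1" where g: "invertible g" "map_matrix to_ac (x' ** herm_adj h h x')
    = g ** map_matrix to_ac (x ** herm_adj h h x) ** matrix_inv g"
    using stable_orbit_conj[OF x(2)] by blast
  have "to_ac ((x' ** herm_adj h h x') $ 1 $ 1) = to_ac ((x ** herm_adj h h x) $ 1 $ 1)"
    using arg_cong[OF g(2), of "\<lambda>A. A $ 1 $ 1"] g(1) by (simp add: invertible_1_iff)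
  then have "N (x' $ 1 $ 1) = N (x $ 1 $ 1)" using c0 by (simp add: herm_adj_1[OF h h] del: to_ac_mult)
  then have "x' $ 1 $ 1 / x $ 1 $ 1 \<in> U1" using x0 norm_eq_unit by blast
  moreover have "x' = mat (x' $ 1 $ 1 / x $ 1 $ 1) ** x" using x0 by (simp add: matrix_1_eq_iff)
  ultimately show ?thesis by blast
qed

lemma self_stable_orbit: "x \<in> stable_orbit h h' x"
  by (auto simp: stable_orbit_def geom_orbit_def intro!: exI[of _ "mat 1"])

text \<open>The endoscopic group is compact of volume one and \<open>f\<close> is constant on
  orbits, so the orbital integral is a value of \<open>f\<close>; moreover the stable orbit is a
  single rational orbit.\<close>

lemma SRO_split:
  fixes f :: "('e^1^1) \<times> ('e^1^1) \<Rightarrow> complex"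
  assumes h: "hermitian_form \<sigma> h"
    and ex: "\<exists>\<nu>. haar_measure (unitary_group h) \<nu> \<and> emeasure \<nu> (carrier (unitary_group h)) = 1"
    and x: "xa \<noteq> 0" "xb \<noteq> 0"
    and f: "\<And>a b u v. u \<in> U1 \<Longrightarrow> v \<in> U1 \<Longrightarrow> f (mat u ** a, mat v ** b) = f (a, b)"
  shows "SRO h h h (xa, xb) f = f (xa, xb)"
proof -
  let ?U = "unitary_group h"
  let ?T = "torus_haar ?U"
  let ?G = "endo_group h h h"
  have UT: "haar_group ?U ?T" "emeasure ?T (carrier ?U) = 1"
    using torus_haar_compact[OF group_unitary compact_unitary_1[OF h] ex continuous_unitary] by auto
  have UU: "haar_group (?U \<times>\<times> ?U) (?T \<Otimes>\<^sub>M ?T)" "emeasure (?T \<Otimes>\<^sub>M ?T) (carrier (?U \<times>\<times> ?U)) = 1"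
    using haar_group_pair[OF UT(1) UT(1)] emeasure_pair_one[OF UT(1) UT(1) UT(2) UT(2)] by auto
  have G: "haar_group ?G (endo_haar h h h)" "emeasure (endo_haar h h h) (carrier ?G) = 1"
    unfolding endo_group_def endo_haar_def
    using haar_group_pair[OF UU(1) UU(1)] emeasure_pair_one[OF UU(1) UU(1) UU(2) UU(2)] by auto
  interpret G: haar_group ?G "endo_haar h h h" by (rule G(1))
  have cU: "g \<in> carrier ?U \<longleftrightarrow> g $ 1 $ 1 \<in> U1" for g using unitary_1[OF h] by blast
  have inv: "invertible g" if "g \<in> carrier ?U" for g using that by (simp add: unitary_group_def)
  have cG: "carrier ?G = (carrier ?U \<times> carrier ?U) \<times> (carrier ?U \<times> carrier ?U)"
    by (simp add: endo_group_def)
  have div: "u / v \<in> U1" if "u \<in> U1" "v \<in> U1" for u v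
    using norm_eq_unit[of v u] that by (auto simp: U1_def)
  have act1: "\<exists>u\<in>U1. pair_act (g, g') a = mat u ** a" if "g \<in> carrier ?U" "g' \<in> carrier ?U" for g g' a
  proof -
    have g0: "g' $ 1 $ 1 \<noteq> 0" using inv[OF that(2)] by (simp add: invertible_1_iff)
    have "pair_act (g, g') a = mat (g $ 1 $ 1 / g' $ 1 $ 1) ** a"
      using g0 by (simp add: pair_act_def matrix_1_eq_iff)
    then show ?thesis using div that cU by blast
  qed
  have finv: "f (endo_act g y) = f y" if "g \<in> carrier ?G" for g y
  proof -
    obtain a b c d ya yb where g: "g = ((a, b), (c, d))" "y = (ya, yb)" by (metis surj_pair)
    have m: "a \<in> carrier ?U" "b \<in> carrier ?U" "c \<in> carrier ?U" "d \<in> carrier ?U"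
      using that unfolding g cG by auto
    obtain u where "u \<in> U1" "pair_act (a, b) ya = mat u ** ya" using act1[OF m(1,2)] by blast
    moreover obtain v where "v \<in> U1" "pair_act (c, d) yb = mat v ** yb" using act1[OF m(3,4)] by blast
    ultimately show ?thesis using f by (simp add: endo_act_def g)
  qed
  have actm: "endo_act (g \<otimes>\<^bsub>?G\<^esub> g') y = endo_act g (endo_act g' y)" if "g \<in> carrier ?G" "g' \<in> carrier ?G" for g g' y
    using that inv by (cases y) (auto simp: endo_group_def endo_act_def pair_act_mult)
  have act1': "endo_act \<one>\<^bsub>?G\<^esub> y = y" for y
    by (cases y) (simp add: endo_group_def endo_act_def pair_act_one)
  have oi: "orbital_integral ?G (endo_haar h h h) endo_act y f = f y" if y: "fst y \<noteq> 0" "snd y \<noteq> 0" for y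
  proof -
    obtain ya yb where yy: "y = (ya, yb)" by (metis surj_pair)
    have y0: "ya $ 1 $ 1 \<noteq> 0" "yb $ 1 $ 1 \<noteq> 0" using y yy by (simp_all add: matrix_1_eq_iff)
    \<comment> \<open>The stabilizer consists of the pairs with equal components, a copy of the
      product of two unitary groups of the line.\<close>
    let ?d = "\<lambda>p :: ('e^1^1) \<times> ('e^1^1). ((fst p, fst p), (snd p, snd p))"
    have pf: "pair_act (a, b) z = z \<longleftrightarrow> a = b" if "a \<in> carrier ?U" "b \<in> carrier ?U" "z $ 1 $ 1 \<noteq> 0" for a b z
      using inv[OF that(2)] that(3) by (auto simp: pair_act_def matrix_1_eq_iff invertible_1_iff nonzero_divide_eq_eq mult.commute)
    have st: "{g \<in> carrier ?G. endo_act g y = y} = ?d ` carrier (?U \<times>\<times> ?U)"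
      using pf y0 by (auto simp: cG endo_act_def yy image_iff)
    have comp: "compact {g \<in> carrier ?G. endo_act g y = y}"
      unfolding st using compact_unitary_1[OF h]
      by (intro compact_continuous_image continuous_intros) (auto intro: compact_Times)
    have grp: "group (stabilizer_group ?G endo_act y)"
      by (rule group_stabilizer[OF G.is_group actm act1'])
    have "\<exists>\<nu>. haar_measure (stabilizer_group ?G endo_act y) \<nu> \<and> emeasure \<nu> (carrier (stabilizer_group ?G endo_act y)) = 1"
    proof (rule haar_measure_pushforward[OF UU grp])
      show "?d \<in> hom (?U \<times>\<times> ?U) (stabilizer_group ?G endo_act y)"
        using st by (auto simp: hom_def endo_group_def)
      show "continuous_on (carrier (?U \<times>\<times> ?U)) ?d" by (intro continuous_intros)
      show "?d ` carrier (?U \<times>\<times> ?U) = carrier (stabilizer_group ?G endo_act y)" using st by simp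
      show "continuous_on (carrier (stabilizer_group ?G endo_act y) \<times> carrier (stabilizer_group ?G endo_act y))
        (\<lambda>(x, ya). x \<otimes>\<^bsub>stabilizer_group ?G endo_act y\<^esub> ya)"
        by (simp del: mult_DirProd) (rule continuous_on_subset[OF G.continuous_mult], auto)
      show "compact (carrier (stabilizer_group ?G endo_act y))" using comp by simp
    qed
    then have exn: "\<exists>\<nu>. haar_measure (stabilizer_group ?G endo_act y) \<nu> \<and> emeasure \<nu> {g \<in> carrier ?G. endo_act g y = y} = 1"
      by simp
    have comm: "g \<otimes>\<^bsub>?G\<^esub> g' = g' \<otimes>\<^bsub>?G\<^esub> g" if "g \<in> carrier ?G" "g' \<in> carrier ?G" for g g'
      using that by (auto simp: endo_group_def matrix_1_eq_iff mult.commute)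
    have fc: "f (endo_act (inv\<^bsub>?G\<^esub> g) y) = f y" if "g \<in> carrier ?G" for g
      by (rule finv) (use that in simp)
    have meas: "(\<lambda>g. f (endo_act (inv\<^bsub>?G\<^esub> g) y)) \<in> borel_measurable (endo_haar h h h)"
      by (rule measurable_cong[THEN iffD2, OF fc]) (auto simp: G.space_haar)
    have "orbital_integral ?G (endo_haar h h h) endo_act y f = (\<integral>g. f (endo_act (inv\<^bsub>?G\<^esub> g) y) \<partial>endo_haar h h h)"
      by (rule orbital_integral_eq[OF G(1) actm act1' comm comp exn meas])
    also have "\<dots> = (\<integral>g. f y \<partial>endo_haar h h h)"
      by (rule Bochner_Integration.integral_cong[OF refl], rule fc) (simp add: G.space_haar)
    also have "\<dots> = f y" using G(2) by (simp add: measure_def G.space_haar)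
    finally show ?thesis .
  qed
  let ?orb = "rational_orbit ?G endo_act"
  have self: "y \<in> ?orb y" for y
    unfolding rational_orbit_def mem_Collect_eq
    by (rule exI[of _ "\<one>\<^bsub>?G\<^esub>"], rule conjI[OF act1'[symmetric] G.one_closed])
  \<comment> \<open>By \<open>stable_orbit_1\<close> every point of the stable orbit is reached by
    norm-one scalars, which are rational group elements.\<close>
  have orbs: "?orb ` (stable_orbit h h xa \<times> stable_orbit h h xb) = {?orb (xa, xb)}"
  proof -
    have "?orb y = ?orb (xa, xb)" if y: "y \<in> stable_orbit h h xa \<times> stable_orbit h h xb" for y
    proof -
      obtain u v where uv: "u \<in> U1" "v \<in> U1" "y = (mat u ** xa, mat v ** xb)"
        using y stable_orbit_1[OF h x(1)] stable_orbit_1[OF h x(2)] by (metis mem_Times_iff surjective_pairing)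
      let ?g = "((mat u, mat 1), (mat v, mat 1)) :: (('e^1^1) \<times> ('e^1^1)) \<times> (('e^1^1) \<times> ('e^1^1))"
      have gG: "?g \<in> carrier ?G" using uv by (simp add: cG cU U1_def)
      have yg: "y = endo_act ?g (xa, xb)" by (simp add: uv(3) endo_act_def pair_act_def)
      have ig: "inv\<^bsub>?G\<^esub> ?g \<in> carrier ?G" by (rule G.inv_closed[OF gG])
      have "endo_act (inv\<^bsub>?G\<^esub> ?g) y = endo_act (inv\<^bsub>?G\<^esub> ?g \<otimes>\<^bsub>?G\<^esub> ?g) (xa, xb)"
        unfolding yg by (rule actm[OF ig gG, symmetric])
      then have xg: "(xa, xb) = endo_act (inv\<^bsub>?G\<^esub> ?g) y" by (simp only: G.l_inv[OF gG] act1')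
      show ?thesis
      proof (intro equalityI subsetI)
        fix z assume "z \<in> ?orb y"
        then obtain k where "k \<in> carrier ?G" "z = endo_act k y" unfolding rational_orbit_def by blast
        then have "z = endo_act (k \<otimes>\<^bsub>?G\<^esub> ?g) (xa, xb)" "k \<otimes>\<^bsub>?G\<^esub> ?g \<in> carrier ?G"
          using actm[OF _ gG] G.m_closed[OF _ gG] by (simp_all only: yg)
        then show "z \<in> ?orb (xa, xb)" unfolding rational_orbit_def by blast
      next
        fix z assume "z \<in> ?orb (xa, xb)"
        then obtain k where "k \<in> carrier ?G" "z = endo_act k (xa, xb)" unfolding rational_orbit_def by blast
        then have "z = endo_act (k \<otimes>\<^bsub>?G\<^esub> inv\<^bsub>?G\<^esub> ?g) y" "k \<otimes>\<^bsub>?G\<^esub> inv\<^bsub>?G\<^esub> ?g \<in> carrier ?G"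
          using actm[OF _ ig] G.m_closed[OF _ ig] by (simp_all only: xg[symmetric])
        then show "z \<in> ?orb y" unfolding rational_orbit_def by blast
      qed
    qed
    moreover have "(xa, xb) \<in> stable_orbit h h xa \<times> stable_orbit h h xb" by (simp add: self_stable_orbit)
    ultimately show ?thesis by blast
  qed
  let ?y = "SOME y. y \<in> ?orb (xa, xb)"
  have "?y \<in> ?orb (xa, xb)" using self by (metis someI)
  then obtain k where k: "k \<in> carrier ?G" "?y = endo_act k (xa, xb)" unfolding rational_orbit_def by blast
  obtain a b c d where kk: "k = ((a, b), (c, d))" by (metis surj_pair)
  have "fst ?y \<noteq> 0" "snd ?y \<noteq> 0" unfolding k(2)
    using x k(1) kk inv[of a] inv[of b] inv[of c] inv[of d]
    by (auto simp: cG endo_act_def pair_act_def matrix_1_eq_iff invertible_1_iff)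
  then have "orbital_integral ?G (endo_haar h h h) endo_act ?y f = f ?y" by (rule oi)
  also have "\<dots> = f (xa, xb)" unfolding k(2) by (rule finv[OF k(1)])
  finally show ?thesis by (simp add: SRO_def orbs)
qed

end

section \<open>Two by two matrices\<close>

definition mat2 :: "'a \<Rightarrow> 'a \<Rightarrow> 'a \<Rightarrow> 'a \<Rightarrow> 'a^2^2" where
  "mat2 a b c d = (\<chi> i j. if i = 1 then if j = 1 then a else b else if j = 1 then c else d)"

definition vec2 :: "'a \<Rightarrow> 'a \<Rightarrow> 'a^2" where
  "vec2 a b = (\<chi> i. if i = 1 then a else b)"

lemma mat2_nth [simp]:
  "mat2 a b c d $ 1 $ 1 = a" "mat2 a b c d $ 1 $ 2 = b" "mat2 a b c d $ 2 $ 1 = c" "mat2 a b c d $ 2 $ 2 = d"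
  "vec2 a b $ 1 = a" "vec2 a b $ 2 = b"
  by (simp_all add: mat2_def vec2_def)

lemma matrix_2_eq_iff: "A = B \<longleftrightarrow> A $ 1 $ 1 = B $ 1 $ 1 \<and> A $ 1 $ 2 = B $ 1 $ 2 \<and> A $ 2 $ 1 = B $ 2 $ 1
    \<and> A $ 2 $ 2 = (B :: 'a^2^2) $ 2 $ 2"
  by (auto simp: vec_eq_iff forall_2)

lemma vec_2_eq_iff: "u = v \<longleftrightarrow> u $ 1 = v $ 1 \<and> u $ 2 = (v :: 'a^2) $ 2"
  by (auto simp: vec_eq_iff forall_2)

lemma mat2_cases: obtains a b c d where "A = mat2 a b c d"
  by (rule that[of "A $ 1 $ 1" "A $ 1 $ 2" "A $ 2 $ 1" "A $ 2 $ 2"]) (simp add: matrix_2_eq_iff)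

lemma matrix_2_mult [simp]:
  "((A :: 'a::semiring_1^2^2) ** B) $ i $ j = A $ i $ 1 * B $ 1 $ j + A $ i $ 2 * B $ 2 $ j"
  by (simp add: matrix_matrix_mult_def sum_2)

lemma matrix_2_vec [simp]:
  "((A :: 'a::semiring_1^2^2) *v u) $ i = A $ i $ 1 * u $ 1 + A $ i $ 2 * u $ 2"
  by (simp add: matrix_vector_mult_def sum_2)

lemma mat_2_nth [simp]:
  "(mat c :: 'a::zero^2^2) $ 1 $ 1 = c" "(mat c :: 'a::zero^2^2) $ 1 $ 2 = 0"
  "(mat c :: 'a::zero^2^2) $ 2 $ 1 = 0" "(mat c :: 'a::zero^2^2) $ 2 $ 2 = c"
  by (simp_all add: mat_def)

lemma invertible_2_iff: "invertible (A :: 'a::field^2^2) \<longleftrightarrow> det A \<noteq> 0"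
  by (rule invertible_det_nz)

lemma continuous_on_mat2 [continuous_intros]:
  assumes "continuous_on S a" "continuous_on S b" "continuous_on S c" "continuous_on S d"
  shows "continuous_on S (\<lambda>x. mat2 (a x) (b x) (c x) (d x))"
  unfolding mat2_def
proof (intro continuous_on_vec_lambda)
  fix i j :: 2
  show "continuous_on S (\<lambda>x. if i = 1 then if j = 1 then a x else b x else if j = 1 then c x else d x)"
    by (cases "i = 1"; cases "j = 1") (simp_all add: assms)
qed

definition integral_matrices :: "('e::nonarch_local_field^2^2) set" where
  "integral_matrices = {x. \<forall>i j. nabs (x $ i $ j) \<le> 1}"

lemma integral_matrices_iff: "x \<in> integral_matrices \<longleftrightarrow> nabs (x $ 1 $ 1) \<le> 1 \<and> nabs (x $ 1 $ 2) \<le> 1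
    \<and> nabs (x $ 2 $ 1) \<le> 1 \<and> nabs (x $ 2 $ 2) \<le> 1"
  by (auto simp: integral_matrices_def forall_2)

lemma integral_matrices_mult:
  "x \<in> integral_matrices \<Longrightarrow> y \<in> integral_matrices \<Longrightarrow> x ** y \<in> integral_matrices"
  by (auto simp: integral_matrices_def nabs_mult intro!: nabs_add_le mult_le_one)

lemma compact_matrices_bounded:
  "compact {x::'e::nonarch_local_field^2^2. \<forall>i j. nabs (x $ i $ j) \<le> c}"
proof -
  let ?B = "{x::'e. nabs x \<le> c}"
  let ?f = "\<lambda>p. mat2 (fst (fst p)) (snd (fst p)) (fst (snd p)) (snd (snd p)) :: 'e^2^2"
  have "compact (?f ` ((?B \<times> ?B) \<times> (?B \<times> ?B)))"
    by (intro compact_continuous_image compact_Times compact_nabs_ball continuous_intros)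
  moreover have "{x::'e^2^2. \<forall>i j. nabs (x $ i $ j) \<le> c} = ?f ` ((?B \<times> ?B) \<times> (?B \<times> ?B))"
  proof (intro equalityI subsetI)
    fix x :: "'e^2^2" assume "x \<in> {x. \<forall>i j. nabs (x $ i $ j) \<le> c}"
    then show "x \<in> ?f ` ((?B \<times> ?B) \<times> (?B \<times> ?B))"
      by (intro image_eqI[of _ _ "((x $ 1 $ 1, x $ 1 $ 2), (x $ 2 $ 1, x $ 2 $ 2))"]) (auto simp: matrix_2_eq_iff)
  qed (auto simp: forall_2)
  ultimately show ?thesis by simp
qed

lemma closed_matrices_bounded: "closed {x::'e::nonarch_local_field^2^2. \<forall>i j. nabs (x $ i $ j) \<le> c}"
  by (rule compact_imp_closed[OF compact_matrices_bounded])

lemma compact_integral_matrices: "compact (integral_matrices :: ('e::nonarch_local_field^2^2) set)"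
  unfolding integral_matrices_def by (rule compact_matrices_bounded)

lemma open_nabs_ball: "open {x::'e::nonarch_local_field. nabs x \<le> 1}"
  unfolding open_dist
proof (intro ballI exI conjI allI impI)
  fix x y :: 'e assume "x \<in> {x. nabs x \<le> 1}" "dist y x < 1"
  then show "y \<in> {x. nabs x \<le> 1}"
    using nabs_add_le[of x 1 "y - x"] by (simp add: dist_eq_nabs)
qed simp

lemma open_integral_matrices: "open (integral_matrices :: ('e::nonarch_local_field^2^2) set)"
proof -
  have op: "open ((\<lambda>x::'e^2^2. x $ i $ j) -` {x. nabs x \<le> 1})" for i j
    by (intro open_vimage open_nabs_ball continuous_intros)
  have eq: "integral_matrices = (\<Inter>i\<in>UNIV. \<Inter>j\<in>UNIV. (\<lambda>x::'e^2^2. x $ i $ j) -` {x. nabs x \<le> 1})"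
    by (auto simp: integral_matrices_def)
  show ?thesis unfolding eq by (intro open_INT finite ballI op)
qed

section \<open>The split Hermitian plane\<close>

text \<open>Applied to the stabilizer \<open>K\<close> of the lattice, this yields a group of volume
  one whose measure can be pushed to tori.\<close>

lemma haar_group_restrict:
  fixes G :: "('g::second_countable_topology) monoid" (structure)
  assumes "haar_group G \<mu>" "subgroup K G" "K \<in> sets \<mu>"
  shows "haar_group (G\<lparr>carrier := K\<rparr>) (restrict_space \<mu> K)"
proof -
  interpret haar_group G \<mu> by fact
  let ?K = "G\<lparr>carrier := K\<rparr>"
  have Kc: "K \<subseteq> carrier G" using assms(2) by (rule subgroup.subset)
  have sp: "space (restrict_space \<mu> K) = K" using Kc by (auto simp: space_restrict_space space_haar)
  have sub: "sets (restrict_space \<mu> K) = {A. A \<subseteq> K \<and> A \<in> sets \<mu>}"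
    using assms(3) by (auto simp: sets_restrict_space_iff)
  have se: "sets (restrict_space \<mu> K) = sets (restrict_space borel (carrier ?K))"
  proof -
    have "sets (restrict_space \<mu> K) = sets (restrict_space (restrict_space borel (carrier G)) K)"
      by (rule sets_restrict_space_cong[OF sets_haar])
    also have "\<dots> = sets (restrict_space borel (carrier G \<inter> K))" by (simp add: sets_restrict_restrict_space)
    also have "carrier G \<inter> K = K" using Kc by auto
    finally show ?thesis by simp
  qed
  have er: "emeasure (restrict_space \<mu> K) B = emeasure \<mu> B" if "B \<subseteq> K" for B
    by (rule emeasure_restrict_space[OF _ that]) (use assms(3) Kc in \<open>simp add: space_haar Int_absorb2\<close>)
  have di: "distr (restrict_space \<mu> K) (restrict_space \<mu> K) (\<lambda>x. g \<otimes>\<^bsub>?K\<^esub> x) = restrict_space \<mu> K" if g: "g \<in> carrier ?K" for g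
  proof (rule measure_eqI)
    have gK: "g \<in> K" and gG: "g \<in> carrier G" using g Kc by auto
    have mt: "(\<lambda>x. g \<otimes> x) \<in> restrict_space \<mu> K \<rightarrow>\<^sub>M restrict_space \<mu> K"
      by (intro measurable_restrict_space2 measurable_restrict_space1 measurable_translate gG)
        (use gK assms(2) sp in \<open>auto intro: subgroup.m_closed\<close>)
    fix A assume "A \<in> sets (distr (restrict_space \<mu> K) (restrict_space \<mu> K) (\<lambda>x. g \<otimes>\<^bsub>?K\<^esub> x))"
    then have A: "A \<subseteq> K" "A \<in> sets \<mu>" by (simp_all add: sub)
    have im: "(\<lambda>x. g \<otimes> x) -` A \<inter> K = (\<lambda>x. inv g \<otimes> x) ` A"
    proof (intro equalityI subsetI)
      fix x assume x: "x \<in> (\<lambda>x. g \<otimes> x) -` A \<inter> K"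
      then have "x = inv g \<otimes> (g \<otimes> x)" using gG Kc by (auto simp flip: m_assoc)
      then show "x \<in> (\<lambda>x. inv g \<otimes> x) ` A" using x by blast
    next
      fix x assume "x \<in> (\<lambda>x. inv g \<otimes> x) ` A"
      then obtain y where y: "y \<in> A" "x = inv g \<otimes> y" by blast
      have yK: "y \<in> K" using y A by auto
      then have "x \<in> K" using y gK assms(2) by (simp add: subgroup.m_closed subgroup.m_inv_closed)
      moreover have "g \<otimes> x = y" unfolding y(2) using gG yK Kc by (auto simp flip: m_assoc)
      ultimately show "x \<in> (\<lambda>x. g \<otimes> x) -` A \<inter> K" using y by simp
    qed
    have "emeasure \<mu> ((\<lambda>x. inv g \<otimes> x) ` A) = emeasure \<mu> A"
      using emeasure_translate_image(3)[of "inv g" A] gG A by simp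
    then have "emeasure (restrict_space \<mu> K) ((\<lambda>x. g \<otimes> x) -` A \<inter> K) = emeasure (restrict_space \<mu> K) A"
      using er[OF A(1)] er[of "(\<lambda>x. g \<otimes> x) -` A \<inter> K"] by (simp add: im[symmetric])
    then show "emeasure (distr (restrict_space \<mu> K) (restrict_space \<mu> K) (\<lambda>x. g \<otimes>\<^bsub>?K\<^esub> x)) A = emeasure (restrict_space \<mu> K) A"
      using A by (subst emeasure_distr) (simp_all add: mt sp sub)
  qed simp
  have sf: "sigma_finite_measure (restrict_space \<mu> K)"
    by (rule sigma_finite_measure_restrict_space[OF sigma_finite_measure_axioms assms(3)])
  have co: "continuous_on (carrier ?K \<times> carrier ?K) (\<lambda>(x, y). x \<otimes>\<^bsub>?K\<^esub> y)"
    using continuous_on_subset[OF continuous_mult, of "K \<times> K"] Kc by auto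
  have gr: "group ?K" by (rule subgroup.subgroup_is_group[OF assms(2) group_axioms])
  show ?thesis
    by (intro haar_group.intro haar_group_axioms.intro gr sf se di co) (simp_all add: sp)
qed

lemma det_mat2 [simp]: "det (mat2 a b c d) = a * d - b * (c::'a::comm_ring_1)"
  by (simp add: det_2)

locale split_plane = unramified_quadratic \<iota> \<sigma>
  for \<iota> :: "'f::nonarch_local_field \<Rightarrow> 'e::nonarch_local_field" and \<sigma> :: "'e \<Rightarrow> 'e" +
  fixes h1 :: "('e, 1) form" and \<Lambda>1 :: "('e^1) set" and dg :: "('e^2^2) measure"
  assumes herm: "hermitian_form \<sigma> h1"
    and lattice: "is_lattice \<Lambda>1"
    and haar: "haar_measure (unitary_group (form_sum h1 h1)) dg"
    and vol: "emeasure dg (lattice_stabilizer (form_sum h1 h1) (lattice_sum \<Lambda>1 \<Lambda>1)) = 1"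
begin

section \<open>Adjoints, unitary matrices and the lattice stabilizer\<close>

abbreviation h2 :: "('e, 2) form" where "h2 \<equiv> form_sum h1 h1"

abbreviation U :: "('e^2^2) set" where "U \<equiv> carrier (unitary_group h2)"

text \<open>The adjoint for \<open>h2\<close> (\<open>herm_adj_2\<close>): the form is a multiple of
  the standard one by a scalar of the base field, which cancels, and what remains is the conjugate
  transpose.\<close>

definition star :: "'e^2^2 \<Rightarrow> 'e^2^2" where
  "star A = mat2 (\<sigma> (A $ 1 $ 1)) (\<sigma> (A $ 2 $ 1)) (\<sigma> (A $ 1 $ 2)) (\<sigma> (A $ 2 $ 2))"

lemma star_nth [simp]: "star A $ 1 $ 1 = \<sigma> (A $ 1 $ 1)" "star A $ 1 $ 2 = \<sigma> (A $ 2 $ 1)"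
  "star A $ 2 $ 1 = \<sigma> (A $ 1 $ 2)" "star A $ 2 $ 2 = \<sigma> (A $ 2 $ 2)"
  by (simp_all add: star_def)

lemma star_mult: "star (A ** B) = star B ** star A"
  by (simp add: matrix_2_eq_iff mult.commute)

lemma star_star [simp]: "star (star A) = A"
  by (simp add: matrix_2_eq_iff)

lemma star_mat_1 [simp]: "star (mat 1) = mat 1"
  by (simp add: matrix_2_eq_iff)

lemma det_star [simp]: "det (star A) = \<sigma> (det A)"
  by (simp add: det_2 mult.commute)

lemma star_integral [simp]: "star x \<in> integral_matrices \<longleftrightarrow> x \<in> integral_matrices"
  by (auto simp: integral_matrices_iff)

lemma continuous_on_star [continuous_intros]: "continuous_on A f \<Longrightarrow> continuous_on A (\<lambda>x. star (f x))"
  unfolding star_def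
  by (intro continuous_on_mat2 continuous_on_compose2[OF continuous_on_\<sigma>[of UNIV]] continuous_on_component) auto

lemma coef_neq_0: "coef h1 \<noteq> 0"
  using hermitian_1[OF herm] by simp

lemma h2_eq: "h2 u v = \<iota> (coef h1) * (u $ 1 * \<sigma> (v $ 1) + u $ 2 * \<sigma> (v $ 2))"
  by (simp add: form_sum_def hermitian_1(2)[OF herm] algebra_simps)

lemma h2_adj: "h2 (x *v u) v = h2 u (star x *v v)"
  by (simp add: h2_eq algebra_simps)

lemma h2_nondeg:
  assumes "\<And>u. h2 u v = h2 u w"
  shows "v = w"
proof -
  have "\<sigma> (v $ 1) = \<sigma> (w $ 1)" using assms[of "vec2 1 0"] coef_neq_0 by (simp add: h2_eq)
  moreover have "\<sigma> (v $ 2) = \<sigma> (w $ 2)" using assms[of "vec2 0 1"] coef_neq_0 by (simp add: h2_eq)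
  ultimately show ?thesis by (simp add: vec_2_eq_iff)
qed

lemma matrix_eq_vec: "(\<And>v. A *v v = B *v v) \<Longrightarrow> A = (B :: 'e^2^2)"
  by (simp add: matrix_eq)

lemma herm_adj_2: "herm_adj h2 h2 x = star x"
  unfolding herm_adj_def
proof (rule the_equality)
  show "\<forall>u v. h2 (x *v u) v = h2 u (star x *v v)" by (simp only: h2_adj) simp
  fix Y assume Y: "\<forall>u v. h2 (x *v u) v = h2 u (Y *v v)"
  show "Y = star x"
  proof (rule matrix_eq_vec, rule h2_nondeg)
    fix u v show "h2 u (Y *v v) = h2 u (star x *v v)" using Y h2_adj by metis
  qed
qed

lemma contraction_2: "contraction h2 h2 x = - (x ** star x)"
  by (simp add: contraction_def herm_adj_2)

lemma U_iff: "g \<in> U \<longleftrightarrow> star g ** g = mat 1"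
proof
  assume g: "g \<in> U"
  then have inv: "invertible g" and pres: "\<And>u v. h2 (g *v u) (g *v v) = h2 u v" by (auto simp: unitary_group_def)
  show "star g ** g = mat 1"
  proof (rule matrix_eq_vec, rule h2_nondeg)
    fix u v
    have "h2 u ((star g ** g) *v v) = h2 (g *v u) (g *v v)" by (simp only: h2_adj matrix_vector_mul_assoc)
    then show "h2 u ((star g ** g) *v v) = h2 u (mat 1 *v v)" by (simp add: pres)
  qed
next
  assume g: "star g ** g = mat 1"
  then have "g ** star g = mat 1" by (simp add: matrix_left_right_inverse)
  then have "invertible g" by (rule matrix_inv_unique)
  moreover have "h2 (g *v u) (g *v v) = h2 u v" for u v
    by (simp only: h2_adj matrix_vector_mul_assoc g matrix_vector_mul_lid)
  ultimately show "g \<in> U" by (simp add: unitary_group_def)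
qed

lemma U_iff': "g \<in> U \<longleftrightarrow> g ** star g = mat 1"
  unfolding U_iff by (rule matrix_left_right_inverse)

lemma U_D: assumes "g \<in> U" shows "matrix_inv g = star g" "invertible g" "star g \<in> U"
proof -
  have "g ** star g = mat 1" using assms U_iff' by blast
  then show "matrix_inv g = star g" "invertible g" by (rule matrix_inv_unique)+
  show "star g \<in> U" using assms U_iff' by (simp add: U_iff)
qed

lemma inv_U: "g \<in> U \<Longrightarrow> inv\<^bsub>unitary_group h2\<^esub> g = star g"
  by (simp add: inv_unitary U_D)

lemma U_mult: "g \<in> U \<Longrightarrow> h \<in> U \<Longrightarrow> g ** h \<in> U"
  using group.subgroup_self[OF group_unitary[of h2], THEN subgroup.m_closed, of g h] by simp

lemma U_one [simp]: "mat 1 \<in> U"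
  by (simp add: U_iff)

lemma det_U: "g \<in> U \<Longrightarrow> det g \<in> U1"
proof -
  assume "g \<in> U"
  then have "det (star g ** g) = det (mat 1 :: 'e^2^2)" by (simp only: U_iff)
  then have "\<sigma> (det g) * det g = 1" by (simp only: det_mul det_star det_I)
  then show ?thesis by (simp add: U1_def mult.commute)
qed

lemma lattice_sum_eq: "\<exists>z::'e. z \<noteq> 0 \<and> lattice_sum \<Lambda>1 \<Lambda>1 = {u. nabs (u $ 1) \<le> nabs z \<and> nabs (u $ 2) \<le> nabs z}"
proof -
  obtain z :: 'e where "z \<noteq> 0" "\<Lambda>1 = {u. nabs (u $ 1) \<le> nabs z}" using lattice_1[OF lattice] by blast
  then show ?thesis by (intro exI[of _ z]) (auto simp: lattice_sum_def)
qed

lemma lattice_End_1: "lattice_End \<Lambda>1 = {x. nabs (x $ 1 $ 1) \<le> 1}"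
proof -
  obtain z :: 'e where z: "z \<noteq> 0" "\<Lambda>1 = {u. nabs (u $ 1) \<le> nabs z}" using lattice_1[OF lattice] by blast
  show ?thesis
  proof (intro equalityI subsetI)
    fix x assume "x \<in> lattice_End \<Lambda>1"
    moreover have "vec z \<in> \<Lambda>1" by (simp add: z)
    ultimately have "x *v vec z \<in> \<Lambda>1" unfolding lattice_End_def by blast
    then show "x \<in> {x. nabs (x $ 1 $ 1) \<le> 1}" using z by (simp add: nabs_mult)
  next
    fix x :: "'e^1^1" assume x: "x \<in> {x. nabs (x $ 1 $ 1) \<le> 1}"
    have "nabs (x $ 1 $ 1) * nabs (u $ 1) \<le> nabs z" if "nabs (u $ 1) \<le> nabs z" for u :: "'e^1"
      using mult_mono[of "nabs (x $ 1 $ 1)" 1 "nabs (u $ 1)" "nabs z"] x that by simp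
    then show "x \<in> lattice_End \<Lambda>1" by (auto simp: lattice_End_def z nabs_mult)
  qed
qed

text \<open>The lattice is a ball of the same radius in both coordinates, hence a multiple of the
  standard lattice, and scaling does not change endomorphisms.\<close>

lemma lattice_End_2: "lattice_End (lattice_sum \<Lambda>1 \<Lambda>1) = integral_matrices"
proof -
  obtain z :: 'e where z: "z \<noteq> 0" "lattice_sum \<Lambda>1 \<Lambda>1 = {u. nabs (u $ 1) \<le> nabs z \<and> nabs (u $ 2) \<le> nabs z}"
    using lattice_sum_eq by blast
  show ?thesis
  proof (intro equalityI subsetI)
    fix x assume "x \<in> lattice_End (lattice_sum \<Lambda>1 \<Lambda>1)"
    moreover have "vec2 z 0 \<in> lattice_sum \<Lambda>1 \<Lambda>1" "vec2 0 z \<in> lattice_sum \<Lambda>1 \<Lambda>1" by (simp_all add: z)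
    ultimately have "x *v vec2 z 0 \<in> lattice_sum \<Lambda>1 \<Lambda>1" "x *v vec2 0 z \<in> lattice_sum \<Lambda>1 \<Lambda>1"
      unfolding lattice_End_def by blast+
    then show "x \<in> integral_matrices" using z by (simp add: integral_matrices_iff nabs_mult)
  next
    fix x :: "'e^2^2" assume "x \<in> integral_matrices"
    then have x: "nabs (x $ i $ j) \<le> 1" for i j by (simp add: integral_matrices_def)
    have "nabs (x $ i $ j * y) \<le> nabs z" if "nabs y \<le> nabs z" for i j y
      using mult_mono[of "nabs (x $ i $ j)" 1 "nabs y" "nabs z"] x that by (simp add: nabs_mult)
    then have "x *v u \<in> lattice_sum \<Lambda>1 \<Lambda>1" if "u \<in> lattice_sum \<Lambda>1 \<Lambda>1" for u
      using that by (simp add: z nabs_add_le)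
    then show "x \<in> lattice_End (lattice_sum \<Lambda>1 \<Lambda>1)" unfolding lattice_End_def by blast
  qed
qed

definition K :: "('e^2^2) set" where "K = U \<inter> integral_matrices"

text \<open>The inverse of a unitary \<open>g\<close> is \<open>star g\<close>, which is integral
  together with \<open>g\<close>; so mapping the lattice into itself already means mapping it onto
  itself.\<close>

lemma stabilizer_eq_K: "lattice_stabilizer h2 (lattice_sum \<Lambda>1 \<Lambda>1) = K"
proof (intro equalityI subsetI)
  fix g assume "g \<in> lattice_stabilizer h2 (lattice_sum \<Lambda>1 \<Lambda>1)"
  then have "g \<in> U" "g \<in> lattice_End (lattice_sum \<Lambda>1 \<Lambda>1)" by (auto simp: lattice_stabilizer_def lattice_End_def)
  then show "g \<in> K" by (simp add: K_def lattice_End_2)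
next
  fix g assume g: "g \<in> K"
  let ?L = "lattice_sum \<Lambda>1 \<Lambda>1"
  have gU: "g \<in> U" and gE: "g \<in> lattice_End ?L" "star g \<in> lattice_End ?L" using g by (simp_all add: K_def lattice_End_2)
  have "?L \<subseteq> (\<lambda>u. g *v u) ` ?L"
  proof
    fix u assume "u \<in> ?L"
    then have "star g *v u \<in> ?L" using gE by (auto simp: lattice_End_def)
    moreover have "u = g *v (star g *v u)" using gU by (simp add: matrix_vector_mul_assoc U_iff')
    ultimately show "u \<in> (\<lambda>u. g *v u) ` ?L" by blast
  qed
  then show "g \<in> lattice_stabilizer h2 ?L" using gU gE(1) by (auto simp: lattice_stabilizer_def lattice_End_def)
qed

lemma emeasure_K: "emeasure dg K = 1"
  using vol by (simp add: stabilizer_eq_K)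

lemma subgroup_K: "subgroup K (unitary_group h2)"
proof -
  interpret group "unitary_group h2" by (rule group_unitary)
  show ?thesis
  proof (rule subgroupI)
    show "K \<noteq> {}" using U_one by (auto simp: K_def integral_matrices_iff intro!: exI[of _ "mat 1"])
  qed (auto simp: K_def inv_U U_D U_mult integral_matrices_mult)
qed

lemma closed_U: "closed U"
proof -
  have "closed {g. star g ** g = mat 1}"
    by (intro closed_Collect_eq continuous_on_matrix_mult continuous_on_star[OF continuous_on_id]
        continuous_on_id continuous_on_const)
  moreover have "U = {g. star g ** g = mat 1}" using U_iff by blast
  ultimately show ?thesis by (simp only:)
qed

text \<open>The bounded parts of the closed set \<open>U\<close> are compact, hence of finite
  measure, and they exhaust it.\<close>

lemma sigma_finite_dg: "sigma_finite_measure dg"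
proof
  let ?B = "\<lambda>n::nat. U \<inter> {x::'e^2^2. \<forall>i j. nabs (x $ i $ j) \<le> real n}"
  have sp: "space dg = U" and se: "sets dg = sets (restrict_space borel U)"
    and fin: "\<And>C. C \<subseteq> U \<Longrightarrow> compact C \<Longrightarrow> emeasure dg C < \<infinity>"
    using haar by (auto simp: haar_measure_def)
  have comp: "compact (?B n)" for n
    using compact_Int_closed[OF compact_matrices_bounded closed_U] by (simp add: Int_commute)
  show "\<exists>A. countable A \<and> A \<subseteq> sets dg \<and> \<Union>A = space dg \<and> (\<forall>a\<in>A. emeasure dg a \<noteq> \<infinity>)"
  proof (intro exI[of _ "range ?B"] conjI ballI)
    show "range ?B \<subseteq> sets dg" unfolding se sets_restrict_space
      using closed_matrices_bounded by (auto intro!: imageI borel_closed)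
    show "\<Union>(range ?B) = space dg"
    proof -
      have "\<exists>n. \<forall>i j. nabs (x $ i $ j) \<le> real n" for x :: "'e^2^2"
      proof -
        obtain n where "nabs (x $ 1 $ 1) + nabs (x $ 1 $ 2) + nabs (x $ 2 $ 1) + nabs (x $ 2 $ 2) \<le> real n"
          using real_arch_simple by blast
        moreover have "nabs (x $ i $ j) \<le> nabs (x $ 1 $ 1) + nabs (x $ 1 $ 2) + nabs (x $ 2 $ 1) + nabs (x $ 2 $ 2)" for i j
          using exhaust_2[of i] exhaust_2[of j] nabs_nonneg[of "x $ 1 $ 1"] nabs_nonneg[of "x $ 1 $ 2"]
            nabs_nonneg[of "x $ 2 $ 1"] nabs_nonneg[of "x $ 2 $ 2"] by (elim disjE) (simp_all del: nabs_nonneg)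
        ultimately show ?thesis by (meson order_trans)
      qed
      then show ?thesis by (auto simp: sp)
    qed
    fix a assume "a \<in> range ?B"
    then obtain n where a: "a = ?B n" by blast
    show "emeasure dg a \<noteq> \<infinity>" unfolding a using fin[OF Int_lower1 comp] by (rule less_imp_neq)
  qed simp
qed

lemma haar_U: "haar_group (unitary_group h2) dg"
  by (rule haar_groupI[OF group_unitary haar sigma_finite_dg continuous_unitary])

lemma K_sets: "K \<in> sets dg"
  unfolding haar_group.sets_haar[OF haar_U] sets_restrict_space K_def
  by (intro imageI borel_open open_integral_matrices)

text \<open>The determinant maps \<open>K\<close> onto the norm-one elements, already on diagonal
  matrices with entries \<open>u\<close> and 1, and carries the volume-one measure of
  \<open>K\<close> to the unitary group of the line.\<close>

lemma ex_haar_1: "\<exists>\<nu>. haar_measure (unitary_group h1) \<nu> \<and> emeasure \<nu> (carrier (unitary_group h1)) = 1"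
proof (rule haar_measure_pushforward[OF haar_group_restrict[OF haar_U subgroup_K K_sets] _ group_unitary])
  let ?K = "unitary_group h2\<lparr>carrier := K\<rparr>"
  let ?p = "\<lambda>g. mat (det g) :: 'e^1^1"
  show "emeasure (restrict_space dg K) (carrier ?K) = 1"
  proof -
    have "K \<inter> space dg = K" by (auto simp: haar_group.space_haar[OF haar_U] K_def)
    then show ?thesis using K_sets by (simp add: emeasure_restrict_space emeasure_K)
  qed
  show "?p \<in> hom ?K (unitary_group h1)"
    by (auto simp: hom_def K_def unitary_1[OF herm] det_U det_mul matrix_1_eq_iff)
  show "continuous_on (carrier ?K) ?p"
    unfolding mat_def det_2
  proof (intro continuous_on_vec_lambda)
    fix i j :: 1
    have "i = j" by (rule trans[OF num1_eq1 num1_eq1[symmetric]])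
    then show "continuous_on (carrier ?K) (\<lambda>x. if i = j then x $ 1 $ 1 * x $ 2 $ 2 - x $ 1 $ 2 * x $ 2 $ 1 else 0)"
      by (simp only: simp_thms if_True) (intro continuous_intros)
  qed
  show "?p ` carrier ?K = carrier (unitary_group h1)"
  proof (intro equalityI subsetI)
    fix y assume "y \<in> carrier (unitary_group h1)"
    then have u: "y $ 1 $ 1 \<in> U1" by (simp add: unitary_1[OF herm])
    then have "mat2 (y $ 1 $ 1) 0 0 1 \<in> K"
      using nabs_U1[OF u] by (auto simp: K_def U_iff matrix_2_eq_iff U1_def integral_matrices_iff mult.commute)
    then show "y \<in> ?p ` carrier ?K" by (intro image_eqI[of _ _ "mat2 (y $ 1 $ 1) 0 0 1"]) (auto simp: matrix_1_eq_iff det_mat2)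
  qed (auto simp: K_def unitary_1[OF herm] det_U)
  show "continuous_on (carrier (unitary_group h1) \<times> carrier (unitary_group h1)) (\<lambda>(x, y). x \<otimes>\<^bsub>unitary_group h1\<^esub> y)"
    by (rule continuous_unitary)
  show "compact (carrier (unitary_group h1))" by (rule compact_unitary_1[OF herm])
qed

subsection \<open>Orthogonal eigenbases\<close>

text \<open>The columns of \<open>P\<close> are orthogonal eigenvectors for \<open>da\<close> and
  \<open>db\<close>. Their norms \<open>ca\<close> and \<open>cb\<close> are taken for the standard
  form, of which \<open>h2\<close> is a multiple.\<close>

definition eigenbasis :: "'e^2^2 \<Rightarrow> 'e^2^2 \<Rightarrow> 'f \<Rightarrow> 'f \<Rightarrow> 'f \<Rightarrow> 'f \<Rightarrow> bool" where
  "eigenbasis \<delta> P da db ca cb \<longleftrightarrow> det P \<noteq> 0 \<and> da \<noteq> db \<and> ca \<noteq> 0 \<and> cb \<noteq> 0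
    \<and> \<delta> ** P = P ** mat2 (\<iota> da) 0 0 (\<iota> db) \<and> star P ** P = mat2 (\<iota> ca) 0 0 (\<iota> cb)"

lemma eigenbasis_exists:
  assumes "star \<delta> = \<delta>" "da \<noteq> db" "\<delta> $ 1 $ 1 + \<delta> $ 2 $ 2 = \<iota> (da + db)" "det \<delta> = \<iota> (da * db)"
  shows "\<exists>P ca cb. eigenbasis \<delta> P da db ca cb"
proof -
  obtain p q r s where d: "\<delta> = mat2 p q r s" by (rule mat2_cases)
  have ps: "s = \<iota> da + \<iota> db - p" using assms(3) by (simp add: d algebra_simps)
  have det: "p * s - q * r = \<iota> da * \<iota> db" using assms(4) by (simp add: d det_mat2)
  have qr: "q * r = p * (\<iota> da + \<iota> db - p) - \<iota> da * \<iota> db" unfolding det[symmetric] ps by simp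
  have ab: "\<iota> da \<noteq> \<iota> db" using assms(2) by simp
  \<comment> \<open>By Cayley-Hamilton the columns of \<open>\<delta> - l2\<close> are eigenvectors
    for \<open>l1\<close>: the first column is used unless it vanishes, otherwise the
    second.\<close>
  have ev: "\<exists>x y. (x, y) \<noteq> (0, 0) \<and> p * x + q * y = l1 * x \<and> r * x + s * y = l1 * y"
    if l: "l1 = \<iota> da \<and> l2 = \<iota> db \<or> l1 = \<iota> db \<and> l2 = \<iota> da" for l1 l2
  proof -
    have s: "s = l1 + l2 - p" and qr': "q * r = p * (l1 + l2 - p) - l1 * l2" and ne: "l1 \<noteq> l2"
      using l ps qr ab by (auto simp: algebra_simps)
    show ?thesis
    proof (cases "p - l2 = 0 \<and> r = 0")
      case False
      then show ?thesis using qr'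
        by (intro exI[of _ "p - l2"] exI[of _ r]) (auto simp: s algebra_simps)
    next
      case True
      show ?thesis using True ne
        by (intro exI[of _ "q"] exI[of _ "s - l2"]) (auto simp: s algebra_simps)
    qed
  qed
  obtain x1 y1 where v1: "(x1, y1) \<noteq> (0, 0)" "p * x1 + q * y1 = \<iota> da * x1" "r * x1 + s * y1 = \<iota> da * y1"
    using ev[of "\<iota> da" "\<iota> db"] by blast
  obtain x2 y2 where v2: "(x2, y2) \<noteq> (0, 0)" "p * x2 + q * y2 = \<iota> db * x2" "r * x2 + s * y2 = \<iota> db * y2"
    using ev[of "\<iota> db" "\<iota> da"] by blast
  define P where "P = mat2 x1 x2 y1 y2"
  have dP: "\<delta> ** P = P ** mat2 (\<iota> da) 0 0 (\<iota> db)"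
    using v1 v2 by (simp add: d P_def matrix_2_eq_iff mult.commute)
  have detP: "det P \<noteq> 0"
  proof
    assume "det P = 0"
    then have z: "x1 * y2 = x2 * y1" by (simp add: P_def det_mat2)
    show False
    proof (cases "x1 = 0")
      case True
      then have "y1 \<noteq> 0" using v1 by simp
      then have "x2 = 0" using z True by simp
      then have "y2 \<noteq> 0" using v2 by simp
      have "s = \<iota> da" "s = \<iota> db" using v1(3) v2(3) True \<open>x2 = 0\<close> \<open>y1 \<noteq> 0\<close> \<open>y2 \<noteq> 0\<close> by simp_all
      then show False using ab by simp
    next
      case False
      define t where "t = x2 / x1"
      have e: "x2 = t * x1" "y2 = t * y1" using z False by (simp_all add: t_def field_simps)
      then have t0: "t \<noteq> 0" using v2 by auto
      have "t * (p * x1 + q * y1) = t * (\<iota> db * x1)" using v2(2) unfolding e by (simp add: algebra_simps)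
      then have "p * x1 + q * y1 = \<iota> db * x1" using t0 by simp
      then show False using v1(2) False ab by simp
    qed
  qed
  \<comment> \<open>As \<delta> is self-adjoint, the Gram matrix commutes with the diagonal matrix
    of distinct eigenvalues. Hence it is diagonal: the eigenvectors are orthogonal.\<close>
  define C where "C = star P ** P"
  have "star P ** \<delta> ** P = C ** mat2 (\<iota> da) 0 0 (\<iota> db)" unfolding C_def
    by (metis dP matrix_mul_assoc)
  moreover have "star P ** \<delta> ** P = mat2 (\<iota> da) 0 0 (\<iota> db) ** C"
  proof -
    have "star P ** \<delta> = star (\<delta> ** P)" by (simp add: star_mult assms(1))
    also have "\<dots> = mat2 (\<iota> da) 0 0 (\<iota> db) ** star P" unfolding dP star_mult by (simp add: matrix_2_eq_iff)
    finally show ?thesis by (simp add: C_def matrix_mul_assoc)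
  qed
  ultimately have comm: "C ** mat2 (\<iota> da) 0 0 (\<iota> db) = mat2 (\<iota> da) 0 0 (\<iota> db) ** C" by simp
  have o: "C $ 1 $ 2 = 0" "C $ 2 $ 1 = 0" using comm ab by (auto simp: matrix_2_eq_iff mult.commute)
  have sC: "star C = C" by (simp add: C_def star_mult)
  have "\<sigma> (C $ 1 $ 1) = C $ 1 $ 1" "\<sigma> (C $ 2 $ 2) = C $ 2 $ 2"
    using sC by (simp_all add: matrix_2_eq_iff)
  then obtain ca cb where c: "C $ 1 $ 1 = \<iota> ca" "C $ 2 $ 2 = \<iota> cb" using fixed_iff by metis
  have Ceq: "C = mat2 (\<iota> ca) 0 0 (\<iota> cb)" using o c by (simp add: matrix_2_eq_iff)
  have "det C = \<sigma> (det P) * det P" by (simp add: C_def det_mul)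
  then have "det C \<noteq> 0" using detP by simp
  then have "ca \<noteq> 0" "cb \<noteq> 0" by (auto simp: Ceq det_mat2)
  then have "eigenbasis \<delta> P da db ca cb"
    using detP assms(2) dP Ceq by (simp add: eigenbasis_def C_def)
  then show ?thesis by blast
qed

text \<open>The determinant \<open>ca * cb\<close> of the Gram matrix is the norm of
  \<open>det P\<close>, so its valuation is even.\<close>

lemma eigenbasis_parity:
  assumes "eigenbasis \<delta> P da db ca cb"
  shows "even (vl ca) \<longleftrightarrow> even (vl cb)"
proof -
  have c: "ca \<noteq> 0" "cb \<noteq> 0" "det P \<noteq> 0" "star P ** P = mat2 (\<iota> ca) 0 0 (\<iota> cb)" using assms by (simp_all add: eigenbasis_def)
  have "N (det P) = \<iota> ca * \<iota> cb" using arg_cong[OF c(4), of det] by (simp add: det_mul det_mat2 mult.commute)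
  then have "2 * vl (det P) = vl (\<iota> ca * \<iota> cb)" using vl_N[OF c(3)] by simp
  also have "\<dots> = vl ca + vl cb" using c by (simp add: vl_mult)
  finally show ?thesis by presburger
qed

lemma eigenbasis_scale:
  assumes "eigenbasis \<delta> P da db ca cb" "a \<noteq> 0" "b \<noteq> 0" "\<iota> ca' = \<iota> ca * N a" "\<iota> cb' = \<iota> cb * N b"
  shows "eigenbasis \<delta> (P ** mat2 a 0 0 b) da db ca' cb'"
proof -
  let ?D = "mat2 (\<iota> da) 0 0 (\<iota> db)" and ?A = "mat2 a 0 0 b"
  have e: "det P \<noteq> 0" "da \<noteq> db" "ca \<noteq> 0" "cb \<noteq> 0" "\<delta> ** P = P ** ?D" "star P ** P = mat2 (\<iota> ca) 0 0 (\<iota> cb)"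
    using assms(1) by (simp_all add: eigenbasis_def)
  have c: "ca' \<noteq> 0" "cb' \<noteq> 0" using assms e by auto
  have "det (P ** ?A) \<noteq> 0" using e(1) assms by (simp add: det_mul det_mat2)
  moreover have "\<delta> ** (P ** ?A) = P ** ?A ** ?D"
  proof -
    have "\<delta> ** (P ** ?A) = P ** (?D ** ?A)" by (simp add: matrix_mul_assoc e(5))
    also have "?D ** ?A = ?A ** ?D" by (simp add: matrix_2_eq_iff mult.commute)
    finally show ?thesis by (simp add: matrix_mul_assoc)
  qed
  moreover have "star (P ** ?A) ** (P ** ?A) = mat2 (\<iota> ca') 0 0 (\<iota> cb')"
  proof -
    have "star (P ** ?A) ** (P ** ?A) = star ?A ** (star P ** P) ** ?A" by (simp add: star_mult matrix_mul_assoc)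
    also have "\<dots> = mat2 (\<iota> ca') 0 0 (\<iota> cb')" unfolding e(6) assms(4,5) by (simp add: matrix_2_eq_iff ac_simps)
    finally show ?thesis .
  qed
  ultimately show ?thesis using e c by (simp add: eigenbasis_def)
qed

text \<open>Two eigenbases for the same distinct eigenvalues differ by a diagonal matrix, which
  changes the norms of the vectors by norms from the extension.\<close>

lemma eigenbasis_unique:
  assumes "eigenbasis \<delta> P da db ca cb" "eigenbasis \<delta> P' da db ca' cb'"
  shows "even (vl cb) = even (vl cb')"
proof -
  let ?D = "mat2 (\<iota> da) 0 0 (\<iota> db)"
  have e: "det P \<noteq> 0" "da \<noteq> db" "cb \<noteq> 0" "\<delta> ** P = P ** ?D" "star P ** P = mat2 (\<iota> ca) 0 0 (\<iota> cb)"
    and e': "det P' \<noteq> 0" "cb' \<noteq> 0" "\<delta> ** P' = P' ** ?D" "star P' ** P' = mat2 (\<iota> ca') 0 0 (\<iota> cb')"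
    using assms by (simp_all add: eigenbasis_def)
  have inv: "invertible P" "invertible P'" using e e' by (simp_all add: invertible_2_iff)
  define A where "A = matrix_inv P ** P'"
  have PA: "P' = P ** A" by (simp add: A_def matrix_mul_assoc matrix_inv_right[OF inv(1)])
  have "P ** (?D ** A) = P ** (A ** ?D)" using e(4) e'(3) unfolding PA by (metis matrix_mul_assoc)
  then have "matrix_inv P ** (P ** (?D ** A)) = matrix_inv P ** (P ** (A ** ?D))" by simp
  then have "?D ** A = A ** ?D" by (simp add: matrix_mul_assoc matrix_inv_left[OF inv(1)])
  then have o: "A $ 1 $ 2 = 0" "A $ 2 $ 1 = 0" using e(2) by (auto simp: matrix_2_eq_iff mult.commute)
  have "det A \<noteq> 0" using e'(1) by (auto simp: PA det_mul)
  then have a: "A $ 2 $ 2 \<noteq> 0" using o by (auto simp: det_2)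
  have "star P' ** P' = star A ** (star P ** P) ** A" by (simp add: PA star_mult matrix_mul_assoc)
  then have "\<iota> cb' = \<sigma> (A $ 2 $ 2) * \<iota> cb * A $ 2 $ 2"
    using o unfolding e(5) e'(4) by (simp add: matrix_2_eq_iff)
  then have "vl (\<iota> cb') = vl (\<iota> cb * N (A $ 2 $ 2))" by (simp add: ac_simps)
  also have "\<dots> = vl (\<iota> cb) + vl (N (A $ 2 $ 2))" using a e by (intro vl_mult) auto
  finally have "vl cb' = vl cb + 2 * vl (A $ 2 $ 2)" using e e' vl_N[OF a] by simp
  then show ?thesis by simp
qed

lemma eigenbasis_conj:
  assumes "eigenbasis \<delta> P da db ca cb" "g \<in> U"
  shows "eigenbasis (g ** \<delta> ** star g) (g ** P) da db ca cb"
proof -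
  have e: "det P \<noteq> 0" "da \<noteq> db" "ca \<noteq> 0" "cb \<noteq> 0" "\<delta> ** P = P ** mat2 (\<iota> da) 0 0 (\<iota> db)" "star P ** P = mat2 (\<iota> ca) 0 0 (\<iota> cb)"
    using assms(1) by (simp_all add: eigenbasis_def)
  have g: "star g ** g = mat 1" using assms(2) U_iff by blast
  have "g ** \<delta> ** star g ** (g ** P) = g ** \<delta> ** (star g ** g) ** P" by (simp only: matrix_mul_assoc)
  also have "\<dots> = g ** (\<delta> ** P)" by (simp add: g matrix_mul_assoc)
  also have "\<dots> = g ** P ** mat2 (\<iota> da) 0 0 (\<iota> db)" by (simp only: e(5) matrix_mul_assoc)
  finally have 1: "g ** \<delta> ** star g ** (g ** P) = g ** P ** mat2 (\<iota> da) 0 0 (\<iota> db)" .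
  have "star (g ** P) ** (g ** P) = star P ** (star g ** g) ** P" by (simp only: star_mult matrix_mul_assoc)
  then have 2: "star (g ** P) ** (g ** P) = mat2 (\<iota> ca) 0 0 (\<iota> cb)" by (simp add: g e(6))
  have "det g \<noteq> 0" using U_D(2)[OF assms(2)] invertible_2_iff by blast
  then show ?thesis using e 1 2 by (simp add: eigenbasis_def det_mul)
qed

text \<open>Equal parity allows the eigenvectors of \<open>\<delta>'\<close> to be rescaled until
  all norms agree with those for \<open>\<delta>\<close>; the change of basis \<open>g\<close> is
  then unitary and conjugates one operator to the other.\<close>

lemma eigenbasis_same_class:
  assumes e: "eigenbasis \<delta> P da db ca cb" "eigenbasis \<delta>' P' da db ca' cb'"
    and p: "even (vl cb) = even (vl cb')"
  shows "\<exists>g\<in>U. \<delta>' = g ** \<delta> ** star g"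
proof -
  have c: "ca \<noteq> 0" "cb \<noteq> 0" "ca' \<noteq> 0" "cb' \<noteq> 0" using e by (simp_all add: eigenbasis_def)
  have "even (vl (ca / ca'))" "even (vl (cb / cb'))"
    using p c eigenbasis_parity[OF e(1)] eigenbasis_parity[OF e(2)] by (auto simp: vl_divide)
  then obtain a b where ab: "a \<noteq> 0" "\<iota> (ca / ca') = N a" "b \<noteq> 0" "\<iota> (cb / cb') = N b"
    using norm_iff_even[of "ca / ca'"] norm_iff_even[of "cb / cb'"] c by auto
  define Q where "Q = P' ** mat2 a 0 0 b"
  have "\<iota> ca = \<iota> ca' * N a" "\<iota> cb = \<iota> cb' * N b" using ab c by (simp_all flip: ab(2,4))
  then have Q: "eigenbasis \<delta>' Q da db ca cb" unfolding Q_def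
    using eigenbasis_scale[OF e(2) ab(1,3)] by blast
  let ?D = "mat2 (\<iota> da) 0 0 (\<iota> db)" and ?C = "mat2 (\<iota> ca) 0 0 (\<iota> cb)"
  have P1: "invertible P" "\<delta> ** P = P ** ?D" "star P ** P = ?C" using e(1) by (simp_all add: eigenbasis_def invertible_2_iff)
  have Q1: "invertible Q" "\<delta>' ** Q = Q ** ?D" "star Q ** Q = ?C" using Q by (simp_all add: eigenbasis_def invertible_2_iff)
  define g where "g = Q ** matrix_inv P"
  have gP: "g ** P = Q" by (simp add: g_def matrix_inv_left[OF P1(1)] flip: matrix_mul_assoc)
  have "star P ** (star g ** g) ** P = star (g ** P) ** (g ** P)" by (simp only: star_mult matrix_mul_assoc)
  also have "\<dots> = star P ** P" by (simp only: gP Q1(3) P1(3))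
  finally have eq: "star P ** (star g ** g) ** P = star P ** mat 1 ** P" by simp
  have sP: "invertible (star P)" using P1(1) by (simp add: invertible_2_iff)
  have cancel: "A = B" if "star P ** A ** P = star P ** B ** P" for A B
  proof -
    have "matrix_inv (star P) ** (star P ** A ** P) ** matrix_inv P = matrix_inv (star P) ** (star P ** B ** P) ** matrix_inv P"
      by (simp only: that)
    then have "(matrix_inv (star P) ** star P) ** A ** (P ** matrix_inv P) = (matrix_inv (star P) ** star P) ** B ** (P ** matrix_inv P)"
      by (simp only: matrix_mul_assoc)
    then show ?thesis by (simp add: matrix_inv_left[OF sP] matrix_inv_right[OF P1(1)])
  qed
  have "star g ** g = mat 1" by (rule cancel[OF eq])
  then have gU: "g \<in> U" by (simp add: U_iff)
  have "g ** \<delta> ** P = g ** P ** ?D" by (metis P1(2) matrix_mul_assoc)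
  also have "\<dots> = \<delta>' ** g ** P" by (metis gP Q1(2) matrix_mul_assoc)
  finally have "g ** \<delta> ** P = \<delta>' ** g ** P" .
  then have "g ** \<delta> ** (P ** matrix_inv P) = \<delta>' ** g ** (P ** matrix_inv P)" by (simp only: matrix_mul_assoc)
  then have "g ** \<delta> = \<delta>' ** g" by (simp add: matrix_inv_right[OF P1(1)])
  then have "g ** \<delta> ** star g = \<delta>' ** (g ** star g)" by (simp add: matrix_mul_assoc)
  then have "\<delta>' = g ** \<delta> ** star g" using gU U_iff' by simp
  then show ?thesis using gU by blast
qed

end

section \<open>Orbital integrals as lattice counts\<close>

lemma haar_group_in: "haar_group G \<mu> \<Longrightarrow> group G"
  by (simp add: haar_group_def)

context split_plane
begin

abbreviation G2 :: "(('e^2^2) \<times> ('e^2^2)) monoid" where "G2 \<equiv> unitary_group h2 \<times>\<times> unitary_group h2"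

lemma haar_G2: "haar_group G2 (dg \<Otimes>\<^sub>M dg)"
  by (rule haar_group_pair[OF haar_U haar_U])

lemma act_G2:
  assumes "g \<in> carrier G2"
  shows "pair_act g x = fst g ** x ** star (snd g)" "inv\<^bsub>G2\<^esub> g = (star (fst g), star (snd g))"
    "pair_act (inv\<^bsub>G2\<^esub> g) x = star (fst g) ** x ** snd g"
proof -
  obtain a b where g: "g = (a, b)" "a \<in> U" "b \<in> U" using assms by auto
  show "pair_act g x = fst g ** x ** star (snd g)" by (simp add: g pair_act_def U_D)
  show i: "inv\<^bsub>G2\<^esub> g = (star (fst g), star (snd g))"
    using g by (simp add: inv_DirProd group_unitary inv_U)
  show "pair_act (inv\<^bsub>G2\<^esub> g) x = star (fst g) ** x ** snd g"
    unfolding i using U_D(1)[OF U_D(3)[OF g(3)]] by (simp add: g pair_act_def)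
qed

lemma act_G2_mult:
  assumes "g \<in> carrier G2" "k \<in> carrier G2"
  shows "pair_act (g \<otimes>\<^bsub>G2\<^esub> k) x = pair_act g (pair_act k x)"
  using assms U_D(2) by (auto simp: pair_act_mult)

lemma act_G2_one: "pair_act \<one>\<^bsub>G2\<^esub> x = x"
  by (simp add: pair_act_one)

lemma measurable_act:
  "(\<lambda>g. indicator integral_matrices (pair_act (inv\<^bsub>G2\<^esub> g) x) :: complex) \<in> borel_measurable (dg \<Otimes>\<^sub>M dg)"
proof -
  interpret haar_group G2 "dg \<Otimes>\<^sub>M dg" by (rule haar_G2)
  have "(\<lambda>g. star (fst g) ** x ** snd g) \<in> measurable (restrict_space borel (carrier G2)) borel"
    by (intro borel_measurable_continuous_on_restrict continuous_intros)
  then have "(\<lambda>g. star (fst g) ** x ** snd g) \<in> measurable (dg \<Otimes>\<^sub>M dg) borel"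
    by (simp add: measurable_cong_sets[OF sets_haar refl])
  then have "(\<lambda>g. indicator integral_matrices (star (fst g) ** x ** snd g) :: complex) \<in> borel_measurable (dg \<Otimes>\<^sub>M dg)"
    by (rule measurable_compose) (intro borel_measurable_indicator borel_open open_integral_matrices)
  then show ?thesis
    by (rule measurable_cong[THEN iffD2, rotated]) (simp only: act_G2(3) space_haar)
qed

text \<open>For a stabilizing pair, \<open>g\<close> commutes with \<open>x ** star x\<close>, so it
  is diagonal in the eigenbasis, with norm-one entries by unitarity. The second component is then
  forced by \<open>g ** x = x ** h\<close>.\<close>

lemma stabilizer_G2:
  assumes e: "eigenbasis (- (x ** star x)) P da db ca cb" and x: "invertible x"
  shows "{g \<in> carrier G2. pair_act g x = x} =
    (\<lambda>t. (P ** mat2 (fst t $ 1 $ 1) 0 0 (snd t $ 1 $ 1) ** matrix_inv P,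
      matrix_inv x ** (P ** mat2 (fst t $ 1 $ 1) 0 0 (snd t $ 1 $ 1) ** matrix_inv P) ** x))
    ` carrier (unitary_group h1 \<times>\<times> unitary_group h1)" (is "?L = ?p ` ?T")
proof -
  let ?\<delta> = "- (x ** star x)" and ?D = "mat2 (\<iota> da) 0 0 (\<iota> db)" and ?C = "mat2 (\<iota> ca) 0 0 (\<iota> cb)"
  let ?Q = "matrix_inv P" and ?y = "matrix_inv x"
  have inv: "invertible P" and ne: "\<iota> da \<noteq> \<iota> db" and c: "\<iota> ca \<noteq> 0" "\<iota> cb \<noteq> 0" and dP: "?\<delta> ** P = P ** ?D" and C: "star P ** P = ?C"
    using e by (simp_all add: eigenbasis_def invertible_2_iff)
  have PQ: "P ** ?Q = mat 1" and QP: "?Q ** P = mat 1" by (simp_all add: matrix_inv_left[OF inv] matrix_inv_right[OF inv])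
  have xy: "x ** ?y = mat 1" and yx: "?y ** x = mat 1" by (simp_all add: matrix_inv_left[OF x] matrix_inv_right[OF x])
  have Qd: "?Q ** ?\<delta> = ?D ** ?Q"
  proof -
    have "?Q ** ?\<delta> = ?Q ** (?\<delta> ** P) ** ?Q" by (simp add: PQ flip: matrix_mul_assoc)
    also have "\<dots> = (?Q ** P) ** ?D ** ?Q" by (simp only: dP matrix_mul_assoc)
    finally show ?thesis by (simp add: QP)
  qed
  have neg: "A ** - B = - (A ** B)" "- A ** B = - (A ** B)" for A B :: "'e^2^2"
    by (simp_all add: matrix_2_eq_iff)
  have sub1: "?p t \<in> ?L" if t: "t \<in> ?T" for t
  proof -
    define T where "T = mat2 (fst t $ 1 $ 1) 0 0 (snd t $ 1 $ 1)"
    have t1: "N (fst t $ 1 $ 1) = 1" "N (snd t $ 1 $ 1) = 1" using t by (auto simp: unitary_1[OF herm] U1_def)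
    define g where "g = P ** T ** ?Q"
    have CT: "star T ** ?C ** T = ?C" using t1 by (simp add: T_def matrix_2_eq_iff ac_simps)
    have "star g ** g = star ?Q ** (star T ** (star P ** P) ** T) ** ?Q"
      by (simp only: g_def star_mult matrix_mul_assoc)
    also have "\<dots> = star ?Q ** (star P ** P) ** ?Q" by (simp only: C CT)
    also have "\<dots> = star (P ** ?Q) ** (P ** ?Q)" by (simp only: star_mult matrix_mul_assoc)
    finally have gU: "g \<in> U" by (simp add: PQ U_iff)
    have TD: "T ** ?D = ?D ** T" by (simp add: T_def matrix_2_eq_iff mult.commute)
    have "?\<delta> ** g = (?\<delta> ** P) ** T ** ?Q" by (simp only: g_def matrix_mul_assoc)
    also have "\<dots> = P ** (?D ** T) ** ?Q" by (simp only: dP matrix_mul_assoc)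
    also have "\<dots> = P ** T ** (?D ** ?Q)" by (simp only: TD[symmetric] matrix_mul_assoc)
    also have "\<dots> = g ** ?\<delta>" by (simp only: Qd[symmetric] g_def matrix_mul_assoc)
    finally have comm: "x ** star x ** g = g ** (x ** star x)" by (simp add: neg)
    define h where "h = ?y ** g ** x"
    have "h ** star h = ?y ** (g ** (x ** star x)) ** star g ** star ?y" by (simp only: h_def star_mult matrix_mul_assoc)
    also have "\<dots> = ?y ** (x ** star x ** g) ** star g ** star ?y" by (simp only: comm)
    also have "\<dots> = (?y ** x) ** star x ** (g ** star g) ** star ?y" by (simp only: matrix_mul_assoc)
    also have "\<dots> = star x ** star ?y" using gU U_iff' by (simp add: yx)
    also have "\<dots> = mat 1" by (simp only: star_mult[symmetric] yx star_mat_1)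
    finally have hU: "h \<in> U" by (simp only: U_iff')
    have "g ** x ** star h = x"
    proof -
      have "g ** x = x ** h" by (simp add: h_def matrix_mul_assoc xy)
      then have "g ** x ** star h = x ** (h ** star h)" by (simp add: matrix_mul_assoc)
      then show ?thesis using hU U_iff' by simp
    qed
    then have "(g, h) \<in> ?L" using gU hU by (simp add: act_G2)
    then show ?thesis by (simp add: g_def h_def T_def)
  qed
  have sub2: "k \<in> ?p ` ?T" if k: "k \<in> ?L" for k
  proof -
    have kG: "k \<in> carrier G2" and kx: "pair_act k x = x" using k by simp_all
    obtain g h where gh: "k = (g, h)" "g \<in> U" "h \<in> U" using kG by auto
    have gxh: "g ** x ** star h = x" using kx act_G2(1)[OF kG] by (simp only: gh(1) fst_conv snd_conv)
    have gx: "g ** x = x ** h"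
    proof -
      have "g ** x ** (star h ** h) = g ** x ** star h ** h" by (simp only: matrix_mul_assoc)
      then show ?thesis using gh U_iff by (simp add: gxh)
    qed
    have "star (g ** x ** star h) = star x" by (simp only: gxh)
    then have sx: "h ** star x ** star g = star x" by (simp add: star_mult matrix_mul_assoc)
    have sxg: "star x ** g = h ** star x"
    proof -
      have "h ** star x ** (star g ** g) = h ** star x ** star g ** g" by (simp only: matrix_mul_assoc)
      then show ?thesis using gh U_iff by (simp add: sx)
    qed
    have "x ** star x ** g = x ** (star x ** g)" by (simp only: matrix_mul_assoc)
    also have "\<dots> = x ** h ** star x" by (simp only: sxg matrix_mul_assoc)
    also have "\<dots> = g ** (x ** star x)" by (simp only: gx[symmetric] matrix_mul_assoc)
    finally have comm: "?\<delta> ** g = g ** ?\<delta>" by (simp add: neg)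
    define T where "T = ?Q ** g ** P"
    have "T ** ?D = ?Q ** g ** (P ** ?D)" by (simp only: T_def matrix_mul_assoc)
    also have "\<dots> = ?Q ** (g ** ?\<delta>) ** P" by (simp only: dP[symmetric] matrix_mul_assoc)
    also have "\<dots> = (?Q ** ?\<delta>) ** g ** P" by (simp only: comm[symmetric] matrix_mul_assoc)
    also have "\<dots> = ?D ** T" by (simp only: Qd T_def matrix_mul_assoc)
    finally have o: "T $ 1 $ 2 = 0" "T $ 2 $ 1 = 0" using ne by (auto simp: matrix_2_eq_iff mult.commute)
    have gP: "g ** P = P ** T"
    proof -
      have "P ** T = (P ** ?Q) ** g ** P" by (simp only: T_def matrix_mul_assoc)
      then show ?thesis by (simp add: PQ)
    qed
    have "star T ** ?C ** T = star (P ** T) ** (P ** T)" by (simp only: star_mult matrix_mul_assoc C[symmetric])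
    also have "\<dots> = star P ** (star g ** g) ** P" by (simp only: gP[symmetric] star_mult matrix_mul_assoc)
    also have "\<dots> = ?C" using gh U_iff C by simp
    finally have "N (T $ 1 $ 1) = 1" "N (T $ 2 $ 2) = 1" using o c by (auto simp: matrix_2_eq_iff ac_simps)
    then have t: "(mat (T $ 1 $ 1), mat (T $ 2 $ 2)) \<in> ?T" by (simp add: unitary_1[OF herm] U1_def)
    have T: "T = mat2 (T $ 1 $ 1) 0 0 (T $ 2 $ 2)" using o by (simp add: matrix_2_eq_iff)
    have g: "g = P ** T ** ?Q" by (simp only: gP[symmetric]) (simp add: PQ flip: matrix_mul_assoc)
    have h: "h = ?y ** g ** x"
    proof -
      have "?y ** g ** x = (?y ** x) ** h" by (simp add: gx flip: matrix_mul_assoc)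
      then show ?thesis by (simp add: yx)
    qed
    have "k = ?p (mat (T $ 1 $ 1), mat (T $ 2 $ 2))" using gh(1) g h T by simp
    then show ?thesis using t by (rule image_eqI)
  qed
  show ?thesis using sub1 sub2 by blast
qed

text \<open>The stabilizer is the image of a product of two unitary groups of the line, so
  \<open>haar_measure_pushforward\<close> supplies the measure that
  \<open>orbital_integral_eq\<close> asks for.\<close>

lemma RO_integral:
  assumes e: "eigenbasis (- (x ** star x)) P da db ca cb" and x: "invertible x"
  shows "RO dg h2 x (indicator integral_matrices)
    = (\<integral>g. indicator integral_matrices (pair_act (inv\<^bsub>G2\<^esub> g) x) \<partial>(dg \<Otimes>\<^sub>M dg))"
  unfolding RO_def
proof (rule orbital_integral_eq[OF haar_G2 act_G2_mult act_G2_one _ _ _ measurable_act])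
  let ?H = "stabilizer_group G2 pair_act x"
  let ?T = "unitary_group h1 \<times>\<times> unitary_group h1"
  let ?c = "\<lambda>t :: ('e^1^1) \<times> ('e^1^1). P ** mat2 (fst t $ 1 $ 1) 0 0 (snd t $ 1 $ 1) ** matrix_inv P"
  let ?p = "\<lambda>t. (?c t, matrix_inv x ** ?c t ** x)"
  interpret G: haar_group G2 "dg \<Otimes>\<^sub>M dg" by (rule haar_G2)
  have st: "{g \<in> carrier G2. pair_act g x = x} = ?p ` carrier ?T" by (rule stabilizer_G2[OF e x])
  have inv: "invertible P" using e by (simp add: eigenbasis_def invertible_2_iff)
  have cm: "?c (t \<otimes>\<^bsub>?T\<^esub> u) = ?c t ** ?c u" for t u
  proof -
    have "?c t ** ?c u = P ** mat2 (fst t $ 1 $ 1) 0 0 (snd t $ 1 $ 1) ** (matrix_inv P ** P)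
        ** mat2 (fst u $ 1 $ 1) 0 0 (snd u $ 1 $ 1) ** matrix_inv P" by (simp only: matrix_mul_assoc)
    also have "\<dots> = P ** (mat2 (fst t $ 1 $ 1) 0 0 (snd t $ 1 $ 1) ** mat2 (fst u $ 1 $ 1) 0 0 (snd u $ 1 $ 1)) ** matrix_inv P"
      by (simp add: matrix_inv_left[OF inv] matrix_mul_assoc)
    also have "mat2 (fst t $ 1 $ 1) 0 0 (snd t $ 1 $ 1) ** mat2 (fst u $ 1 $ 1) 0 0 (snd u $ 1 $ 1)
      = mat2 (fst (t \<otimes>\<^bsub>?T\<^esub> u) $ 1 $ 1) 0 0 (snd (t \<otimes>\<^bsub>?T\<^esub> u) $ 1 $ 1)"
      by (cases t; cases u) (simp add: matrix_2_eq_iff)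
    finally show ?thesis ..
  qed
  have pm: "?p (t \<otimes>\<^bsub>?T\<^esub> u) = ?p t \<otimes>\<^bsub>G2\<^esub> ?p u" for t u
  proof -
    have "(matrix_inv x ** ?c t ** x) ** (matrix_inv x ** ?c u ** x) = matrix_inv x ** ?c t ** (x ** matrix_inv x) ** ?c u ** x"
      by (simp only: matrix_mul_assoc)
    also have "\<dots> = matrix_inv x ** (?c t ** ?c u) ** x"
      by (simp add: matrix_inv_right[OF x] matrix_mul_assoc)
    finally show ?thesis by (simp only: cm mult_DirProd unitary_group_simps)
  qed
  have Tcomm: "t \<otimes>\<^bsub>?T\<^esub> u = u \<otimes>\<^bsub>?T\<^esub> t" for t u
    by (cases t; cases u) (simp add: matrix_1_eq_iff mult.commute)
  have UT: "haar_group (unitary_group h1) (torus_haar (unitary_group h1))"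
    "emeasure (torus_haar (unitary_group h1)) (carrier (unitary_group h1)) = 1"
    using torus_haar_compact[OF group_unitary compact_unitary_1[OF herm] ex_haar_1 continuous_unitary] by auto
  have cp: "continuous_on A ?p" for A by (intro continuous_intros)
  show comp: "compact {g \<in> carrier G2. pair_act g x = x}" unfolding st
    by (rule compact_continuous_image[OF cp]) (simp add: compact_Times compact_unitary_1[OF herm])
  show "g \<otimes>\<^bsub>G2\<^esub> h = h \<otimes>\<^bsub>G2\<^esub> g" if "g \<in> carrier G2" "h \<in> carrier G2" "pair_act g x = x" "pair_act h x = x" for g h
  proof -
    have "g \<in> ?p ` carrier ?T" "h \<in> ?p ` carrier ?T" using that st by blast+
    then obtain t u where tu: "g = ?p t" "h = ?p u" by blast
    show ?thesis unfolding tu pm[symmetric] by (simp only: Tcomm[of t u])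
  qed
  have "\<exists>\<nu>. haar_measure ?H \<nu> \<and> emeasure \<nu> (carrier ?H) = 1"
  proof (rule haar_measure_pushforward[OF haar_group_pair[OF UT(1) UT(1)] emeasure_pair_one[OF UT(1) UT(1) UT(2) UT(2)]])
    show "group ?H" by (rule group_stabilizer[OF G.is_group act_G2_mult act_G2_one])
    show im: "?p ` carrier ?T = carrier ?H" by (simp only: stabilizer_group_simps st)
    show "?p \<in> hom ?T ?H"
    proof (rule homI)
      fix t assume "t \<in> carrier ?T"
      then show "?p t \<in> carrier ?H" using im by blast
      fix u show "?p (t \<otimes>\<^bsub>?T\<^esub> u) = ?p t \<otimes>\<^bsub>?H\<^esub> ?p u" by (simp only: pm stabilizer_group_simps)
    qed
    show "continuous_on (carrier ?T) ?p" by (rule cp)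
    show "continuous_on (carrier ?H \<times> carrier ?H) (\<lambda>(x, y). x \<otimes>\<^bsub>?H\<^esub> y)"
      unfolding stabilizer_group_simps by (rule continuous_on_subset[OF G.continuous_mult]) blast
    show "compact (carrier ?H)" unfolding stabilizer_group_simps by (rule comp)
  qed
  then show "\<exists>\<nu>. haar_measure ?H \<nu> \<and> emeasure \<nu> {g \<in> carrier G2. pair_act g x = x} = 1"
    by (simp only: stabilizer_group_simps)
qed

text \<open>Defined for every \<open>x\<close>, so that its symmetries can be proved without
  reference to an eigenbasis.\<close>

definition ro :: "'e^2^2 \<Rightarrow> complex" where
  "ro x = (\<integral>g. indicator integral_matrices (pair_act (inv\<^bsub>G2\<^esub> g) x) \<partial>(dg \<Otimes>\<^sub>M dg))"

lemma ro_orbit: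
  assumes "k \<in> carrier G2"
  shows "ro (pair_act k x) = ro x"
proof -
  interpret G: haar_group G2 "dg \<Otimes>\<^sub>M dg" by (rule haar_G2)
  let ?F = "\<lambda>g. indicator integral_matrices (pair_act (inv\<^bsub>G2\<^esub> g) x) :: complex"
  have ik: "inv\<^bsub>G2\<^esub> k \<in> carrier G2" by (rule G.inv_closed[OF assms])
  have "ro (pair_act k x) = (\<integral>g. ?F (inv\<^bsub>G2\<^esub> k \<otimes>\<^bsub>G2\<^esub> g) \<partial>(dg \<Otimes>\<^sub>M dg))"
    unfolding ro_def
  proof (rule Bochner_Integration.integral_cong[OF refl])
    fix g assume "g \<in> space (dg \<Otimes>\<^sub>M dg)"
    then have g: "g \<in> carrier G2" by (simp only: G.space_haar)
    have "inv\<^bsub>G2\<^esub> (inv\<^bsub>G2\<^esub> k \<otimes>\<^bsub>G2\<^esub> g) = inv\<^bsub>G2\<^esub> g \<otimes>\<^bsub>G2\<^esub> k"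
      by (simp only: G.inv_mult_group[OF ik g] G.inv_inv[OF assms])
    then show "indicator integral_matrices (pair_act (inv\<^bsub>G2\<^esub> g) (pair_act k x)) = ?F (inv\<^bsub>G2\<^esub> k \<otimes>\<^bsub>G2\<^esub> g)"
      by (simp only: act_G2_mult[OF G.inv_closed[OF g] assms])
  qed
  also have "\<dots> = ro x" unfolding ro_def by (rule G.integral_translate[OF ik measurable_act])
  finally show ?thesis .
qed

text \<open>Interchanging the two group variables and taking adjoints turns
  \<open>star b ** x ** a\<close> into \<open>star a ** star x ** b\<close>. Integrality is stable
  under adjoints, and the product measure under the interchange.\<close>

lemma ro_star: "ro (star x) = ro x"
proof -
  interpret G: haar_group G2 "dg \<Otimes>\<^sub>M dg" by (rule haar_G2)
  interpret D: haar_group "unitary_group h2" dg by (rule haar_U)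
  interpret pair_sigma_finite dg dg ..
  let ?F = "\<lambda>g. indicator integral_matrices (pair_act (inv\<^bsub>G2\<^esub> g) x) :: complex"
  have "ro x = integral\<^sup>L (distr (dg \<Otimes>\<^sub>M dg) (dg \<Otimes>\<^sub>M dg) (\<lambda>(x, y). (y, x))) ?F"
    unfolding ro_def by (simp only: distr_pair_swap[symmetric])
  also have "\<dots> = (\<integral>g. ?F (case g of (x, y) \<Rightarrow> (y, x)) \<partial>(dg \<Otimes>\<^sub>M dg))"
    by (rule integral_distr[OF measurable_pair_swap' measurable_act])
  also have "\<dots> = ro (star x)" unfolding ro_def
  proof (rule Bochner_Integration.integral_cong[OF refl])
    fix g assume "g \<in> space (dg \<Otimes>\<^sub>M dg)"
    then have gG: "g \<in> carrier G2" by (simp only: G.space_haar)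
    then obtain a b where g: "g = (a, b)" "a \<in> U" "b \<in> U" by auto
    then have gG': "(b, a) \<in> carrier G2" by simp
    have "star (star b ** x ** a) = star a ** star x ** b" by (simp add: star_mult matrix_mul_assoc)
    then have "star b ** x ** a \<in> integral_matrices \<longleftrightarrow> star a ** star x ** b \<in> integral_matrices"
      by (metis star_integral)
    then show "?F (case g of (x, y) \<Rightarrow> (y, x)) = indicator integral_matrices (pair_act (inv\<^bsub>G2\<^esub> g) (star x))"
      using act_G2(3)[OF gG] act_G2(3)[OF gG'] by (simp only: g(1) prod.case fst_conv snd_conv indicator_def)
  qed
  finally show ?thesis ..
qed

text \<open>The integrand is invariant under right translation by \<open>K\<close> in both
  variables, so the integral counts pairs of cosets, each of volume one; \<open>I\<close> represents
  those on which the integrand is 1.\<close>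

lemma ro_card:
  assumes "finite I"
    and I: "\<And>a b. (a, b) \<in> I \<Longrightarrow> a \<in> U \<and> b \<in> U \<and> star a ** x ** b \<in> integral_matrices"
    and ex: "\<And>g h. g \<in> U \<Longrightarrow> h \<in> U \<Longrightarrow> star g ** x ** h \<in> integral_matrices \<Longrightarrow>
      \<exists>!p. p \<in> I \<and> star (fst p) ** g \<in> integral_matrices \<and> star (snd p) ** h \<in> integral_matrices"
  shows "ro x = of_nat (card I)"
proof -
  interpret G: haar_group G2 "dg \<Otimes>\<^sub>M dg" by (rule haar_G2)
  interpret D: haar_group "unitary_group h2" dg by (rule haar_U)
  define C :: "'e^2^2 \<Rightarrow> ('e^2^2) set" where "C a = (\<lambda>k. a ** k) ` K" for a
  have Cm: "C a \<in> sets dg" "emeasure dg (C a) = 1" if "a \<in> U" for a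
    using D.emeasure_translate_image(2,3)[OF that K_sets] emeasure_K by (simp_all add: C_def)
  have Ciff: "g \<in> C a \<longleftrightarrow> g \<in> U \<and> star a ** g \<in> integral_matrices" if a: "a \<in> U" for a g
  proof
    assume "g \<in> C a"
    then obtain k where k: "k \<in> K" "g = a ** k" by (auto simp: C_def)
    have "star a ** g = (star a ** a) ** k" by (simp only: k matrix_mul_assoc)
    then have "star a ** g = k" using a U_iff by simp
    then show "g \<in> U \<and> star a ** g \<in> integral_matrices" using k a by (auto simp: K_def U_mult)
  next
    assume g: "g \<in> U \<and> star a ** g \<in> integral_matrices"
    have "g = (a ** star a) ** g" using a U_iff' by simp
    then have "g = a ** (star a ** g)" by (simp only: matrix_mul_assoc)
    moreover have "star a ** g \<in> K" using g a U_mult[OF U_D(3)] by (simp add: K_def)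
    ultimately show "g \<in> C a" unfolding C_def by blast
  qed
  have pt: "indicator integral_matrices (pair_act (inv\<^bsub>G2\<^esub> g) x)
      = (\<Sum>p\<in>I. indicator (C (fst p) \<times> C (snd p)) g :: complex)" if g: "g \<in> carrier G2" for g
  proof -
    obtain a b where ab: "g = (a, b)" "a \<in> U" "b \<in> U" using g by auto
    have act: "pair_act (inv\<^bsub>G2\<^esub> g) x = star a ** x ** b" using act_G2(3)[OF g] by (simp only: ab(1) fst_conv snd_conv)
    have mem: "g \<in> C (fst p) \<times> C (snd p) \<longleftrightarrow> star (fst p) ** a \<in> integral_matrices \<and> star (snd p) ** b \<in> integral_matrices"
      if "p \<in> I" for p using Ciff I[of "fst p" "snd p"] that ab by (simp add: mem_Times_iff)
    show ?thesis
    proof (cases "star a ** x ** b \<in> integral_matrices")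
      case True
      obtain p where P: "p \<in> I \<and> star (fst p) ** a \<in> integral_matrices \<and> star (snd p) ** b \<in> integral_matrices"
        "\<forall>p'. p' \<in> I \<and> star (fst p') ** a \<in> integral_matrices \<and> star (snd p') ** b \<in> integral_matrices \<longrightarrow> p' = p"
        using ex[OF ab(2,3) True] by (elim ex1E) (rule that)
      have p: "p \<in> I" "star (fst p) ** a \<in> integral_matrices \<and> star (snd p) ** b \<in> integral_matrices"
        by (rule conjunct1[OF P(1)], rule conjunct2[OF P(1)])
      have un: "p' = p" if "p' \<in> I" "star (fst p') ** a \<in> integral_matrices \<and> star (snd p') ** b \<in> integral_matrices" for p'
        by (rule P(2)[THEN spec, THEN mp, OF conjI[OF that]])
      have "(\<Sum>p\<in>I. indicator (C (fst p) \<times> C (snd p)) g :: complex) = (\<Sum>p'\<in>I. if p' = p then 1 else 0)"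
      proof (rule sum.cong[OF refl])
        fix p' assume p': "p' \<in> I"
        have "g \<in> C (fst p') \<times> C (snd p') \<longleftrightarrow> p' = p"
        proof
          assume "g \<in> C (fst p') \<times> C (snd p')"
          then show "p' = p" by (rule un[OF p' mem[OF p', THEN iffD1]])
        next
          assume "p' = p"
          then show "g \<in> C (fst p') \<times> C (snd p')" using mem[OF p'] p(2) by (simp only:)
        qed
        then show "(indicator (C (fst p') \<times> C (snd p')) g :: complex) = (if p' = p then 1 else 0)"
          by (simp only: indicator_def of_bool_def)
      qed
      also have "\<dots> = 1" using assms(1) p(1) by simp
      finally show ?thesis using True by (simp only: act indicator_simps)
    next
      case False
      \<comment> \<open>Membership in a listed pair of cosets would make the integrand 1, because
        elements of \<open>K\<close> preserve integrality from both sides.\<close>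
      have "indicator (C (fst p) \<times> C (snd p)) g = (0::complex)" if pI: "p \<in> I" for p
      proof -
        have pU: "fst p \<in> U" "snd p \<in> U" and pM: "star (fst p) ** x ** snd p \<in> integral_matrices"
          using I[of "fst p" "snd p"] pI by auto
        have "\<not> (star (fst p) ** a \<in> integral_matrices \<and> star (snd p) ** b \<in> integral_matrices)"
        proof
          assume m: "star (fst p) ** a \<in> integral_matrices \<and> star (snd p) ** b \<in> integral_matrices"
          have "star a ** fst p = star (star (fst p) ** a)" by (simp add: star_mult)
          then have sa: "star a ** fst p \<in> integral_matrices" using m by simp
          have "(star a ** fst p) ** (star (fst p) ** x ** snd p) ** (star (snd p) ** b) \<in> integral_matrices"
            by (rule integral_matrices_mult[OF integral_matrices_mult[OF sa pM] conjunct2[OF m]])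
          moreover have "(star a ** fst p) ** (star (fst p) ** x ** snd p) ** (star (snd p) ** b)
            = star a ** (fst p ** star (fst p)) ** x ** (snd p ** star (snd p)) ** b" by (simp only: matrix_mul_assoc)
          ultimately show False using False pU U_iff' by simp
        qed
        then show ?thesis using mem[OF pI] by (simp add: indicator_def)
      qed
      then have zs: "(\<Sum>p\<in>I. indicator (C (fst p) \<times> C (snd p)) g :: complex) = 0" by (intro sum.neutral ballI)
      show ?thesis unfolding act zs using False by (simp add: indicator_def)
    qed
  qed
  have rect: "C (fst p) \<times> C (snd p) \<in> sets (dg \<Otimes>\<^sub>M dg)" "emeasure (dg \<Otimes>\<^sub>M dg) (C (fst p) \<times> C (snd p)) = 1"
    if pI: "p \<in> I" for p
  proof -
    have pU: "fst p \<in> U" "snd p \<in> U" using I[of "fst p" "snd p"] pI by auto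
    show "C (fst p) \<times> C (snd p) \<in> sets (dg \<Otimes>\<^sub>M dg)" using Cm pU by (intro pair_measureI) auto
    show "emeasure (dg \<Otimes>\<^sub>M dg) (C (fst p) \<times> C (snd p)) = 1"
      using Cm pU by (simp add: D.emeasure_pair_measure_Times)
  qed
  have "ro x = (\<integral>g. (\<Sum>p\<in>I. indicator (C (fst p) \<times> C (snd p)) g :: complex) \<partial>(dg \<Otimes>\<^sub>M dg))"
    unfolding ro_def by (rule Bochner_Integration.integral_cong[OF refl], rule pt) (simp only: G.space_haar)
  also have "\<dots> = (\<Sum>p\<in>I. 1)"
  proof (rule has_bochner_integral_integral_eq, rule has_bochner_integral_sum)
    fix p assume pI: "p \<in> I"
    let ?A = "C (fst p) \<times> C (snd p)"
    have "has_bochner_integral (dg \<Otimes>\<^sub>M dg) (\<lambda>g. indicator ?A g *\<^sub>R (1::complex)) (measure (dg \<Otimes>\<^sub>M dg) ?A *\<^sub>R 1)"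
      by (rule has_bochner_integral_indicator[OF rect(1)[OF pI]]) (simp add: rect(2)[OF pI])
    moreover have "(\<lambda>g. indicator ?A g *\<^sub>R (1::complex)) = indicator ?A" by (simp add: fun_eq_iff indicator_def)
    moreover have "measure (dg \<Otimes>\<^sub>M dg) ?A = 1" by (simp add: measure_def rect(2)[OF pI])
    ultimately show "has_bochner_integral (dg \<Otimes>\<^sub>M dg) (\<lambda>g. indicator ?A g) (1::complex)" by simp
  qed
  finally show ?thesis by simp
qed

text \<open>A similitude \<open>Q\<close> with multiplier \<open>c\<close> moves \<open>x\<close> to \<open>Q x Q\<^sup>-\<^sup>1\<close>, which lies in the same stable orbit;
  its orbital integral counts pairs of lattices that are self-dual for the rescaled form.\<close>

lemma ro_card_similitude:
  assumes "finite I" and Q: "star Q ** Q = mat c" "c \<noteq> 0"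
    and I: "\<And>a b. (a, b) \<in> I \<Longrightarrow> star a ** a = mat (1 / c) \<and> star b ** b = mat (1 / c)
      \<and> mat c ** star a ** x ** b \<in> integral_matrices"
    and ex: "\<And>g h. star g ** g = mat (1 / c) \<Longrightarrow> star h ** h = mat (1 / c) \<Longrightarrow> mat c ** star g ** x ** h \<in> integral_matrices \<Longrightarrow>
      \<exists>!p. p \<in> I \<and> mat c ** star (fst p) ** g \<in> integral_matrices \<and> mat c ** star (snd p) ** h \<in> integral_matrices"
  shows "ro (Q ** x ** matrix_inv Q) = of_nat (card I)"
proof -
  have sc: "mat c ** A = A ** mat c" "mat c ** mat (1 / c) = (mat 1 :: 'e^2^2)" "mat (1 / c) ** mat c = (mat 1 :: 'e^2^2)" for A :: "'e^2^2"
    using Q(2) by (simp_all add: matrix_2_eq_iff mult.commute)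
  have inv: "invertible Q"
  proof -
    have "mat (1 / c) ** star Q ** Q = mat 1" using sc(3) Q by (simp flip: matrix_mul_assoc)
    then show ?thesis by (metis matrix_left_right_inverse matrix_inv_unique(2))
  qed
  let ?Q = "matrix_inv Q"
  have QQ: "Q ** ?Q = mat 1" "?Q ** Q = mat 1" by (simp_all add: matrix_inv_left[OF inv] matrix_inv_right[OF inv])
  have sQ: "star Q = mat c ** ?Q"
  proof -
    have "star Q = star Q ** (Q ** ?Q)" by (simp add: QQ)
    then show ?thesis by (simp only: matrix_mul_assoc Q(1))
  qed
  have sQa: "star (Q ** a) ** (Q ** b) = mat c ** star a ** b" for a b
  proof -
    have "star (Q ** a) ** (Q ** b) = star a ** (star Q ** Q) ** b" by (simp only: star_mult matrix_mul_assoc)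
    then show ?thesis by (simp only: Q(1) sc(1))
  qed
  have UQ: "Q ** a \<in> U \<longleftrightarrow> star a ** a = mat (1 / c)" for a
  proof -
    have "Q ** a \<in> U \<longleftrightarrow> mat c ** (star a ** a) = mat 1" by (simp only: U_iff sQa) (simp only: matrix_mul_assoc)
    also have "\<dots> \<longleftrightarrow> star a ** a = mat (1 / c)"
    proof
      assume "mat c ** (star a ** a) = mat 1"
      then have "mat (1 / c) ** (mat c ** (star a ** a)) = mat (1 / c)" by simp
      moreover have "mat (1 / c) ** (mat c ** (star a ** a)) = (mat (1 / c) ** mat c) ** (star a ** a)" by (simp only: matrix_mul_assoc)
      ultimately show "star a ** a = mat (1 / c)" by (simp add: sc(3))
    qed (simp add: sc)
    finally show ?thesis .
  qed
  have act: "star (Q ** a) ** (Q ** x ** ?Q) ** (Q ** b) = mat c ** star a ** x ** b" for a b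
  proof -
    have "star (Q ** a) ** (Q ** x ** ?Q) ** (Q ** b) = (star (Q ** a) ** (Q ** x)) ** (?Q ** Q) ** b" by (simp only: matrix_mul_assoc)
    then show ?thesis by (simp only: sQa QQ matrix_mul_rid)
  qed
  have QI: "Q ** (?Q ** g) = g" for g :: "'e^2^2" by (simp add: matrix_mul_assoc QQ)
  \<comment> \<open>By \<open>UQ\<close>, left multiplication by \<open>Q\<close> carries the
    similitudes of multiplier \<open>1 / c\<close> to the unitary matrices.\<close>
  let ?f = "\<lambda>p. (Q ** fst p, Q ** snd p)"
  have inj: "inj ?f"
  proof (rule injI)
    fix p q assume "?f p = ?f q"
    then have "?Q ** (Q ** fst p) = ?Q ** (Q ** fst q)" "?Q ** (Q ** snd p) = ?Q ** (Q ** snd q)" by simp_all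
    then show "p = q" by (simp add: matrix_mul_assoc QQ prod_eq_iff)
  qed
  have "ro (Q ** x ** ?Q) = of_nat (card (?f ` I))"
  proof (rule ro_card)
    show "finite (?f ` I)" using assms(1) by simp
    fix a b assume "(a, b) \<in> ?f ` I"
    then show "a \<in> U \<and> b \<in> U \<and> star a ** (Q ** x ** ?Q) ** b \<in> integral_matrices"
      using I by (auto simp: UQ act)
  next
    fix g h assume gh: "g \<in> U" "h \<in> U" "star g ** (Q ** x ** ?Q) ** h \<in> integral_matrices"
    let ?g = "?Q ** g" and ?h = "?Q ** h"
    have "star ?g ** ?g = mat (1 / c)" "star ?h ** ?h = mat (1 / c)" using gh UQ[of ?g] UQ[of ?h] by (simp_all add: QI)
    moreover have "mat c ** star ?g ** x ** ?h \<in> integral_matrices" using gh(3) act[of ?g ?h] by (simp add: QI)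
    ultimately have e1: "\<exists>!p. p \<in> I \<and> mat c ** star (fst p) ** ?g \<in> integral_matrices \<and> mat c ** star (snd p) ** ?h \<in> integral_matrices"
      by (rule ex)
    obtain p where P: "p \<in> I \<and> mat c ** star (fst p) ** ?g \<in> integral_matrices \<and> mat c ** star (snd p) ** ?h \<in> integral_matrices"
      "\<forall>p'. p' \<in> I \<and> mat c ** star (fst p') ** ?g \<in> integral_matrices \<and> mat c ** star (snd p') ** ?h \<in> integral_matrices \<longrightarrow> p' = p"
      using e1 by (elim ex1E) (rule that)
    have p: "p \<in> I" "mat c ** star (fst p) ** ?g \<in> integral_matrices" "mat c ** star (snd p) ** ?h \<in> integral_matrices"
      by (rule conjunct1[OF P(1)], rule conjunct1[OF conjunct2[OF P(1)]], rule conjunct2[OF conjunct2[OF P(1)]])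
    have un: "p' = p" if "p' \<in> I" "mat c ** star (fst p') ** ?g \<in> integral_matrices" "mat c ** star (snd p') ** ?h \<in> integral_matrices" for p'
      by (rule P(2)[THEN spec, THEN mp, OF conjI[OF that(1) conjI[OF that(2,3)]]])
    have tr: "star (Q ** a) ** g = mat c ** star a ** ?g" "star (Q ** a) ** h = mat c ** star a ** ?h" for a
      using sQa[of a ?g] sQa[of a ?h] by (simp_all add: QI)
    show "\<exists>!p. p \<in> ?f ` I \<and> star (fst p) ** g \<in> integral_matrices \<and> star (snd p) ** h \<in> integral_matrices"
    proof (rule ex1I[of _ "?f p"])
      show "?f p \<in> ?f ` I \<and> star (fst (?f p)) ** g \<in> integral_matrices \<and> star (snd (?f p)) ** h \<in> integral_matrices"
        using p by (simp add: tr)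
      fix r assume "r \<in> ?f ` I \<and> star (fst r) ** g \<in> integral_matrices \<and> star (snd r) ** h \<in> integral_matrices"
      then obtain p' where "p' \<in> I" "r = ?f p'" "star (fst (?f p')) ** g \<in> integral_matrices" "star (snd (?f p')) ** h \<in> integral_matrices" by blast
      then show "r = ?f p" using un[of p'] by (simp add: tr)
    qed
  qed
  then show ?thesis by (simp only: card_image[OF inj_on_subset[OF inj subset_UNIV]])
qed

end

lemma vl_power: "x \<noteq> 0 \<Longrightarrow> vl (x ^ n) = int n * vl (x::'k::nonarch_local_field)"
  by (induction n) (simp_all add: vl_mult algebra_simps)

section \<open>Self-dual lattices and isotropic lines\<close>

context split_plane
begin

text \<open>Taken from the base field, so that \<sigma> fixes it; unramifiedness keeps it a
  uniformizer of the extension.\<close>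

definition p :: 'e where "p = \<iota> (SOME \<pi>. uniformizer \<pi>)"

lemma uniformizer_p: "uniformizer p" and \<sigma>_p [simp]: "\<sigma> p = p"
  unfolding p_def by (rule uniformizer_\<iota>, rule someI_ex, use ex_uniformizer in blast) simp

lemma p_neq_0 [simp]: "p \<noteq> 0" and nabs_p: "nabs p = rad TYPE('e)" and vl_p: "vl p = 1"
  using uniformizer_p by (auto simp: uniformizer_nabs vl_uniformizer uniformizer_def)

lemma nabs_p_power: "nabs (p ^ n) = rad TYPE('e) ^ n"
  by (simp add: nabs_power nabs_p)

lemma nabs_p_power_le: "nabs (p ^ n) \<le> 1"
  by (simp add: nabs_p_power power_le_one less_imp_le)

lemma S_D: "s \<in> S \<Longrightarrow> s \<noteq> 0 \<and> \<sigma> s = - (1 / s) \<and> nabs s = 1"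
proof -
  assume s: "s \<in> S"
  then have n: "N s = - 1" by (simp add: S_def)
  then have s0: "s \<noteq> 0" by auto
  have "\<sigma> s = N s / s" using s0 by simp
  also have "\<dots> = - (1 / s)" by (simp only: n minus_divide_left)
  finally show ?thesis using s0 nabs_S[OF s] by simp
qed

lemma four_neq_0 [simp]: "(4::'e) \<noteq> 0"
proof -
  have "(4::'e) = 2 * 2" by simp
  then show ?thesis using two_neq_0(1) by (metis mult_eq_0_iff)
qed

text \<open>The lattice spanned by \<open>p\<^sup>i e\<^sub>1\<close> and \<open>p\<^bsup>-j\<^esup> (e\<^sub>2 + s e\<^sub>1)\<close> with \<open>N s = -1\<close>; \<open>gm\<close> is a similitude
  which maps the standard lattice to it, scaling the isotropic lines through \<open>e\<^sub>2 \<plusminus> s e\<^sub>1\<close>.\<close>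

definition bm :: "nat \<Rightarrow> nat \<Rightarrow> 'e \<Rightarrow> 'e^2^2" where
  "bm i j s = mat2 (p ^ i) (s / p ^ j) 0 (1 / p ^ j)"

definition bi :: "nat \<Rightarrow> nat \<Rightarrow> 'e \<Rightarrow> 'e^2^2" where
  "bi i j s = mat2 (1 / p ^ i) (- s / p ^ i) 0 (p ^ j)"

definition gm :: "nat \<Rightarrow> nat \<Rightarrow> 'e \<Rightarrow> 'e^2^2" where
  "gm i j s = mat2 ((1 + p ^ i * p ^ j) / (2 * p ^ j)) (s * (1 - p ^ i * p ^ j) / (2 * p ^ j))
    ((1 - p ^ i * p ^ j) / (2 * s * p ^ j)) ((1 + p ^ i * p ^ j) / (2 * p ^ j))"

text \<open>The change of basis from the triangular \<open>bm\<close> to the similitude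
  \<open>gm\<close> (\<open>gm_eq\<close>). It has determinant 1 and is integral because 2 and
  \<open>s\<close> are units.\<close>

definition km :: "nat \<Rightarrow> nat \<Rightarrow> 'e \<Rightarrow> 'e^2^2" where
  "km i j s = mat2 1 (- s) ((1 - p ^ i * p ^ j) / (2 * s)) ((1 + p ^ i * p ^ j) / 2)"

definition ki :: "nat \<Rightarrow> nat \<Rightarrow> 'e \<Rightarrow> 'e^2^2" where
  "ki i j s = mat2 ((1 + p ^ i * p ^ j) / 2) s (- ((1 - p ^ i * p ^ j) / (2 * s))) 1"

lemma bm_inverse: "bi i j s ** bm i j s = mat 1" "bm i j s ** bi i j s = mat 1"
  by (simp_all add: bm_def bi_def matrix_2_eq_iff)

lemma km_inverse:
  assumes "s \<in> S"
  shows "ki i j s ** km i j s = mat 1" "km i j s ** ki i j s = mat 1"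
proof -
  have s: "s \<noteq> 0" using S_D[OF assms] by simp
  define u where "u = (1 + p ^ i * p ^ j) / 2"
  define v where "v = (1 - p ^ i * p ^ j) / 2"
  have "u + v = (1 + p ^ i * p ^ j + (1 - p ^ i * p ^ j)) / 2" unfolding u_def v_def by (rule add_divide_distrib[symmetric])
  then have uv: "u + v = 1" by simp
  then have uv': "v + u = 1" by (simp only: add.commute)
  have vs: "(1 - p ^ i * p ^ j) / (2 * s) = v / s" by (simp add: v_def)
  show "ki i j s ** km i j s = mat 1" "km i j s ** ki i j s = mat 1"
    using s uv uv' unfolding km_def ki_def vs u_def[symmetric] by (simp_all add: matrix_2_eq_iff mult.commute)
qed

lemma gm_eq:
  assumes "s \<in> S"
  shows "gm i j s = bm i j s ** km i j s"
proof -
  have s: "s \<noteq> 0" using S_D[OF assms] by simp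
  define a where "a = p ^ i"
  define b where "b = p ^ j"
  have b: "b \<noteq> 0" by (simp add: b_def)
  have "a + s / b * ((1 - a * b) / (2 * s)) = (1 + a * b) / (2 * b)"
    using s b by (simp add: divide_simps; simp add: algebra_simps)
  moreover have "a * - s + s / b * ((1 + a * b) / 2) = s * (1 - a * b) / (2 * b)"
    using s b by (simp add: divide_simps; simp add: algebra_simps)
  ultimately show ?thesis using s b
    unfolding gm_def bm_def km_def a_def[symmetric] b_def[symmetric] by (simp add: matrix_2_eq_iff)
qed

text \<open>\<open>gm\<close> multiplies the isotropic vector \<open>e_2 + s e_1\<close> by
  \<open>1 / p ^ j\<close> and \<open>e_2 - s e_1\<close> by \<open>p ^ i\<close>. The form sees
  only the pairing between the two lines, which is multiplied by the product of these
  factors.\<close>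

lemma gm_similitude:
  assumes "s \<in> S"
  shows "star (gm i j s) ** gm i j s = mat (p ^ i / p ^ j)"
proof -
  have s: "s \<noteq> 0" "\<sigma> s = - (1 / s)" using S_D[OF assms] by simp_all
  define a where "a = p ^ i"
  define b where "b = p ^ j"
  have b: "b \<noteq> 0" "\<sigma> b = b" "\<sigma> a = a" by (simp_all add: a_def b_def)
  show ?thesis using s b
    unfolding gm_def a_def[symmetric] b_def[symmetric]
    by (simp add: matrix_2_eq_iff divide_simps; simp add: algebra_simps)
qed

lemma km_integral:
  assumes "s \<in> S"
  shows "km i j s \<in> integral_matrices" "ki i j s \<in> integral_matrices"
proof -
  have s: "nabs s = 1" using S_D[OF assms] by simp
  have pp: "nabs (p ^ i * p ^ j) \<le> 1" using nabs_p_power_le[of "i + j"] by (simp add: power_add)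
  have "nabs (1 + p ^ i * p ^ j) \<le> 1" "nabs (1 - p ^ i * p ^ j) \<le> 1" using pp by (auto intro: nabs_add_le nabs_diff_le)
  then show "km i j s \<in> integral_matrices" "ki i j s \<in> integral_matrices"
    using s by (simp_all add: integral_matrices_iff km_def ki_def nabs_divide nabs_mult nabs_two)
qed

lemma unimodular_left:
  assumes "k' ** k = mat 1" "k \<in> integral_matrices" "k' \<in> integral_matrices"
  shows "k ** y \<in> integral_matrices \<longleftrightarrow> y \<in> (integral_matrices :: ('e^2^2) set)"
proof
  assume "k ** y \<in> integral_matrices"
  then have "k' ** (k ** y) \<in> integral_matrices" by (rule integral_matrices_mult[OF assms(3)])
  then show "y \<in> integral_matrices" by (simp add: matrix_mul_assoc assms(1))
qed (rule integral_matrices_mult[OF assms(2)])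

lemma unimodular_right:
  assumes "k ** k' = mat 1" "k \<in> integral_matrices" "k' \<in> integral_matrices"
  shows "y ** k \<in> integral_matrices \<longleftrightarrow> y \<in> (integral_matrices :: ('e^2^2) set)"
proof
  assume "y ** k \<in> integral_matrices"
  then have "(y ** k) ** k' \<in> integral_matrices" by (rule integral_matrices_mult[OF _ assms(3)])
  then show "y \<in> integral_matrices" by (simp add: assms(1) flip: matrix_mul_assoc)
qed (rule integral_matrices_mult[OF _ assms(2)])

text \<open>Both sides are inverse to \<open>gm i j s\<close>, the left one by the similitude
  relation and the right one by the factorization \<open>gm_eq\<close>.\<close>

lemma gm_star:
  assumes s: "s \<in> S" and j: "j = i + c"
  shows "mat (p ^ c) ** star (gm i j s) = ki i j s ** bi i j s"
proof -
  have "mat (p ^ c) ** star (gm i j s) ** gm i j s = mat (p ^ c) ** mat (p ^ i / p ^ j)"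
    using gm_similitude[OF s] by (simp flip: matrix_mul_assoc)
  also have "\<dots> = mat 1" by (simp add: j power_add matrix_2_eq_iff)
  finally have 1: "mat (p ^ c) ** star (gm i j s) ** gm i j s = mat 1" .
  have "gm i j s ** (ki i j s ** bi i j s) = bm i j s ** (km i j s ** ki i j s) ** bi i j s"
    by (simp only: gm_eq[OF s] matrix_mul_assoc)
  then have 2: "gm i j s ** (ki i j s ** bi i j s) = mat 1" by (simp add: km_inverse[OF s] bm_inverse)
  have "mat (p ^ c) ** star (gm i j s) = mat (p ^ c) ** star (gm i j s) ** (gm i j s ** (ki i j s ** bi i j s))"
    by (simp add: 2)
  also have "\<dots> = (mat (p ^ c) ** star (gm i j s) ** gm i j s) ** (ki i j s ** bi i j s)" by (simp only: matrix_mul_assoc)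
  finally show ?thesis by (simp add: 1)
qed

text \<open>Up to a unimodular factor on the left, the inverse of \<open>gm\<close> is the
  triangular \<open>bi\<close>, which makes the integrality conditions explicit.\<close>

lemma gm_integral:
  assumes s: "s \<in> S" and j: "j = i + c"
  shows "mat (p ^ c) ** star (gm i j s) ** h \<in> integral_matrices \<longleftrightarrow> bi i j s ** h \<in> integral_matrices"
  unfolding gm_star[OF assms] matrix_mul_assoc[symmetric]
  by (rule unimodular_left[OF km_inverse(2)[OF s] km_integral(2,1)[OF s]])

lemma gm_integral_pair:
  assumes s: "s \<in> S" and j: "j = i + c" and t: "t \<in> S"
  shows "mat (p ^ c) ** star (gm i j s) ** x ** gm k l t \<in> integral_matrices
    \<longleftrightarrow> bi i j s ** x ** bm k l t \<in> integral_matrices"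
proof -
  have "mat (p ^ c) ** star (gm i j s) ** (x ** gm k l t) \<in> integral_matrices \<longleftrightarrow> bi i j s ** (x ** gm k l t) \<in> integral_matrices"
    by (rule gm_integral[OF s j])
  also have "bi i j s ** (x ** gm k l t) = (bi i j s ** x ** bm k l t) ** km k l t"
    by (simp only: gm_eq[OF t] matrix_mul_assoc)
  also have "\<dots> \<in> integral_matrices \<longleftrightarrow> bi i j s ** x ** bm k l t \<in> integral_matrices"
    by (rule unimodular_right[OF km_inverse(2)[OF t] km_integral[OF t]])
  finally show ?thesis by (simp only: matrix_mul_assoc)
qed

text \<open>The entries are those of a similitude, whose columns span the lattice. The larger lower
  entry \<open>c\<close> fixes the depth \<open>i\<close>, and the slope \<open>a / c\<close>
  satisfies the norm equation modulo the power \<open>i + (i + e)\<close> of the maximal ideal, so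
  that it can be replaced by an isotropic slope.\<close>

lemma lattice_cover_aux:
  assumes P: "N a + N c = 1 / p ^ e" "N c + N d = 1 / p ^ e" and cd: "nabs d \<le> nabs c"
    and D: "nabs (a * d - b * c) = rad TYPE('e) powi (- int e)" and e: "e \<le> 1"
  shows "\<exists>i. \<forall>T. (\<forall>s\<in>S. \<exists>t\<in>T. dist s t \<le> rad TYPE('e) ^ (i + (i + e))) \<longrightarrow> (\<exists>t\<in>T.
    nabs ((a - t * c) / p ^ i) \<le> 1 \<and> nabs ((b - t * d) / p ^ i) \<le> 1 \<and> nabs (p ^ (i + e) * c) \<le> 1 \<and> nabs (p ^ (i + e) * d) \<le> 1)"
proof -
  let ?r = "rad TYPE('e)"
  have c0: "c \<noteq> 0"
  proof
    assume c: "c = 0"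
    then have "nabs d \<le> 0" using cd by simp
    then have "d = 0" using nabs_nonneg[of d] nabs_eq_0_iff[of d] by linarith
    then show False using P(2) c by simp
  qed
  have rp: "nabs (1 / p ^ e) = ?r powi (- int e)" by (simp add: nabs_divide nabs_p_power power_int_minus field_simps)
  have nc: "nabs c = ?r powi vl c" by (rule nabs_vl[OF c0])
  have nc2: "nabs (N c) = ?r powi (2 * vl c)" using nabs_vl[of "N c"] vl_N[OF c0] c0 by simp
  have "nabs (N d) \<le> nabs (N c)" using cd by (simp add: nabs_mult mult_mono)
  then have "nabs (N c + N d) \<le> nabs (N c)" by (intro nabs_add_le) auto
  then have "?r powi (- int e) \<le> ?r powi (2 * vl c)" by (simp only: P(2) rp nc2)
  then have v: "2 * vl c \<le> - int e" by (simp only: rad_powi_le)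
  \<comment> \<open>For \<open>e \<le> 1\<close> integrality of the valuation sharpens
    \<open>2 * vl c \<le> - e\<close> to \<open>vl c \<le> - e\<close>, so \<open>nat\<close>
    truncates nothing.\<close>
  define i where "i = nat (- vl c - int e)"
  have vc: "vl c = - int (i + e)" using v e by (simp add: i_def)
  let ?I = "i + (i + e)"
  define s0 where "s0 = a / c"
  have Ns0: "nabs (N s0 + 1) = ?r ^ ?I"
  proof -
    have "N s0 = N a / N c" by (simp add: s0_def)
    then have "N s0 + 1 = (N a + N c) / N c" using c0 by (simp add: add_divide_distrib)
    then have "nabs (N s0 + 1) = ?r powi (- int e) / ?r powi (2 * vl c)" by (simp only: P(1) nabs_divide[of "1 / p ^ e"] rp nc2)
    also have "\<dots> = ?r powi (- int e - 2 * vl c)" by (simp add: power_int_diff)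
    also have "- int e - 2 * vl c = int ?I" by (simp add: vc)
    finally show ?thesis by (simp only: power_int_of_nat)
  qed
  have ex1: "\<exists>s\<in>S. nabs (s - s0) \<le> ?r ^ ?I"
  proof (cases "?I = 0")
    case False
    then have "1 \<le> ?I" by linarith
    then show ?thesis by (rule S_approx[OF _ eq_refl[OF Ns0]])
  next
    case True
    \<comment> \<open>At exponent 0 \<open>S_approx\<close> does not apply, but the slope
      \<open>s0\<close> is integral and any element of \<open>S\<close> is within distance 1 of
      it.\<close>
    obtain s where s: "s \<in> S" using S_nonempty by blast
    have "nabs (N s0 + 1) \<le> 1" using Ns0 True by simp
    then have "nabs ((N s0 + 1) - 1) \<le> 1" by (rule nabs_diff_le) simp
    then have "nabs s0 ^ 2 \<le> 1" using nabs_N[of s0] by simp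
    then have "nabs s0 \<le> 1" using nabs_nonneg[of s0] by (simp add: power_le_one_iff)
    then have "nabs (s - s0) \<le> 1" using nabs_S[OF s] by (intro nabs_diff_le) auto
    then show ?thesis using s True by auto
  qed
  show ?thesis
  proof (rule exI[of _ i], intro allI impI)
    fix T :: "'e set" assume T: "\<forall>s\<in>S. \<exists>t\<in>T. dist s t \<le> ?r ^ ?I"
    obtain s where s: "s \<in> S" "nabs (s - s0) \<le> ?r ^ ?I" using ex1 by blast
    then obtain t where t: "t \<in> T" "dist s t \<le> ?r ^ ?I" using T by blast
    have "nabs ((s - t) - (s - s0)) \<le> ?r ^ ?I" using s t by (intro nabs_diff_le[of "s - t"]) (auto simp: dist_eq_nabs)
    moreover have "(s - t) - (s - s0) = s0 - t" by simp
    ultimately have ts: "nabs (s0 - t) \<le> ?r powi int ?I" by (simp only: power_int_of_nat)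
    have le: "nabs ((s0 - t) * y) \<le> ?r powi int i" if "nabs y \<le> nabs c" for y
    proof -
      have "nabs ((s0 - t) * y) \<le> ?r powi int ?I * ?r powi vl c"
        unfolding nabs_mult using ts that nc by (intro mult_mono) (auto simp: less_imp_le)
      also have "\<dots> = ?r powi (int ?I + vl c)" by (simp add: power_int_add)
      also have "int ?I + vl c = int i" by (simp add: vc)
      finally show ?thesis .
    qed
    have div: "nabs (y / p ^ i) \<le> 1 \<longleftrightarrow> nabs y \<le> ?r powi int i" for y
      by (simp add: nabs_divide nabs_p_power divide_le_eq)
    have "a - t * c = (s0 - t) * c" using c0 by (simp add: s0_def algebra_simps)
    then have 1: "nabs ((a - t * c) / p ^ i) \<le> 1" using div le[of c] by simp
    \<comment> \<open>The second column has the same slope up to the determinant divided by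
      \<open>c\<close>, and the multiplier prescribes the size of the determinant.\<close>
    have e2: "b - t * d = (s0 - t) * d - (a * d - b * c) / c" using c0 by (simp add: s0_def field_simps)
    have "nabs ((a * d - b * c) / c) = ?r powi (- int e - vl c)" by (simp add: nabs_divide D nc power_int_diff)
    also have "- int e - vl c = int i" by (simp add: vc)
    finally have "nabs ((a * d - b * c) / c) \<le> ?r powi int i" by simp
    then have 2: "nabs ((b - t * d) / p ^ i) \<le> 1" using div le[OF cd] unfolding e2 by (intro iffD2[OF div] nabs_diff_le)
    have 3: "nabs (p ^ (i + e) * c) \<le> 1"
    proof -
      have "nabs (p ^ (i + e) * c) = ?r powi int (i + e) * ?r powi vl c"
        by (simp only: nabs_mult nabs_p_power nc power_int_of_nat)
      also have "\<dots> = ?r powi (int (i + e) + vl c)" by (simp add: power_int_add)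
      finally show ?thesis by (simp add: vc)
    qed
    have "nabs (p ^ (i + e) * d) \<le> nabs (p ^ (i + e) * c)" using cd by (simp add: nabs_mult mult_left_mono)
    then have 4: "nabs (p ^ (i + e) * d) \<le> 1" using 3 by linarith
    show "\<exists>t\<in>T. nabs ((a - t * c) / p ^ i) \<le> 1 \<and> nabs ((b - t * d) / p ^ i) \<le> 1 \<and> nabs (p ^ (i + e) * c) \<le> 1 \<and> nabs (p ^ (i + e) * d) \<le> 1"
      using t(1) 1 2 3 4 by blast
  qed
qed

text \<open>The rows of a similitude satisfy the same norm relations as its columns. Interchanging
  the columns of \<open>h\<close> does not affect integrality, so the case in which \<open>d\<close>
  is the larger lower entry reduces to the other one.\<close>

lemma lattice_cover:
  assumes h: "star h ** h = mat (1 / p ^ e)" and e: "e \<le> 1"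
    and T: "\<And>I s. s \<in> S \<Longrightarrow> \<exists>t\<in>T I. dist s t \<le> rad TYPE('e) ^ I"
  shows "\<exists>i. \<exists>t\<in>T (i + (i + e)). bi i (i + e) t ** h \<in> integral_matrices"
proof -
  let ?P = "1 / p ^ e"
  obtain a b c d where hh: "h = mat2 a b c d" by (rule mat2_cases)
  have com: "h ** star h = mat ?P"
  proof -
    have "mat (p ^ e) ** star h ** h = mat (p ^ e) ** mat ?P" by (simp add: h flip: matrix_mul_assoc)
    also have "\<dots> = mat 1" by (simp add: matrix_2_eq_iff)
    finally have "h ** (mat (p ^ e) ** star h) = mat 1" by (simp add: matrix_left_right_inverse)
    then have "mat ?P ** (h ** (mat (p ^ e) ** star h)) = mat ?P" by simp
    moreover have "mat ?P ** (h ** (mat (p ^ e) ** star h)) = h ** star h" by (simp add: matrix_2_eq_iff field_simps)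
    ultimately show ?thesis by simp
  qed
  have P: "N a + N c = ?P" "N b + N d = ?P" using h by (simp_all add: hh matrix_2_eq_iff mult.commute)
  have Pr: "N c + N d = ?P" using com by (simp add: hh matrix_2_eq_iff)
  have D: "nabs (a * d - b * c) = rad TYPE('e) powi (- int e)"
  proof -
    have "det (star h ** h) = det (mat ?P :: 'e^2^2)" by (simp only: h)
    moreover have "det (mat ?P :: 'e^2^2) = ?P * ?P" by (simp add: det_2)
    ultimately have "\<sigma> (det h) * det h = ?P * ?P" by (simp only: det_mul det_star)
    then have "N (det h) = ?P * ?P" by (simp only: mult.commute)
    then have "nabs (N (det h)) = nabs ?P ^ 2" by (simp only: nabs_mult power2_eq_square)
    then have "nabs (det h) ^ 2 = nabs ?P ^ 2" by (simp only: nabs_N)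
    then have "nabs (det h) = nabs ?P" by (rule power2_eq_imp_eq) auto
    then show ?thesis by (simp add: hh nabs_divide nabs_p_power power_int_minus field_simps)
  qed
  have D': "nabs (b * c - a * d) = rad TYPE('e) powi (- int e)" using D nabs_minus_commute by metis
  have mem: "bi i (i + e) t ** h \<in> integral_matrices \<longleftrightarrow> nabs ((a - t * c) / p ^ i) \<le> 1 \<and> nabs ((b - t * d) / p ^ i) \<le> 1
      \<and> nabs (p ^ (i + e) * c) \<le> 1 \<and> nabs (p ^ (i + e) * d) \<le> 1" for i t
  proof -
    have 1: "1 / p ^ i * y + - t / p ^ i * z = (y - t * z) / p ^ i" for y z by (simp add: diff_divide_distrib)
    show ?thesis unfolding integral_matrices_iff matrix_2_mult hh bi_def mat2_nth 1 mult_zero_left add_0_left ..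
  qed
  show ?thesis
  proof (cases "nabs d \<le> nabs c")
    case True
    obtain i where i: "(\<forall>s\<in>S. \<exists>t\<in>T (i + (i + e)). dist s t \<le> rad TYPE('e) ^ (i + (i + e))) \<longrightarrow> (\<exists>t\<in>T (i + (i + e)).
      nabs ((a - t * c) / p ^ i) \<le> 1 \<and> nabs ((b - t * d) / p ^ i) \<le> 1 \<and> nabs (p ^ (i + e) * c) \<le> 1 \<and> nabs (p ^ (i + e) * d) \<le> 1)"
      using lattice_cover_aux[OF P(1) Pr True D e] by metis
    have "\<forall>s\<in>S. \<exists>t\<in>T (i + (i + e)). dist s t \<le> rad TYPE('e) ^ (i + (i + e))" using T by (rule ballI)
    with i have "\<exists>t\<in>T (i + (i + e)). bi i (i + e) t ** h \<in> integral_matrices" unfolding mem by (rule mp)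
    then show ?thesis by (rule exI)
  next
    case False
    then have dc: "nabs c \<le> nabs d" by simp
    obtain i where i: "(\<forall>s\<in>S. \<exists>t\<in>T (i + (i + e)). dist s t \<le> rad TYPE('e) ^ (i + (i + e))) \<longrightarrow> (\<exists>t\<in>T (i + (i + e)).
      nabs ((b - t * d) / p ^ i) \<le> 1 \<and> nabs ((a - t * c) / p ^ i) \<le> 1 \<and> nabs (p ^ (i + e) * d) \<le> 1 \<and> nabs (p ^ (i + e) * c) \<le> 1)"
      using lattice_cover_aux[OF P(2) _ dc D' e] Pr by (metis add.commute)
    have "\<forall>s\<in>S. \<exists>t\<in>T (i + (i + e)). dist s t \<le> rad TYPE('e) ^ (i + (i + e))" using T by (rule ballI)
    with i have "\<exists>t\<in>T (i + (i + e)). nabs ((b - t * d) / p ^ i) \<le> 1 \<and> nabs ((a - t * c) / p ^ i) \<le> 1 \<and> nabs (p ^ (i + e) * d) \<le> 1 \<and> nabs (p ^ (i + e) * c) \<le> 1"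
      by (rule mp)
    then have "\<exists>t\<in>T (i + (i + e)). bi i (i + e) t ** h \<in> integral_matrices" unfolding mem by (simp only: conj_ac)
    then show ?thesis by (rule exI)
  qed
qed

text \<open>Between similitudes of the same multiplier, integrality means that they span the same
  lattice. Comparing its two triangular bases in both directions gives equal depths and congruent
  slopes.\<close>

lemma lattice_unique:
  assumes h: "star h ** h = mat (1 / p ^ e)" and s: "s \<in> S" "t \<in> S"
    and m: "bi i (i + e) s ** h \<in> integral_matrices" "bi k (k + e) t ** h \<in> integral_matrices"
  shows "i = k \<and> dist s t \<le> rad TYPE('e) ^ (i + (i + e))"
proof -
  \<comment> \<open>The left factor is the inverse of \<open>gm\<close>. Similitudes of equal
    multiplier have a unitary quotient, and an integral one lies in \<open>K\<close>.\<close>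
  have U: "mat (p ^ e) ** star (gm l (l + e) u) ** h \<in> K" if u: "u \<in> S" "bi l (l + e) u ** h \<in> integral_matrices" for l u
  proof -
    let ?g = "gm l (l + e) u"
    have g: "star ?g ** ?g = mat (1 / p ^ e)" using gm_similitude[OF u(1), of l "l + e"] by (simp add: power_add)
    have c: "mat (p ^ e) ** A = A ** mat (p ^ e)" for A :: "'e^2^2" by (simp add: matrix_2_eq_iff mult.commute)
    have gi: "?g ** (mat (p ^ e) ** star ?g) = mat 1"
    proof -
      have "(mat (p ^ e) ** star ?g) ** ?g = mat (p ^ e) ** mat (1 / p ^ e)" by (simp add: g flip: matrix_mul_assoc)
      also have "\<dots> = mat 1" by (simp add: matrix_2_eq_iff)
      finally show ?thesis by (simp add: matrix_left_right_inverse)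
    qed
    have sm: "star (mat (p ^ e)) = mat (p ^ e)" by (simp add: matrix_2_eq_iff)
    have "star (mat (p ^ e) ** star ?g ** h) ** (mat (p ^ e) ** star ?g ** h)
      = star h ** (?g ** (star (mat (p ^ e)) ** (mat (p ^ e) ** star ?g))) ** h" by (simp only: star_mult star_star matrix_mul_assoc)
    also have "?g ** (star (mat (p ^ e)) ** (mat (p ^ e) ** star ?g)) = (?g ** (mat (p ^ e) ** star ?g)) ** mat (p ^ e)"
      unfolding sm c[of "mat (p ^ e) ** star ?g"] by (simp only: matrix_mul_assoc)
    also have "\<dots> = mat (p ^ e)" by (simp add: gi)
    also have "star h ** mat (p ^ e) ** h = mat (p ^ e) ** (star h ** h)" by (simp only: c[symmetric] matrix_mul_assoc)
    also have "\<dots> = mat 1" unfolding h by (simp add: matrix_2_eq_iff)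
    finally have "mat (p ^ e) ** star ?g ** h \<in> U" by (simp add: U_iff)
    moreover have "mat (p ^ e) ** star ?g ** h \<in> integral_matrices" using gm_integral[OF u(1), of "l + e" l e h] u(2) by simp
    ultimately show ?thesis by (simp add: K_def)
  qed
  have hs: "h ** star h = mat (1 / p ^ e)"
  proof -
    have "mat (p ^ e) ** star h ** h = mat (p ^ e) ** mat (1 / p ^ e)" by (simp add: h flip: matrix_mul_assoc)
    also have "\<dots> = mat 1" by (simp add: matrix_2_eq_iff)
    finally have "h ** (mat (p ^ e) ** star h) = mat 1" by (simp add: matrix_left_right_inverse)
    then have "mat (1 / p ^ e) ** (h ** (mat (p ^ e) ** star h)) = mat (1 / p ^ e)" by simp
    moreover have "mat (1 / p ^ e) ** (h ** (mat (p ^ e) ** star h)) = h ** star h" by (simp add: matrix_2_eq_iff field_simps)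
    ultimately show ?thesis by simp
  qed
  have pair: "bi l (l + e) u ** bm l' (l' + e) u' \<in> integral_matrices"
    if u: "u \<in> S" "bi l (l + e) u ** h \<in> integral_matrices" and u': "u' \<in> S" "bi l' (l' + e) u' ** h \<in> integral_matrices" for l u l' u'
  proof -
    let ?g = "gm l (l + e) u" and ?g' = "gm l' (l' + e) u'"
    have "star (mat (p ^ e) ** star ?g' ** h) \<in> integral_matrices" using U[OF u'] by (simp add: K_def)
    moreover have "mat (p ^ e) ** star ?g ** h \<in> integral_matrices" using U[OF u] by (simp add: K_def)
    ultimately have "(mat (p ^ e) ** star ?g ** h) ** star (mat (p ^ e) ** star ?g' ** h) \<in> integral_matrices"
      by (intro integral_matrices_mult[of "mat (p ^ e) ** star ?g ** h"])
    moreover have "(mat (p ^ e) ** star ?g ** h) ** star (mat (p ^ e) ** star ?g' ** h)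
      = mat (p ^ e) ** star ?g ** ((h ** star h) ** (?g' ** star (mat (p ^ e))))" by (simp only: star_mult star_star matrix_mul_assoc)
    moreover have "(h ** star h) ** (?g' ** star (mat (p ^ e))) = ?g'" unfolding hs by (simp add: matrix_2_eq_iff)
    ultimately have "mat (p ^ e) ** star ?g ** ?g' \<in> integral_matrices" by simp
    then have "mat (p ^ e) ** star ?g ** mat 1 ** ?g' \<in> integral_matrices" by simp
    then have "bi l (l + e) u ** mat 1 ** bm l' (l' + e) u' \<in> integral_matrices"
      by (simp only: gm_integral_pair[OF u(1) refl u'(1)])
    then show ?thesis by simp
  qed
  have ent: "nabs (p ^ l' / p ^ l) \<le> 1 \<and> nabs ((u' - u) / (p ^ l * p ^ (l' + e))) \<le> 1"
    if "bi l (l + e) u ** bm l' (l' + e) u' \<in> integral_matrices" for l u l' u'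
    using that by (simp add: integral_matrices_iff bi_def bm_def diff_divide_distrib mult.commute)
  have le: "l \<le> l'" if "nabs (p ^ l' / p ^ l) \<le> 1" for l l'
  proof -
    have "vl (p ^ l' / p ^ l) \<ge> 0" using that by (subst vl_nonneg_iff) auto
    then show ?thesis by (simp add: vl_divide vl_power vl_p)
  qed
  have "i = k" using le ent[OF pair[OF s(1) m(1) s(2) m(2)]] ent[OF pair[OF s(2) m(2) s(1) m(1)]] by (meson antisym)
  moreover have "nabs ((t - s) / (p ^ i * p ^ (k + e))) \<le> 1" using ent[OF pair[OF s(1) m(1) s(2) m(2)]] by blast
  ultimately show ?thesis
    by (simp add: dist_eq_nabs nabs_minus_commute nabs_divide nabs_p_power divide_le_eq flip: power_add)
qed

end

section \<open>Pairs of self-dual lattices\<close>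

context split_plane
begin

definition TS :: "nat \<Rightarrow> 'e set" where
  "TS I = (SOME T. finite T \<and> card T = cc I \<and> transversal S (rad TYPE('e) ^ I) T)"

lemma TS: "finite (TS I)" "card (TS I) = cc I" "transversal S (rad TYPE('e) ^ I) (TS I)"
  unfolding TS_def using someI_ex[OF transversal_S[of I]] by blast+

lemma TS_S: "s \<in> TS I \<Longrightarrow> s \<in> S"
  using TS(3)[of I] by (auto simp: transversal_def)

lemma TS_ex: "s \<in> S \<Longrightarrow> \<exists>t\<in>TS I. dist s t \<le> rad TYPE('e) ^ I"
  using TS(3)[of I] unfolding transversal_def by blast

lemma TS_unique: "s \<in> TS I \<Longrightarrow> t \<in> TS I \<Longrightarrow> dist s t \<le> rad TYPE('e) ^ I \<Longrightarrow> s = t"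
proof -
  assume a: "s \<in> TS I" "t \<in> TS I" "dist s t \<le> rad TYPE('e) ^ I"
  have "\<exists>!u. u \<in> TS I \<and> dist s u \<le> rad TYPE('e) ^ I" using TS(3)[of I] TS_S[OF a(1)] unfolding transversal_def by blast
  moreover have "dist s s \<le> rad TYPE('e) ^ I" by simp
  ultimately show "s = t" using a by blast
qed

text \<open>The product is upper triangular: the diagonal entries compare the depths of the two
  lattices, the remaining one their slopes.\<close>

lemma entry_condition:
  assumes xab: "xa \<noteq> 0" "xb \<noteq> 0"
  shows "bi i (i + e) s ** mat2 xa 0 0 xb ** bm k (k + e) t \<in> integral_matrices \<longleftrightarrow>
    int i \<le> int k + vl xa \<and> int k \<le> int i + vl xb \<and> nabs (xa * t - xb * s) \<le> rad TYPE('e) ^ (i + (k + e))"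
proof -
  have 1: "nabs (xa * p ^ k / p ^ i) \<le> 1 \<longleftrightarrow> int i \<le> int k + vl xa"
    using xab by (subst vl_nonneg_iff[symmetric]) (auto simp: vl_divide vl_mult vl_power vl_p)
  have 2: "nabs (xb * p ^ (i + e) / p ^ (k + e)) \<le> 1 \<longleftrightarrow> int k \<le> int i + vl xb"
    using xab by (subst vl_nonneg_iff[symmetric]) (auto simp: vl_divide vl_mult vl_power vl_p simp del: power_add)
  have 3: "nabs ((xa * t - xb * s) / (p ^ i * p ^ (k + e))) \<le> 1 \<longleftrightarrow> nabs (xa * t - xb * s) \<le> rad TYPE('e) ^ (i + (k + e))"
    by (simp add: nabs_divide nabs_p_power divide_le_eq flip: power_add)
  have e: "bi i (i + e) s ** mat2 xa 0 0 xb ** bm k (k + e) t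
    = mat2 (xa * p ^ k / p ^ i) ((xa * t - xb * s) / (p ^ i * p ^ (k + e))) 0 (xb * p ^ (i + e) / p ^ (k + e))"
    by (simp add: bi_def bm_def matrix_2_eq_iff diff_divide_distrib mult.commute)
  show ?thesis unfolding e integral_matrices_iff mat2_nth 1 2 3 by auto
qed

text \<open>The pairs of lattices \<open>(L, M)\<close>, where \<open>L\<close> has the parameters \<open>(i, s)\<close> and \<open>M\<close> has \<open>(k, t)\<close>.\<close>

definition pairs :: "nat \<Rightarrow> 'e \<Rightarrow> 'e \<Rightarrow> (nat \<times> nat \<times> 'e \<times> 'e) set" where
  "pairs e xa xb = {(i, k, s, t). s \<in> TS (i + (i + e)) \<and> t \<in> TS (k + (k + e))
    \<and> int i \<le> int k + vl xa \<and> int k \<le> int i + vl xb \<and> nabs (xa * t - xb * s) \<le> rad TYPE('e) ^ (i + (k + e))}"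

text \<open>The identity as \<open>Q\<close> with \<open>e = 0\<close> treats the diagonal matrix, a
  \<open>Q\<close> of multiplier \<open>p\<close> with \<open>e = 1\<close> its conjugate.
  Representatives exist by \<open>lattice_cover\<close> and are unique by
  \<open>lattice_unique\<close> and \<open>TS_unique\<close>.\<close>

lemma ro_pairs:
  assumes fin: "finite (pairs e xa xb)" and e: "e \<le> 1" and xab: "xa \<noteq> 0" "xb \<noteq> 0"
    and Q: "star Q ** Q = mat (p ^ e)"
  shows "ro (Q ** mat2 xa 0 0 xb ** matrix_inv Q) = of_nat (card (pairs e xa xb))"
proof -
  let ?f = "\<lambda>(i, k, s, t). (gm i (i + e) s, gm k (k + e) t)"
  let ?x = "mat2 xa 0 0 xb"
  have g: "star (gm i (i + e) s) ** gm i (i + e) s = mat (1 / p ^ e)" if "s \<in> S" for i s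
    using gm_similitude[OF that, of i "i + e"] by (simp add: power_add)
  have self: "bi i (i + e) s ** gm i (i + e) s \<in> integral_matrices" if s: "s \<in> S" for i s
  proof -
    have "bi i (i + e) s ** gm i (i + e) s = (bi i (i + e) s ** bm i (i + e) s) ** km i (i + e) s"
      by (simp only: gm_eq[OF s] matrix_mul_assoc)
    then show ?thesis using km_integral(1)[OF s] by (simp add: bm_inverse)
  qed
  have uq: "i = k \<and> s = t" if h: "star h ** h = mat (1 / p ^ e)" and st: "s \<in> TS (i + (i + e))" "t \<in> TS (k + (k + e))"
    and m: "bi i (i + e) s ** h \<in> integral_matrices" "bi k (k + e) t ** h \<in> integral_matrices" for i k s t h
    using lattice_unique[OF h TS_S[OF st(1)] TS_S[OF st(2)] m] TS_unique st by auto
  have inj: "inj_on ?f (pairs e xa xb)"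
  proof (rule inj_onI)
    fix y y' assume y: "y \<in> pairs e xa xb" "y' \<in> pairs e xa xb" "?f y = ?f y'"
    obtain i k s t where yy: "y = (i, k, s, t)" by (cases y) auto
    obtain i' k' s' t' where yy': "y' = (i', k', s', t')" by (cases y') auto
    have eq: "gm i (i + e) s = gm i' (i' + e) s'" "gm k (k + e) t = gm k' (k' + e) t'" using y(3) by (simp_all add: yy yy')
    have m: "s \<in> TS (i + (i + e))" "t \<in> TS (k + (k + e))" "s' \<in> TS (i' + (i' + e))" "t' \<in> TS (k' + (k' + e))"
      using y(1,2) by (auto simp: pairs_def yy yy')
    have "bi i' (i' + e) s' ** gm i (i + e) s \<in> integral_matrices" unfolding eq(1) by (rule self[OF TS_S[OF m(3)]])
    then have "i = i' \<and> s = s'" by (rule uq[OF g[OF TS_S[OF m(1)]] m(1) m(3) self[OF TS_S[OF m(1)]]])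
    moreover have "bi k' (k' + e) t' ** gm k (k + e) t \<in> integral_matrices" unfolding eq(2) by (rule self[OF TS_S[OF m(4)]])
    then have "k = k' \<and> t = t'" by (rule uq[OF g[OF TS_S[OF m(2)]] m(2) m(4) self[OF TS_S[OF m(2)]]])
    ultimately show "y = y'" by (simp add: yy yy')
  qed
  have "ro (Q ** ?x ** matrix_inv Q) = of_nat (card (?f ` pairs e xa xb))"
  proof (rule ro_card_similitude[OF _ Q])
    show "finite (?f ` pairs e xa xb)" using fin by simp
    show "p ^ e \<noteq> 0" by simp
    fix a b assume "(a, b) \<in> ?f ` pairs e xa xb"
    then obtain i k s t where ab: "a = gm i (i + e) s" "b = gm k (k + e) t" "(i, k, s, t) \<in> pairs e xa xb" by auto
    then have st: "s \<in> S" "t \<in> S" and "bi i (i + e) s ** ?x ** bm k (k + e) t \<in> integral_matrices"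
      using TS_S by (auto simp: pairs_def entry_condition[OF xab])
    then have "mat (p ^ e) ** star a ** ?x ** b \<in> integral_matrices"
      unfolding ab by (simp only: gm_integral_pair[OF st(1) refl st(2)])
    then show "star a ** a = mat (1 / p ^ e) \<and> star b ** b = mat (1 / p ^ e) \<and> mat (p ^ e) ** star a ** ?x ** b \<in> integral_matrices"
      using g[OF st(1)] g[OF st(2)] by (simp only: ab simp_thms)
  next
    fix g1 h1 assume gh: "star g1 ** g1 = mat (1 / p ^ e)" "star h1 ** h1 = mat (1 / p ^ e)"
      "mat (p ^ e) ** star g1 ** ?x ** h1 \<in> integral_matrices"
    obtain i s where s: "s \<in> TS (i + (i + e))" "bi i (i + e) s ** g1 \<in> integral_matrices"
      using lattice_cover[OF gh(1) e TS_ex] by blast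
    obtain k t where t: "t \<in> TS (k + (k + e))" "bi k (k + e) t ** h1 \<in> integral_matrices"
      using lattice_cover[OF gh(2) e TS_ex] by blast
    have sS: "s \<in> S" and tS: "t \<in> S" using TS_S s t by auto
    have ms: "mat (p ^ e) ** star (gm i (i + e) s) ** g1 \<in> integral_matrices" using s(2) gm_integral[OF sS refl] by simp
    have mt: "mat (p ^ e) ** star (gm k (k + e) t) ** h1 \<in> integral_matrices" using t(2) gm_integral[OF tS refl] by simp
    \<comment> \<open>\<open>g1\<close> and \<open>h1\<close> are replaced by the representatives of
      the lattices they span; this multiplies the integral matrix \<open>gh(3)\<close> by integral
      matrices on both sides.\<close>
    have inP: "(i, k, s, t) \<in> pairs e xa xb"
    proof -
      let ?a = "gm i (i + e) s" and ?b = "gm k (k + e) t"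
      let ?c = "mat (p ^ e) :: 'e^2^2"
      have c: "?c ** A = A ** ?c" for A :: "'e^2^2" by (simp add: matrix_2_eq_iff mult.commute)
      have sm: "star ?c = ?c" by (simp add: matrix_2_eq_iff)
      have unit: "A ** star A = mat (1 / p ^ e)" if A: "star A ** A = mat (1 / p ^ e)" for A
      proof -
        have "(?c ** star A) ** A = ?c ** mat (1 / p ^ e)" by (simp add: A flip: matrix_mul_assoc)
        also have "\<dots> = mat 1" by (simp add: matrix_2_eq_iff)
        finally have "A ** (?c ** star A) = mat 1" by (simp add: matrix_left_right_inverse)
        then have "mat (1 / p ^ e) ** (A ** (?c ** star A)) = mat (1 / p ^ e)" by simp
        moreover have "mat (1 / p ^ e) ** (A ** (?c ** star A)) = A ** star A" by (simp add: matrix_2_eq_iff field_simps)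
        ultimately show ?thesis by simp
      qed
      have cu: "?c ** mat (1 / p ^ e) = (mat 1 :: 'e^2^2)" by (simp add: matrix_2_eq_iff)
      have "star (?c ** star ?b ** h1) \<in> integral_matrices" using mt by simp
      then have T: "star h1 ** ?b ** ?c \<in> integral_matrices" by (simp only: star_mult star_star sm matrix_mul_assoc)
      have "(?c ** star ?a ** g1) ** (?c ** star g1 ** ?x ** h1) ** (star h1 ** ?b ** ?c) \<in> integral_matrices"
        by (rule integral_matrices_mult[OF integral_matrices_mult[OF ms gh(3)] T])
      also have "(?c ** star ?a ** g1) ** (?c ** star g1 ** ?x ** h1) ** (star h1 ** ?b ** ?c)
        = (?c ** star ?a) ** ((g1 ** ?c) ** star g1) ** ?x ** (h1 ** star h1) ** (?b ** ?c)" by (simp only: matrix_mul_assoc)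
      also have "\<dots> = (?c ** star ?a) ** (?c ** (g1 ** star g1)) ** ?x ** ((h1 ** star h1) ** ?c) ** ?b"
        by (simp only: c[of g1, symmetric] c[of ?b, symmetric] matrix_mul_assoc)
      also have "\<dots> = ?c ** star ?a ** ?x ** ?b"
        by (simp only: unit[OF gh(1)] unit[OF gh(2)] c[of "mat (1 / p ^ e)", symmetric] cu matrix_mul_rid matrix_mul_assoc)
      finally have "bi i (i + e) s ** ?x ** bm k (k + e) t \<in> integral_matrices"
        by (simp only: gm_integral_pair[OF sS refl tS])
      then show ?thesis using s(1) t(1) by (simp add: pairs_def entry_condition[OF xab])
    qed
    show "\<exists>!q. q \<in> ?f ` pairs e xa xb \<and> mat (p ^ e) ** star (fst q) ** g1 \<in> integral_matrices
      \<and> mat (p ^ e) ** star (snd q) ** h1 \<in> integral_matrices"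
    proof (rule ex1I[of _ "?f (i, k, s, t)"])
      show "?f (i, k, s, t) \<in> ?f ` pairs e xa xb \<and> mat (p ^ e) ** star (fst (?f (i, k, s, t))) ** g1 \<in> integral_matrices
        \<and> mat (p ^ e) ** star (snd (?f (i, k, s, t))) ** h1 \<in> integral_matrices"
        using imageI[OF inP, of ?f] ms mt by (simp only: prod.case fst_conv snd_conv simp_thms)
      fix q assume q: "q \<in> ?f ` pairs e xa xb \<and> mat (p ^ e) ** star (fst q) ** g1 \<in> integral_matrices
        \<and> mat (p ^ e) ** star (snd q) ** h1 \<in> integral_matrices"
      then obtain i' k' s' t' where q': "q = (gm i' (i' + e) s', gm k' (k' + e) t')" "(i', k', s', t') \<in> pairs e xa xb" by auto
      then have st': "s' \<in> TS (i' + (i' + e))" "t' \<in> TS (k' + (k' + e))" by (auto simp: pairs_def)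
      have "bi i' (i' + e) s' ** g1 \<in> integral_matrices" "bi k' (k' + e) t' ** h1 \<in> integral_matrices"
        using q gm_integral[OF TS_S[OF st'(1)] refl] gm_integral[OF TS_S[OF st'(2)] refl] by (simp_all only: q'(1) fst_conv snd_conv)
      then have "i = i' \<and> s = s'" "k = k' \<and> t = t'"
        using uq[OF gh(1) s(1) st'(1) s(2)] uq[OF gh(2) t(1) st'(2) t(2)] by blast+
      then show "q = ?f (i, k, s, t)" by (simp add: q'(1))
    qed
  qed
  then show ?thesis by (simp only: card_image[OF inj])
qed

end

section \<open>The alternating lattice count\<close>

text \<open>An odd number of alternating terms leaves the first one.\<close>

lemma alternating_sum: "(\<Sum>I\<in>{r..r + 2 * m}. (-1::int) ^ I) = (-1) ^ r"
proof (induction m)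
  case (Suc m)
  have "{r..r + 2 * Suc m} = insert (Suc (Suc (r + 2 * m))) (insert (Suc (r + 2 * m)) {r..r + 2 * m})" by auto
  then show ?case using Suc by simp
qed simp

lemma sum_parity_split:
  fixes f :: "nat \<Rightarrow> int"
  assumes "finite A"
  shows "(\<Sum>I\<in>{I\<in>A. I mod 2 = 0}. f I) - (\<Sum>I\<in>{I\<in>A. I mod 2 = 1}. f I) = (\<Sum>I\<in>A. (-1) ^ I * f I)"
proof -
  have A: "A = {I\<in>A. I mod 2 = 0} \<union> {I\<in>A. I mod 2 = 1}" by auto
  have "(\<Sum>I\<in>A. (-1) ^ I * f I) = (\<Sum>I\<in>{I\<in>A. I mod 2 = 0}. (-1) ^ I * f I) + (\<Sum>I\<in>{I\<in>A. I mod 2 = 1}. (-1) ^ I * f I)"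
    by (subst A, rule sum.union_disjoint) (use assms in auto)
  also have "(\<Sum>I\<in>{I\<in>A. I mod 2 = 0}. (-1) ^ I * f I) = (\<Sum>I\<in>{I\<in>A. I mod 2 = 0}. f I)"
    by (intro sum.cong refl) (auto simp: even_iff_mod_2_eq_zero)
  also have "(\<Sum>I\<in>{I\<in>A. I mod 2 = 1}. (-1) ^ I * f I) = - (\<Sum>I\<in>{I\<in>A. I mod 2 = 1}. f I)"
    unfolding sum_negf[symmetric] by (intro sum.cong refl) (auto simp: odd_iff_mod_2_eq_one)
  finally show ?thesis by simp
qed

context split_plane
begin

definition qF :: int where "qF = int (residue_card TYPE('f))"

lemma cc_Suc: "int (cc (Suc I)) = qF ^ I * (qF + 1)"
  by (simp add: cc_def qF_def algebra_simps)

lemma cc_0: "cc 0 = 1"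
  by (simp add: cc_def)

text \<open>For positive \<open>D\<close> the inner terms all equal
  \<open>qF ^ (2 * (D - 1)) * (qF + 1) ^ 2\<close> up to sign and sum to minus this value. At the
  two ends one factor is \<open>cc 0 = 1\<close>, and they add
  \<open>2 * qF ^ (2 * D - 1) * (qF + 1)\<close>.\<close>

lemma alternating_cc:
  "(\<Sum>I\<le>2 * D. (-1) ^ I * int (cc I * cc (2 * D - I))) = (if D = 0 then 1 else (qF\<^sup>2 - 1) * qF ^ (2 * (D - 1)))"
proof (cases D)
  case (Suc E)
  let ?f = "\<lambda>I. (-1) ^ I * int (cc I * cc (2 * D - I))"
  have "{..2 * D} = insert 0 (insert (2 * D) {1..1 + 2 * E})" unfolding Suc by auto
  then have "(\<Sum>I\<le>2 * D. ?f I) = ?f 0 + (?f (2 * D) + (\<Sum>I\<in>{1..1 + 2 * E}. ?f I))"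
    by (simp add: Suc)
  also have "(\<Sum>I\<in>{1..1 + 2 * E}. ?f I) = (\<Sum>I\<in>{1..1 + 2 * E}. (-1) ^ I * (qF ^ (2 * E) * (qF + 1)\<^sup>2))"
  proof (rule sum.cong[OF refl])
    fix I assume "I \<in> {1..1 + 2 * E}"
    then obtain a where a: "I = Suc a" "a \<le> 2 * E" by (cases I) auto
    then have k: "2 * D - I = Suc (2 * E - a)" by (simp add: Suc)
    have "qF ^ a * qF ^ (2 * E - a) = qF ^ (2 * E)" using a(2) by (simp flip: power_add)
    then have "int (cc I) * int (cc (2 * D - I)) = qF ^ (2 * E) * (qF + 1)\<^sup>2"
      unfolding k unfolding a(1) cc_Suc by (simp add: power2_eq_square algebra_simps)
    then show "?f I = (-1) ^ I * (qF ^ (2 * E) * (qF + 1)\<^sup>2)" by simp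
  qed
  also have "\<dots> = (\<Sum>I\<in>{1..1 + 2 * E}. (-1) ^ I) * (qF ^ (2 * E) * (qF + 1)\<^sup>2)" by (simp only: sum_distrib_right)
  also have "\<dots> = - (qF ^ (2 * E) * (qF + 1)\<^sup>2)" by (simp only: alternating_sum) simp
  also have "?f 0 = qF ^ (2 * E) * (qF * (qF + 1))"
    using cc_Suc[of "2 * E + 1"] by (simp add: Suc cc_0 algebra_simps)
  also have "?f (2 * D) = qF ^ (2 * E) * (qF * (qF + 1))"
    using cc_Suc[of "2 * E + 1"] by (simp add: Suc cc_0 algebra_simps)
  finally show ?thesis by (simp add: Suc power2_eq_square algebra_simps)
qed (simp add: cc_0)

text \<open>For positive \<open>D\<close> the value in \<open>alternating_cc\<close> is the
  increment \<open>qF ^ (2 * D) - qF ^ (2 * (D - 1))\<close>.\<close>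

lemma sum_alternating_cc:
  "(\<Sum>D\<le>M. \<Sum>I\<le>2 * D. (-1) ^ I * int (cc I * cc (2 * D - I))) = qF ^ (2 * M)"
proof (induction M)
  case 0
  show ?case using alternating_cc[of 0] by simp
next
  case (Suc M)
  have "(\<Sum>D\<le>Suc M. \<Sum>I\<le>2 * D. (-1) ^ I * int (cc I * cc (2 * D - I))) = qF ^ (2 * M) + (qF\<^sup>2 - 1) * qF ^ (2 * M)"
    using Suc alternating_cc[of "Suc M"] by simp
  then show ?case by (simp add: power2_eq_square algebra_simps)
qed

text \<open>The slopes of pairs whose lattices are at distances \<open>I\<close> and
  \<open>I'\<close> from the standard one; in the counts below \<open>D\<close> is half of
  \<open>I + I'\<close>.\<close>

definition CP :: "'e \<Rightarrow> 'e \<Rightarrow> nat \<Rightarrow> nat \<Rightarrow> nat \<Rightarrow> ('e \<times> 'e) set" where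
  "CP xa xb D I I' = {(s, t). s \<in> TS I \<and> t \<in> TS I' \<and> nabs (xa * t - xb * s) \<le> rad TYPE('e) ^ D}"

lemma finite_CP: "finite (CP xa xb D I I')"
  by (rule finite_subset[of _ "TS I \<times> TS I'"]) (auto simp: CP_def TS)

text \<open>For \<open>I = 2 * i + e\<close> and \<open>D = i + k + e\<close> the difference
  \<open>I - D\<close> is \<open>i - k\<close>, so the depth conditions in \<open>pairs\<close>
  become conditions on \<open>I\<close> and \<open>D\<close> without \<open>e\<close>.\<close>

definition AD :: "'e \<Rightarrow> 'e \<Rightarrow> nat \<Rightarrow> nat set" where
  "AD xa xb D = {I. I \<le> 2 * D \<and> int I \<le> int D + vl xa \<and> int D \<le> int I + vl xb}"

lemma finite_AD: "finite (AD xa xb D)"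
  by (rule finite_subset[of _ "{..2 * D}"]) (auto simp: AD_def)

text \<open>In the coordinates \<open>I\<close> and \<open>D\<close> the two counts are the even and
  the odd part of one sum, as \<open>e\<close> survives only as the parity of \<open>I\<close>. The
  bound \<open>D0\<close> makes the sum finite.\<close>

lemma pairs_reindex:
  assumes e: "e = 0 \<or> e = 1"
    and bound: "\<And>D I s t. I \<in> AD xa xb D \<Longrightarrow> (s, t) \<in> CP xa xb D I (2 * D - I) \<Longrightarrow> D \<le> D0"
  shows "finite (pairs e xa xb)"
    "int (card (pairs e xa xb)) = (\<Sum>D\<le>D0. \<Sum>I\<in>{I \<in> AD xa xb D. I mod 2 = e}. int (card (CP xa xb D I (2 * D - I))))"
proof -
  define J where "J = (SIGMA D:{..D0}. SIGMA I:{I \<in> AD xa xb D. I mod 2 = e}. CP xa xb D I (2 * D - I))"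
  let ?f = "\<lambda>(D, I, s, t). (I div 2, D - I div 2 - e, s, t)"
  let ?g = "\<lambda>(i, k, s, t). (i + k + e, i + (i + e), s, t)"
  have fJ: "finite J" unfolding J_def by (intro finite_SigmaI finite_CP) (auto intro: finite_subset[OF _ finite_AD])
  have bij: "bij_betw ?f J (pairs e xa xb)"
  proof (rule bij_betw_byWitness[where f' = ?g])
    show "\<forall>a\<in>J. ?g (?f a) = a" using e by (auto simp: J_def AD_def) presburger+
    show "\<forall>b\<in>pairs e xa xb. ?f (?g b) = b" using e by (auto simp: pairs_def)
    show "?f ` J \<subseteq> pairs e xa xb"
    proof (rule image_subsetI)
      fix a assume a: "a \<in> J"
      obtain D I s t where a4: "a = (D, I, s, t)" by (cases a) auto
      have I: "I \<le> 2 * D" "int I \<le> int D + vl xa" "int D \<le> int I + vl xb" "I mod 2 = e"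
        and st: "s \<in> TS I" "t \<in> TS (2 * D - I)" "nabs (xa * t - xb * s) \<le> rad TYPE('e) ^ D"
        using a by (auto simp: J_def a4 AD_def CP_def)
      have Ie: "I = 2 * (I div 2) + e" using I(4) div_mult_mod_eq[of I 2] by simp
      have De: "I div 2 + e \<le> D" using Ie I(1) e by arith
      have k: "I div 2 + (I div 2 + e) = I" "D - I div 2 - e + (D - I div 2 - e + e) = 2 * D - I" "I div 2 + (D - I div 2 - e + e) = D"
        using Ie De by linarith+
      have "int (I div 2) \<le> int (D - I div 2 - e) + vl xa" "int (D - I div 2 - e) \<le> int (I div 2) + vl xb"
        using I k by linarith+
      then show "?f a \<in> pairs e xa xb" using st k by (simp add: a4 pairs_def)
    qed
    show "?g ` pairs e xa xb \<subseteq> J"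
    proof (rule image_subsetI)
      fix b assume b: "b \<in> pairs e xa xb"
      obtain i k s t where b4: "b = (i, k, s, t)" by (cases b) auto
      have h: "s \<in> TS (i + (i + e))" "t \<in> TS (k + (k + e))" "int i \<le> int k + vl xa" "int k \<le> int i + vl xb"
        "nabs (xa * t - xb * s) \<le> rad TYPE('e) ^ (i + (k + e))" using b by (auto simp: pairs_def b4)
      have kk: "2 * (i + k + e) - (i + (i + e)) = k + (k + e)" "i + k + e = i + (k + e)" by simp_all
      have 1: "i + (i + e) \<in> AD xa xb (i + k + e)" using h by (simp add: AD_def)
      have 2: "(s, t) \<in> CP xa xb (i + k + e) (i + (i + e)) (2 * (i + k + e) - (i + (i + e)))"
        unfolding kk(1) unfolding kk(2) CP_def mem_Collect_eq prod.case using h(1,2,5) by blast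
      have "(i + (i + e)) mod 2 = e" using e by presburger
      then show "?g b \<in> J" using 1 2 bound[OF 1 2] by (simp add: b4 J_def)
    qed
  qed
  show "finite (pairs e xa xb)" using bij_betw_finite[OF bij] fJ by simp
  have "card (pairs e xa xb) = card J" by (rule bij_betw_same_card[OF bij, symmetric])
  also have "\<dots> = (\<Sum>D\<le>D0. \<Sum>I\<in>{I \<in> AD xa xb D. I mod 2 = e}. card (CP xa xb D I (2 * D - I)))"
    unfolding J_def using finite_CP finite_AD by (simp add: card_SigmaI)
  finally show "int (card (pairs e xa xb)) = (\<Sum>D\<le>D0. \<Sum>I\<in>{I \<in> AD xa xb D. I mod 2 = e}. int (card (CP xa xb D I (2 * D - I))))"
    by simp
qed

text \<open>Both terms of the congruence are already divisible by the required power, so every pair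
  of slopes is allowed.\<close>

lemma card_CP_all:
  assumes "xa \<noteq> 0" "xb \<noteq> 0" "int D \<le> vl xa" "int D \<le> vl xb"
  shows "card (CP xa xb D I I') = cc I * cc I'"
proof -
  have "nabs (xa * t - xb * s) \<le> rad TYPE('e) ^ D" if "s \<in> S" "t \<in> S" for s t
  proof -
    have "nabs xa \<le> rad TYPE('e) powi int D" "nabs xb \<le> rad TYPE('e) powi int D"
      using assms by (simp_all add: nabs_vl del: power_int_of_nat)
    then show ?thesis using nabs_S[OF that(1)] nabs_S[OF that(2)] by (intro nabs_diff_le) (simp_all add: nabs_mult)
  qed
  then have "CP xa xb D I I' = TS I \<times> TS I'" using TS_S by (auto simp: CP_def)
  then show ?thesis by (simp add: card_cartesian_product TS)
qed

text \<open>Slopes are units, so with different valuations there is no cancellation, and the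
  difference has the smaller valuation.\<close>

lemma CP_empty_ne:
  assumes "xa \<noteq> 0" "xb \<noteq> 0" "vl xa \<noteq> vl xb" "min (vl xa) (vl xb) < int D"
  shows "CP xa xb D I I' = {}"
proof -
  have "\<not> nabs (xa * t - xb * s) \<le> rad TYPE('e) ^ D" if "s \<in> S" "t \<in> S" for s t
  proof -
    have a: "nabs (xa * t) = rad TYPE('e) powi vl xa" "nabs (xb * s) = rad TYPE('e) powi vl xb"
      using assms nabs_S[OF that(1)] nabs_S[OF that(2)] by (simp_all add: nabs_mult nabs_vl)
    have "nabs (xa * t - xb * s) = rad TYPE('e) powi min (vl xa) (vl xb)"
    proof (cases "vl xa < vl xb")
      case True
      then have "nabs (xb * s) < nabs (xa * t)" by (simp only: a rad_powi_less)
      then have "nabs (xa * t - xb * s) = nabs (xa * t)" by (rule nabs_diff_eq')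
      then show ?thesis using True by (simp add: a)
    next
      case False
      then have "nabs (xa * t) < nabs (xb * s)" using assms(3) by (simp only: a rad_powi_less)
      then have "nabs (xa * t - xb * s) = nabs (xb * s)" by (rule nabs_diff_eq)
      then show ?thesis using False by (simp add: a)
    qed
    moreover have "rad TYPE('e) powi int D < rad TYPE('e) powi min (vl xa) (vl xb)" using assms(4) by (simp only: rad_powi_less)
    ultimately show ?thesis by simp
  qed
  then show ?thesis using TS_S by (auto simp: CP_def)
qed

lemma nabs_N_diff:
  assumes "nabs x \<le> 1" "nabs y \<le> 1" "nabs (x - y) \<le> c"
  shows "nabs (N x - N y) \<le> c"
proof -
  have e: "N x - N y = (x - y) * \<sigma> x + y * \<sigma> (x - y)" by (simp add: algebra_simps)
  have "nabs (x - y) * nabs x \<le> nabs (x - y) * 1" "nabs y * nabs (x - y) \<le> 1 * nabs (x - y)"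
    using assms by (intro mult_left_mono mult_right_mono; simp)+
  then have "nabs ((x - y) * \<sigma> x) \<le> c" "nabs (y * \<sigma> (x - y)) \<le> c"
    using assms(3) by (simp_all only: nabs_mult nabs_\<sigma>)
  then show ?thesis unfolding e by (rule nabs_add_le)
qed

text \<open>After division by \<open>xb\<close> the condition reads \<open>u * t = s\<close> modulo
  the power \<open>r\<close>, for the unit \<open>u = xa / xb\<close>. Taking norms forces
  \<open>N u\<close> to be 1 modulo this power; if it is, every \<open>s\<close> leaves exactly one
  class modulo the power \<open>r\<close> for \<open>t\<close>.\<close>

lemma CP_eq_valuation:
  assumes x: "xa \<noteq> 0" "xb \<noteq> 0" "vl xa = vl xb" and d: "N xb - N xa \<noteq> 0"
    and D: "int D = vl xa + int r" "r \<ge> 1"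
  shows "vl (N xb - N xa) < 2 * vl xa + int r \<Longrightarrow> CP xa xb D I I' = {}"
    "int r \<le> vl (N xb - N xa) - 2 * vl xa \<Longrightarrow> r \<le> I' \<Longrightarrow> card (CP xa xb D I I') = cc I * residue_card TYPE('f) ^ (I' - r)"
proof -
  let ?r = "rad TYPE('e)"
  define u where "u = xa / xb"
  have u0: "u \<noteq> 0" and u1: "nabs u = 1" and xa: "xa = xb * u" using x by (simp_all add: u_def nabs_divide nabs_vl)
  have iff: "nabs (xa * t - xb * s) \<le> ?r ^ D \<longleftrightarrow> nabs (u * t - s) \<le> ?r ^ r" for s t
  proof -
    have E: "xa * t - xb * s = xb * (u * t - s)" by (simp add: xa algebra_simps)
    have "nabs (xa * t - xb * s) = ?r powi vl xa * nabs (u * t - s)" by (simp only: E nabs_mult nabs_vl[OF x(2)] x(3))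
    moreover have "?r ^ D = ?r powi vl xa * ?r ^ r"
    proof -
      have "?r ^ D = ?r powi (vl xa + int r)" by (simp only: D(1)[symmetric] power_int_of_nat)
      then show ?thesis by (simp add: power_int_add)
    qed
    ultimately show ?thesis by simp
  qed
  \<comment> \<open>\<open>N xb - N xa\<close> is \<open>N u - 1\<close> up to sign and the factor
    \<open>N xb\<close>; in this way the difference of the eigenvalues enters the count.\<close>
  have nu: "nabs (N u - 1) = ?r powi (vl (N xb - N xa) - 2 * vl xa)"
  proof -
    have "N xb - N xa = - (N xb * (N u - 1))" unfolding xa N_mult by (simp add: algebra_simps)
    then have "nabs (N xb - N xa) = nabs (N xb) * nabs (N u - 1)" by (simp only: nabs_minus nabs_mult)
    moreover have "nabs (N xb) = ?r powi (2 * vl xa)" using x vl_N[OF x(2)] nabs_vl[of "N xb"] by simp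
    moreover have "nabs (N xb - N xa) = ?r powi vl (N xb - N xa)" by (rule nabs_vl[OF d])
    ultimately have "?r powi (2 * vl xa) * nabs (N u - 1) = ?r powi vl (N xb - N xa)" by simp
    then show ?thesis by (simp add: power_int_diff field_simps)
  qed
  { assume l: "vl (N xb - N xa) < 2 * vl xa + int r"
    have "\<not> nabs (u * t - s) \<le> ?r ^ r" if st: "s \<in> S" "t \<in> S" for s t
    proof
      assume "nabs (u * t - s) \<le> ?r ^ r"
      then have "nabs (N (u * t) - N s) \<le> ?r ^ r"
        using u1 nabs_S[OF st(1)] nabs_S[OF st(2)] by (intro nabs_N_diff) (simp_all add: nabs_mult)
      moreover have "N (u * t) - N s = - (N u - 1)" unfolding N_mult using st by (simp add: S_def)
      ultimately have "?r powi (vl (N xb - N xa) - 2 * vl xa) \<le> ?r powi int r" by (simp only: nabs_minus nu power_int_of_nat)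
      then show False using l by (simp only: rad_powi_le)
    qed
    then show "CP xa xb D I I' = {}" using TS_S by (auto simp: CP_def iff) }
  { assume l: "int r \<le> vl (N xb - N xa) - 2 * vl xa" and rK: "r \<le> I'"
    have fib: "card {t \<in> TS I'. nabs (u * t - s) \<le> ?r ^ r} = residue_card TYPE('f) ^ (I' - r)" if s: "s \<in> S" for s
    proof -
      have "N (s / u) + 1 = (N u - 1) / N u"
      proof -
        have "N (s / u) = N s / N u" by simp
        then show ?thesis using s u0 by (simp add: S_def field_simps)
      qed
      then have "nabs (N (s / u) + 1) = nabs (N u - 1)" using u1 by (simp only: nabs_divide nabs_N; simp)
      also have "\<dots> \<le> ?r powi int r" unfolding nu using l by (simp only: rad_powi_le)
      finally have "nabs (N (s / u) + 1) \<le> ?r ^ r" by (simp only: power_int_of_nat)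
      \<comment> \<open>The norm of \<open>s / u\<close> is close to -1, so a nearby point of
        \<open>S\<close> can replace it; the admissible \<open>t\<close> then form a ball in
        \<open>S\<close>.\<close>
      then obtain z where z: "z \<in> S" "nabs (z - s / u) \<le> ?r ^ r" using S_approx[OF D(2)] by blast
      have i2: "nabs (u * t - s) \<le> ?r ^ r \<longleftrightarrow> dist t z \<le> ?r ^ r" for t
      proof -
        have "u * t - s = u * (t - s / u)" using u0 by (simp add: algebra_simps)
        then have "nabs (u * t - s) = nabs (t - s / u)" using u1 by (simp only: nabs_mult; simp)
        moreover have "nabs (t - s / u) \<le> ?r ^ r \<longleftrightarrow> nabs (t - z) \<le> ?r ^ r"
        proof
          assume "nabs (t - s / u) \<le> ?r ^ r"
          then have "nabs ((t - s / u) - (z - s / u)) \<le> ?r ^ r" using z(2) by (rule nabs_diff_le)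
          then show "nabs (t - z) \<le> ?r ^ r" by simp
        next
          assume "nabs (t - z) \<le> ?r ^ r"
          then have "nabs ((t - z) + (z - s / u)) \<le> ?r ^ r" using z(2) by (rule nabs_add_le)
          then show "nabs (t - s / u) \<le> ?r ^ r" by simp
        qed
        ultimately show ?thesis by (simp only: dist_eq_nabs)
      qed
      obtain T where T: "card T = residue_card TYPE('f) ^ (I' - r)" "transversal {y\<in>S. dist y z \<le> ?r ^ r} (?r ^ (r + (I' - r))) T"
        using transversal_S_ball[OF D(2) z(1)] by blast
      have rr: "?r ^ I' \<le> ?r ^ r" using rK by (intro power_decreasing) (auto simp: less_imp_le)
      \<comment> \<open>Since \<open>r \<le> I'\<close>, a class modulo the finer power lies wholly
        inside or outside the ball, so the fixed representatives inside it form a transversal of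
        it.\<close>
      have tr: "transversal {y\<in>S. dist y z \<le> ?r ^ r} (?r ^ I') {t \<in> TS I'. dist t z \<le> ?r ^ r}" unfolding transversal_def
      proof (intro conjI ballI)
        show "{t \<in> TS I'. dist t z \<le> ?r ^ r} \<subseteq> {y \<in> S. dist y z \<le> ?r ^ r}" using TS_S by auto
        fix y assume y: "y \<in> {y \<in> S. dist y z \<le> ?r ^ r}"
        then have ex: "\<exists>!t. t \<in> TS I' \<and> dist y t \<le> ?r ^ I'" using TS(3)[of I'] unfolding transversal_def by blast
        have near: "dist t z \<le> ?r ^ r" if "dist y t \<le> ?r ^ I'" for t
        proof (rule nonarch_dist_trans[of t y "?r ^ r" z])
          show "dist t y \<le> ?r ^ r" using order_trans[OF that rr] by (simp only: dist_commute[of t y])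
          show "dist y z \<le> ?r ^ r" using y by simp
        qed
        have "(t \<in> {t \<in> TS I'. dist t z \<le> ?r ^ r} \<and> dist y t \<le> ?r ^ I') = (t \<in> TS I' \<and> dist y t \<le> ?r ^ I')" for t
          using near[of t] by (simp only: mem_Collect_eq) (rule iffI; elim conjE; intro conjI; assumption)
        then show "\<exists>!t. t \<in> {t \<in> TS I'. dist t z \<le> ?r ^ r} \<and> dist y t \<le> ?r ^ I'" using ex by (simp only:)
      qed
      have "r + (I' - r) = I'" using rK by simp
      then have "card {t \<in> TS I'. dist t z \<le> ?r ^ r} = card T"
        using T(2) by (intro transversal_card_eq[OF tr]) (simp only:)
      then show ?thesis using T(1) by (simp only: i2)
    qed
    have "CP xa xb D I I' = (SIGMA s:TS I. {t \<in> TS I'. nabs (u * t - s) \<le> ?r ^ r})" by (auto simp: CP_def iff)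
    then have "card (CP xa xb D I I') = (\<Sum>s\<in>TS I. card {t \<in> TS I'. nabs (u * t - s) \<le> ?r ^ r})"
      using TS(1) by (simp add: card_SigmaI)
    also have "\<dots> = (\<Sum>s\<in>TS I. residue_card TYPE('f) ^ (I' - r))" using fib TS_S by (intro sum.cong refl) auto
    finally show "card (CP xa xb D I I') = cc I * residue_card TYPE('f) ^ (I' - r)" by (simp add: TS(2)) }
qed

text \<open>The congruence forces equal valuations by \<open>CP_empty_ne\<close>. If the common
  valuation is negative, the two inequalities between the depths contradict each other when
  added.\<close>

lemma pairs_nonintegral:
  assumes x: "xa \<noteq> 0" "xb \<noteq> 0" and neg: "vl xa < 0 \<or> vl xb < 0"
  shows "pairs e xa xb = {}"
proof -
  have "False" if y: "y \<in> pairs e xa xb" for y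
  proof -
    obtain i k s t where y4: "y = (i, k, s, t)" by (cases y) auto
    have h: "s \<in> TS (i + (i + e))" "t \<in> TS (k + (k + e))" "int i \<le> int k + vl xa" "int k \<le> int i + vl xb"
      "nabs (xa * t - xb * s) \<le> rad TYPE('e) ^ (i + (k + e))" using y by (auto simp: pairs_def y4)
    have "(s, t) \<in> CP xa xb (i + (k + e)) (i + (i + e)) (k + (k + e))" using h by (simp add: CP_def)
    then have "vl xa = vl xb" using CP_empty_ne[OF x, of "i + (k + e)"] neg by (cases "vl xa = vl xb") auto
    then show False using h(3,4) neg by linarith
  qed
  then show ?thesis by blast
qed

text \<open>The layers with \<open>D\<close> at most the smaller valuation \<open>M\<close>
  contribute \<open>qF ^ (2 * M)\<close>. For different valuations no further layer occurs, and
  \<open>2 * M\<close> is the valuation of \<open>N xb - N xa\<close>. For equal ones this valuation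
  may exceed \<open>2 * M\<close> by some \<open>E\<close>, and each of \<open>E\<close> further
  layers multiplies the partial sum by \<open>- qF\<close>.\<close>

lemma signed_count:
  assumes x: "xa \<noteq> 0" "xb \<noteq> 0" and d: "N xb - N xa \<noteq> 0" and pos: "vl xa \<ge> 0" "vl xb \<ge> 0"
  shows "finite (pairs 0 xa xb) \<and> finite (pairs 1 xa xb) \<and> vl (N xb - N xa) \<ge> 0 \<and>
    int (card (pairs 0 xa xb)) - int (card (pairs 1 xa xb)) = (- qF) ^ nat (vl (N xb - N xa))"
proof -
  define M where "M = nat (min (vl xa) (vl xb))"
  have M: "int M = min (vl xa) (vl xb)" using pos by (simp add: M_def)
  let ?F = "\<lambda>D. \<Sum>I\<in>AD xa xb D. (-1) ^ I * int (card (CP xa xb D I (2 * D - I)))"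
  have total: "finite (pairs 0 xa xb) \<and> finite (pairs 1 xa xb) \<and> int (card (pairs 0 xa xb)) - int (card (pairs 1 xa xb)) = (\<Sum>D\<le>D0. ?F D)"
    if b: "\<And>D I s t. I \<in> AD xa xb D \<Longrightarrow> (s, t) \<in> CP xa xb D I (2 * D - I) \<Longrightarrow> D \<le> D0" for D0
  proof -
    have "int (card (pairs 0 xa xb)) - int (card (pairs 1 xa xb)) =
      (\<Sum>D\<le>D0. (\<Sum>I\<in>{I \<in> AD xa xb D. I mod 2 = 0}. int (card (CP xa xb D I (2 * D - I))))
        - (\<Sum>I\<in>{I \<in> AD xa xb D. I mod 2 = 1}. int (card (CP xa xb D I (2 * D - I)))))"
      using pairs_reindex(2)[OF _ b, of 0] pairs_reindex(2)[OF _ b, of 1] by (simp add: sum_subtractf)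
    also have "\<dots> = (\<Sum>D\<le>D0. ?F D)" by (intro sum.cong refl sum_parity_split finite_AD)
    finally show ?thesis using pairs_reindex(1)[OF _ b, of 0] pairs_reindex(1)[OF _ b, of 1] by simp
  qed
  have low: "(\<Sum>D\<le>M. ?F D) = qF ^ (2 * M)"
  proof -
    have L: "?F D = (\<Sum>I\<le>2 * D. (-1) ^ I * int (cc I * cc (2 * D - I)))" if "D \<le> M" for D
    proof -
      have Dl: "int D \<le> vl xa" "int D \<le> vl xb" using that M by linarith+
      have "AD xa xb D = {..2 * D}" using Dl by (auto simp: AD_def)
      then show ?thesis using card_CP_all[OF x Dl] by simp
    qed
    have "(\<Sum>D\<le>M. ?F D) = (\<Sum>D\<le>M. \<Sum>I\<le>2 * D. (-1) ^ I * int (cc I * cc (2 * D - I)))"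
      by (rule sum.cong[OF refl]) (rule L, simp)
    then show ?thesis by (simp only: sum_alternating_cc)
  qed
  show ?thesis
  proof (cases "vl xa = vl xb")
    case False
    have b: "D \<le> M" if "(s, t) \<in> CP xa xb D I (2 * D - I)" for D I s t
      using CP_empty_ne[OF x False, of D] that M by force
    have vd: "vl (N xb - N xa) = 2 * int M"
    proof -
      have n: "nabs (N xa) = rad TYPE('e) powi (2 * vl xa)" "nabs (N xb) = rad TYPE('e) powi (2 * vl xb)"
        using vl_N x nabs_vl[of "N xa"] nabs_vl[of "N xb"] by simp_all
      show ?thesis
      proof (rule vl_eqI, cases "vl xa < vl xb")
        case True
        then have "nabs (N xb) < nabs (N xa)" by (simp only: n rad_powi_less)
        then have "nabs (N xb - N xa) = nabs (N xa)" by (rule nabs_diff_eq)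
        then show "nabs (N xb - N xa) = rad TYPE('e) powi (2 * int M)" using True M by (simp only: n; simp)
      next
        case F2: False
        then have "nabs (N xa) < nabs (N xb)" using False by (simp only: n rad_powi_less; simp)
        then have "nabs (N xb - N xa) = nabs (N xb)" by (rule nabs_diff_eq')
        then show "nabs (N xb - N xa) = rad TYPE('e) powi (2 * int M)" using F2 M by (simp only: n; simp)
      qed
    qed
    then have nv: "nat (vl (N xb - N xa)) = 2 * M" by simp
    show ?thesis using total[of M, OF b] low vd unfolding nv by (simp add: power_mult)
  next
    case True
    have Mv: "vl xa = int M" using True M by simp
    have x1: "xa = xb * (xa / xb)" using x by simp
    have vge: "vl (N xb - N xa) \<ge> 2 * int M"
    proof -
      have "nabs (N xa) = rad TYPE('e) powi (2 * int M)" "nabs (N xb) = rad TYPE('e) powi (2 * int M)"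
        using vl_N x nabs_vl[of "N xa"] nabs_vl[of "N xb"] Mv True by simp_all
      then have "nabs (N xb - N xa) \<le> rad TYPE('e) powi (2 * int M)" by (intro nabs_diff_le) simp_all
      then have "rad TYPE('e) powi vl (N xb - N xa) \<le> rad TYPE('e) powi (2 * int M)" by (simp only: nabs_vl[OF d])
      then show ?thesis by (simp only: rad_powi_le)
    qed
    define E where "E = nat (vl (N xb - N xa) - 2 * int M)"
    have E: "vl (N xb - N xa) = 2 * int M + int E" using vge by (simp add: E_def)
    have b: "D \<le> M + E" if c: "(s, t) \<in> CP xa xb D I (2 * D - I)" for D I s t
    proof (rule ccontr)
      assume "\<not> D \<le> M + E"
      then have "int D = vl xa + int (D - M)" "D - M \<ge> 1" "vl (N xb - N xa) < 2 * vl xa + int (D - M)" using Mv E by simp_all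
      then have "CP xa xb D I (2 * D - I) = {}" using CP_eq_valuation(1)[OF x True d] by blast
      then show False using c by simp
    qed
    \<comment> \<open>In the layer \<open>M + r\<close> the summand depends on \<open>I\<close> only
      through its sign, and the range of \<open>I\<close> has the odd length
      \<open>2 * M + 1\<close>.\<close>
    have high: "?F (M + r) = (-1) ^ r * (qF ^ (2 * M + r) + qF ^ (2 * M + r - 1))" if r: "1 \<le> r" "r \<le> E" for r
    proof -
      have D: "int (M + r) = vl xa + int r" "int r \<le> vl (N xb - N xa) - 2 * vl xa" using Mv E r by simp_all
      have A: "AD xa xb (M + r) = {r..r + 2 * M}" using Mv True by (auto simp: AD_def)
      have "?F (M + r) = (\<Sum>I\<in>{r..r + 2 * M}. (-1) ^ I * (qF ^ (2 * M + r) + qF ^ (2 * M + r - 1)))"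
        unfolding A
      proof (rule sum.cong[OF refl])
        fix I assume "I \<in> {r..r + 2 * M}"
        then have I: "r \<le> I" "I \<le> r + 2 * M" by auto
        have rK: "r \<le> 2 * (M + r) - I" using I by simp
        have c: "card (CP xa xb (M + r) I (2 * (M + r) - I)) = cc I * residue_card TYPE('f) ^ (2 * (M + r) - I - r)"
          by (rule CP_eq_valuation(2)[OF x True d D(1) r(1) D(2) rK])
        obtain J where J: "I = Suc J" using I r by (cases I) auto
        have k: "2 * (M + r) - I - r = 2 * M + r - I" "Suc (J + (2 * M + r - I)) = 2 * M + r" using I J by simp_all
        have k3: "J + (2 * M + r - I) = 2 * M + r - 1" using k(2) by linarith
        have p1: "qF ^ J * qF ^ (2 * M + r - I) = qF ^ (2 * M + r - 1)" by (simp only: power_add[symmetric] k3)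
        have p2: "qF ^ (2 * M + r) = qF * qF ^ (2 * M + r - 1)" using r by (simp flip: power_Suc)
        have "int (card (CP xa xb (M + r) I (2 * (M + r) - I))) = (qF ^ J * qF ^ (2 * M + r - I)) * (qF + 1)"
          unfolding c k unfolding J by (simp add: cc_Suc qF_def[symmetric] algebra_simps)
        also have "\<dots> = qF ^ (2 * M + r) + qF ^ (2 * M + r - 1)" unfolding p1 p2 by (simp add: algebra_simps)
        finally show "(-1) ^ I * int (card (CP xa xb (M + r) I (2 * (M + r) - I))) = (-1) ^ I * (qF ^ (2 * M + r) + qF ^ (2 * M + r - 1))"
          by simp
      qed
      also have "\<dots> = (-1) ^ r * (qF ^ (2 * M + r) + qF ^ (2 * M + r - 1))"
        by (simp only: sum_distrib_right[symmetric] alternating_sum)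
      finally show ?thesis .
    qed
    \<comment> \<open>Each layer cancels the value reached before it and leaves the next power of
      \<open>- qF\<close>.\<close>
    have "(\<Sum>D\<le>M + r. ?F D) = (- qF) ^ (2 * M + r)" if "r \<le> E" for r
      using that
    proof (induction r)
      case 0
      then show ?case using low by (simp add: power_mult)
    next
      case (Suc r)
      have "(\<Sum>D\<le>M + Suc r. ?F D) = (- qF) ^ (2 * M + r) + ?F (M + Suc r)" using Suc by simp
      also have "?F (M + Suc r) = (-1) ^ Suc r * (qF ^ (2 * M + Suc r) + qF ^ (2 * M + r))"
        using high[of "Suc r"] Suc.prems by simp
      also have "(- qF) ^ (2 * M + r) = (-1) ^ r * qF ^ (2 * M + r)"
        by (subst power_minus) (simp add: power_add power_mult)
      also have "(-1) ^ r * qF ^ (2 * M + r) + (-1) ^ Suc r * (qF ^ (2 * M + Suc r) + qF ^ (2 * M + r)) = (-1) ^ Suc r * qF ^ (2 * M + Suc r)"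
        by (simp add: algebra_simps)
      also have "\<dots> = (- qF) ^ (2 * M + Suc r)"
        by (subst power_minus[of qF]) (simp add: power_add power_mult)
      finally show ?case .
    qed
    then have "(\<Sum>D\<le>M + E. ?F D) = (- qF) ^ nat (vl (N xb - N xa))" by (simp add: E nat_add_distrib nat_mult_distrib)
    then show ?thesis using total[of "M + E", OF b] E by simp
  qed
qed

end

section \<open>The character \<open>\<kappa>\<close>\<close>

lemma conj_trace_det:
  fixes A g :: "'k::field^'n::finite^'n"
  assumes "invertible g"
  shows "trace (g ** A ** matrix_inv g) = trace A" "det (g ** A ** matrix_inv g) = det A"
proof -
  have "trace (g ** A ** matrix_inv g) = trace (matrix_inv g ** (g ** A))" by (rule trace_mul_sym)
  then show "trace (g ** A ** matrix_inv g) = trace A" by (simp only: matrix_mul_assoc matrix_inv_left[OF assms] matrix_mul_lid)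
  have "det g * det (matrix_inv g) = 1" by (simp only: det_mul[symmetric] matrix_inv_right[OF assms] det_I)
  then show "det (g ** A ** matrix_inv g) = det A" by (simp add: det_mul algebra_simps)
qed

lemma trace_2: "trace (A :: 'k::comm_ring_1^2^2) = A $ 1 $ 1 + A $ 2 $ 2"
  by (simp add: trace_def sum_2)

lemma mat_comm_2: "(mat c :: 'k::comm_ring_1^2^2) ** A = (A :: 'k^2^2) ** mat c"
  by (simp add: matrix_2_eq_iff mult.commute)

lemma right_cancel: "invertible (P :: 'k::field^'n::finite^'n) \<Longrightarrow> A ** P = B ** P \<Longrightarrow> A = B"
  by (metis matrix_inv_right matrix_mul_assoc matrix_mul_rid)

lemma left_cancel: "invertible (P :: 'k::field^'n::finite^'n) \<Longrightarrow> P ** A = P ** B \<Longrightarrow> A = B"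
  by (metis matrix_inv_left matrix_mul_assoc matrix_mul_lid)

lemma eval_at_matrix_diag:
  fixes A P :: "'k::field^2^2"
  assumes A: "A ** P = P ** mat2 x 0 0 y"
  shows "eval_at_matrix q A ** P = P ** mat2 (poly q x) 0 0 (poly q y)"
proof -
  have pw: "((((**) A) ^^ i) (mat 1)) ** P = P ** mat2 (x ^ i) 0 0 (y ^ i)" for i
  proof (induction i)
    case 0
    have "mat2 1 0 0 1 = (mat 1 :: 'k^2^2)" by (simp add: matrix_2_eq_iff)
    then show ?case by simp
  next
    case (Suc i)
    have "((((**) A) ^^ Suc i) (mat 1)) ** P = A ** (P ** mat2 (x ^ i) 0 0 (y ^ i))"
      by (simp only: funpow.simps o_apply Suc.IH matrix_mul_assoc[symmetric])
    also have "\<dots> = P ** (mat2 x 0 0 y ** mat2 (x ^ i) 0 0 (y ^ i))" by (simp only: A matrix_mul_assoc)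
    also have "mat2 x 0 0 y ** mat2 (x ^ i) 0 0 (y ^ i) = mat2 (x ^ Suc i) 0 0 (y ^ Suc i)" by (simp add: matrix_2_eq_iff)
    finally show ?case .
  qed
  have tm: "(mat c ** ((((**) A) ^^ i) (mat 1))) ** P = P ** mat2 (c * x ^ i) 0 0 (c * y ^ i)" for c i
  proof -
    have "(mat c ** ((((**) A) ^^ i) (mat 1))) ** P = mat c ** P ** mat2 (x ^ i) 0 0 (y ^ i)"
      by (simp only: matrix_mul_assoc[symmetric] pw)
    also have "\<dots> = P ** (mat c ** mat2 (x ^ i) 0 0 (y ^ i))" by (simp only: mat_comm_2[of c P] matrix_mul_assoc)
    also have "mat c ** mat2 (x ^ i) 0 0 (y ^ i) = mat2 (c * x ^ i) 0 0 (c * y ^ i)" by (simp add: matrix_2_eq_iff)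
    finally show ?thesis .
  qed
  have "(\<Sum>i\<le>n. mat (c i) ** ((((**) A) ^^ i) (mat 1))) ** P = P ** mat2 (\<Sum>i\<le>n. c i * x ^ i) 0 0 (\<Sum>i\<le>n. c i * y ^ i)" for n c
  proof (induction n)
    case 0
    show ?case using tm[of "c 0" 0] by simp
  next
    case (Suc n)
    have s: "mat2 (a + b) 0 0 (a' + b') = mat2 a 0 0 a' + (mat2 b 0 0 b' :: 'k^2^2)" for a b a' b' by (simp add: matrix_2_eq_iff)
    have d: "(B + C) ** P = B ** P + C ** P" for B C :: "'k^2^2" by (simp add: matrix_2_eq_iff algebra_simps)
    show ?case by (simp only: sum.atMost_Suc d Suc.IH tm s matrix_add_ldistrib)
  qed
  then show ?thesis by (simp only: eval_at_matrix_def poly_altdef)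
qed

lemma poly_map_poly_hom:
  assumes "\<phi> 0 = 0" "\<And>x y. \<phi> (x + y) = \<phi> x + \<phi> y" "\<And>x y. \<phi> (x * y) = \<phi> x * \<phi> (y::'a::field)" "\<phi> 1 = (1::'b::field)"
  shows "poly (map_poly \<phi> q) (\<phi> x) = \<phi> (poly q x)"
  by (induction q) (simp_all add: map_poly_pCons assms)

lemma commuting_diag:
  fixes A :: "'k::field^2^2"
  assumes "mat2 x 0 0 y ** A = A ** mat2 x 0 0 y" "x \<noteq> y"
  shows "A = mat2 (A $ 1 $ 1) 0 0 (A $ 2 $ 2)"
proof -
  have "x * A $ 1 $ 2 = A $ 1 $ 2 * y" "y * A $ 2 $ 1 = A $ 2 $ 1 * x"
    using assms(1) by (simp_all add: matrix_2_eq_iff)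
  then have "A $ 1 $ 2 = 0" "A $ 2 $ 1 = 0" using assms(2) by (metis mult.commute mult_right_cancel)+
  then show ?thesis by (simp add: matrix_2_eq_iff)
qed

context split_plane
begin

lemma star_uminus: "star (- A) = - star A"
  by (simp add: matrix_2_eq_iff)

lemma star_contraction: "star (- (x ** star x)) = - (x ** star x)"
  by (simp only: star_uminus star_mult star_star)

lemma eigenbasis_trace_det:
  assumes "eigenbasis \<delta> P da db ca cb"
  shows "\<delta> $ 1 $ 1 + \<delta> $ 2 $ 2 = \<iota> (da + db)" "det \<delta> = \<iota> (da * db)" "\<delta> = P ** mat2 (\<iota> da) 0 0 (\<iota> db) ** matrix_inv P"
proof -
  have P: "invertible P" "\<delta> ** P = P ** mat2 (\<iota> da) 0 0 (\<iota> db)" using assms by (simp_all add: eigenbasis_def invertible_2_iff)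
  show d: "\<delta> = P ** mat2 (\<iota> da) 0 0 (\<iota> db) ** matrix_inv P"
    by (simp only: P(2)[symmetric] matrix_mul_assoc[symmetric] matrix_inv_right[OF P(1)] matrix_mul_rid)
  show "\<delta> $ 1 $ 1 + \<delta> $ 2 $ 2 = \<iota> (da + db)" "det \<delta> = \<iota> (da * db)"
    using conj_trace_det[OF P(1), of "mat2 (\<iota> da) 0 0 (\<iota> db)"] unfolding d[symmetric] trace_2 by simp_all
qed

text \<open>Nondegeneracy gives \<open>star c = star g ** g\<close>, and the right side is
  self-adjoint.\<close>

lemma similitude_form:
  assumes "\<And>u v. h2 (g *v u) (g *v v) = h2 (c *v u) v"
  shows "c = star g ** g"
proof -
  have "star c *v v = (star g ** g) *v v" for v
  proof (rule h2_nondeg)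
    fix u
    have "h2 u (star c *v v) = h2 (g *v u) (g *v v)" by (simp only: h2_adj[symmetric] assms)
    also have "\<dots> = h2 u (star g *v (g *v v))" by (rule h2_adj)
    finally show "h2 u (star c *v v) = h2 u ((star g ** g) *v v)" by (simp only: matrix_vector_mul_assoc)
  qed
  then have "star c = star g ** g" by (rule matrix_eq_vec)
  then have "star (star c) = star (star g ** g)" by (simp only:)
  then show ?thesis by (simp only: star_star star_mult)
qed

text \<open>Between the two eigenbases \<open>g\<close> is diagonal, with entries \<open>a\<close>
  and \<open>b\<close>, so \<open>star g ** g\<close> scales the second eigenvector by
  \<open>cb2 * N b / cb1\<close>; the norm has even valuation.\<close>

lemma transport_diag:
  assumes e1: "eigenbasis \<delta>1 P1 da db ca1 cb1" and e2: "eigenbasis \<delta>2 P2 da db ca2 cb2"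
    and g: "invertible g" "\<delta>2 = g ** \<delta>1 ** matrix_inv g"
  shows "\<exists>la lb. star g ** g ** P1 = P1 ** mat2 (\<iota> la) 0 0 (\<iota> lb) \<and> lb \<noteq> 0 \<and> (even (vl lb) \<longleftrightarrow> even (vl cb1) = even (vl cb2))"
proof -
  let ?D = "mat2 (\<iota> da) 0 0 (\<iota> db)" and ?C1 = "mat2 (\<iota> ca1) 0 0 (\<iota> cb1)" and ?C2 = "mat2 (\<iota> ca2) 0 0 (\<iota> cb2)"
  have 1: "invertible P1" "\<delta>1 ** P1 = P1 ** ?D" "star P1 ** P1 = ?C1" "ca1 \<noteq> 0" "cb1 \<noteq> 0" "\<iota> da \<noteq> \<iota> db"
    and 2: "invertible P2" "\<delta>2 ** P2 = P2 ** ?D" "star P2 ** P2 = ?C2" "ca2 \<noteq> 0" "cb2 \<noteq> 0"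
    using e1 e2 by (simp_all add: eigenbasis_def invertible_2_iff)
  define A where "A = matrix_inv P2 ** (g ** P1)"
  have gP: "g ** P1 = P2 ** A" by (simp only: A_def matrix_mul_assoc matrix_inv_right[OF 2(1)] matrix_mul_lid)
  have "\<delta>2 ** (g ** P1) = g ** (\<delta>1 ** P1)"
    by (simp only: g(2) matrix_mul_assoc[symmetric]) (simp only: matrix_mul_assoc[of "matrix_inv g"] matrix_inv_left[OF g(1)] matrix_mul_lid)
  also have "\<dots> = P2 ** A ** ?D" by (simp only: 1(2) matrix_mul_assoc gP)
  finally have "P2 ** (?D ** A) = P2 ** (A ** ?D)" by (simp only: gP matrix_mul_assoc 2(2))
  then have "?D ** A = A ** ?D" by (rule left_cancel[OF 2(1)])
  then have Ad: "A = mat2 (A $ 1 $ 1) 0 0 (A $ 2 $ 2)" using 1(6) by (rule commuting_diag)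
  obtain a b :: 'e where ab: "A = mat2 a 0 0 b" using Ad by blast
  have "invertible A" unfolding A_def using 1(1) 2(1) g(1) by (intro invertible_mult invertible_matrix_inv)
  then have b0: "a \<noteq> 0" "b \<noteq> 0" by (simp_all add: ab invertible_2_iff)
  obtain na nb :: 'f where n: "N a = \<iota> na" "N b = \<iota> nb" using N_in_F by metis
  have nb: "nb \<noteq> 0" using n(2) b0(2) by auto
  then have vnb: "vl nb = 2 * vl b" using vl_\<iota>[of nb] vl_N[OF b0(2)] by (simp add: n(2))
  have "star P1 ** (star g ** g ** P1) = star (g ** P1) ** (g ** P1)" by (simp only: star_mult matrix_mul_assoc)
  also have "\<dots> = star A ** (star P2 ** P2) ** A" unfolding gP by (simp only: star_mult matrix_mul_assoc)
  also have "\<dots> = mat2 (\<iota> ca2 * N a) 0 0 (\<iota> cb2 * N b)" unfolding 2(3) by (simp add: ab matrix_2_eq_iff)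
  also have "\<dots> = ?C1 ** mat2 (\<iota> (ca2 * na / ca1)) 0 0 (\<iota> (cb2 * nb / cb1))" unfolding n using 1(4,5) by (simp add: matrix_2_eq_iff)
  also have "\<dots> = star P1 ** (P1 ** mat2 (\<iota> (ca2 * na / ca1)) 0 0 (\<iota> (cb2 * nb / cb1)))" by (simp only: 1(3)[symmetric] matrix_mul_assoc)
  finally have "star P1 ** (star g ** g ** P1) = star P1 ** (P1 ** mat2 (\<iota> (ca2 * na / ca1)) 0 0 (\<iota> (cb2 * nb / cb1)))" .
  moreover have "invertible (star P1)" using 1(1) by (simp add: invertible_2_iff)
  ultimately have "star g ** g ** P1 = P1 ** mat2 (\<iota> (ca2 * na / ca1)) 0 0 (\<iota> (cb2 * nb / cb1))" by (rule left_cancel[rotated])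
  moreover have "cb2 * nb / cb1 \<noteq> 0" using nb 1 2 by simp
  moreover have "vl (cb2 * nb / cb1) = vl cb2 + 2 * vl b - vl cb1" using nb vnb 1 2 by (simp add: vl_divide vl_mult)
  then have "even (vl (cb2 * nb / cb1)) \<longleftrightarrow> even (vl cb1) = even (vl cb2)" by auto
  ultimately show ?thesis by blast
qed

text \<open>Existence of the polynomial is linear interpolation at the two eigenvalues; its value at
  \<open>db\<close> is unique because it is read off from the action on the second
  eigenvector.\<close>

lemma eigen_component_eq:
  fixes \<delta> P w :: "'e^2^2"
  assumes P: "invertible P" "\<delta> ** P = P ** mat2 (\<iota> da) 0 0 (\<iota> db)" "da \<noteq> db" and w: "w ** P = P ** mat2 (\<iota> a) 0 0 (\<iota> b)"
  shows "eigen_component \<iota> \<delta> db w = b"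
  unfolding eigen_component_def
proof (rule the_equality)
  have ev: "eval_at_matrix (map_poly \<iota> q) \<delta> ** P = P ** mat2 (\<iota> (poly q da)) 0 0 (\<iota> (poly q db))" for q
    by (simp add: eval_at_matrix_diag[OF P(2)] poly_map_poly_hom)
  define m where "m = (a - b) / (da - db)"
  define q where "q = [:b - m * db, m:]"
  have "m * (da - db) = a - b" using P(3) by (simp add: m_def)
  then have "poly q da = a" "poly q db = b" by (simp_all add: q_def algebra_simps)
  then have "w ** P = eval_at_matrix (map_poly \<iota> q) \<delta> ** P" by (simp only: ev w)
  then have "w = eval_at_matrix (map_poly \<iota> q) \<delta>" by (rule right_cancel[OF P(1)])
  then show "\<exists>q. w = eval_at_matrix (map_poly \<iota> q) \<delta> \<and> b = poly q db" using \<open>poly q db = b\<close> by blast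
  fix b' assume "\<exists>q. w = eval_at_matrix (map_poly \<iota> q) \<delta> \<and> b' = poly q db"
  then obtain q where q: "w = eval_at_matrix (map_poly \<iota> q) \<delta>" "b' = poly q db" by (elim exE conjE) (rule that)
  have "P ** mat2 (\<iota> (poly q da)) 0 0 (\<iota> (poly q db)) = P ** mat2 (\<iota> a) 0 0 (\<iota> b)" by (simp only: ev[symmetric] q(1)[symmetric] w)
  then have "mat2 (\<iota> (poly q da)) 0 0 (\<iota> (poly q db)) = mat2 (\<iota> a) 0 0 (\<iota> b)" by (rule left_cancel[OF P(1)])
  then show "b' = b" by (simp add: matrix_2_eq_iff q(2))
qed

text \<open>Two choices enter and neither matters: every admissible \<open>c\<close> is
  \<open>star g ** g\<close>, to which \<open>transport_diag\<close> applies, and another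
  representative of its class changes the component at \<open>db\<close> by a norm.\<close>

lemma kappa_eq:
  assumes e1: "eigenbasis \<delta>1 P1 da db ca1 cb1" and e2: "eigenbasis \<delta>2 P2 da db ca2 cb2"
  shows "kappa \<iota> \<sigma> \<delta>1 db (inv_class \<sigma> h2 h2 \<delta>1 \<delta>2) = (if even (vl cb1) = even (vl cb2) then 1 else -1)"
proof -
  have P1: "invertible P1" "\<delta>1 ** P1 = P1 ** mat2 (\<iota> da) 0 0 (\<iota> db)" "da \<noteq> db"
    and P2: "invertible P2" using e1 e2 by (simp_all add: eigenbasis_def invertible_2_iff)
  define good where "good c \<longleftrightarrow> (\<exists>g. invertible g \<and> \<delta>2 = g ** \<delta>1 ** matrix_inv g \<and> (\<forall>u v. h2 (g *v u) (g *v v) = h2 (c *v u) v))" for c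
  define c where "c = (SOME c. good c)"
  \<comment> \<open>The change of eigenbasis provides an admissible \<open>c\<close>, so the choice
    operator returns one.\<close>
  have "good (star (P2 ** matrix_inv P1) ** (P2 ** matrix_inv P1))" unfolding good_def
  proof (intro exI conjI allI)
    let ?g = "P2 ** matrix_inv P1"
    show "invertible ?g" using P1(1) P2 by (intro invertible_mult invertible_matrix_inv)
    have i: "matrix_inv ?g = P1 ** matrix_inv P2"
    proof (rule matrix_inv_unique)
      show "?g ** (P1 ** matrix_inv P2) = mat 1"
        by (simp only: matrix_mul_assoc[symmetric]) (simp only: matrix_mul_assoc[of "matrix_inv P1"] matrix_inv_left[OF P1(1)] matrix_mul_lid matrix_inv_right[OF P2])
    qed
    show "\<delta>2 = ?g ** \<delta>1 ** matrix_inv ?g"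
      unfolding i eigenbasis_trace_det(3)[OF e1] eigenbasis_trace_det(3)[OF e2]
      by (simp only: matrix_mul_assoc[symmetric])
        (simp only: matrix_mul_assoc[of "matrix_inv P1"] matrix_inv_left[OF P1(1)] matrix_mul_lid)
    fix u v
    show "h2 (?g *v u) (?g *v v) = h2 (star ?g ** ?g *v u) v"
      by (simp only: h2_adj star_mult[of "star ?g" ?g] star_star matrix_vector_mul_assoc)
  qed
  then have "good c" unfolding c_def by (rule someI)
  then obtain g where g0: "invertible g \<and> \<delta>2 = g ** \<delta>1 ** matrix_inv g \<and> (\<forall>u v. h2 (g *v u) (g *v v) = h2 (c *v u) v)"
    unfolding good_def by (elim exE) (rule that)
  have g: "invertible g" "\<delta>2 = g ** \<delta>1 ** matrix_inv g" "\<And>u v. h2 (g *v u) (g *v v) = h2 (c *v u) v"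
    using conjunct1[OF g0] conjunct1[OF conjunct2[OF g0]] conjunct2[OF conjunct2[OF g0]] by simp_all
  have cg: "c = star g ** g" by (rule similitude_form) (rule g(3))
  obtain la lb :: 'f where l: "c ** P1 = P1 ** mat2 (\<iota> la) 0 0 (\<iota> lb)" "lb \<noteq> 0" "even (vl lb) \<longleftrightarrow> even (vl cb1) = even (vl cb2)"
    using transport_diag[OF e1 e2 g(1,2)] unfolding cg[symmetric] by (elim exE conjE) (rule that)
  let ?C = "norm_class \<sigma> \<delta>1 c"
  have C: "inv_class \<sigma> h2 h2 \<delta>1 \<delta>2 = ?C" unfolding inv_class_def c_def good_def ..
  have ev: "eval_at_matrix q \<delta>1 ** P1 = P1 ** mat2 (poly q (\<iota> da)) 0 0 (poly q (\<iota> db))" for q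
    by (rule eval_at_matrix_diag[OF P1(2)])
  have ev1: "eval_at_matrix 1 \<delta>1 = mat 1" by (simp add: eval_at_matrix_def)
  \<comment> \<open>The constant polynomial 1 shows that the class is nonempty.\<close>
  have "c ** (eval_at_matrix 1 \<delta>1 ** eval_at_matrix (map_poly \<sigma> 1) \<delta>1) \<in> ?C"
    unfolding norm_class_def mem_Collect_eq by (intro exI conjI) (rule refl, simp add: ev1)
  then have "(SOME w. w \<in> ?C) \<in> ?C" by (rule someI)
  define w where "w = (SOME w. w \<in> ?C)"
  have "w \<in> ?C" using \<open>(SOME w. w \<in> ?C) \<in> ?C\<close> unfolding w_def .
  then obtain q where q: "w = c ** (eval_at_matrix q \<delta>1 ** eval_at_matrix (map_poly \<sigma> q) \<delta>1)" "invertible (eval_at_matrix q \<delta>1)"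
    unfolding norm_class_def mem_Collect_eq by (elim exE conjE) (rule that)
  let ?a = "poly q (\<iota> da)" and ?b = "poly q (\<iota> db)"
  have \<sigma>q: "poly (map_poly \<sigma> q) (\<iota> x) = \<sigma> (poly q (\<iota> x))" for x
    using poly_map_poly_hom[of \<sigma> q "\<iota> x"] by simp
  have "invertible (eval_at_matrix q \<delta>1 ** P1)" using q(2) P1(1) by (rule invertible_mult)
  then have b0: "?a \<noteq> 0" "?b \<noteq> 0" unfolding ev by (simp_all add: invertible_2_iff det_mul)
  obtain na nb :: 'f where n: "N ?a = \<iota> na" "N ?b = \<iota> nb" using N_in_F by metis
  have nb: "nb \<noteq> 0" using n(2) b0(2) by auto
  then have vnb: "vl nb = 2 * vl ?b" using vl_\<iota>[of nb] vl_N[OF b0(2)] by (simp add: n(2))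
  have "w ** P1 = c ** (eval_at_matrix q \<delta>1 ** (eval_at_matrix (map_poly \<sigma> q) \<delta>1 ** P1))"
    by (simp only: q(1) matrix_mul_assoc)
  also have "\<dots> = c ** ((eval_at_matrix q \<delta>1 ** P1) ** mat2 (\<sigma> ?a) 0 0 (\<sigma> ?b))"
    by (simp only: ev \<sigma>q matrix_mul_assoc)
  also have "\<dots> = (c ** P1) ** (mat2 ?a 0 0 ?b ** mat2 (\<sigma> ?a) 0 0 (\<sigma> ?b))" by (simp only: ev matrix_mul_assoc)
  also have "\<dots> = P1 ** (mat2 (\<iota> la) 0 0 (\<iota> lb) ** (mat2 ?a 0 0 ?b ** mat2 (\<sigma> ?a) 0 0 (\<sigma> ?b)))" by (simp only: l(1) matrix_mul_assoc)
  also have "mat2 (\<iota> la) 0 0 (\<iota> lb) ** (mat2 ?a 0 0 ?b ** mat2 (\<sigma> ?a) 0 0 (\<sigma> ?b)) = mat2 (\<iota> (la * na)) 0 0 (\<iota> (lb * nb))"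
    by (simp add: matrix_2_eq_iff n)
  finally have "eigen_component \<iota> \<delta>1 db w = lb * nb" by (rule eigen_component_eq[OF P1])
  then have "kappa \<iota> \<sigma> \<delta>1 db ?C = omega \<iota> \<sigma> (lb * nb)" by (simp only: kappa_def w_def[symmetric])
  also have "\<dots> = (if even (vl (lb * nb)) then 1 else -1)" using l(2) nb by (intro omega_eq) simp
  also have "vl (lb * nb) = vl lb + 2 * vl ?b" using l(2) nb vnb by (simp add: vl_mult)
  finally show ?thesis unfolding C using l(3) by simp
qed

end

section \<open>Stable and rational orbits\<close>

lemma det_uminus_2: "det (- A) = det (A :: 'k::comm_ring_1^2^2)"
  by (simp add: det_2)

context split_plane
begin

lemma trace_to_ac: "trace (map_matrix to_ac A) = to_ac (trace (A :: 'e^2^2))"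
  by (simp add: trace_2 map_matrix_def)

lemma det_to_ac: "det (map_matrix to_ac A) = to_ac (det (A :: 'e^2^2))"
  by (simp add: det_2 map_matrix_def)

lemma eigenbasis_neq_0:
  assumes "eigenbasis (- (x ** star x)) P da db ca cb" "invertible x"
  shows "da \<noteq> 0" "db \<noteq> 0"
proof -
  have "det (- (x ** star x)) = det (x ** star x)" by (rule det_uminus_2)
  then have "\<iota> (da * db) = N (det x)" using eigenbasis_trace_det(2)[OF assms(1)] by (simp add: det_mul)
  then have "\<iota> (da * db) \<noteq> 0" using assms(2) by (simp add: invertible_2_iff)
  then show "da \<noteq> 0" "db \<noteq> 0" by auto
qed

text \<open>Trace and determinant of \<open>x ** star x\<close> are preserved over the algebraic
  closure, and they determine the eigenvalues. Conversely the eigenbases give a rational conjugation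
  \<open>G\<close>, and the second component \<open>H\<close> is forced by
  \<open>y ** H = G ** x\<close>.\<close>

lemma stable_orbit_iff:
  assumes e: "eigenbasis (- (x ** star x)) P da db ca cb" and x: "invertible x"
  shows "y \<in> stable_orbit h2 h2 x \<longleftrightarrow> (\<exists>P' ca' cb'. eigenbasis (- (y ** star y)) P' da db ca' cb')"
proof
  assume y: "y \<in> stable_orbit h2 h2 x"
  obtain g :: "'e alg_closure^2^2" where g: "invertible g"
    "map_matrix to_ac (y ** star y) = g ** map_matrix to_ac (x ** star x) ** matrix_inv g"
    using stable_orbit_conj[OF y] unfolding herm_adj_2 by (elim exE conjE) (rule that)
  have "to_ac (trace (y ** star y)) = to_ac (trace (x ** star x))" "to_ac (det (y ** star y)) = to_ac (det (x ** star x))"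
    using conj_trace_det[OF g(1), of "map_matrix to_ac (x ** star x)"] unfolding g(2)[symmetric]
    by (simp_all only: trace_to_ac det_to_ac)
  then have td: "trace (y ** star y) = trace (x ** star x)" "det (y ** star y) = det (x ** star x)" by simp_all
  have m: "trace (- A) = - trace A" "det (- A) = det A" for A :: "'e^2^2" by (simp_all add: trace_2 det_2)
  have "trace (- (y ** star y)) = \<iota> (da + db)" "det (- (y ** star y)) = \<iota> (da * db)"
    unfolding m td using eigenbasis_trace_det(1,2)[OF e] by (simp_all only: trace_2[symmetric] m)
  moreover have "da \<noteq> db" using e by (simp add: eigenbasis_def)
  ultimately show "\<exists>P' ca' cb'. eigenbasis (- (y ** star y)) P' da db ca' cb'"
    by (intro eigenbasis_exists star_contraction) (simp_all only: trace_2[symmetric] not_False_eq_True)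
next
  assume "\<exists>P' ca' cb'. eigenbasis (- (y ** star y)) P' da db ca' cb'"
  then obtain P' ca' cb' where e': "eigenbasis (- (y ** star y)) P' da db ca' cb'" by (elim exE) (rule that)
  have PP: "invertible P" "invertible P'" using e e' by (simp_all add: eigenbasis_def invertible_2_iff)
  have "det (- (y ** star y)) = det (y ** star y)" by (rule det_uminus_2)
  then have "N (det y) = \<iota> (da * db)" using eigenbasis_trace_det(2)[OF e'] by (simp add: det_mul)
  then have "N (det y) \<noteq> 0" using eigenbasis_neq_0[OF e x] by simp
  then have iy: "invertible y" by (auto simp: invertible_2_iff)
  define G where "G = P' ** matrix_inv P"
  have iG: "invertible G" unfolding G_def using PP by (intro invertible_mult invertible_matrix_inv)
  have "G ** (- (x ** star x)) = - (y ** star y) ** G"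
    unfolding eigenbasis_trace_det(3)[OF e] eigenbasis_trace_det(3)[OF e'] G_def
    by (simp only: matrix_mul_assoc[symmetric])
      (simp only: matrix_mul_assoc[of "matrix_inv P"] matrix_mul_assoc[of "matrix_inv P'"] matrix_inv_left[OF PP(1)] matrix_inv_left[OF PP(2)] matrix_mul_lid)
  then have "- (G ** (x ** star x)) = - ((y ** star y) ** G)" by (simp add: matrix_2_eq_iff algebra_simps)
  then have Gc: "G ** (x ** star x) = (y ** star y) ** G" by simp
  define H where "H = matrix_inv y ** G ** x"
  have iH: "invertible H" unfolding H_def using iy iG x by (intro invertible_mult invertible_matrix_inv)
  have yH: "y ** H = G ** x" by (simp only: H_def matrix_mul_assoc matrix_inv_right[OF iy] matrix_mul_lid)
  have "y ** (star y ** G) = y ** (H ** star x)" by (simp only: matrix_mul_assoc yH Gc[symmetric])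
  then have sH: "star y ** G = H ** star x" by (rule left_cancel[OF iy])
  let ?m = "map_matrix to_ac :: 'e^2^2 \<Rightarrow> _"
  note mm = map_matrix_mult[OF field_hom_to_ac, where 'n = 2]
  have inv: "invertible (?m A)" if "invertible A" for A
    using that by (simp add: invertible_2_iff det_to_ac)
  have 1: "?m y = ?m G ** ?m x ** matrix_inv (?m H)"
  proof (rule right_cancel[OF inv[OF iH]])
    show "?m y ** ?m H = ?m G ** ?m x ** matrix_inv (?m H) ** ?m H"
      by (simp only: matrix_mul_assoc[symmetric] matrix_inv_left[OF inv[OF iH]] matrix_mul_rid) (simp only: mm[symmetric] yH)
  qed
  have 2: "?m (star y) = ?m H ** ?m (star x) ** matrix_inv (?m G)"
  proof (rule right_cancel[OF inv[OF iG]])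
    show "?m (star y) ** ?m G = ?m H ** ?m (star x) ** matrix_inv (?m G) ** ?m G"
      by (simp only: matrix_mul_assoc[symmetric] matrix_inv_left[OF inv[OF iG]] matrix_mul_rid) (simp only: mm[symmetric] sH)
  qed
  show "y \<in> stable_orbit h2 h2 x"
    unfolding stable_orbit_def geom_point_def geom_orbit_def herm_adj_2 mem_Collect_eq prod.case 1 2
    by (intro exI conjI) (rule refl, rule inv[OF iG], rule inv[OF iH])
qed

lemma G2_iff: "g \<in> carrier G2 \<longleftrightarrow> fst g \<in> U \<and> snd g \<in> U"
  by (cases g) (simp add: DirProd_def)

lemma eigenbasis_act:
  assumes "eigenbasis (- (y ** star y)) P da db ca cb" "k \<in> carrier G2"
  shows "eigenbasis (- (pair_act k y ** star (pair_act k y))) (fst k ** P) da db ca cb"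
proof -
  have k: "fst k \<in> U" "snd k \<in> U" using assms(2) unfolding G2_iff by auto
  have k': "star (snd k) ** snd k = mat 1" using k(2) by (simp only: U_iff)
  have "pair_act k y ** star (pair_act k y) = fst k ** y ** (star (snd k) ** snd k) ** star y ** star (fst k)"
    by (simp only: act_G2(1)[OF assms(2)] star_mult star_star matrix_mul_assoc)
  then have "- (pair_act k y ** star (pair_act k y)) = - (fst k ** (y ** star y) ** star (fst k))"
    by (simp only: k' matrix_mul_rid matrix_mul_assoc)
  also have "\<dots> = fst k ** (- (y ** star y)) ** star (fst k)" by (simp add: matrix_2_eq_iff algebra_simps)
  finally show ?thesis using eigenbasis_conj[OF assms(1) k(1)] by (simp only:)
qed

text \<open>A unitary \<open>g\<close> conjugates the contractions. The solution \<open>w\<close> of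
  \<open>y ** w = star g ** z\<close> is then unitary, because \<open>y\<close> and
  \<open>star y\<close> cancel in the comparison of the contractions.\<close>

lemma same_parity_orbit:
  assumes e: "eigenbasis (- (y ** star y)) P da db ca cb" and e': "eigenbasis (- (z ** star z)) P' da db ca' cb'"
    and iy: "invertible y" and par: "even (vl cb) = even (vl cb')"
  shows "\<exists>k\<in>carrier G2. z = pair_act k y"
proof -
  obtain g where g: "g \<in> U" "- (z ** star z) = g ** (- (y ** star y)) ** star g"
    using eigenbasis_same_class[OF e e' par] by (elim bexE) (rule that)
  have gg: "star g ** g = mat 1" "g ** star g = mat 1" by (rule iffD1[OF U_iff g(1)], rule iffD1[OF U_iff' g(1)])
  have "- (z ** star z) = - (g ** (y ** star y) ** star g)" unfolding g(2) by (simp add: matrix_2_eq_iff algebra_simps)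
  then have zz: "z ** star z = g ** (y ** star y) ** star g" by simp
  have isy: "invertible (star y)" using iy by (simp add: invertible_2_iff)
  define w where "w = matrix_inv y ** star g ** z"
  have yw: "y ** w = star g ** z" by (simp only: w_def matrix_mul_assoc matrix_inv_right[OF iy] matrix_mul_lid)
  have "(y ** (w ** star w)) ** star y = (y ** w) ** star (y ** w)" by (simp only: star_mult matrix_mul_assoc)
  also have "\<dots> = star g ** (z ** star z) ** g" unfolding yw by (simp only: star_mult star_star matrix_mul_assoc)
  also have "\<dots> = (star g ** g) ** (y ** star y) ** (star g ** g)" unfolding zz by (simp only: matrix_mul_assoc)
  also have "\<dots> = (y ** mat 1) ** star y" by (simp only: gg matrix_mul_lid matrix_mul_rid)
  finally have "y ** (w ** star w) = y ** mat 1" by (rule right_cancel[OF isy])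
  then have "w ** star w = mat 1" by (rule left_cancel[OF iy])
  then have w: "w \<in> U" by (simp only: U_iff')
  have k: "(g, star w) \<in> carrier G2" using g(1) U_D(3)[OF w] unfolding G2_iff by simp
  have "pair_act (g, star w) y = g ** (y ** w)" by (simp only: act_G2(1)[OF k] fst_conv snd_conv star_star matrix_mul_assoc)
  also have "\<dots> = z" by (simp only: yw matrix_mul_assoc gg matrix_mul_lid)
  finally show ?thesis using k by (intro bexI[of _ "(g, star w)"]) (simp_all only:)
qed

abbreviation orb :: "'e^2^2 \<Rightarrow> ('e^2^2) set" where "orb \<equiv> rational_orbit G2 pair_act"

lemma orb_self: "y \<in> orb y"
proof -
  have "\<one>\<^bsub>G2\<^esub> \<in> carrier G2" by (rule monoid.one_closed[OF group.is_monoid[OF haar_group_in[OF haar_G2]]])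
  then show ?thesis unfolding rational_orbit_def mem_Collect_eq by (intro exI[of _ "\<one>\<^bsub>G2\<^esub>"] conjI act_G2_one[symmetric])
qed

lemma orb_act:
  assumes k: "k \<in> carrier G2"
  shows "orb (pair_act k y) = orb y"
proof -
  interpret group G2 by (rule haar_group_in[OF haar_G2])
  show ?thesis
  proof
    show "orb (pair_act k y) \<subseteq> orb y"
    proof
      fix z assume "z \<in> orb (pair_act k y)"
      then obtain g where g: "z = pair_act g (pair_act k y)" "g \<in> carrier G2" unfolding rational_orbit_def mem_Collect_eq by (elim exE conjE) (rule that)
      show "z \<in> orb y" unfolding rational_orbit_def mem_Collect_eq
        by (intro exI[of _ "g \<otimes>\<^bsub>G2\<^esub> k"] conjI m_closed g(2) k) (simp only: act_G2_mult[OF g(2) k] g(1))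
    qed
    show "orb y \<subseteq> orb (pair_act k y)"
    proof
      fix z assume "z \<in> orb y"
      then obtain g where g: "z = pair_act g y" "g \<in> carrier G2" unfolding rational_orbit_def mem_Collect_eq by (elim exE conjE) (rule that)
      have gk: "g \<otimes>\<^bsub>G2\<^esub> inv\<^bsub>G2\<^esub> k \<in> carrier G2" using g(2) k by (intro m_closed inv_closed)
      have "pair_act (g \<otimes>\<^bsub>G2\<^esub> inv\<^bsub>G2\<^esub> k) (pair_act k y) = pair_act (g \<otimes>\<^bsub>G2\<^esub> inv\<^bsub>G2\<^esub> k \<otimes>\<^bsub>G2\<^esub> k) y"
        by (rule act_G2_mult[OF gk k, symmetric])
      also have "g \<otimes>\<^bsub>G2\<^esub> inv\<^bsub>G2\<^esub> k \<otimes>\<^bsub>G2\<^esub> k = g" by (simp only: m_assoc[OF g(2) inv_closed[OF k] k] l_inv[OF k] r_one[OF g(2)])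
      finally show "z \<in> orb (pair_act k y)" unfolding rational_orbit_def mem_Collect_eq
        using gk by (intro exI[of _ "g \<otimes>\<^bsub>G2\<^esub> inv\<^bsub>G2\<^esub> k"]) (simp only: g(1))
    qed
  qed
qed

text \<open>\<kappa> compares the parity of an orbit with the parity at \<open>x\<close>, which
  explains the sign in front. Any representatives of the two parities may serve: \<open>x\<close>
  and its adjoint, or a diagonal matrix and its conjugate by a similitude.\<close>

lemma RO_kappa_eq:
  assumes e: "eigenbasis (- (x ** star x)) P da db ca cb" and x: "invertible x"
    and e1: "eigenbasis (- (y1 ** star y1)) P1 da db ca1 cb1" "even (vl cb1)"
    and e2: "eigenbasis (- (y2 ** star y2)) P2 da db ca2 cb2" "odd (vl cb2)"
  shows "RO_kappa \<iota> \<sigma> dg h2 db x (indicator integral_matrices) = (if even (vl cb) then 1 else -1) * (ro y1 - ro y2)"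
proof -
  have inv: "invertible y" if "eigenbasis (- (y ** star y)) Q da db c c'" for y Q c c'
  proof -
    have "det (- (y ** star y)) = det (y ** star y)" by (rule det_uminus_2)
    then have "N (det y) = \<iota> (da * db)" using eigenbasis_trace_det(2)[OF that] by (simp add: det_mul)
    then have "N (det y) \<noteq> 0" using eigenbasis_neq_0[OF e x] by simp
    then show ?thesis by (auto simp: invertible_2_iff)
  qed
  define F where "F O' = (let x' = SOME y. y \<in> O' in
    kappa \<iota> \<sigma> (- (x ** star x)) db (inv_class \<sigma> h2 h2 (- (x ** star x)) (- (x' ** star x'))) * RO dg h2 x' (indicator integral_matrices))" for O'
  \<comment> \<open>The representative picked from an orbit is irrelevant: the group action
    preserves the norms of eigenvectors and the value of \<open>ro\<close>.\<close>
  have F: "F (orb y) = (if even (vl cb) = even (vl c') then 1 else -1) * ro y" if E: "eigenbasis (- (y ** star y)) Q da db c c'" for y Q c c'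
  proof -
    define x' where "x' = (SOME z. z \<in> orb y)"
    have "x' \<in> orb y" unfolding x'_def using orb_self by (rule someI)
    then obtain k where k: "x' = pair_act k y" "k \<in> carrier G2" unfolding rational_orbit_def mem_Collect_eq by (elim exE conjE) (rule that)
    have E': "eigenbasis (- (x' ** star x')) (fst k ** Q) da db c c'" unfolding k(1) by (rule eigenbasis_act[OF E k(2)])
    have "RO dg h2 x' (indicator integral_matrices) = ro x'" unfolding ro_def by (rule RO_integral[OF E' inv[OF E']])
    also have "\<dots> = ro y" unfolding k(1) by (rule ro_orbit[OF k(2)])
    finally show ?thesis unfolding F_def Let_def x'_def[symmetric] kappa_eq[OF e E'] by simp
  qed
  have ne: "orb y1 \<noteq> orb y2"
  proof
    assume "orb y1 = orb y2"
    then have "y1 \<in> orb y2" using orb_self[of y1] by simp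
    then obtain k where k: "y1 = pair_act k y2" "k \<in> carrier G2" unfolding rational_orbit_def mem_Collect_eq by (elim exE conjE) (rule that)
    have "eigenbasis (- (y1 ** star y1)) (fst k ** P2) da db ca2 cb2" unfolding k(1) by (rule eigenbasis_act[OF e2(1) k(2)])
    then show False using eigenbasis_unique[OF e1(1)] e1(2) e2(2) by blast
  qed
  have "orb ` stable_orbit h2 h2 x = {orb y1, orb y2}"
  proof
    show "{orb y1, orb y2} \<subseteq> orb ` stable_orbit h2 h2 x"
      using stable_orbit_iff[OF e x, of y1] stable_orbit_iff[OF e x, of y2] e1(1) e2(1) by blast
    show "orb ` stable_orbit h2 h2 x \<subseteq> {orb y1, orb y2}"
    proof (rule image_subsetI)
      fix z assume "z \<in> stable_orbit h2 h2 x"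
      then obtain Q c c' where E: "eigenbasis (- (z ** star z)) Q da db c c'" unfolding stable_orbit_iff[OF e x] by (elim exE) (rule that)
      show "orb z \<in> {orb y1, orb y2}"
      proof (cases "even (vl c')")
        case True
        then obtain k where "k \<in> carrier G2" "z = pair_act k y1" using same_parity_orbit[OF e1(1) E inv[OF e1(1)]] e1(2) by blast
        then show ?thesis using orb_act by simp
      next
        case False
        then obtain k where "k \<in> carrier G2" "z = pair_act k y2" using same_parity_orbit[OF e2(1) E inv[OF e2(1)]] e2(2) by blast
        then show ?thesis using orb_act by simp
      qed
    qed
  qed
  then have "RO_kappa \<iota> \<sigma> dg h2 db x (indicator integral_matrices) = (\<Sum>O'\<in>{orb y1, orb y2}. F O')"
    unfolding RO_kappa_def Let_def contraction_2 F_def by (simp only:)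
  also have "\<dots> = F (orb y1) + F (orb y2)" using ne by simp
  also have "\<dots> = (if even (vl cb) then 1 else -1) * (ro y1 - ro y2)"
    unfolding F[OF e1(1)] F[OF e2(1)] using e1(2) e2(2) by (simp add: algebra_simps)
  finally show ?thesis .
qed

text \<open>\<open>star x\<close> carries eigenvectors of \<open>x ** star x\<close> to eigenvectors
  of \<open>star x ** x\<close> and multiplies their norms by the eigenvalues up to sign. An odd
  eigenvalue therefore exchanges the two orbits.\<close>

lemma eigenbasis_star:
  assumes e: "eigenbasis (- (x ** star x)) P da db ca cb" and x: "invertible x"
  shows "eigenbasis (- (star x ** star (star x))) (star x ** P) da db (- ca * da) (- cb * db)"
proof -
  have E: "det P \<noteq> 0" "da \<noteq> db" "ca \<noteq> 0" "cb \<noteq> 0" "- (x ** star x) ** P = P ** mat2 (\<iota> da) 0 0 (\<iota> db)"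
    "star P ** P = mat2 (\<iota> ca) 0 0 (\<iota> cb)" using e by (simp_all add: eigenbasis_def)
  have m: "(- A) ** B = - (A ** B)" "A ** (- B) = - (A ** B)" for A B :: "'e^2^2" by (simp_all add: matrix_2_eq_iff algebra_simps)
  have "- (star x ** star (star x)) ** (star x ** P) = star x ** (- (x ** star x) ** P)"
    by (simp only: m star_star matrix_mul_assoc)
  also have "\<dots> = star x ** P ** mat2 (\<iota> da) 0 0 (\<iota> db)" by (simp only: E(5) matrix_mul_assoc)
  finally have 1: "- (star x ** star (star x)) ** (star x ** P) = star x ** P ** mat2 (\<iota> da) 0 0 (\<iota> db)" .
  have "star (star x ** P) ** (star x ** P) = - (star P ** (- (x ** star x) ** P))"
    by (simp only: m star_mult star_star matrix_mul_assoc minus_minus)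
  also have "\<dots> = - (mat2 (\<iota> ca) 0 0 (\<iota> cb) ** mat2 (\<iota> da) 0 0 (\<iota> db))" by (simp only: E(5) E(6)[symmetric] matrix_mul_assoc)
  also have "\<dots> = mat2 (\<iota> (- ca * da)) 0 0 (\<iota> (- cb * db))" by (simp add: matrix_2_eq_iff)
  finally have 2: "star (star x ** P) ** (star x ** P) = mat2 (\<iota> (- ca * da)) 0 0 (\<iota> (- cb * db))" .
  have "det (star x ** P) \<noteq> 0" using E(1) x by (simp add: det_mul invertible_2_iff)
  then show ?thesis unfolding eigenbasis_def using E eigenbasis_neq_0[OF e x] 1 2 by simp
qed

text \<open>\<open>eigenbasis_parity\<close> holds for \<open>x\<close> and for its adjoint, and the
  norms for the two differ by the eigenvalues. Hence one odd eigenvalue makes both odd.\<close>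

lemma eigenvalue_parity:
  assumes e: "eigenbasis (- (x ** star x)) P da db ca cb" and x: "invertible x"
  shows "even (vl da) \<longleftrightarrow> even (vl db)"
proof -
  have n: "da \<noteq> 0" "db \<noteq> 0" "ca \<noteq> 0" "cb \<noteq> 0" using eigenbasis_neq_0[OF e x] e by (simp_all add: eigenbasis_def)
  have v: "vl (- ca * da) = vl ca + vl da" "vl (- cb * db) = vl cb + vl db" using n by (simp_all add: vl_mult vl_minus)
  show ?thesis using eigenbasis_parity[OF e] eigenbasis_parity[OF eigenbasis_star[OF e x]] unfolding v by auto
qed

lemma RO_kappa_nonsplit:
  assumes e: "eigenbasis (- (x ** star x)) P da db ca cb" and x: "invertible x" and odd: "odd (vl db)"
  shows "RO_kappa \<iota> \<sigma> dg h2 db x (indicator integral_matrices) = 0"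
proof -
  have n: "db \<noteq> 0" "cb \<noteq> 0" using eigenbasis_neq_0[OF e x] e by (simp_all add: eigenbasis_def)
  have v: "vl (- cb * db) = vl cb + vl db" using n by (simp add: vl_mult vl_minus)
  note e' = eigenbasis_star[OF e x]
  show ?thesis
  proof (cases "even (vl cb)")
    case True
    then have "odd (vl (- cb * db))" unfolding v using odd by simp
    from RO_kappa_eq[OF e x e True e' this] show ?thesis by (simp add: ro_star)
  next
    case False
    then have "even (vl (- cb * db))" unfolding v using odd by simp
    from RO_kappa_eq[OF e x e' this e False] show ?thesis by (simp add: ro_star)
  qed
qed

lemma ex_p_similitude: "\<exists>Q. star Q ** Q = mat p"
proof -
  obtain s :: 'e where s: "s \<in> S" using S_nonempty by blast
  have "star (gm 1 0 s) ** gm 1 0 s = mat p" using gm_similitude[OF s, of 1 0] by simp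
  then show ?thesis ..
qed

text \<open>The identity is an eigenbasis with norms 1 for the diagonal matrix, and \<open>Q\<close>
  is one with norms of valuation 1 for its conjugate.\<close>

lemma diagonal_orbits:
  assumes xab: "xa \<noteq> 0" "xb \<noteq> 0" "\<iota> da = - N xa" "\<iota> db = - N xb" "da \<noteq> db"
  shows "eigenbasis (- (mat2 xa 0 0 xb ** star (mat2 xa 0 0 xb))) (mat 1) da db 1 1"
    "star Q ** Q = mat p \<Longrightarrow> \<exists>c. odd (vl c) \<and>
      eigenbasis (- (Q ** mat2 xa 0 0 xb ** matrix_inv Q ** star (Q ** mat2 xa 0 0 xb ** matrix_inv Q))) Q da db c c"
proof -
  let ?X = "mat2 xa 0 0 xb" and ?D = "mat2 (\<iota> da) 0 0 (\<iota> db)"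
  have D: "- (?X ** star ?X) = ?D" using xab by (simp add: matrix_2_eq_iff)
  show "eigenbasis (- (?X ** star ?X)) (mat 1) da db 1 1"
    unfolding D eigenbasis_def using xab by (simp add: matrix_2_eq_iff)
  assume Q: "star Q ** Q = mat p"
  have p0: "p \<noteq> 0" by simp
  define c where "c = (SOME \<pi>::'f. uniformizer \<pi>)"
  have pc: "p = \<iota> c" by (simp add: p_def c_def)
  have c0: "c \<noteq> 0" using p0 pc by auto
  have vc: "vl c = 1" using vl_\<iota>[OF c0] vl_p pc by simp
  have "det (star Q ** Q) \<noteq> 0" unfolding Q using p0 by (simp add: det_2)
  then have iQ: "invertible Q" by (auto simp: det_mul invertible_2_iff)
  have isQ: "invertible (star Q)" using iQ by (simp add: invertible_2_iff)
  \<comment> \<open>For a similitude the inverse and the adjoint agree up to the multiplier, so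
    conjugation by \<open>Q\<close> also conjugates the contraction.\<close>
  have qs: "matrix_inv Q ** star (matrix_inv Q) = mat (1 / p)"
  proof (rule right_cancel[OF isQ])
    have "star (matrix_inv Q) ** star Q = mat 1" by (simp only: star_mult[symmetric] matrix_inv_right[OF iQ] star_mat_1)
    then have "matrix_inv Q ** star (matrix_inv Q) ** star Q = matrix_inv Q" by (simp only: matrix_mul_assoc[symmetric] matrix_mul_rid)
    also have "matrix_inv Q = mat (1 / p) ** star Q"
    proof (rule right_cancel[OF iQ])
      show "matrix_inv Q ** Q = mat (1 / p) ** star Q ** Q"
        unfolding matrix_mul_assoc[symmetric] Q matrix_inv_left[OF iQ] using p0 by (simp add: matrix_2_eq_iff)
    qed
    finally show "matrix_inv Q ** star (matrix_inv Q) ** star Q = mat (1 / p) ** star Q" .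
  qed
  let ?Y = "Q ** ?X ** matrix_inv Q"
  have "?Y ** star ?Y = Q ** ?X ** (matrix_inv Q ** star (matrix_inv Q)) ** star ?X ** star Q"
    by (simp only: star_mult matrix_mul_assoc)
  then have "?Y ** star ?Y ** Q = Q ** (?X ** mat (1 / p) ** star ?X ** mat p)"
    unfolding qs by (simp only: matrix_mul_assoc[symmetric] Q)
  also have "?X ** mat (1 / p) ** star ?X ** mat p = ?X ** star ?X" using p0 by (simp add: matrix_2_eq_iff)
  finally have "- (?Y ** star ?Y) ** Q = Q ** (- (?X ** star ?X))" by (simp add: matrix_2_eq_iff algebra_simps)
  then have "- (?Y ** star ?Y) ** Q = Q ** ?D" by (simp only: D)
  moreover have "star Q ** Q = mat2 (\<iota> c) 0 0 (\<iota> c)" unfolding Q by (simp add: pc matrix_2_eq_iff)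
  ultimately have "eigenbasis (- (?Y ** star ?Y)) Q da db c c"
    unfolding eigenbasis_def using iQ c0 xab(5) by (simp add: invertible_2_iff)
  then show "\<exists>c. odd (vl c) \<and> eigenbasis (- (?Y ** star ?Y)) Q da db c c" using vc by (intro exI[of _ c]) simp
qed

text \<open>The sign given by the parity of \<open>cb\<close> occurs twice, in front and inside
  \<open>RO_kappa\<close>, and squares to 1. What remains is \<open>(- q) ^ v\<close> against the
  factors \<open>(- 1) ^ v\<close> and \<open>(1 / q) ^ v\<close>, where \<open>v\<close> is the
  valuation of the difference of the eigenvalues.\<close>

lemma RO_kappa_split:
  assumes e: "eigenbasis (- (x ** star x)) P da db ca cb" and x: "invertible x"
    and xab: "xa \<noteq> 0" "xb \<noteq> 0" "\<iota> da = - N xa" "\<iota> db = - N xb"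
  shows "(if even (vl cb) then 1 else -1) * omega \<iota> \<sigma> (da - db) * complex_of_real (nabs (da - db))
      * RO_kappa \<iota> \<sigma> dg h2 db x (indicator integral_matrices)
    = indicator {z. nabs z \<le> 1} xa * indicator {z. nabs z \<le> 1} xb"
proof -
  have ne: "da \<noteq> db" using e by (simp add: eigenbasis_def)
  obtain Q where Q: "star Q ** Q = mat p" using ex_p_similitude by blast
  obtain c where c: "odd (vl c)"
    "eigenbasis (- (Q ** mat2 xa 0 0 xb ** matrix_inv Q ** star (Q ** mat2 xa 0 0 xb ** matrix_inv Q))) Q da db c c"
    using diagonal_orbits(2)[OF xab ne Q] by (elim exE conjE) (rule that)
  note e1 = diagonal_orbits(1)[OF xab ne]
  have one: "even (vl (1::'f))" by simp
  have d: "N xb - N xa = \<iota> (da - db)" using xab by simp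
  have d0: "N xb - N xa \<noteq> 0" unfolding d using ne by simp
  have vd: "vl (N xb - N xa) = vl (da - db)" unfolding d using ne by (intro vl_\<iota>) simp
  show ?thesis
  proof (cases "vl xa \<ge> 0 \<and> vl xb \<ge> 0")
    case True
    have sc: "finite (pairs 0 xa xb)" "finite (pairs 1 xa xb)" "0 \<le> vl (N xb - N xa)"
      "int (card (pairs 0 xa xb)) - int (card (pairs 1 xa xb)) = (- qF) ^ nat (vl (N xb - N xa))"
      using signed_count[OF xab(1,2) d0 conjunct1[OF True] conjunct2[OF True]] by blast+
    have r1: "ro (mat2 xa 0 0 xb) = of_nat (card (pairs 0 xa xb))"
      using ro_pairs[OF sc(1) _ xab(1,2), of "mat 1"] by simp
    have r2: "ro (Q ** mat2 xa 0 0 xb ** matrix_inv Q) = of_nat (card (pairs 1 xa xb))"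
      using ro_pairs[OF sc(2) _ xab(1,2), of Q] Q by simp
    obtain v where v: "vl (da - db) = int v" using sc(3) unfolding vd by (rule nonneg_int_cases)
    have q: "qF > 0" unfolding qF_def using residue_card_ge_2[where 'k='f] by simp
    have "ro (mat2 xa 0 0 xb) - ro (Q ** mat2 xa 0 0 xb ** matrix_inv Q)
      = of_int (int (card (pairs 0 xa xb)) - int (card (pairs 1 xa xb)))" unfolding r1 r2 by simp
    also have "\<dots> = of_int ((- qF) ^ v)" unfolding sc(4) vd v nat_int ..
    finally have rr: "ro (mat2 xa 0 0 xb) - ro (Q ** mat2 xa 0 0 xb ** matrix_inv Q) = of_int ((- qF) ^ v)" .
    have "nabs (da - db) = rad TYPE('f) powi int v" using nabs_vl[of "da - db"] ne by (simp only: v right_minus_eq not_False_eq_True)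
    then have n: "nabs (da - db) = (1 / of_int qF) ^ v" by (simp add: rad_def qF_def)
    have o: "omega \<iota> \<sigma> (da - db) = (-1) ^ v" using omega_eq[of "da - db"] ne v by (simp add: minus_one_power_iff)
    have "omega \<iota> \<sigma> (da - db) * complex_of_real (nabs (da - db)) * of_int ((- qF) ^ v) = ((-1) * (1 / of_int qF) * (- of_int qF)) ^ v"
      unfolding o n by (simp only: power_mult_distrib of_real_power of_real_divide of_real_1 of_real_of_int_eq of_int_power of_int_minus)
    also have "\<dots> = 1" using q by simp
    finally have *: "omega \<iota> \<sigma> (da - db) * complex_of_real (nabs (da - db)) * of_int ((- qF) ^ v) = 1" .
    have "nabs xa \<le> 1" "nabs xb \<le> 1" using True vl_nonneg_iff xab(1,2) by blast+
    then show ?thesis unfolding RO_kappa_eq[OF e x e1 one c(2,1)] rr using * by (auto simp: mult.assoc)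
  next
    case False
    \<comment> \<open>With a nonintegral entry both counts are empty, in agreement with the right
      side.\<close>
    then have em: "pairs i xa xb = {}" for i using pairs_nonintegral[OF xab(1,2)] by (meson not_le)
    have f: "finite (pairs i xa xb)" for i unfolding em by simp
    have r1: "ro (mat2 xa 0 0 xb) = 0"
      using ro_pairs[OF f _ xab(1,2), of 0 "mat 1"] by (simp add: em)
    have r2: "ro (Q ** mat2 xa 0 0 xb ** matrix_inv Q) = 0"
      using ro_pairs[OF f _ xab(1,2), of 1 Q] Q by (simp add: em)
    have "\<not> (nabs xa \<le> 1 \<and> nabs xb \<le> 1)" using False vl_nonneg_iff xab(1,2) by blast
    then show ?thesis unfolding RO_kappa_eq[OF e x e1 one c(2,1)] r1 r2 by (auto simp: indicator_def)
  qed
qed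

end

section \<open>Regular semisimple diagonal elements\<close>

text \<open>The scalar action inside \<open>geom_stabilizer_dim\<close>, named so that
  \<open>vector_space\<close> can be interpreted with it.\<close>

definition pair_scale :: "'k::field \<Rightarrow> ('k^2^2) \<times> ('k^2^2) \<Rightarrow> ('k^2^2) \<times> ('k^2^2)" where
  "pair_scale = (\<lambda>c (P, Q). (mat c ** P, mat c ** Q))"

lemma pair_scale [simp]: "pair_scale c (P, Q) = (mat c ** P, mat c ** Q)"
  by (simp add: pair_scale_def)

lemma vector_space_pairs: "vector_space (pair_scale :: 'k::field \<Rightarrow> _)"
  by unfold_locales (auto simp: matrix_2_eq_iff algebra_simps)

lemma pairs_spanned: "\<exists>T. finite T \<and> module.span pair_scale T = (UNIV :: (('k::field^2^2) \<times> ('k^2^2)) set)"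
proof -
  interpret V: vector_space "pair_scale :: 'k \<Rightarrow> _" by (rule vector_space_pairs)
  let ?T = "{(mat2 1 0 0 0, 0), (mat2 0 1 0 0, 0), (mat2 0 0 1 0, 0), (mat2 0 0 0 1, 0),
    (0, mat2 1 0 0 0), (0, mat2 0 1 0 0), (0, mat2 0 0 1 0), (0, mat2 0 0 0 1)} :: (('k^2^2) \<times> ('k^2^2)) set"
  have "(P, Q) \<in> V.span ?T" for P Q :: "'k^2^2"
  proof -
    have "(P, Q) = pair_scale (P $ 1 $ 1) (mat2 1 0 0 0, 0) + pair_scale (P $ 1 $ 2) (mat2 0 1 0 0, 0)
      + pair_scale (P $ 2 $ 1) (mat2 0 0 1 0, 0) + pair_scale (P $ 2 $ 2) (mat2 0 0 0 1, 0)
      + pair_scale (Q $ 1 $ 1) (0, mat2 1 0 0 0) + pair_scale (Q $ 1 $ 2) (0, mat2 0 1 0 0)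
      + pair_scale (Q $ 2 $ 1) (0, mat2 0 0 1 0) + pair_scale (Q $ 2 $ 2) (0, mat2 0 0 0 1)"
      by (simp add: matrix_2_eq_iff)
    also have "\<dots> \<in> V.span ?T" by (intro V.span_add V.span_scale V.span_base) simp_all
    finally show ?thesis .
  qed
  then have "V.span ?T = UNIV" by auto
  then show ?thesis by (intro exI[of _ ?T]) simp
qed

lemma dim_pairs_ge_2:
  fixes S :: "(('k::field^2^2) \<times> ('k^2^2)) set"
  assumes S: "u \<in> S" "v \<in> S" and ind: "\<And>a b. pair_scale a u + pair_scale b v = 0 \<Longrightarrow> a = 0 \<and> b = 0"
  shows "vector_space.dim pair_scale S \<ge> 2"
proof -
  interpret V: vector_space "pair_scale :: 'k \<Rightarrow> _" by (rule vector_space_pairs)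
  have u0: "u \<noteq> 0" using ind[of 1 0] by auto
  have nin: "v \<notin> V.span {u}"
  proof
    assume "v \<in> V.span {u}"
    then obtain k where k: "v = pair_scale k u" unfolding V.span_singleton by blast
    have "pair_scale k u + pair_scale (- 1) v = 0" unfolding k by (simp add: V.scale_minus_left)
    then show False using ind[of k "- 1"] by simp
  qed
  have ne: "u \<noteq> v" using nin V.span_base[of u "{u}"] by auto
  have i: "V.independent {v, u}" using nin u0 by (intro V.independent_insertI) (simp_all add: V.dependent_single V.independent_empty)
  obtain B where B: "{v, u} \<subseteq> B" "B \<subseteq> S" "V.independent B" "S \<subseteq> V.span B"
    using V.maximal_independent_subset_extend[OF _ i, of S] S by (metis empty_subsetI insert_subset)
  \<comment> \<open>\<open>V.dim\<close> is a \<open>card\<close>, which is 0 for an infinite basis;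
    the finite spanning set excludes this.\<close>
  obtain T :: "(('k^2^2) \<times> ('k^2^2)) set" where T: "finite T" "V.span T = UNIV" using pairs_spanned by blast
  have "finite B" using V.independent_span_bound[OF T(1) B(3)] T(2) by simp
  then have "card {v, u} \<le> card B" using B(1) by (rule card_mono)
  also have "card B = V.dim S" by (rule V.basis_card_eq_dim[OF B(2,4,3)])
  finally show ?thesis using ne by simp
qed

lemma geom_stabilizer_dim_eq:
  "geom_stabilizer_dim (A, B) = vector_space.dim pair_scale {(P, Q). P ** A = A ** Q \<and> Q ** B = B ** (P :: 'k::field^2^2)}"
  by (simp add: geom_stabilizer_dim_def pair_scale_def)

text \<open>A nonzero singular matrix is not scalar.\<close>

lemma identity_independent:
  fixes P Q :: "'k::field^2^2"
  assumes d: "det P = 0" "P \<noteq> 0" and "pair_scale a (mat 1, mat 1) + pair_scale b (P, Q) = 0"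
  shows "a = 0 \<and> b = 0"
proof -
  obtain w x y z where P: "P = mat2 w x y z" by (rule mat2_cases)
  have e: "a + b * w = 0" "b * x = 0" "b * y = 0" "a + b * z = 0"
    using assms(3) by (simp_all add: P matrix_2_eq_iff zero_prod_def)
  have wz: "w * z = x * y" using d(1) by (simp add: P)
  have "b = 0"
  proof (rule ccontr)
    assume b: "b \<noteq> 0"
    then have xy: "x = 0" "y = 0" using e by auto
    have "b * w = b * z" using e(1,4) by (metis add_left_cancel)
    then have "w = z" using b by simp
    then have "w = 0" "z = 0" using wz xy by auto
    then show False using d(2) xy by (simp add: P matrix_2_eq_iff)
  qed
  then show ?thesis using e(1) by simp
qed

text \<open>Besides the identity a second independent element always exists. The pair
  \<open>(A ** B, B ** A)\<close> serves unless it is scalar. If it is a nonzero scalar,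
  \<open>B\<close> is a multiple of the inverse of \<open>A\<close>, which transports a nilpotent
  matrix. If it is 0, products of \<open>A\<close> or \<open>B\<close> with nilpotent matrices
  serve, or nilpotent matrices themselves when \<open>A\<close> and \<open>B\<close> vanish.\<close>

lemma geom_stabilizer_dim_ge_2: "geom_stabilizer_dim Z \<ge> 2"
  for Z :: "('k::field^2^2) \<times> ('k^2^2)"
proof -
  obtain A B where Z: "Z = (A, B)" by (cases Z)
  let ?S = "{(P, Q). P ** A = A ** Q \<and> Q ** B = B ** P}"
  have one: "(mat 1, mat 1) \<in> ?S" by simp
  have sing: "vector_space.dim pair_scale ?S \<ge> 2" if "(P, Q) \<in> ?S" "det P = 0" "P \<noteq> 0" for P Q
    using identity_independent[OF that(2,3)] by (intro dim_pairs_ge_2[OF one that(1)])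
  have "vector_space.dim pair_scale ?S \<ge> 2"
  proof (cases "\<exists>c. A ** B = mat c \<and> B ** A = mat c")
    case False
    have AB: "(A ** B, B ** A) \<in> ?S" by (simp add: matrix_mul_assoc)
    show ?thesis
    proof (rule dim_pairs_ge_2[OF one AB])
      fix a b assume z: "pair_scale a (mat 1, mat 1) + pair_scale b (A ** B, B ** A) = 0"
      have "b = 0"
      proof (rule ccontr)
        assume b: "b \<noteq> 0"
        have sc: "M = mat (- a / b)" if "mat a + mat b ** M = (0 :: 'k^2^2)" for M
        proof -
          have "a + b * M $ 1 $ 1 = 0" "b * M $ 1 $ 2 = 0" "b * M $ 2 $ 1 = 0" "a + b * M $ 2 $ 2 = 0"
            using that by (simp_all add: matrix_2_eq_iff)
          then have "b * M $ 1 $ 1 = - a" "b * M $ 1 $ 2 = 0" "b * M $ 2 $ 1 = 0" "b * M $ 2 $ 2 = - a"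
            by (metis add.commute add_eq_0_iff)+
          then show ?thesis using b by (simp add: matrix_2_eq_iff field_simps)
        qed
        have "mat a + mat b ** (A ** B) = (0 :: 'k^2^2)" "mat a + mat b ** (B ** A) = (0 :: 'k^2^2)"
          using z by (simp_all add: zero_prod_def)
        then show False using False sc by blast
      qed
      moreover have "mat a ** mat 1 + mat b ** (A ** B) = (0 :: 'k^2^2)" using z by (simp add: zero_prod_def)
      ultimately show "a = 0 \<and> b = 0" by (simp add: matrix_2_eq_iff)
    qed
  next
    case True
    then obtain c where c: "A ** B = mat c" "B ** A = mat c" by blast
    have mc: "mat x ** M = M ** mat x" for x and M :: "'k^2^2" by (rule mat_comm_2)
    show ?thesis
    proof (cases "c = 0")
      case False
      let ?E = "mat2 0 1 0 0 :: 'k^2^2"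
      have ii: "mat (1 / c) ** mat c = (mat 1 :: 'k^2^2)" using False by (simp add: matrix_2_eq_iff)
      have "A ** (mat (1 / c) ** B ** ?E ** A) = mat (1 / c) ** (A ** B) ** ?E ** A"
        by (simp only: matrix_mul_assoc mc[of "1 / c" A])
      then have 1: "?E ** A = A ** (mat (1 / c) ** B ** ?E ** A)" by (simp only: c ii matrix_mul_lid)
      have "(mat (1 / c) ** B ** ?E ** A) ** B = mat (1 / c) ** B ** (?E ** (A ** B))" by (simp only: matrix_mul_assoc)
      also have "\<dots> = mat (1 / c) ** B ** (?E ** mat c)" by (simp only: c)
      also have "\<dots> = (mat (1 / c) ** mat c) ** B ** ?E" by (simp add: matrix_2_eq_iff algebra_simps)
      finally have 2: "(mat (1 / c) ** B ** ?E ** A) ** B = B ** ?E" by (simp only: ii matrix_mul_lid)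
      show ?thesis by (rule sing[of ?E "mat (1 / c) ** B ** ?E ** A"]) (use 1 2 in \<open>simp_all add: matrix_2_eq_iff\<close>)
    next
      case True
      then have c0: "A ** B = 0" "B ** A = 0" using c by (simp_all add: matrix_2_eq_iff)
      have AX: "(A ** M, M ** A) \<in> ?S" for M
        by (simp add: matrix_mul_assoc[symmetric] c0) (simp add: matrix_mul_assoc c0)
      have XB: "(M ** B, B ** M) \<in> ?S" for M
        by (simp add: matrix_mul_assoc[symmetric] c0) (simp add: matrix_mul_assoc c0)
      let ?E = "mat2 0 1 0 0 :: 'k^2^2" and ?F = "mat2 0 0 1 0 :: 'k^2^2"
      have "A ** ?E \<noteq> 0 \<or> A ** ?F \<noteq> 0 \<or> A = 0" by (auto simp: matrix_2_eq_iff)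
      moreover have "?E ** B \<noteq> 0 \<or> ?F ** B \<noteq> 0 \<or> B = 0" by (auto simp: matrix_2_eq_iff)
      moreover have ?thesis if "A ** ?E \<noteq> 0" by (rule sing[OF AX _ that]) (simp add: det_mul)
      moreover have ?thesis if "A ** ?F \<noteq> 0" by (rule sing[OF AX _ that]) (simp add: det_mul)
      moreover have ?thesis if "?E ** B \<noteq> 0" by (rule sing[OF XB _ that]) (simp add: det_mul)
      moreover have ?thesis if "?F ** B \<noteq> 0" by (rule sing[OF XB _ that]) (simp add: det_mul)
      moreover have ?thesis if "A = 0" "B = 0" by (rule sing[of ?E ?E]) (simp_all add: that matrix_2_eq_iff)
      ultimately show ?thesis by blast
    qed
  qed
  then show ?thesis by (simp only: Z geom_stabilizer_dim_eq)
qed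

text \<open>\<open>P\<close> commutes with \<open>A ** B\<close>, which has distinct eigenvalues, so
  \<open>P\<close> is diagonal; \<open>Q\<close> is determined by \<open>P\<close> because
  \<open>A\<close> is invertible.\<close>

lemma geom_stabilizer_dim_diagonal:
  fixes a b a' b' :: "'k::field"
  assumes n: "a \<noteq> 0" "b \<noteq> 0" "a * a' \<noteq> b * b'"
  shows "geom_stabilizer_dim (mat2 a 0 0 b, mat2 a' 0 0 b') \<le> 2"
proof -
  interpret V: vector_space "pair_scale :: 'k \<Rightarrow> _" by (rule vector_space_pairs)
  let ?A = "mat2 a 0 0 b" and ?B = "mat2 a' 0 0 b'"
  let ?u = "(mat2 1 0 0 0, mat2 1 0 0 0) :: ('k^2^2) \<times> ('k^2^2)" and ?v = "(mat2 0 0 0 1, mat2 0 0 0 1) :: ('k^2^2) \<times> ('k^2^2)"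
  have "{(P, Q). P ** ?A = ?A ** Q \<and> Q ** ?B = ?B ** P} \<subseteq> V.span {?u, ?v}"
  proof (rule subsetI, clarify)
    fix P Q :: "'k^2^2" assume h: "P ** ?A = ?A ** Q" "Q ** ?B = ?B ** P"
    have "mat2 (a * a') 0 0 (b * b') ** P = ?A ** (?B ** P)" by (simp add: matrix_2_eq_iff)
    also have "\<dots> = P ** (?A ** ?B)" by (simp only: h(2)[symmetric]) (simp only: matrix_mul_assoc h(1))
    also have "?A ** ?B = mat2 (a * a') 0 0 (b * b')" by (simp add: matrix_2_eq_iff)
    finally have P: "P = mat2 (P $ 1 $ 1) 0 0 (P $ 2 $ 2)" using n(3) by (rule commuting_diag)
    obtain x y where xy: "P = mat2 x 0 0 y" using P by blast
    have "Q = mat2 x 0 0 y" using h(1) n by (simp add: xy matrix_2_eq_iff)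
    then have "(P, Q) = pair_scale x ?u + pair_scale y ?v" by (simp add: xy matrix_2_eq_iff)
    also have "\<dots> \<in> V.span {?u, ?v}" by (intro V.span_add V.span_scale V.span_base) simp_all
    finally show "(P, Q) \<in> V.span {?u, ?v}" .
  qed
  then have "V.dim {(P, Q). P ** ?A = ?A ** Q \<and> Q ** ?B = ?B ** P} \<le> card {?u, ?v}" by (rule V.dim_le_card) simp
  also have "\<dots> \<le> 2" by (simp add: card_insert_if)
  finally show ?thesis by (simp only: geom_stabilizer_dim_eq)
qed

text \<open>The eigenvectors are the first columns of \<open>M - y\<close> and \<open>M - x\<close>.
  When the lower left entry vanishes they are read off from the first row, and a diagonal matrix
  needs at most an interchange of the basis vectors.\<close>

lemma diagonalize_2:
  fixes M :: "'k::field^2^2"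
  assumes t: "trace M = x + y" and d: "det M = x * y" and ne: "x \<noteq> y"
  shows "\<exists>G. invertible G \<and> M ** G = G ** mat2 x 0 0 y"
proof -
  obtain a b c e where M: "M = mat2 a b c e" by (rule mat2_cases)
  have e: "e = x + y - a" using t by (simp add: M trace_2 algebra_simps)
  have q: "b * c = a * (x + y - a) - x * y" using d by (simp add: M e algebra_simps)
  show ?thesis
  proof (cases "c = 0")
    case False
    have "M ** mat2 (a - y) (a - x) c c = mat2 (a - y) (a - x) c c ** mat2 x 0 0 y"
      using q by (simp add: M e matrix_2_eq_iff algebra_simps)
    moreover have "c * x \<noteq> c * y" using False ne by auto
    then have "invertible (mat2 (a - y) (a - x) c c)" by (simp add: invertible_2_iff algebra_simps)
    ultimately show ?thesis by blast
  next
    case c: True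
    have ax: "(a - x) * (a - y) = 0" using q c by (simp add: algebra_simps)
    show ?thesis
    proof (cases "b = 0")
      case False
      have "M ** mat2 b b (x - a) (y - a) = mat2 b b (x - a) (y - a) ** mat2 x 0 0 y"
        using q ax by (simp add: M e c matrix_2_eq_iff algebra_simps)
      moreover have "b * x \<noteq> b * y" using False ne by auto
      then have "invertible (mat2 b b (x - a) (y - a))" using ne[symmetric] by (simp add: invertible_2_iff algebra_simps)
      ultimately show ?thesis by blast
    next
      case True
      show ?thesis
      proof (cases "a = x")
        case True
        then show ?thesis using \<open>b = 0\<close> by (intro exI[of _ "mat 1"]) (simp add: M e c matrix_2_eq_iff)
      next
        case False
        then have "a = y" using ax by simp
        then show ?thesis using \<open>b = 0\<close>
          by (intro exI[of _ "mat2 0 1 1 0"]) (simp add: M e c matrix_2_eq_iff invertible_2_iff)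
      qed
    qed
  qed
qed

text \<open>Trace and determinant of the product are invariants. Where the eigenvalues are nonzero
  and distinct, they determine the product up to conjugation and make the first component
  invertible, so that the second group element is forced; the fibre is a single orbit.\<close>

lemma geom_orbit_eq:
  fixes A B :: "'k::field^2^2"
  assumes AB: "A ** B = mat2 x 0 0 y" and n: "x \<noteq> 0" "y \<noteq> 0" "x \<noteq> y"
  shows "geom_orbit (A, B) = {v. trace (fst v ** snd v) = x + y \<and> det (fst v ** snd v) = x * y}"
proof (intro equalityI subsetI)
  fix v :: "('k^2^2) \<times> ('k^2^2)" assume "v \<in> geom_orbit (A, B)"
  then obtain g h where v: "v = (g ** A ** matrix_inv h, h ** B ** matrix_inv g)" and gh: "invertible g" "invertible h"
    unfolding geom_orbit_def by auto
  have "fst v ** snd v = g ** A ** (matrix_inv h ** h) ** B ** matrix_inv g" by (simp only: v fst_conv snd_conv matrix_mul_assoc)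
  also have "\<dots> = g ** (A ** B) ** matrix_inv g" by (simp only: matrix_inv_left[OF gh(2)] matrix_mul_rid matrix_mul_assoc)
  finally have fs: "fst v ** snd v = g ** (A ** B) ** matrix_inv g" .
  show "v \<in> {v. trace (fst v ** snd v) = x + y \<and> det (fst v ** snd v) = x * y}"
    by (simp only: fs mem_Collect_eq conj_trace_det[OF gh(1)] AB) (simp add: trace_2)
next
  fix v :: "('k^2^2) \<times> ('k^2^2)" assume v0: "v \<in> {v. trace (fst v ** snd v) = x + y \<and> det (fst v ** snd v) = x * y}"
  obtain A' B' where v: "v = (A', B')" by (cases v)
  have td: "trace (A' ** B') = x + y" "det (A' ** B') = x * y" using v0 by (simp_all add: v)
  obtain G where G: "invertible G" "A' ** B' ** G = G ** mat2 x 0 0 y" using diagonalize_2[OF td n(3)] by blast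
  have iA': "invertible A'" using td(2) n by (auto simp: det_mul invertible_2_iff)
  have "det (A ** B) \<noteq> 0" unfolding AB using n by simp
  then have iA: "invertible A" by (auto simp: det_mul invertible_2_iff)
  define H where "H = matrix_inv A' ** G ** A"
  have iH: "invertible H" unfolding H_def using iA iA' G(1) by (intro invertible_mult invertible_matrix_inv)
  have AH: "A' ** H = G ** A" by (simp only: H_def matrix_mul_assoc matrix_inv_right[OF iA'] matrix_mul_lid)
  have 1: "A' = G ** A ** matrix_inv H"
    by (rule right_cancel[OF iH]) (simp only: matrix_mul_assoc[symmetric] matrix_inv_left[OF iH] matrix_mul_rid AH)
  have "A' ** (B' ** G) = A' ** (H ** B)" by (simp only: matrix_mul_assoc G(2) AH) (simp only: matrix_mul_assoc[symmetric] AB)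
  then have BG: "B' ** G = H ** B" by (rule left_cancel[OF iA'])
  have 2: "B' = H ** B ** matrix_inv G"
    by (rule right_cancel[OF G(1)]) (simp only: matrix_mul_assoc[symmetric] matrix_inv_left[OF G(1)] matrix_mul_rid BG)
  show "v \<in> geom_orbit (A, B)" unfolding geom_orbit_def v prod.case mem_Collect_eq
    by (intro exI[of _ G] exI[of _ H] conjI iH G(1)) (simp only: 1[symmetric] 2[symmetric])
qed

lemma zariski_closed_trace_det:
  fixes t d :: "'k::field"
  shows "zariski_closed matrix_pair_coords {v :: ('k^2^2) \<times> ('k^2^2). trace (fst v ** snd v) = t \<and> det (fst v ** snd v) = d}"
proof -
  have co: "(\<lambda>v. fst v $ i $ j) \<in> polynomial_functions matrix_pair_coords"
    "(\<lambda>v. snd v $ i $ j) \<in> polynomial_functions (matrix_pair_coords :: (('k^2^2) \<times> ('k^2^2) \<Rightarrow> 'k) set)" for i j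
    by (rule polynomial_functions.intros(2), auto simp: matrix_pair_coords_def case_prod_unfold)+
  note pf = polynomial_functions.intros(1,3,4) co
  \<comment> \<open>Only constants, coordinates, sums and products generate
    \<open>polynomial_functions\<close>, so subtraction is spelled out with negative
    constants.\<close>
  define tr :: "('k^2^2) \<times> ('k^2^2) \<Rightarrow> 'k" where
    "tr = (\<lambda>v. fst v $ 1 $ 1 * snd v $ 1 $ 1 + fst v $ 1 $ 2 * snd v $ 2 $ 1 + (fst v $ 2 $ 1 * snd v $ 1 $ 2 + fst v $ 2 $ 2 * snd v $ 2 $ 2) + (- t))"
  define dt :: "('k^2^2) \<times> ('k^2^2) \<Rightarrow> 'k" where
    "dt = (\<lambda>v. (fst v $ 1 $ 1 * fst v $ 2 $ 2 + (- 1) * (fst v $ 1 $ 2 * fst v $ 2 $ 1)) *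
      (snd v $ 1 $ 1 * snd v $ 2 $ 2 + (- 1) * (snd v $ 1 $ 2 * snd v $ 2 $ 1)) + (- d))"
  have "tr \<in> polynomial_functions matrix_pair_coords" unfolding tr_def by (intro pf)
  moreover have "dt \<in> polynomial_functions matrix_pair_coords" unfolding dt_def by (intro pf)
  moreover have "tr v = trace (fst v ** snd v) - t" "dt v = det (fst v ** snd v) - d" for v
    unfolding det_mul by (simp_all add: tr_def dt_def trace_2 det_2)
  then have "{v. trace (fst v ** snd v) = t \<and> det (fst v ** snd v) = d} = {v. \<forall>p\<in>{tr, dt}. p v = 0}" by simp
  ultimately show ?thesis unfolding zariski_closed_def by (intro exI[of _ "{tr, dt}"]) simp
qed

section \<open>Smooth functions and regular semisimple diagonal matrices\<close>

lemma smooth_indicator: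
  fixes S :: "'x::t2_space set"
  assumes "open S" "compact S"
  shows "smooth_compact_support (indicator S)"
proof -
  have "\<exists>T. open T \<and> x \<in> T \<and> (\<forall>y\<in>T. indicator S y = (indicator S x :: complex))" for x
  proof (cases "x \<in> S")
    case True
    then show ?thesis using assms(1) by (intro exI[of _ S]) simp
  next
    case False
    then show ?thesis using compact_imp_closed[OF assms(2)] by (intro exI[of _ "- S"]) (simp add: open_Compl)
  qed
  moreover have "{x. indicator S x \<noteq> (0::complex)} = S" by (auto simp: indicator_def)
  ultimately show ?thesis using assms(2) compact_imp_closed[OF assms(2)] by (simp add: smooth_compact_support_def)
qed

context split_plane
begin

lemma smooth_End_2: "smooth_compact_support (indicator (lattice_End (lattice_sum \<Lambda>1 \<Lambda>1)))"
  unfolding lattice_End_2 by (rule smooth_indicator[OF open_integral_matrices compact_integral_matrices])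

lemma smooth_End_1:
  "smooth_compact_support (\<lambda>(xa, xb). indicator (lattice_End \<Lambda>1) xa * indicator (lattice_End \<Lambda>1) xb)"
proof -
  let ?S = "lattice_End \<Lambda>1"
  have "open ((\<lambda>x::'e^1^1. x $ 1 $ 1) -` {x. nabs x \<le> 1})" by (intro open_vimage open_nabs_ball continuous_intros)
  moreover have "(\<lambda>x::'e^1^1. x $ 1 $ 1) -` {x. nabs x \<le> 1} = ?S" unfolding lattice_End_1 by auto
  ultimately have op: "open ?S" by simp
  have "compact ((\<lambda>z::'e. (\<chi> i j. z) :: 'e^1^1) ` {x. nabs x \<le> 1})"
    by (intro compact_continuous_image compact_nabs_ball continuous_intros)
  moreover have "(\<lambda>z::'e. (\<chi> i j. z) :: 'e^1^1) ` {x. nabs x \<le> 1} = ?S" unfolding lattice_End_1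
  proof (intro equalityI subsetI)
    fix x :: "'e^1^1" assume "x \<in> {x. nabs (x $ 1 $ 1) \<le> 1}"
    then show "x \<in> (\<lambda>z::'e. (\<chi> i j. z) :: 'e^1^1) ` {x. nabs x \<le> 1}"
      by (intro image_eqI[of _ _ "x $ 1 $ 1"]) (simp_all add: matrix_1_eq_iff)
  qed auto
  ultimately have co: "compact ?S" by simp
  have "(\<lambda>(xa, xb). indicator ?S xa * indicator ?S xb) = (indicator (?S \<times> ?S) :: _ \<Rightarrow> complex)"
    by (auto simp: indicator_def)
  then show ?thesis using smooth_indicator[OF open_Times[OF op op] compact_Times[OF co co]] by simp
qed

lemma smooth_zero: "smooth_compact_support (\<lambda>_::('e^1^1) \<times> ('e^1^1). 0)"
  by (auto simp: smooth_compact_support_def)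

text \<open>The orbit is a fibre of the invariants, hence closed, and the stabilizer attains the
  lower bound 2. In the split case such matrices provide a match for every regular semisimple
  pair.\<close>

lemma reg_semisimple_diagonal:
  assumes n: "xa \<noteq> 0" "xb \<noteq> 0" "N xa \<noteq> N xb"
  shows "reg_semisimple h2 h2 (mat2 xa 0 0 xb)"
proof -
  let ?x = "mat2 xa 0 0 xb"
  let ?A = "mat2 (to_ac xa) 0 0 (to_ac xb)" and ?B = "mat2 (to_ac (\<sigma> xa)) 0 0 (to_ac (\<sigma> xb))"
  have gp: "geom_point h2 h2 ?x = (?A, ?B)"
    by (simp add: geom_point_def herm_adj_2 matrix_2_eq_iff map_matrix_def)
  have AB: "?A ** ?B = mat2 (to_ac (N xa)) 0 0 (to_ac (N xb))" by (simp add: matrix_2_eq_iff)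
  have nn: "to_ac (N xa) \<noteq> 0" "to_ac (N xb) \<noteq> 0" "to_ac (N xa) \<noteq> to_ac (N xb)"
    using n by (simp_all only: to_ac_eq_0_iff to_ac_eq_iff) simp_all
  have z: "zariski_closed matrix_pair_coords (geom_orbit (?A, ?B))"
    unfolding geom_orbit_eq[OF AB nn] by (rule zariski_closed_trace_det)
  have "geom_stabilizer_dim (?A, ?B) \<le> 2"
    using n nn(3) by (intro geom_stabilizer_dim_diagonal) simp_all
  then have "geom_stabilizer_dim (?A, ?B) \<le> geom_stabilizer_dim Z" for Z :: "('e alg_closure^2^2) \<times> ('e alg_closure^2^2)"
    using geom_stabilizer_dim_ge_2[of Z] by simp
  then show ?thesis unfolding reg_semisimple_def gp using z by blast
qed

section \<open>Smooth transfer\<close>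

text \<open>The endoscopic side gives a diagonal matrix, for which the identity is an eigenbasis
  with norms 1; so the sign of the invariant relative to it is the parity of
  \<open>cb\<close>.\<close>

lemma matching_eigenbasis:
  assumes h: "hermitian_form \<sigma> \<alpha>" "hermitian_form \<sigma> \<beta>" and rss: "(xa, xb) \<in> endo_rss \<iota> h1 \<alpha> \<beta>"
    and m: "matches h1 \<alpha> \<beta> x (xa, xb)"
    and d: "da = herm_scalar \<iota> (contraction h1 \<alpha> xa)" "db = herm_scalar \<iota> (contraction h1 \<beta> xb)"
  shows "invertible x" "\<exists>P ca cb. eigenbasis (- (x ** star x)) P da db ca cb"
    "eigenbasis (block_diag (contraction h1 \<alpha> xa) (contraction h1 \<beta> xb)) (mat 1) da db 1 1"
proof -
  have x0: "xa \<noteq> 0" "xb \<noteq> 0" "da \<noteq> db" using rss by (simp_all add: endo_rss_def d)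
  let ?D = "mat2 (\<iota> da) 0 0 (\<iota> db)"
  have "contraction h1 \<alpha> xa = mat (\<iota> da)" "contraction h1 \<beta> xb = mat (\<iota> db)"
    unfolding d by (rule contraction_1[OF herm h(1)], rule contraction_1[OF herm h(2)])
  then have bd: "block_diag (contraction h1 \<alpha> xa) (contraction h1 \<beta> xb) = ?D"
    by (simp add: block_diag_def matrix_2_eq_iff)
  show "eigenbasis (block_diag (contraction h1 \<alpha> xa) (contraction h1 \<beta> xb)) (mat 1) da db 1 1"
    unfolding bd eigenbasis_def using x0 by (simp add: matrix_2_eq_iff)
  obtain g where g: "invertible g" "?D = g ** (- (x ** star x)) ** matrix_inv g"
    using m unfolding matches_def prod.case bd contraction_2 by (elim exE conjE) (rule that)
  have td: "trace (- (x ** star x)) = \<iota> (da + db)" "det (- (x ** star x)) = \<iota> (da * db)"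
    using conj_trace_det[OF g(1), of "- (x ** star x)"] unfolding g(2)[symmetric] by (simp_all add: trace_2)
  show "\<exists>P ca cb. eigenbasis (- (x ** star x)) P da db ca cb"
    using td x0(3) by (intro eigenbasis_exists star_contraction) (simp_all only: trace_2[symmetric] not_False_eq_True)
  have "da \<noteq> 0" "db \<noteq> 0" unfolding d using vl_herm_scalar(1)[OF herm h(1) x0(1)] vl_herm_scalar(1)[OF herm h(2) x0(2)] by blast+
  then have "\<iota> (da * db) \<noteq> 0" by simp
  then have "N (det x) \<noteq> 0" using td(2) unfolding det_uminus_2 by (simp add: det_mul)
  then show "invertible x" by (auto simp: invertible_2_iff)
qed

text \<open>By \<open>vl_herm_scalar\<close> the valuation of an eigenvalue is even exactly when its
  form is \<open>h1\<close>. So some eigenvalue is odd, and \<open>eigenvalue_parity\<close> makes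
  \<open>db\<close> odd.\<close>

lemma transfer_nonsplit:
  assumes R: "form_reps \<sigma> R" "h1 \<in> R" "split_form h1" and ab: "\<alpha> \<in> R" "\<beta> \<in> R" "\<alpha> \<noteq> h1 \<or> \<beta> \<noteq> h1"
  shows "smooth_transfers \<iota> \<sigma> dg h1 \<alpha> \<beta> (indicator (lattice_End (lattice_sum \<Lambda>1 \<Lambda>1))) (\<lambda>_. 0)"
proof -
  have h: "hermitian_form \<sigma> \<alpha>" "hermitian_form \<sigma> \<beta>" using R(1) ab by (simp_all add: form_reps_def)
  have "RO_kappa \<iota> \<sigma> dg h2 (herm_scalar \<iota> (contraction h1 \<beta> xb)) x (indicator integral_matrices) = 0"
    if rss: "(xa, xb) \<in> endo_rss \<iota> h1 \<alpha> \<beta>" and m: "matches h1 \<alpha> \<beta> x (xa, xb)" for x xa xb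
  proof -
    define da where "da = herm_scalar \<iota> (contraction h1 \<alpha> xa)"
    define db where "db = herm_scalar \<iota> (contraction h1 \<beta> xb)"
    note me = matching_eigenbasis[OF h rss m da_def db_def]
    obtain P ca cb where e: "eigenbasis (- (x ** star x)) P da db ca cb" using me(2) by (elim exE) (rule that)
    have x0: "xa \<noteq> 0" "xb \<noteq> 0" using rss by (simp_all add: endo_rss_def)
    have "vl da = vl (coef h1) - vl (coef \<alpha>) + 2 * vl (xa $ 1 $ 1)" "vl db = vl (coef h1) - vl (coef \<beta>) + 2 * vl (xb $ 1 $ 1)"
      unfolding da_def db_def by (rule vl_herm_scalar(2)[OF herm h(1) x0(1)], rule vl_herm_scalar(2)[OF herm h(2) x0(2)])
    then have "even (vl da) \<longleftrightarrow> \<alpha> = h1" "even (vl db) \<longleftrightarrow> \<beta> = h1"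
      using form_reps_1(3)[OF R ab(1)] form_reps_1(3)[OF R ab(2)] form_reps_1(3)[OF R R(2)] by simp_all
    then have "odd (vl db)" using eigenvalue_parity[OF e me(1)] ab(3) by auto
    then show ?thesis unfolding db_def[symmetric] by (rule RO_kappa_nonsplit[OF e me(1)])
  qed
  then show ?thesis unfolding smooth_transfers_def Let_def SRO_zero lattice_End_2
    using smooth_End_2[unfolded lattice_End_2] smooth_zero by auto
qed

lemma transfer_split:
  "smooth_transfers \<iota> \<sigma> dg h1 h1 h1 (indicator (lattice_End (lattice_sum \<Lambda>1 \<Lambda>1)))
    (\<lambda>(xa, xb). indicator (lattice_End \<Lambda>1) xa * indicator (lattice_End \<Lambda>1) xb)"
proof -
  let ?f = "\<lambda>(xa, xb). indicator (lattice_End \<Lambda>1) xa * indicator (lattice_End \<Lambda>1) xb :: complex"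
  have hs: "\<iota> (herm_scalar \<iota> (contraction h1 h1 xa)) = - N (xa $ 1 $ 1)" for xa
    using contraction_1(2)[OF herm herm, of xa] coef_neq_0 by simp
  have nz: "y $ 1 $ 1 \<noteq> 0" if "y \<noteq> 0" for y :: "'e^1^1" using that by (auto simp: matrix_1_eq_iff)
  have 1: "SRO h1 h1 h1 (xa, xb) ?f = transfer_factor \<iota> \<sigma> h1 h1 h1 (xa, xb) x
      * RO_kappa \<iota> \<sigma> dg h2 (herm_scalar \<iota> (contraction h1 h1 xb)) x (indicator integral_matrices)"
    if rss: "(xa, xb) \<in> endo_rss \<iota> h1 h1 h1" and m: "matches h1 h1 h1 x (xa, xb)" for x xa xb
  proof -
    define da where "da = herm_scalar \<iota> (contraction h1 h1 xa)"
    define db where "db = herm_scalar \<iota> (contraction h1 h1 xb)"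
    note me = matching_eigenbasis[OF herm herm rss m da_def db_def]
    obtain P ca cb where e: "eigenbasis (- (x ** star x)) P da db ca cb" using me(2) by (elim exE) (rule that)
    have x0: "xa \<noteq> 0" "xb \<noteq> 0" using rss by (simp_all add: endo_rss_def)
    have f: "SRO h1 h1 h1 (xa, xb) ?f = ?f (xa, xb)"
    proof (rule SRO_split[OF herm ex_haar_1 x0])
      fix a b :: "'e^1^1" and u v :: 'e assume "u \<in> U1" "v \<in> U1"
      then show "?f (mat u ** a, mat v ** b) = ?f (a, b)"
        by (simp add: lattice_End_1 indicator_def nabs_mult nabs_U1)
    qed
    have "kappa \<iota> \<sigma> (- (x ** star x)) db (inv_class \<sigma> h2 h2 (- (x ** star x)) (block_diag (contraction h1 h1 xa) (contraction h1 h1 xb)))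
      = (if even (vl cb) then 1 else -1)"
      unfolding kappa_eq[OF e me(3)] by simp
    then have "transfer_factor \<iota> \<sigma> h1 h1 h1 (xa, xb) x
      = (if even (vl cb) then 1 else -1) * omega \<iota> \<sigma> (da - db) * complex_of_real (nabs (da - db))"
      unfolding transfer_factor_def prod.case Let_def contraction_2 da_def[symmetric] db_def[symmetric] by (simp only:)
    then have "transfer_factor \<iota> \<sigma> h1 h1 h1 (xa, xb) x * RO_kappa \<iota> \<sigma> dg h2 db x (indicator integral_matrices)
      = indicator {z. nabs z \<le> 1} (xa $ 1 $ 1) * indicator {z. nabs z \<le> 1} (xb $ 1 $ 1)"
      using RO_kappa_split[OF e me(1) nz[OF x0(1)] nz[OF x0(2)] hs[of xa, folded da_def] hs[of xb, folded db_def]] by (simp only:)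
    then show ?thesis unfolding f db_def[symmetric] by (simp add: lattice_End_1 indicator_def)
  qed
  \<comment> \<open>The diagonal matrix with the same entries matches the pair, which settles the
    second condition of smooth transfer.\<close>
  have 2: "\<exists>x. reg_semisimple h2 h2 x \<and> matches h1 h1 h1 x (xa, xb)" if rss: "(xa, xb) \<in> endo_rss \<iota> h1 h1 h1" for xa xb
  proof (intro exI conjI)
    let ?x = "mat2 (xa $ 1 $ 1) 0 0 (xb $ 1 $ 1)"
    have x0: "xa \<noteq> 0" "xb \<noteq> 0" "herm_scalar \<iota> (contraction h1 h1 xa) \<noteq> herm_scalar \<iota> (contraction h1 h1 xb)"
      using rss by (simp_all add: endo_rss_def)
    have "\<iota> (herm_scalar \<iota> (contraction h1 h1 xa)) \<noteq> \<iota> (herm_scalar \<iota> (contraction h1 h1 xb))" using x0(3) by simp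
    then have "N (xa $ 1 $ 1) \<noteq> N (xb $ 1 $ 1)" unfolding hs by auto
    then show "reg_semisimple h2 h2 ?x" using x0 by (intro reg_semisimple_diagonal nz)
    have c: "contraction h1 h1 y = mat (- N (y $ 1 $ 1))" for y
      using contraction_1(1)[OF herm herm, of y] by (simp only: hs)
    have "block_diag (contraction h1 h1 xa) (contraction h1 h1 xb) = contraction h2 h2 ?x"
      unfolding c contraction_2 by (simp add: block_diag_def matrix_2_eq_iff)
    then show "matches h1 h1 h1 ?x (xa, xb)" unfolding matches_def prod.case
      by (intro exI[of _ "mat 1"]) (simp only: invertible_mat_1 matrix_inv_mat_1 matrix_mul_lid matrix_mul_rid simp_thms)
  qed
  show ?thesis unfolding smooth_transfers_def Let_def lattice_End_2
  proof (intro conjI allI ballI)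
    show "smooth_compact_support (indicator integral_matrices :: 'e^2^2 \<Rightarrow> complex)" using smooth_End_2 unfolding lattice_End_2 .
    show "smooth_compact_support ?f" by (rule smooth_End_1)
    fix v assume v: "v \<in> endo_rss \<iota> h1 h1 h1"
    obtain xa xb where ab: "v = (xa, xb)" by (cases v)
    show "case v of (xa, xb) \<Rightarrow> reg_semisimple h2 h2 x \<and> matches h1 h1 h1 x (xa, xb) \<longrightarrow>
      SRO h1 h1 h1 (xa, xb) ?f = transfer_factor \<iota> \<sigma> h1 h1 h1 (xa, xb) x
        * RO_kappa \<iota> \<sigma> dg h2 (herm_scalar \<iota> (contraction h1 h1 xb)) x (indicator integral_matrices)" for x
      unfolding ab prod.case by (intro impI) (elim conjE, rule 1[OF v[unfolded ab]])
    show "case v of (xa, xb) \<Rightarrow> (\<nexists>x. reg_semisimple h2 h2 x \<and> matches h1 h1 h1 x (xa, xb)) \<longrightarrow> SRO h1 h1 h1 (xa, xb) ?f = 0"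
      unfolding ab prod.case using 2[OF v[unfolded ab]] by (intro impI) (elim notE)
  qed
qed

end

theorem theorem5p1:
  fixes \<iota> :: "'f::nonarch_local_field \<Rightarrow> 'e::nonarch_local_field"
    and \<sigma> :: "'e \<Rightarrow> 'e"
    and h1 :: "('e, 1) form"
    and \<Lambda>1 :: "('e^1) set"
    and R :: "('e, 1) form set"
    and dg :: "('e^2^2) measure"
    and s :: "complex^2^2"
    and \<eta> :: "complex \<times> complex \<Rightarrow> complex^2^2"
  assumes "quadratic_extension \<iota>"
    and "unramified_extension \<iota>"
    and "galois_conj \<iota> \<sigma>"
    and "odd (residue_char TYPE('f))"
    and "hermitian_form \<sigma> h1" and "split_form h1" and "self_dual_lattice h1 \<Lambda>1"
    and "form_reps \<sigma> R" and "h1 \<in> R"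
    and "haar_measure (unitary_group (form_sum h1 h1)) dg"
    and "emeasure dg (lattice_stabilizer (form_sum h1 h1) (lattice_sum \<Lambda>1 \<Lambda>1)) = 1"
    and "endoscopic_datum s \<eta>"
  shows "card ({(s, \<eta>)} \<times> R \<times> R) = 4
    \<and> (\<forall>\<alpha>\<in>R. \<forall>\<beta>\<in>R.
         smooth_transfers \<iota> \<sigma> dg h1 \<alpha> \<beta>
           (indicator (lattice_End (lattice_sum \<Lambda>1 \<Lambda>1)))
           (if split_form \<alpha> \<and> split_form \<beta>
            then (\<lambda>(xa, xb). indicator (lattice_End \<Lambda>1) xa * indicator (lattice_End \<Lambda>1) xb)
            else (\<lambda>_. 0)))"
proof -
  interpret split_plane \<iota> \<sigma> h1 \<Lambda>1 dg
    using assms by unfold_locales (simp_all add: self_dual_lattice_def)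
  note R = assms(8,9,6)
  show ?thesis
  proof (intro conjI ballI)
    show "card ({(s, \<eta>)} \<times> R \<times> R) = 4"
      using form_reps_1(1)[OF R] by (simp add: card_cartesian_product)
  next
    fix \<alpha> \<beta> assume ab: "\<alpha> \<in> R" "\<beta> \<in> R"
    show "smooth_transfers \<iota> \<sigma> dg h1 \<alpha> \<beta> (indicator (lattice_End (lattice_sum \<Lambda>1 \<Lambda>1)))
      (if split_form \<alpha> \<and> split_form \<beta>
       then (\<lambda>(xa, xb). indicator (lattice_End \<Lambda>1) xa * indicator (lattice_End \<Lambda>1) xb) else (\<lambda>_. 0))"
    proof (cases "\<alpha> = h1 \<and> \<beta> = h1")
      case True
      then show ?thesis using transfer_split assms(6) by simp
    next
      case False
      then have "\<not> (split_form \<alpha> \<and> split_form \<beta>)" using form_reps_1(2)[OF R] ab by blast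
      moreover have "\<alpha> \<noteq> h1 \<or> \<beta> \<noteq> h1" using False by blast
      ultimately show ?thesis using transfer_nonsplit[OF R ab] by (simp only: if_False)
    qed
  qed
qed

end
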